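(* Let $A\subseteq B$ be a ring extension with $A$ Hensel local and $B$ seminormal. Then $$M\mathcal{I}(A,B)\cong M\mathcal{I}(A,{}^{+}\!A)\oplus M\mathcal{I}({}^{+}\!A,B),$$ where ${}^{+}\!A$ is the subintegral closure of $A$ in $B$.
   Context: All rings are commutative with $1$ and ring homomorphisms are unitary; $X$ is an indeterminate. For a ring extension $A\subseteq B$, an $A$-submodule $I$ of $B$ is invertible if there is an $A$-submodule $J$ of $B$ with $IJ=A$; $\mathcal{I}(A,B)$ is the group, under multiplication, of invertible $A$-submodules of $B$. $M\mathcal{I}(A,B)$ denotes the cokernel of the natural map $\mathcal{I}(A,B)\to\mathcal{I}(A[X,X^{-1}],B[X,X^{-1}])$, $I\mapsto I A[X,X^{-1}]$. An extension $A\subseteq B$ is elementary subintegral if $B=A[b]$ for some $b\in B$ with $b^2,b^3\in A$. An extension $A\subseteq B$ is subintegral if for each $b\in B$ there is a finite sequence of ring extensions $A=C_0\subseteq C_1\subseteq\cdots\subseteq C_r\subseteq B$ with $b\in C_r$ and each $C_{i-1}\subseteq C_i$ elementary subintegral ($1\le i\le r$). The subintegral closure ${}^{+}\!A$ of $A$ in $B$ is the largest subring $C$ of $B$ containing $A$ such that $A\subseteq C$ is subintegral. A ring $R$ is seminormal if whenever $b,c\in R$ and $b^3=c^2$, there exists $a\in R$ with $b=a^2$ and $c=a^3$. A local ring $A$ is Hensel if every finite $A$-algebra is a direct product of local rings. *)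

theory Defs
  imports "HOL-Algebra.Algebra"
begin

text \<open>
  A ring extension is a commutative ring \<open>B\<close> together with a set \<open>A\<close> such that \<open>subcring A B\<close>.
  An intermediate ring \<open>C\<close>, regarded as a ring in its own right, is \<open>B\<lparr>carrier := C\<rparr>\<close>.
\<close>

section \<open>Invertible submodules\<close>

text \<open>
  The library locale \<open>subalgebra A I B\<close> says just that \<open>I\<close> is an additive subgroup of \<open>B\<close> closed
  under multiplication by elements of \<open>A\<close>, that is, an \<open>A\<close>-submodule of \<open>B\<close>; and \<open>ideal_prod B I J\<close>
  is, for arbitrary submodules, the set of finite sums of products \<open>i \<otimes> j\<close>.
\<close>

definition invertible_submodule :: "'a set \<Rightarrow> ('a, 'm) ring_scheme \<Rightarrow> 'a set \<Rightarrow> bool"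
  where "invertible_submodule A B I \<longleftrightarrow>
    subalgebra A I B \<and> (\<exists>J. subalgebra A J B \<and> ideal_prod B I J = A)"

definition inv_submodules :: "'a set \<Rightarrow> ('a, 'm) ring_scheme \<Rightarrow> 'a set monoid"
  where "inv_submodules A B =
    \<lparr>carrier = {I. invertible_submodule A B I}, monoid.mult = ideal_prod B, monoid.one = A\<rparr>"

section \<open>Laurent polynomials\<close>

text \<open>\<open>R[X, X\<^sup>-\<^sup>1]\<close>: the function \<open>f\<close> stands for the sum of the \<open>f n X\<^sup>n\<close>.\<close>

definition laurent :: "('a, 'm) ring_scheme \<Rightarrow> (int \<Rightarrow> 'a) ring"
  where "laurent R =
    \<lparr>carrier = {f. range f \<subseteq> carrier R \<and> finite {n. f n \<noteq> \<zero>\<^bsub>R\<^esub>}},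
     monoid.mult = (\<lambda>f g n. \<Oplus>\<^bsub>R\<^esub>i\<in>{i. f i \<noteq> \<zero>\<^bsub>R\<^esub>}. f i \<otimes>\<^bsub>R\<^esub> g (n - i)),
     monoid.one = (\<lambda>n. if n = 0 then \<one>\<^bsub>R\<^esub> else \<zero>\<^bsub>R\<^esub>),
     ring.zero = (\<lambda>n. \<zero>\<^bsub>R\<^esub>),
     ring.add = (\<lambda>f g n. f n \<oplus>\<^bsub>R\<^esub> g n)\<rparr>"

definition laurent_const :: "('a, 'm) ring_scheme \<Rightarrow> 'a \<Rightarrow> int \<Rightarrow> 'a"
  where "laurent_const R a = (\<lambda>n. if n = 0 then a else \<zero>\<^bsub>R\<^esub>)"

abbreviation laurent_sub :: "'a set \<Rightarrow> ('a, 'm) ring_scheme \<Rightarrow> (int \<Rightarrow> 'a) set"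
  where "laurent_sub A B \<equiv> carrier (laurent (B\<lparr>carrier := A\<rparr>))"

definition laurent_extend :: "'a set \<Rightarrow> ('a, 'm) ring_scheme \<Rightarrow> 'a set \<Rightarrow> (int \<Rightarrow> 'a) set"
  where "laurent_extend A B I = ideal_prod (laurent B) (laurent_const B ` I) (laurent_sub A B)"

text \<open>
  The cokernel of \<open>laurent_extend A B\<close>, which is a group homomorphism by \<open>laurent_extend_hom\<close> below.
\<close>

definition MI :: "'a set \<Rightarrow> ('a, 'm) ring_scheme \<Rightarrow> (int \<Rightarrow> 'a) set set monoid"
  where "MI A B = inv_submodules (laurent_sub A B) (laurent B) Mod
                    (laurent_extend A B ` carrier (inv_submodules A B))"

section \<open>Subintegral extensions and seminormal rings\<close>

definition elementary_subintegral :: "'a set \<Rightarrow> ('a, 'm) ring_scheme \<Rightarrow> bool"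
  where "elementary_subintegral A B \<longleftrightarrow>
    (\<exists>b\<in>carrier B. carrier B = generate_ring B (insert b A) \<and>
       b [^]\<^bsub>B\<^esub> (2::nat) \<in> A \<and> b [^]\<^bsub>B\<^esub> (3::nat) \<in> A)"

definition subintegral :: "'a set \<Rightarrow> ('a, 'm) ring_scheme \<Rightarrow> bool"
  where "subintegral A B \<longleftrightarrow>
    (\<forall>b\<in>carrier B. \<exists>(r::nat) C. C 0 = A \<and> b \<in> C r \<and> (\<forall>i\<le>r. subcring (C i) B) \<and>
       (\<forall>i<r. C i \<subseteq> C (Suc i) \<and> elementary_subintegral (C i) (B\<lparr>carrier := C (Suc i)\<rparr>)))"

text \<open>
  The largest such \<open>C\<close> exists by \<open>subintegral_closure_greatest\<close> below.
\<close>

definition subintegral_closure :: "'a set \<Rightarrow> ('a, 'm) ring_scheme \<Rightarrow> 'a set"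
  where "subintegral_closure A B =
    (GREATEST C. subcring C B \<and> A \<subseteq> C \<and> subintegral A (B\<lparr>carrier := C\<rparr>))"

definition seminormal_ring :: "('a, 'm) ring_scheme \<Rightarrow> bool"
  where "seminormal_ring R \<longleftrightarrow>
    (\<forall>b\<in>carrier R. \<forall>c\<in>carrier R. b [^]\<^bsub>R\<^esub> (3::nat) = c [^]\<^bsub>R\<^esub> (2::nat) \<longrightarrow>
       (\<exists>a\<in>carrier R. b = a [^]\<^bsub>R\<^esub> (2::nat) \<and> c = a [^]\<^bsub>R\<^esub> (3::nat)))"

section \<open>Hensel local rings\<close>

definition local_ring :: "('a, 'm) ring_scheme \<Rightarrow> bool"
  where "local_ring R \<longleftrightarrow> cring R \<and> (\<exists>!M. maximalideal M R)"

definition finite_algebra ::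
    "('a, 'm) ring_scheme \<Rightarrow> ('c, 'n) ring_scheme \<Rightarrow> ('a \<Rightarrow> 'c) \<Rightarrow> bool"
  where "finite_algebra R C \<phi> \<longleftrightarrow> cring C \<and> \<phi> \<in> ring_hom R C \<and>
    (\<exists>S. finite S \<and> S \<subseteq> carrier C \<and>
       (\<forall>c\<in>carrier C. \<exists>f\<in>S \<rightarrow> carrier R. c = (\<Oplus>\<^bsub>C\<^esub>s\<in>S. \<phi> (f s) \<otimes>\<^bsub>C\<^esub> s)))"

text \<open>
  A direct product of local rings is \<open>RDirProd_list Rs\<close>; the zero algebra is the case \<open>Rs = []\<close>.
  A product of infinitely many local rings has infinitely many maximal ideals, so it is never finite
  over a local ring, and each factor is isomorphic to a ring on a subset of the product; hence
  finite lists of rings of the same type lose nothing.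
  Algebras with carrier in \<open>'a list\<close> suffice: a finite \<open>R\<close>-algebra is the image of some
  \<open>R\<^sup>n\<close>, hence isomorphic to one whose elements are lists over \<open>R\<close>.
  See \<open>hensel_local_ring_algebra\<close> below for algebras over arbitrary types.
\<close>

definition hensel_local_ring :: "('a, 'm) ring_scheme \<Rightarrow> bool"
  where "hensel_local_ring R \<longleftrightarrow> local_ring R \<and>
    (\<forall>(C :: 'a list ring) \<phi>. finite_algebra R C \<phi> \<longrightarrow>
       (\<exists>Rs :: 'a list ring list. (\<forall>S\<in>set Rs. local_ring S) \<and> C \<simeq> RDirProd_list Rs))"

section \<open>The subintegral closure exists\<close>

lemma (in ring) subcring_carrier_update_iff:
  assumes "subcring C R" "D \<subseteq> C"
  shows "subcring D (R\<lparr>carrier := C\<rparr>) \<longleftrightarrow> subcring D R"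
proof -
  have C: "C \<subseteq> carrier R" "ring (R\<lparr>carrier := C\<rparr>)"
    using assms(1) subcring.axioms(1) subcringE(1) subring_is_ring by blast+
  show ?thesis
    using ring.subcring_iff[OF C(2), of D] subcring_iff[of D] assms(2) C(1) by auto
qed

lemma (in ring) generate_ring_carrier_update:
  assumes "subring C R" "H \<subseteq> C"
  shows "generate_ring (R\<lparr>carrier := C\<rparr>) H = generate_ring R H"
  using subring_gen_incl[OF assms(1) carrier_is_subring assms(2)]
    subring_gen_incl[OF carrier_is_subring assms(1)] assms subringE(1)[OF assms(1)]
  by auto

definition (in cring) el_step :: "'a set \<Rightarrow> 'a set \<Rightarrow> bool"
  where "el_step C D \<longleftrightarrow> subcring C R \<and> subcring D R \<and> C \<subseteq> D \<and>
    elementary_subintegral C (R\<lparr>carrier := D\<rparr>)"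

lemma (in ring) elementary_subintegral_carrier_update:
  assumes "subring D R" "C \<subseteq> D"
  shows "elementary_subintegral C (R\<lparr>carrier := D\<rparr>) \<longleftrightarrow>
    (\<exists>b\<in>D. D = generate_ring R (insert b C) \<and> b [^] (2::nat) \<in> C \<and> b [^] (3::nat) \<in> C)"
proof -
  have "generate_ring (R\<lparr>carrier := D\<rparr>) (insert b C) = generate_ring R (insert b C)" if "b \<in> D" for b
    using generate_ring_carrier_update[OF assms(1)] assms(2) that by simp
  moreover have "b [^]\<^bsub>R\<lparr>carrier := D\<rparr>\<^esub> (n::nat) = b [^] n" for b n
    by (simp add: nat_pow_def)
  ultimately show ?thesis
    unfolding elementary_subintegral_def by auto
qed

lemma (in cring) el_step_extend:
  assumes "el_step C D" "subcring E R" "C \<subseteq> E"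
  shows "\<exists>F. el_step E F \<and> D \<subseteq> F"
proof -
  have D: "subring D R" and CD: "C \<subseteq> D" and C: "C \<subseteq> carrier R" and E: "E \<subseteq> carrier R"
    using assms subcring.axioms(1) subcringE(1) unfolding el_step_def by blast+
  obtain b where b: "b \<in> D" "D = generate_ring R (insert b C)" "b [^] (2::nat) \<in> C" "b [^] (3::nat) \<in> C"
    using assms(1) elementary_subintegral_carrier_update[OF D CD] unfolding el_step_def by blast
  have bR: "b \<in> carrier R" using b(1) subringE(1)[OF D] by blast
  define F where "F = generate_ring R (insert b E)"
  have F: "subring F R" "b \<in> F" "E \<subseteq> F"
    using generate_ring_is_subring[of "insert b E"] bR E generate_ring.incl[of _ "insert b E" R]
    unfolding F_def by auto
  have "D \<subseteq> F" unfolding b(2) F_def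
    using mono_generate_ring[of "insert b C" "insert b E"] assms(3) bR E by blast
  moreover have "elementary_subintegral E (R\<lparr>carrier := F\<rparr>)"
    using elementary_subintegral_carrier_update[OF F(1,3)] F b assms(3) unfolding F_def by blast
  ultimately show ?thesis
    using F assms(2) subcringI'[OF F(1)] unfolding el_step_def by blast
qed

lemma (in cring) el_steps_subcring:
  assumes "el_step\<^sup>*\<^sup>* C D" "subcring C R" shows "subcring D R \<and> C \<subseteq> D"
  using assms by (induction rule: rtranclp_induct) (auto simp: el_step_def)

lemma (in cring) el_steps_directed:
  assumes "el_step\<^sup>*\<^sup>* A D" "el_step\<^sup>*\<^sup>* A E" "subcring A R"
  shows "\<exists>F. el_step\<^sup>*\<^sup>* A F \<and> D \<subseteq> F \<and> E \<subseteq> F"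
  using assms(2)
proof (induction rule: rtranclp_induct)
  case base
  show ?case using assms(1) el_steps_subcring[OF assms(1,3)] by blast
next
  case (step E E')
  then obtain F where F: "el_step\<^sup>*\<^sup>* A F" "D \<subseteq> F" "E \<subseteq> F" by blast
  then obtain G where "el_step F G" "E' \<subseteq> G"
    using el_step_extend[OF step(2)] el_steps_subcring[OF F(1) assms(3)] by blast
  thus ?case using F by (meson el_step_def order_trans rtranclp.rtrancl_into_rtrancl)
qed

lemma (in cring) subintegral_carrier_update:
  assumes "subcring A R" "subcring C R"
  shows "subintegral A (R\<lparr>carrier := C\<rparr>) \<longleftrightarrow> (\<forall>b\<in>C. \<exists>D. el_step\<^sup>*\<^sup>* A D \<and> b \<in> D \<and> D \<subseteq> C)"
proof (intro iffI ballI)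
  fix b assume "subintegral A (R\<lparr>carrier := C\<rparr>)" "b \<in> C"
  then obtain r :: nat and D where D: "D 0 = A" "b \<in> D r" "\<And>i. i \<le> r \<Longrightarrow> subcring (D i) (R\<lparr>carrier := C\<rparr>)"
    "\<And>i. i < r \<Longrightarrow> D i \<subseteq> D (Suc i) \<and> elementary_subintegral (D i) (R\<lparr>carrier := D (Suc i)\<rparr>)"
    unfolding subintegral_def by fastforce
  have DC: "D i \<subseteq> C" and DR: "subcring (D i) R" if "i \<le> r" for i
    using subcringE(1)[OF D(3)[OF that]] D(3)[OF that] subcring_carrier_update_iff[OF assms(2)] by auto
  have "el_step\<^sup>*\<^sup>* A (D i)" if "i \<le> r" for i
    using that
  proof (induction i)
    case 0 thus ?case using D(1) by simp
  next
    case (Suc i)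
    hence "el_step (D i) (D (Suc i))" unfolding el_step_def using DR D(4) by simp
    thus ?case using Suc by simp
  qed
  thus "\<exists>D. el_step\<^sup>*\<^sup>* A D \<and> b \<in> D \<and> D \<subseteq> C" using D(2) DC by blast
next
  assume *: "\<forall>b\<in>C. \<exists>D. el_step\<^sup>*\<^sup>* A D \<and> b \<in> D \<and> D \<subseteq> C"
  show "subintegral A (R\<lparr>carrier := C\<rparr>)"
    unfolding subintegral_def
  proof
    fix b assume "b \<in> carrier (R\<lparr>carrier := C\<rparr>)"
    then obtain D where D: "el_step\<^sup>*\<^sup>* A D" "b \<in> D" "D \<subseteq> C" using * by auto
    from D(1) obtain r where "(el_step ^^ r) A D" by (auto simp: rtranclp_power)
    then obtain f where f: "f 0 = A" "f r = D" "\<And>i. i < r \<Longrightarrow> el_step (f i) (f (Suc i))"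
      by (auto simp: relpowp_fun_conv)
    have i: "subcring (f i) R \<and> f i \<subseteq> C" if "i \<le> r" for i
      using that
    proof (induction rule: inc_induct)
      case base show ?case using f(2) D el_steps_subcring[OF D(1) assms(1)] by simp
    next
      case (step i) thus ?case using f(3)[of i] unfolding el_step_def by auto
    qed
    show "\<exists>(r::nat) F. F 0 = A \<and> b \<in> F r \<and> (\<forall>i\<le>r. subcring (F i) (R\<lparr>carrier := C\<rparr>)) \<and>
       (\<forall>i<r. F i \<subseteq> F (Suc i) \<and> elementary_subintegral (F i) (R\<lparr>carrier := C, carrier := F (Suc i)\<rparr>))"
      using f D(2) i subcring_carrier_update_iff[OF assms(2)]
      by (intro exI[of _ r] exI[of _ f]) (auto simp: el_step_def)
  qed
qed

lemma (in cring) subintegral_closure_greatest: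
  assumes "subcring A R"
  defines "C \<equiv> subintegral_closure A R"
  shows "subcring C R" "A \<subseteq> C" "subintegral A (R\<lparr>carrier := C\<rparr>)"
    and "\<And>D. \<lbrakk> subcring D R; A \<subseteq> D; subintegral A (R\<lparr>carrier := D\<rparr>) \<rbrakk> \<Longrightarrow> D \<subseteq> C"
proof -
  define U where "U = \<Union>{D. el_step\<^sup>*\<^sup>* A D}"
  have sub: "subring D R" if "el_step\<^sup>*\<^sup>* A D" for D
    using el_steps_subcring[OF that assms(1)] subcring.axioms(1) by blast
  have two: "\<exists>D. el_step\<^sup>*\<^sup>* A D \<and> x \<in> D \<and> y \<in> D" if "x \<in> U" "y \<in> U" for x y
    using that el_steps_directed[OF _ _ assms(1)] unfolding U_def by (smt (verit) UnionE mem_Collect_eq subsetD)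
  have inU: "x \<in> U" if "el_step\<^sup>*\<^sup>* A D" "x \<in> D" for x D using that unfolding U_def by blast
  have AU: "A \<subseteq> U" unfolding U_def by auto
  have "subring U R"
  proof (rule subringI)
    show "U \<subseteq> carrier R" unfolding U_def using sub subringE(1) by blast
    show "\<one> \<in> U" using AU subcringE(3)[OF assms(1)] by blast
  next
    fix h assume "h \<in> U" thus "\<ominus> h \<in> U" using two[of h h] inU subringE(5)[OF sub] by metis
  next
    fix h k assume "h \<in> U" "k \<in> U"
    then obtain D where D: "el_step\<^sup>*\<^sup>* A D" "h \<in> D" "k \<in> D" using two by blast
    show "h \<otimes> k \<in> U" "h \<oplus> k \<in> U" 
      using inU[OF D(1)] subringE(6,7)[OF sub[OF D(1)]] D by blast+
  qed
  hence U: "subcring U R" by (rule subcringI')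
  have SU: "subintegral A (R\<lparr>carrier := U\<rparr>)"
    using subintegral_carrier_update[OF assms(1) U] unfolding U_def by blast
  have max: "D \<subseteq> U" if "subcring D R" "subintegral A (R\<lparr>carrier := D\<rparr>)" for D
    using subintegral_carrier_update[OF assms(1) that(1)] that inU by blast
  have "C = U"
    unfolding C_def subintegral_closure_def by (rule Greatest_equality) (use U AU SU max in auto)
  thus "subcring C R" "A \<subseteq> C" "subintegral A (R\<lparr>carrier := C\<rparr>)"
    "\<And>D. \<lbrakk> subcring D R; A \<subseteq> D; subintegral A (R\<lparr>carrier := D\<rparr>) \<rbrakk> \<Longrightarrow> D \<subseteq> C"
    using U AU SU max by auto
qed

section \<open>Hensel local rings and algebras over arbitrary types\<close>

lemma hensel_local_ring_algebra:
  fixes R :: "('a, 'm) ring_scheme" and C :: "('c, 'n) ring_scheme"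
  assumes "cring R" and "hensel_local_ring R" and "finite_algebra R C \<phi>"
  shows "\<exists>Rs :: 'a list ring list. (\<forall>S\<in>set Rs. local_ring S) \<and> C \<simeq> RDirProd_list Rs"
proof -
  interpret C: cring C using assms(3) unfolding finite_algebra_def by simp
  interpret R: cring R by fact
  have \<phi>: "\<phi> \<in> ring_hom R C" using assms(3) unfolding finite_algebra_def by simp
  obtain S where S: "finite S" "S \<subseteq> carrier C"
    "\<And>c. c \<in> carrier C \<Longrightarrow> \<exists>f\<in>S \<rightarrow> carrier R. c = (\<Oplus>\<^bsub>C\<^esub>s\<in>S. \<phi> (f s) \<otimes>\<^bsub>C\<^esub> s)"
    using assms(3) unfolding finite_algebra_def by blast
  obtain f where f: "\<And>c. c \<in> carrier C \<Longrightarrow> f c \<in> S \<rightarrow> carrier R"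
    "\<And>c. c \<in> carrier C \<Longrightarrow> c = (\<Oplus>\<^bsub>C\<^esub>s\<in>S. \<phi> (f c s) \<otimes>\<^bsub>C\<^esub> s)"
    using S(3) by metis
  obtain xs where xs: "set xs = S" using S(1) finite_list by blast
  define g where "g c = map (f c) xs" for c
  have \<phi>c: "\<phi> a \<in> carrier C" if "a \<in> carrier R" for a using \<phi> that by (simp add: ring_hom_closed)
  have g: "inj_on g (carrier C)"
  proof (rule inj_onI)
    fix c d assume cd: "c \<in> carrier C" "d \<in> carrier C" "g c = g d"
    hence "\<And>s. s \<in> S \<Longrightarrow> f c s = f d s" unfolding g_def using xs by simp
    hence "(\<Oplus>\<^bsub>C\<^esub>s\<in>S. \<phi> (f c s) \<otimes>\<^bsub>C\<^esub> s) = (\<Oplus>\<^bsub>C\<^esub>s\<in>S. \<phi> (f d s) \<otimes>\<^bsub>C\<^esub> s)"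
      using f(1)[OF cd(2)] S(2) by (intro C.finsum_cong') (auto intro!: \<phi>c)
    thus "c = d" using f(2) cd by metis
  qed
  define C' where "C' = image_ring g C"
  have iso: "g \<in> ring_iso C C'" unfolding C'_def by (rule inj_imp_image_ring_iso[OF g])
  have C': "cring C'"
    using C.ring_iso_imp_img_cring[OF iso] unfolding C'_def image_ring_def image_group_def
    by (simp add: monoid.defs)
  interpret h: ring_hom_cring C C' g
    using iso C.is_cring C' by (auto intro!: ring_hom_cring.intro ring_hom_cring_axioms.intro simp: ring_iso_def)
  have "finite_algebra R C' (g \<circ> \<phi>)"
    unfolding finite_algebra_def
  proof (intro conjI exI[of _ "g ` S"] ballI)
    show "g \<circ> \<phi> \<in> ring_hom R C'" using \<phi> h.homh by (rule ring_hom_trans)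
    show "g ` S \<subseteq> carrier C'" using S(2) by auto
    fix c' assume "c' \<in> carrier C'"
    then obtain c where c: "c \<in> carrier C" "c' = g c" unfolding C'_def image_ring_carrier by blast
    have gS: "inj_on g S" using g S(2) inj_on_subset by blast
    have fc: "f c s \<in> carrier R" if "s \<in> S" for s using f(1)[OF c(1)] that by auto
    have "c' = g (\<Oplus>\<^bsub>C\<^esub>s\<in>S. \<phi> (f c s) \<otimes>\<^bsub>C\<^esub> s)" using f(2) c by metis
    also have "\<dots> = (\<Oplus>\<^bsub>C'\<^esub>s\<in>S. g (\<phi> (f c s)) \<otimes>\<^bsub>C'\<^esub> g s)"
    proof -
      have "g (\<Oplus>\<^bsub>C\<^esub>s\<in>S. \<phi> (f c s) \<otimes>\<^bsub>C\<^esub> s) = finsum C' (g \<circ> (\<lambda>s. \<phi> (f c s) \<otimes>\<^bsub>C\<^esub> s)) S"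
        by (rule h.hom_finsum) (use S(2) fc \<phi>c in auto)
      also have "\<dots> = (\<Oplus>\<^bsub>C'\<^esub>s\<in>S. g (\<phi> (f c s)) \<otimes>\<^bsub>C'\<^esub> g s)"
        by (rule h.S.finsum_cong') (use S(2) fc \<phi>c in \<open>auto intro!: h.hom_mult\<close>)
      finally show ?thesis .
    qed
    also have "\<dots> = (\<Oplus>\<^bsub>C'\<^esub>s\<in>S. g (\<phi> (f c (inv_into S g (g s)))) \<otimes>\<^bsub>C'\<^esub> g s)"
      by (rule h.S.finsum_cong') (use S(2) fc \<phi>c gS in auto)
    also have "\<dots> = (\<Oplus>\<^bsub>C'\<^esub>t\<in>g ` S. (g \<circ> \<phi>) ((f c \<circ> inv_into S g) t) \<otimes>\<^bsub>C'\<^esub> t)"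
      by (subst h.S.finsum_reindex) (use S(2) fc \<phi>c gS in auto)
    finally show "\<exists>k\<in>g ` S \<rightarrow> carrier R. c' = (\<Oplus>\<^bsub>C'\<^esub>t\<in>g ` S. (g \<circ> \<phi>) (k t) \<otimes>\<^bsub>C'\<^esub> t)"
      by (intro bexI[of _ "f c \<circ> inv_into S g"]) (use fc gS in auto)
  qed (use C' S(1) in auto)
  then obtain Rs :: "'a list ring list" where "\<forall>S\<in>set Rs. local_ring S" "C' \<simeq> RDirProd_list Rs"
    using assms(2) unfolding hensel_local_ring_def by blast
  thus ?thesis using iso ring_iso_trans[of C C'] unfolding is_ring_iso_def by blast
qed

section \<open>Laurent polynomials form a commutative ring\<close>

lemma (in cring) laurent_mult_window:
  assumes "f \<in> carrier (laurent R)" "g \<in> carrier (laurent R)"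
    and "finite S" "{i. f i \<noteq> \<zero>} \<subseteq> S"
  shows "(f \<otimes>\<^bsub>laurent R\<^esub> g) n = (\<Oplus>i\<in>S. f i \<otimes> g (n - i))"
proof -
  have c: "f i \<in> carrier R" "g i \<in> carrier R" for i
    using assms(1,2) by (auto simp: laurent_def)
  show ?thesis unfolding laurent_def
    by (simp, rule add.finprod_mono_neutral_cong_left) (use assms c in auto)
qed

lemma (in cring) finsum_finsum_swap:
  assumes "finite S" "finite T" "\<And>i j. \<lbrakk> i \<in> S; j \<in> T \<rbrakk> \<Longrightarrow> f i j \<in> carrier R"
  shows "(\<Oplus>i\<in>S. \<Oplus>j\<in>T. f i j) = (\<Oplus>j\<in>T. \<Oplus>i\<in>S. f i j)"
  using assms(1,3)
proof (induction S)
  case empty show ?case by simp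
next
  case (insert x S)
  have "(\<Oplus>j\<in>T. \<Oplus>i\<in>insert x S. f i j) = (\<Oplus>j\<in>T. f x j \<oplus> (\<Oplus>i\<in>S. f i j))"
    by (rule finsum_cong') (use insert in \<open>auto intro!: finsum_closed\<close>)
  also have "\<dots> = (\<Oplus>j\<in>T. f x j) \<oplus> (\<Oplus>j\<in>T. \<Oplus>i\<in>S. f i j)"
    by (rule finsum_addf) (use insert in \<open>auto intro!: finsum_closed\<close>)
  finally show ?case
    using insert by (subst finsum_insert) (auto intro!: finsum_closed)
qed

lemma (in cring) laurent_mult_support:
  assumes "f \<in> carrier (laurent R)" "g \<in> carrier (laurent R)"
  shows "{n. (f \<otimes>\<^bsub>laurent R\<^esub> g) n \<noteq> \<zero>} \<subseteq> (\<lambda>(i, j). i + j) ` ({i. f i \<noteq> \<zero>} \<times> {i. g i \<noteq> \<zero>})"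
proof
  have c: "f i \<in> carrier R" "g i \<in> carrier R" for i
    using assms(1,2) by (auto simp: laurent_def)
  fix n assume "n \<in> {n. (f \<otimes>\<^bsub>laurent R\<^esub> g) n \<noteq> \<zero>}"
  hence "(\<Oplus>i\<in>{i. f i \<noteq> \<zero>}. f i \<otimes> g (n - i)) \<noteq> \<zero>" by (simp add: laurent_def)
  then obtain i where "f i \<noteq> \<zero>" "f i \<otimes> g (n - i) \<noteq> \<zero>"
    using add.finprod_one_eqI by (metis (mono_tags, lifting) mem_Collect_eq)
  hence "f i \<noteq> \<zero>" "g (n - i) \<noteq> \<zero>" using c by auto
  thus "n \<in> (\<lambda>(i, j). i + j) ` ({i. f i \<noteq> \<zero>} \<times> {i. g i \<noteq> \<zero>})"
    by (intro image_eqI[of _ _ "(i, n - i)"]) auto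
qed

lemma (in cring) laurent_mult_closed:
  assumes "f \<in> carrier (laurent R)" "g \<in> carrier (laurent R)"
  shows "f \<otimes>\<^bsub>laurent R\<^esub> g \<in> carrier (laurent R)"
proof -
  have "finite {n. (f \<otimes>\<^bsub>laurent R\<^esub> g) n \<noteq> \<zero>}"
    by (rule finite_subset[OF laurent_mult_support[OF assms]])
       (use assms in \<open>auto simp: laurent_def\<close>)
  moreover have "(f \<otimes>\<^bsub>laurent R\<^esub> g) n \<in> carrier R" for n
    using assms unfolding laurent_def by (auto simp: image_subset_iff intro!: finsum_closed m_closed)
  ultimately show ?thesis unfolding laurent_def by auto
qed

lemma (in cring) laurent_mult_comm:
  assumes "f \<in> carrier (laurent R)" "g \<in> carrier (laurent R)"
  shows "f \<otimes>\<^bsub>laurent R\<^esub> g = g \<otimes>\<^bsub>laurent R\<^esub> f"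
proof
  fix n
  have c: "f i \<in> carrier R" "g i \<in> carrier R" for i
    using assms by (auto simp: laurent_def)
  have fin: "finite {i. f i \<noteq> \<zero>}" "finite {i. g i \<noteq> \<zero>}"
    using assms by (auto simp: laurent_def)
  define S where "S = {i. f i \<noteq> \<zero>} \<union> (\<lambda>i. n - i) ` {i. g i \<noteq> \<zero>}"
  have inj: "inj_on (\<lambda>i. n - i) S" by (auto intro: inj_onI)
  have "(f \<otimes>\<^bsub>laurent R\<^esub> g) n = (\<Oplus>i\<in>S. f i \<otimes> g (n - i))"
    by (rule laurent_mult_window[OF assms]) (use fin in \<open>auto simp: S_def\<close>)
  also have "\<dots> = (\<Oplus>i\<in>S. g (n - i) \<otimes> f (n - (n - i)))"
    by (rule finsum_cong') (use c m_comm in auto)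
  also have "\<dots> = (\<Oplus>j\<in>(\<lambda>i. n - i) ` S. g j \<otimes> f (n - j))"
    by (subst finsum_reindex[OF _ inj]) (use c in auto)
  also have "\<dots> = (g \<otimes>\<^bsub>laurent R\<^esub> f) n"
    by (rule laurent_mult_window[OF assms(2,1), symmetric])
       (use fin in \<open>auto simp: S_def image_Un image_image\<close>)
  finally show "(f \<otimes>\<^bsub>laurent R\<^esub> g) n = (g \<otimes>\<^bsub>laurent R\<^esub> f) n" .
qed

lemma (in cring) laurent_mult_assoc:
  assumes "f \<in> carrier (laurent R)" "g \<in> carrier (laurent R)" "h \<in> carrier (laurent R)"
  shows "f \<otimes>\<^bsub>laurent R\<^esub> g \<otimes>\<^bsub>laurent R\<^esub> h = f \<otimes>\<^bsub>laurent R\<^esub> (g \<otimes>\<^bsub>laurent R\<^esub> h)"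
proof
  fix n
  have c: "f i \<in> carrier R" "g i \<in> carrier R" "h i \<in> carrier R" for i
    using assms by (auto simp: laurent_def)
  define F where "F = {i. f i \<noteq> \<zero>}"
  define G where "G = {i. g i \<noteq> \<zero>}"
  define S where "S = (\<lambda>(i, j). i + j) ` (F \<times> G)"
  have fin: "finite F" "finite G" "finite S"
    using assms by (auto simp: laurent_def F_def G_def S_def)
  have "(f \<otimes>\<^bsub>laurent R\<^esub> g \<otimes>\<^bsub>laurent R\<^esub> h) n = (\<Oplus>i\<in>S. (f \<otimes>\<^bsub>laurent R\<^esub> g) i \<otimes> h (n - i))"
    by (rule laurent_mult_window)
       (use laurent_mult_closed laurent_mult_support[OF assms(1,2)] assms fin in \<open>auto simp: F_def G_def S_def\<close>)
  also have "\<dots> = (\<Oplus>i\<in>S. \<Oplus>j\<in>F. f j \<otimes> g (i - j) \<otimes> h (n - i))"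
  proof (rule finsum_cong')
    fix i
    have "(f \<otimes>\<^bsub>laurent R\<^esub> g) i = (\<Oplus>j\<in>F. f j \<otimes> g (i - j))"
      by (rule laurent_mult_window[OF assms(1,2) fin(1)]) (auto simp: F_def)
    thus "(f \<otimes>\<^bsub>laurent R\<^esub> g) i \<otimes> h (n - i) = (\<Oplus>j\<in>F. f j \<otimes> g (i - j) \<otimes> h (n - i))"
      using c fin by (simp add: finsum_ldistr)
  qed (use c in \<open>auto intro!: finsum_closed\<close>)
  also have "\<dots> = (\<Oplus>j\<in>F. \<Oplus>i\<in>S. f j \<otimes> g (i - j) \<otimes> h (n - i))"
    by (rule finsum_finsum_swap) (use c fin in auto)
  also have "\<dots> = (\<Oplus>j\<in>F. f j \<otimes> (g \<otimes>\<^bsub>laurent R\<^esub> h) (n - j))"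
  proof (rule finsum_cong')
    fix j assume j: "j \<in> F"
    have inj: "inj_on (\<lambda>k. j + k) G" by (auto intro: inj_onI)
    have "(\<Oplus>i\<in>S. f j \<otimes> g (i - j) \<otimes> h (n - i)) = (\<Oplus>i\<in>(\<lambda>k. j + k) ` G. f j \<otimes> g (i - j) \<otimes> h (n - i))"
    proof (rule add.finprod_mono_neutral_cong_right)
      fix i assume "i \<in> S - (\<lambda>k. j + k) ` G"
      hence "i - j \<notin> G" by (metis DiffD2 add_diff_cancel_left' diff_add_cancel image_eqI add.commute)
      thus "f j \<otimes> g (i - j) \<otimes> h (n - i) = \<zero>\<^bsub>R\<^esub>" using c by (simp add: G_def)
    qed (use c fin j in \<open>auto simp: S_def\<close>)
    also have "\<dots> = (\<Oplus>k\<in>G. f j \<otimes> g (j + k - j) \<otimes> h (n - (j + k)))"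
      by (rule finsum_reindex[OF _ inj]) (use c in auto)
    also have "\<dots> = (\<Oplus>k\<in>G. f j \<otimes> (g k \<otimes> h (n - j - k)))"
      by (rule finsum_cong') (use c in \<open>auto simp: m_assoc diff_diff_add\<close>)
    also have "\<dots> = f j \<otimes> (\<Oplus>k\<in>G. g k \<otimes> h (n - j - k))"
      by (rule finsum_rdistr[symmetric]) (use c fin in auto)
    also have "(\<Oplus>k\<in>G. g k \<otimes> h (n - j - k)) = (g \<otimes>\<^bsub>laurent R\<^esub> h) (n - j)"
      by (rule laurent_mult_window[OF assms(2,3) fin(2), symmetric]) (auto simp: G_def)
    finally show "(\<Oplus>i\<in>S. f j \<otimes> g (i - j) \<otimes> h (n - i)) = f j \<otimes> (g \<otimes>\<^bsub>laurent R\<^esub> h) (n - j)" .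
  next
    have "(g \<otimes>\<^bsub>laurent R\<^esub> h) i \<in> carrier R" for i
      using laurent_mult_closed[OF assms(2,3)] by (auto simp: laurent_def)
    thus "(\<lambda>j. f j \<otimes> (g \<otimes>\<^bsub>laurent R\<^esub> h) (n - j)) \<in> F \<rightarrow> carrier R" using c by auto
  qed simp
  also have "\<dots> = (f \<otimes>\<^bsub>laurent R\<^esub> (g \<otimes>\<^bsub>laurent R\<^esub> h)) n"
    by (rule laurent_mult_window[symmetric])
       (use laurent_mult_closed assms fin in \<open>auto simp: F_def\<close>)
  finally show "(f \<otimes>\<^bsub>laurent R\<^esub> g \<otimes>\<^bsub>laurent R\<^esub> h) n = (f \<otimes>\<^bsub>laurent R\<^esub> (g \<otimes>\<^bsub>laurent R\<^esub> h)) n" .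
qed

lemma (in cring) laurent_cring: "cring (laurent R)"
proof (rule cringI)
  note simps = laurent_def image_subset_iff
  have fin_add: "finite {n. f n \<oplus> g n \<noteq> \<zero>}"
    if "finite {n. f n \<noteq> \<zero>}" "finite {n. g n \<noteq> \<zero>}" for f g :: "int \<Rightarrow> 'a"
    by (rule finite_subset[OF _ finite_UnI[OF that]]) auto
  show "abelian_group (laurent R)"
  proof (rule abelian_groupI)
    fix f assume "f \<in> carrier (laurent R)"
    thus "\<exists>g\<in>carrier (laurent R). g \<oplus>\<^bsub>laurent R\<^esub> f = \<zero>\<^bsub>laurent R\<^esub>"
      by (intro bexI[of _ "\<lambda>n. \<ominus> f n"]) (auto simp: simps l_neg elim!: finite_subset[rotated])
  qed (auto simp: simps fin_add a_ac)
  show "comm_monoid (laurent R)"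
  proof (rule comm_monoidI)
    show one: "\<one>\<^bsub>laurent R\<^esub> \<in> carrier (laurent R)"
      by (auto simp: simps)
    fix f assume f: "f \<in> carrier (laurent R)"
    hence c: "f n \<in> carrier R" for n by (auto simp: simps)
    have "(\<one>\<^bsub>laurent R\<^esub> \<otimes>\<^bsub>laurent R\<^esub> f) n = (\<Oplus>i\<in>{0}. \<one>\<^bsub>laurent R\<^esub> i \<otimes> f (n - i))" for n
      by (rule laurent_mult_window[OF one f]) (auto simp: laurent_def split: if_splits)
    moreover have "\<dots>n = f n" for n
      using c by (simp add: laurent_def finsum_insert)
    ultimately show "\<one>\<^bsub>laurent R\<^esub> \<otimes>\<^bsub>laurent R\<^esub> f = f" by auto
  qed (auto intro: laurent_mult_closed laurent_mult_assoc laurent_mult_comm)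
  fix f g h assume a: "f \<in> carrier (laurent R)" "g \<in> carrier (laurent R)" "h \<in> carrier (laurent R)"
  define S where "S = {i. f i \<noteq> \<zero>} \<union> {i. g i \<noteq> \<zero>}"
  have c: "f n \<in> carrier R" "g n \<in> carrier R" "h n \<in> carrier R" for n using a by (auto simp: simps)
  have S: "finite S" using a by (auto simp: simps S_def)
  have fg: "f \<oplus>\<^bsub>laurent R\<^esub> g \<in> carrier (laurent R)" using a by (auto simp: simps fin_add)
  have "((f \<oplus>\<^bsub>laurent R\<^esub> g) \<otimes>\<^bsub>laurent R\<^esub> h) n =
      (f \<otimes>\<^bsub>laurent R\<^esub> h \<oplus>\<^bsub>laurent R\<^esub> g \<otimes>\<^bsub>laurent R\<^esub> h) n" for n
  proof -
    have "((f \<oplus>\<^bsub>laurent R\<^esub> g) \<otimes>\<^bsub>laurent R\<^esub> h) n = (\<Oplus>i\<in>S. (f \<oplus>\<^bsub>laurent R\<^esub> g) i \<otimes> h (n - i))"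
      by (rule laurent_mult_window[OF fg a(3) S]) (auto simp: S_def laurent_def)
    also have "\<dots> = (\<Oplus>i\<in>S. f i \<otimes> h (n - i) \<oplus> g i \<otimes> h (n - i))"
      by (rule finsum_cong') (use c in \<open>auto simp: laurent_def l_distr\<close>)
    also have "\<dots> = (\<Oplus>i\<in>S. f i \<otimes> h (n - i)) \<oplus> (\<Oplus>i\<in>S. g i \<otimes> h (n - i))"
      by (rule finsum_addf) (use c in auto)
    also have "\<dots> = (f \<otimes>\<^bsub>laurent R\<^esub> h) n \<oplus> (g \<otimes>\<^bsub>laurent R\<^esub> h) n"
      using laurent_mult_window[OF a(1,3) S] laurent_mult_window[OF a(2,3) S] by (simp add: S_def)
    finally show ?thesis by (simp add: laurent_def)
  qed
  thus "(f \<oplus>\<^bsub>laurent R\<^esub> g) \<otimes>\<^bsub>laurent R\<^esub> h =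
      f \<otimes>\<^bsub>laurent R\<^esub> h \<oplus>\<^bsub>laurent R\<^esub> g \<otimes>\<^bsub>laurent R\<^esub> h" by auto
qed

lemma (in cring) laurent_sub_subcring:
  assumes "subcring A R"
  shows "subcring (laurent_sub A R) (laurent R)"
proof -
  interpret L: cring "laurent R" by (rule laurent_cring)
  have A: "subring A R" using assms subcring.axioms(1) by blast
  note AE = subringE[OF A]
  have eq: "laurent_sub A R = {f \<in> carrier (laurent R). range f \<subseteq> A}"
    using AE(1) by (auto simp: laurent_def)
  have sum: "finsum R k T \<in> A" if "finite T" "\<And>i. i \<in> T \<Longrightarrow> k i \<in> A" for k and T :: "int set"
    using that
  proof (induction T)
    case (insert x T)
    have "k \<in> T \<rightarrow> carrier R" "k x \<in> carrier R" using insert AE(1) by auto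
    thus ?case using insert AE(7) by simp
  qed (use AE in simp)
  have inv: "(\<ominus>\<^bsub>laurent R\<^esub> f) = (\<lambda>n. \<ominus> f n)" if "f \<in> carrier (laurent R)" for f
  proof -
    have "(\<lambda>n. \<ominus> f n) \<in> carrier (laurent R)"
      using that by (auto simp: laurent_def elim!: finite_subset[rotated])
    moreover have "f \<oplus>\<^bsub>laurent R\<^esub> (\<lambda>n. \<ominus> f n) = \<zero>\<^bsub>laurent R\<^esub>"
      using that by (auto simp: laurent_def r_neg image_subset_iff)
    ultimately show ?thesis using that L.minus_equality L.a_comm by metis
  qed
  show ?thesis unfolding eq
  proof (rule L.subcringI', rule L.subringI)
    fix f g assume f: "f \<in> {f \<in> carrier (laurent R). range f \<subseteq> A}"
    show "\<ominus>\<^bsub>laurent R\<^esub> f \<in> {f \<in> carrier (laurent R). range f \<subseteq> A}"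
      using f inv L.a_inv_closed[of f] AE(5) by auto
    assume g: "g \<in> {f \<in> carrier (laurent R). range f \<subseteq> A}"
    have "(f \<otimes>\<^bsub>laurent R\<^esub> g) n \<in> A" for n
      using f g AE(6) by (simp add: laurent_def, intro sum) (auto simp: image_subset_iff)
    thus "f \<otimes>\<^bsub>laurent R\<^esub> g \<in> {f \<in> carrier (laurent R). range f \<subseteq> A}"
      using f g by auto
    show "f \<oplus>\<^bsub>laurent R\<^esub> g \<in> {f \<in> carrier (laurent R). range f \<subseteq> A}"
      using f g L.a_closed[of f g] AE(7) by (auto simp: laurent_def image_subset_iff)
  qed (use L.one_closed AE(2,3) in \<open>auto simp: laurent_def\<close>)
qed

section \<open>The groups of invertible submodules\<close>

lemma ideal_prod_mono: "\<lbrakk> I \<subseteq> I'; J \<subseteq> J' \<rbrakk> \<Longrightarrow> ideal_prod R I J \<subseteq> ideal_prod R I' J'"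
proof
  fix x assume "I \<subseteq> I'" "J \<subseteq> J'" "x \<in> ideal_prod R I J"
  from this(3,1,2) show "x \<in> ideal_prod R I' J'"
    by (induction rule: ideal_prod.induct) (auto intro: ideal_prod.intros)
qed

lemma (in cring) ideal_prod_carrier:
  assumes "I \<subseteq> carrier R" "J \<subseteq> carrier R" shows "ideal_prod R I J \<subseteq> carrier R"
proof
  fix x assume "x \<in> ideal_prod R I J"
  thus "x \<in> carrier R" using assms by (induction rule: ideal_prod.induct) auto
qed

lemma (in cring) ideal_prod_commute_sets:
  assumes "I \<subseteq> carrier R" "J \<subseteq> carrier R" shows "ideal_prod R I J = ideal_prod R J I"
proof -
  have "ideal_prod R I J \<subseteq> ideal_prod R J I" if "I \<subseteq> carrier R" "J \<subseteq> carrier R" for I J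
  proof
    fix x assume "x \<in> ideal_prod R I J"
    thus "x \<in> ideal_prod R J I"
    proof (induction rule: ideal_prod.induct)
      case (prod i j)
      have "i \<in> carrier R" "j \<in> carrier R" using prod that by auto
      thus ?case using m_comm[of i j] ideal_prod.prod[of j J i I R] prod by simp
    qed (auto intro: ideal_prod.sum)
  qed
  thus ?thesis using assms by blast
qed

lemma (in cring) ideal_prod_assoc_sets:
  assumes "I \<subseteq> carrier R" "J \<subseteq> carrier R" "K \<subseteq> carrier R"
  shows "ideal_prod R (ideal_prod R I J) K = ideal_prod R I (ideal_prod R J K)"
proof -
  have *: "ideal_prod R (ideal_prod R I J) K \<subseteq> ideal_prod R I (ideal_prod R J K)"
    if c: "I \<subseteq> carrier R" "J \<subseteq> carrier R" "K \<subseteq> carrier R" for I J K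
  proof
    fix x assume "x \<in> ideal_prod R (ideal_prod R I J) K"
    thus "x \<in> ideal_prod R I (ideal_prod R J K)"
    proof (induction rule: ideal_prod.induct)
      case (prod s k)
      from prod(1) show ?case
      proof (induction rule: ideal_prod.induct)
        case ij: (prod i j)
        have "i \<otimes> j \<otimes> k = i \<otimes> (j \<otimes> k)" using ij prod(2) c by (intro m_assoc) auto
        thus ?case using ij prod(2) by (auto intro: ideal_prod.intros)
      next
        case (sum s t)
        have "s \<in> carrier R" "t \<in> carrier R" "k \<in> carrier R"
          using sum(1,2) prod(2) ideal_prod_carrier[OF c(1,2)] c(3) by auto
        thus ?case using sum by (simp add: l_distr ideal_prod.sum)
      qed
    qed (auto intro: ideal_prod.sum)
  qed
  have "ideal_prod R I (ideal_prod R J K) = ideal_prod R (ideal_prod R K J) I"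
    using ideal_prod_commute_sets assms ideal_prod_carrier by simp
  also have "\<dots> \<subseteq> ideal_prod R K (ideal_prod R J I)" using * assms by blast
  also have "\<dots> = ideal_prod R (ideal_prod R I J) K"
    using ideal_prod_commute_sets assms ideal_prod_carrier by simp
  finally show ?thesis using *[OF assms] by blast
qed

lemma (in cring) ideal_prod_submodule:
  assumes "A \<subseteq> carrier R" "I \<subseteq> carrier R" "I \<noteq> {}" "subalgebra A K R"
  shows "subalgebra A (ideal_prod R I K) R"
proof -
  have K: "subgroup K (add_monoid R)" "K \<subseteq> carrier R"
    using assms(4) subalgebra.axioms(1) subalgebra_in_carrier by blast+
  have c: "ideal_prod R I K \<subseteq> carrier R" using ideal_prod_carrier assms(2) K(2) by blast
  have "subgroup (ideal_prod R I K) (add_monoid R)"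
  proof (rule add.subgroupI)
    obtain i where "i \<in> I" using assms(3) by blast
    thus "ideal_prod R I K \<noteq> {}"
      using subgroup.one_closed[OF K(1)] ideal_prod.prod[of i I _ K R] by auto
    fix x assume "x \<in> ideal_prod R I K"
    thus "\<ominus> x \<in> ideal_prod R I K"
    proof (induction rule: ideal_prod.induct)
      case (prod i j)
      have "\<ominus> j \<in> K" using subgroup.m_inv_closed[OF K(1) prod(2)] by (simp add: a_inv_def)
      moreover have "\<ominus> (i \<otimes> j) = i \<otimes> \<ominus> j" using prod assms(2) K(2) r_minus[of i j] by (metis subsetD)
      ultimately show ?case using prod by (auto intro: ideal_prod.prod)
    next
      case (sum s t)
      hence "s \<in> carrier R" "t \<in> carrier R" using c by auto
      thus ?case using sum by (simp add: minus_add ideal_prod.sum)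
    qed
  qed (use c in \<open>auto intro: ideal_prod.sum\<close>)
  moreover have "a \<otimes> x \<in> ideal_prod R I K" if "a \<in> A" "x \<in> ideal_prod R I K" for a x
    using that(2)
  proof (induction rule: ideal_prod.induct)
    case (prod i j)
    have "a \<otimes> j \<in> K" using subalgebra.smult_closed[OF assms(4) that(1) prod(2)] .
    moreover have "a \<otimes> (i \<otimes> j) = i \<otimes> (a \<otimes> j)" using prod assms(1,2) K(2) that(1) by (intro m_lcomm) auto
    ultimately show ?case using prod by (auto intro: ideal_prod.prod)
  next
    case (sum s t)
    hence "s \<in> carrier R" "t \<in> carrier R" "a \<in> carrier R" using c that(1) assms(1) by auto
    thus ?case using sum by (simp add: r_distr ideal_prod.sum)
  qed
  ultimately show ?thesis unfolding subalgebra_def subalgebra_axioms_def by blast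
qed

lemma (in cring) ideal_prod_unit:
  assumes "subcring A R" "subalgebra A I R" shows "ideal_prod R A I = I"
proof
  show "ideal_prod R A I \<subseteq> I"
  proof
    fix x assume "x \<in> ideal_prod R A I"
    thus "x \<in> I"
      using subalgebra.smult_closed[OF assms(2)] subgroup.m_closed[OF subalgebra.axioms(1)[OF assms(2)]]
      by (induction rule: ideal_prod.induct) auto
  qed
  show "I \<subseteq> ideal_prod R A I"
    using ideal_prod.prod[OF subcringE(3)[OF assms(1)], of _ I R] subalgebra_in_carrier[OF assms(2)]
    by (metis l_one subset_iff)
qed

lemma (in cring) subcring_is_submodule: "subcring A R \<Longrightarrow> subalgebra A A R"
  using subcring.axioms(1)[of A R] subcringE(6)[of A R]
  unfolding subalgebra_def subalgebra_axioms_def subring_def by auto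

lemma (in cring) inv_submodules_comm_group:
  assumes A: "subcring A R"
  shows "comm_group (inv_submodules A R)"
proof (rule comm_groupI)
  have c: "I \<subseteq> carrier R" "I \<noteq> {}" if "subalgebra A I R" for I
    using subalgebra_in_carrier[OF that] subgroup.one_closed[OF subalgebra.axioms(1)[OF that]] by auto
  note AA = subcring_is_submodule[OF A]
  have prod: "subalgebra A (ideal_prod R I J) R" if "subalgebra A I R" "subalgebra A J R" for I J
    using ideal_prod_submodule[OF subcringE(1)[OF A] c[OF that(1)] that(2)] .
  note simps = inv_submodules_def invertible_submodule_def
  fix I assume I: "I \<in> carrier (inv_submodules A R)"
  show "\<one>\<^bsub>inv_submodules A R\<^esub> \<otimes>\<^bsub>inv_submodules A R\<^esub> I = I"
    using I ideal_prod_unit[OF A] by (simp add: simps)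
  show "\<exists>J\<in>carrier (inv_submodules A R). J \<otimes>\<^bsub>inv_submodules A R\<^esub> I = \<one>\<^bsub>inv_submodules A R\<^esub>"
  proof -
    obtain J where "subalgebra A I R" "subalgebra A J R" "ideal_prod R I J = A"
      using I by (auto simp: simps)
    moreover from this have "ideal_prod R J I = A" using ideal_prod_commute_sets c(1) by metis
    ultimately show ?thesis by (intro bexI[of _ J]) (auto simp: simps)
  qed
  fix J assume J: "J \<in> carrier (inv_submodules A R)"
  show "I \<otimes>\<^bsub>inv_submodules A R\<^esub> J = J \<otimes>\<^bsub>inv_submodules A R\<^esub> I"
    using I J ideal_prod_commute_sets[OF c(1) c(1)] by (simp add: simps)
  obtain I' where I': "subalgebra A I R" "subalgebra A I' R" "ideal_prod R I I' = A"
    using I by (auto simp: simps)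
  obtain J' where J': "subalgebra A J R" "subalgebra A J' R" "ideal_prod R J J' = A"
    using J by (auto simp: simps)
  have "ideal_prod R (ideal_prod R I J) (ideal_prod R J' I') =
      ideal_prod R I (ideal_prod R (ideal_prod R J J') I')"
    using ideal_prod_assoc_sets[of J J' I'] ideal_prod_assoc_sets[of I J "ideal_prod R J' I'"]
      ideal_prod_carrier[of J' I'] c(1)[OF I'(1)] c(1)[OF I'(2)] c(1)[OF J'(1)] c(1)[OF J'(2)] by simp
  also have "\<dots> = A" using I' J' ideal_prod_unit[OF A] by simp
  finally show "I \<otimes>\<^bsub>inv_submodules A R\<^esub> J \<in> carrier (inv_submodules A R)"
    using prod I' J' by (auto simp: simps)
  fix K assume K: "K \<in> carrier (inv_submodules A R)"
  show "I \<otimes>\<^bsub>inv_submodules A R\<^esub> J \<otimes>\<^bsub>inv_submodules A R\<^esub> K =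
      I \<otimes>\<^bsub>inv_submodules A R\<^esub> (J \<otimes>\<^bsub>inv_submodules A R\<^esub> K)"
    using I J K ideal_prod_assoc_sets c(1) by (simp add: simps)
next
  show "\<one>\<^bsub>inv_submodules A R\<^esub> \<in> carrier (inv_submodules A R)"
    using subcring_is_submodule[OF A] ideal_prod_unit[OF A]
    by (auto simp: inv_submodules_def invertible_submodule_def)
qed

lemma (in cring) laurent_const_hom: "laurent_const R \<in> ring_hom R (laurent R)"
proof (rule ring_hom_memI)
  show c: "laurent_const R a \<in> carrier (laurent R)" if "a \<in> carrier R" for a
    using that by (auto simp: laurent_const_def laurent_def)
  fix a b assume ab: "a \<in> carrier R" "b \<in> carrier R"
  show "laurent_const R (a \<otimes> b) = laurent_const R a \<otimes>\<^bsub>laurent R\<^esub> laurent_const R b"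
  proof
    fix n
    have "(laurent_const R a \<otimes>\<^bsub>laurent R\<^esub> laurent_const R b) n =
        (\<Oplus>i\<in>{0}. laurent_const R a i \<otimes> laurent_const R b (n - i))"
      by (rule laurent_mult_window) (use c ab in \<open>auto simp: laurent_const_def split: if_splits\<close>)
    also have "\<dots> = laurent_const R (a \<otimes> b) n"
      using ab by (simp add: laurent_const_def finsum_insert)
    finally show "laurent_const R (a \<otimes> b) n = (laurent_const R a \<otimes>\<^bsub>laurent R\<^esub> laurent_const R b) n" ..
  qed
  show "laurent_const R (a \<oplus> b) = laurent_const R a \<oplus>\<^bsub>laurent R\<^esub> laurent_const R b"
    using ab by (auto simp: laurent_const_def laurent_def)
qed (auto simp: laurent_const_def laurent_def)

lemma (in cring) laurent_extend_hom:
  assumes A: "subcring A R"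
  shows "laurent_extend A R \<in> hom (inv_submodules A R) (inv_submodules (laurent_sub A R) (laurent R))"
proof -
  interpret L: cring "laurent R" by (rule laurent_cring)
  let ?c = "laurent_const R" and ?L = "laurent_sub A R" and ?P = "ideal_prod (laurent R)"
  have L: "subcring ?L (laurent R)" using laurent_sub_subcring[OF A] .
  note Lc = subcringE(1)[OF L]
  have cc: "?c ` I \<subseteq> carrier (laurent R)" if "I \<subseteq> carrier R" for I
    using laurent_const_hom that by (auto simp: ring_hom_def)
  have cP: "?P (?c ` I) (?c ` J) = ?c ` ideal_prod R I J" if IJ: "I \<subseteq> carrier R" "J \<subseteq> carrier R" for I J
  proof
    show "?P (?c ` I) (?c ` J) \<subseteq> ?c ` ideal_prod R I J"
    proof
      fix x assume "x \<in> ?P (?c ` I) (?c ` J)"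
      thus "x \<in> ?c ` ideal_prod R I J"
      proof (induction rule: ideal_prod.induct)
        case (prod i j)
        then obtain a b where "a \<in> I" "b \<in> J" "i = ?c a" "j = ?c b" by blast
        moreover have "i \<otimes>\<^bsub>laurent R\<^esub> j = ?c (a \<otimes> b)"
          using calculation ring_hom_mult[OF laurent_const_hom subsetD[OF IJ(1)] subsetD[OF IJ(2)]] by simp
        ultimately show ?case using ideal_prod.prod[of a I b J R] by simp
      next
        case (sum s t)
        then obtain a b where "a \<in> ideal_prod R I J" "b \<in> ideal_prod R I J" "s = ?c a" "t = ?c b" by blast
        moreover have "s \<oplus>\<^bsub>laurent R\<^esub> t = ?c (a \<oplus> b)"
          using calculation ring_hom_add[OF laurent_const_hom, of a b] subsetD[OF ideal_prod_carrier[OF IJ]] by simp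
        ultimately show ?case using ideal_prod.sum[of a R I J b] by simp
      qed
    qed
    show "?c ` ideal_prod R I J \<subseteq> ?P (?c ` I) (?c ` J)"
    proof
      fix x assume "x \<in> ?c ` ideal_prod R I J"
      then obtain a where "a \<in> ideal_prod R I J" "x = ?c a" by blast
      from this(1) have "?c a \<in> ?P (?c ` I) (?c ` J)"
      proof (induction rule: ideal_prod.induct)
        case (prod i j)
        thus ?case using ring_hom_mult[OF laurent_const_hom subsetD[OF IJ(1)] subsetD[OF IJ(2)]]
          by (auto intro!: ideal_prod.prod)
      next
        case (sum s t)
        thus ?case using ring_hom_add[OF laurent_const_hom, of s t] subsetD[OF ideal_prod_carrier[OF IJ]]
          by (auto intro!: ideal_prod.sum)
      qed
      thus "x \<in> ?P (?c ` I) (?c ` J)" using \<open>x = ?c a\<close> by simp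
    qed
  qed
  have LL: "?P ?L ?L = ?L" using L.ideal_prod_unit[OF L L.subcring_is_submodule[OF L]] .
  have mult: "laurent_extend A R (ideal_prod R I J) = ?P (laurent_extend A R I) (laurent_extend A R J)"
    if IJ: "I \<subseteq> carrier R" "J \<subseteq> carrier R" for I J
  proof -
    note c = cc[OF IJ(1)] cc[OF IJ(2)] Lc
    have "?P (laurent_extend A R I) (laurent_extend A R J) = ?P (?c ` I) (?P (?P ?L (?c ` J)) ?L)"
      unfolding laurent_extend_def using c by (simp add: L.ideal_prod_assoc_sets L.ideal_prod_carrier)
    also have "?P ?L (?c ` J) = ?P (?c ` J) ?L" using c by (intro L.ideal_prod_commute_sets)
    also have "?P (?c ` I) (?P (?P (?c ` J) ?L) ?L) = ?P (?P (?c ` I) (?c ` J)) ?L"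
      using c LL by (simp add: L.ideal_prod_assoc_sets L.ideal_prod_carrier)
    finally show ?thesis unfolding laurent_extend_def cP[OF IJ] ..
  qed
  have sub: "subalgebra ?L (laurent_extend A R I) (laurent R)" if "subalgebra A I R" for I
    unfolding laurent_extend_def
    by (rule L.ideal_prod_submodule[OF Lc cc _ L.subcring_is_submodule[OF L]])
       (use subalgebra_in_carrier[OF that] subgroup.one_closed[OF subalgebra.axioms(1)[OF that]] in auto)
  have A1: "laurent_extend A R A = ?L"
  proof
    have "?c ` A \<subseteq> ?L" using subcringE(1,2)[OF A] by (auto simp: laurent_const_def laurent_def)
    thus "laurent_extend A R A \<subseteq> ?L"
      unfolding laurent_extend_def using ideal_prod_mono[of "?c ` A" ?L ?L ?L] LL by blast
    have one: "\<one>\<^bsub>laurent R\<^esub> \<in> ?c ` A"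
      using ring_hom_one[OF laurent_const_hom] subcringE(3)[OF A] by (metis image_eqI)
    show "?L \<subseteq> laurent_extend A R A"
    proof
      fix l assume "l \<in> ?L"
      thus "l \<in> laurent_extend A R A"
        unfolding laurent_extend_def
        using ideal_prod.prod[OF one, of l ?L "laurent R"] L.l_one[of l] Lc by auto
    qed
  qed
  show ?thesis
  proof (rule homI)
    fix I assume "I \<in> carrier (inv_submodules A R)"
    then obtain J where I: "subalgebra A I R" "subalgebra A J R" "ideal_prod R I J = A"
      by (auto simp: inv_submodules_def invertible_submodule_def)
    hence "?P (laurent_extend A R I) (laurent_extend A R J) = ?L"
      using mult[of I J] A1 subalgebra_in_carrier by simp
    thus "laurent_extend A R I \<in> carrier (inv_submodules ?L (laurent R))"
      using sub I by (auto simp: inv_submodules_def invertible_submodule_def)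
  next
    fix I J assume "I \<in> carrier (inv_submodules A R)" "J \<in> carrier (inv_submodules A R)"
    hence "subalgebra A I R" "subalgebra A J R"
      by (simp_all add: inv_submodules_def invertible_submodule_def)
    thus "laurent_extend A R (I \<otimes>\<^bsub>inv_submodules A R\<^esub> J) =
        laurent_extend A R I \<otimes>\<^bsub>inv_submodules ?L (laurent R)\<^esub> laurent_extend A R J"
      using mult[of I J] subalgebra_in_carrier by (simp add: inv_submodules_def)
  qed
qed

lemma (in cring) MI_comm_group:
  assumes A: "subcring A R"
  shows "comm_group (MI A R)"
proof -
  interpret L: cring "laurent R" by (rule laurent_cring)
  interpret G: comm_group "inv_submodules A R" by (rule inv_submodules_comm_group[OF A])
  interpret H: comm_group "inv_submodules (laurent_sub A R) (laurent R)"
    by (rule L.inv_submodules_comm_group[OF laurent_sub_subcring[OF A]])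
  interpret h: group_hom "inv_submodules A R" "inv_submodules (laurent_sub A R) (laurent R)" "laurent_extend A R"
    using laurent_extend_hom[OF A] by unfold_locales
  show ?thesis
    unfolding MI_def by (rule H.abelian_FactGroup[OF h.img_is_subgroup])
qed

end

(*
Write C for the subintegral closure, A[X], C[X], B[X] for the Laurent polynomial rings and [.] for
classes in the cokernels. On the product of I(A[X], C[X]) and the unit group of B[X], the maps
(I, v) |-> [v I] to MI(A, B) and (I, v) |-> ([I], [v C[X]]) to MI(A, C) x MI(C, B) are surjective
and have the same kernel.

Equality of the kernels holds since C is reduced and has no idempotents except 0 and 1 (those of C
lie in the local ring A), so that the units of C[X] are the monomials with unit coefficient.

Surjectivity: given J J' = A[X], where I(A, B) consists of principal modules, one may assume that J
and J' become A under X = 1. By Dedekind and Mertens the coefficients of J and J' generate a finite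
A-algebra D, which splits into local rings because A is Hensel. A unit of D[X] made of powers of X
on the idempotents of D normalises a generating element f of J. Modulo every prime of D the modules
become generated by monomials, which compares f modulo two primes with the same contraction to C.
If a coefficient of f were outside C, a minimal prime of the conductor would contradict that C
contains all b in B with b^2, b^3 in C. Hence J and J' are moved into C[X]; the argument for
I(C[X], B[X]) reduces to a finite subintegral extension of A inside C.
*)
theory Submission
  imports Defs
begin

section \<open>Submodules and ideals of a subring\<close>

text \<open>The unit group of B[X] enters because no direct map from MI(C, B) to MI(A, B) is at
  hand. Up to extended modules, every invertible C[X]-submodule of B[X] is generated by a unit of
  B[X]. This one fact serves both surjectivities: a unit that carries J C[X] onto C[X] also moves J
  itself into C[X]. The obstacle is that C need not be finite over A, so the Hensel property gives
  nothing over C itself. But \<one> = \<Sum> i j involves finitely many elements, whose relevant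
  coefficients and values at X = 1 lie in a finite chain of elementary subintegral extensions E of
  A. Finite algebras over E are finite over A, where they split. Normalising at X = 1 fixes scalars
  but leaves powers of X free: modulo different primes of D the generating monomials may have
  different exponents. In one local factor of D a coefficient is a unit exactly if it is one modulo
  any chosen prime of that factor. So the position of the lowest unit coefficient can be compared
  across primes, and putting it at degree 0 in every factor forces the exponents to agree.\<close>

lemma (in cring) subcring_uminus_one: "subcring A R \<Longrightarrow> \<ominus> \<one> \<in> A"
  by (rule subcringE(5)[OF _ subcringE(3)])

text \<open>Negatives are multiples by \<open>\<ominus> \<one>\<close>, an element of
  \<open>A\<close>, so a set with \<open>\<zero>\<close> that is closed under sums and multiples is
  automatically an additive subgroup.\<close>

lemma (in cring) submodule_iff:
  assumes "subcring A R"
  shows "subalgebra A I R \<longleftrightarrow> I \<subseteq> carrier R \<and> \<zero> \<in> I \<and> (\<forall>x\<in>I. \<forall>y\<in>I. x \<oplus> y \<in> I) \<and>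
    (\<forall>a\<in>A. \<forall>x\<in>I. a \<otimes> x \<in> I)" (is "_ \<longleftrightarrow> ?r")
proof
  assume I: "subalgebra A I R"
  hence "subgroup I (add_monoid R)" by (rule subalgebra.axioms(1))
  thus ?r
    using subgroup.subset[of I "add_monoid R"] subgroup.one_closed[of I "add_monoid R"]
      subgroup.m_closed[of I "add_monoid R"] subalgebra.smult_closed[OF I] by auto
next
  assume r: ?r
  have "\<ominus> x \<in> I" if "x \<in> I" for x
  proof -
    have "\<ominus> \<one> \<otimes> x \<in> I" using r that subcring_uminus_one[OF assms] by blast
    thus ?thesis using r that l_minus[of \<one> x] by (metis l_one one_closed subsetD)
  qed
  moreover have "I \<noteq> {}" using r by blast
  ultimately have "subgroup I (add_monoid R)"
    using r by (intro add.subgroupI) blast+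
  thus "subalgebra A I R" using r unfolding subalgebra_def subalgebra_axioms_def by blast
qed

lemma (in cring) add_minus_cancel_left:
  "\<lbrakk>x \<in> carrier R; y \<in> carrier R\<rbrakk> \<Longrightarrow> x \<oplus> y \<ominus> x = y"
  by algebra

lemma (in cring) finsum_in_set:
  assumes "finite S" "\<And>i. i \<in> S \<Longrightarrow> h i \<in> Q" "Q \<subseteq> carrier R" "\<zero> \<in> Q"
    and "\<And>x y. \<lbrakk>x \<in> Q; y \<in> Q\<rbrakk> \<Longrightarrow> x \<oplus> y \<in> Q"
  shows "finsum R h S \<in> Q"
  using assms(1,2)
proof (induction S)
  case (insert x S)
  hence "h \<in> S \<rightarrow> carrier R" "h x \<in> carrier R" using assms(3) by auto
  thus ?case using insert assms(5) by simp
qed (use assms(4) in simp)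

text \<open>Ideals and primes are taken relative to a subset \<open>D\<close> of the fixed ring
  \<open>R\<close> instead of in the ring \<open>R\<lparr>carrier := D\<rparr>\<close>. Ideals of
  several subrings can then be intersected and compared as plain sets, with one
  multiplication.\<close>

definition (in cring) ideal_in :: "'a set \<Rightarrow> 'a set \<Rightarrow> bool"
  where "ideal_in I D \<longleftrightarrow> I \<subseteq> D \<and> \<zero> \<in> I \<and> (\<forall>x\<in>I. \<forall>y\<in>I. x \<oplus> y \<in> I) \<and> (\<forall>d\<in>D. \<forall>x\<in>I. d \<otimes> x \<in> I)"

definition (in cring) prime_in :: "'a set \<Rightarrow> 'a set \<Rightarrow> bool"
  where "prime_in q D \<longleftrightarrow> ideal_in q D \<and> \<one> \<notin> q \<and> (\<forall>x\<in>D. \<forall>y\<in>D. x \<otimes> y \<in> q \<longrightarrow> x \<in> q \<or> y \<in> q)"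

lemma (in cring) ideal_inD:
  assumes "ideal_in I D"
  shows "I \<subseteq> D" "\<zero> \<in> I" "\<And>x y. \<lbrakk>x \<in> I; y \<in> I\<rbrakk> \<Longrightarrow> x \<oplus> y \<in> I" "\<And>d x. \<lbrakk>d \<in> D; x \<in> I\<rbrakk> \<Longrightarrow> d \<otimes> x \<in> I"
  using assms by (auto simp: ideal_in_def)

lemma (in cring) ideal_in_minus:
  assumes "subcring D R" "ideal_in I D" "x \<in> I"
  shows "\<ominus> x \<in> I" "y \<in> I \<Longrightarrow> y \<ominus> x \<in> I"
proof -
  have "x \<in> carrier R" using assms ideal_inD(1) subcringE(1) by blast
  moreover have "\<ominus> \<one> \<otimes> x \<in> I" using assms ideal_inD(4) subcring_uminus_one by blast
  ultimately show *: "\<ominus> x \<in> I" using l_minus[of \<one> x] by simp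
  show "y \<ominus> x \<in> I" if "y \<in> I" using ideal_inD(3)[OF assms(2) that *] by (simp add: a_minus_def)
qed

lemma (in cring) ideal_in_multr:
  assumes "subcring D R" "ideal_in I D" "d \<in> D" "x \<in> I"
  shows "x \<otimes> d \<in> I"
  using ideal_inD[OF assms(2)] assms subcringE(1)[OF assms(1)] by (metis m_comm subsetD)

lemma (in cring) prime_inD:
  assumes "prime_in q D"
  shows "ideal_in q D" "\<one> \<notin> q" "\<And>x y. \<lbrakk>x \<in> D; y \<in> D; x \<otimes> y \<in> q\<rbrakk> \<Longrightarrow> x \<in> q \<or> y \<in> q"
  using assms by (auto simp: prime_in_def)

lemma (in cring) ideal_in_adjoin:
  assumes D: "subcring D R" and q: "ideal_in q D" and x: "x \<in> D"
  defines "J \<equiv> {a \<oplus> d \<otimes> x |a d. a \<in> q \<and> d \<in> D}"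
  shows "ideal_in J D" "q \<subseteq> J" "x \<in> J"
proof -
  note Dc = subcringE[OF D]
  have qc: "a \<in> carrier R" if "a \<in> q" for a using that ideal_inD(1)[OF q] Dc(1) by blast
  have dc: "d \<in> carrier R" if "d \<in> D" for d using that Dc(1) by blast
  show "q \<subseteq> J"
  proof
    fix a assume "a \<in> q"
    hence "a = a \<oplus> \<zero> \<otimes> x" using qc dc x by simp
    thus "a \<in> J" unfolding J_def using \<open>a \<in> q\<close> Dc(2) by blast
  qed
  have "x = \<zero> \<oplus> \<one> \<otimes> x" using dc x by simp
  thus "x \<in> J" unfolding J_def using ideal_inD(2)[OF q] Dc(3) by blast
  show "ideal_in J D"
    unfolding ideal_in_def
  proof (intro conjI ballI)
    show "J \<subseteq> D" unfolding J_def using ideal_inD(1)[OF q] Dc(6,7) x by blast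
    show "\<zero> \<in> J" using \<open>q \<subseteq> J\<close> ideal_inD(2)[OF q] by blast
  next
    fix y z assume "y \<in> J" "z \<in> J"
    then obtain a d b e where *: "y = a \<oplus> d \<otimes> x" "z = b \<oplus> e \<otimes> x" "a \<in> q" "b \<in> q" "d \<in> D" "e \<in> D"
      unfolding J_def by blast
    hence "y \<oplus> z = (a \<oplus> b) \<oplus> (d \<oplus> e) \<otimes> x" using qc dc x by (simp, algebra)
    thus "y \<oplus> z \<in> J" unfolding J_def using * ideal_inD(3)[OF q] Dc(7) by blast
  next
    fix c y assume "c \<in> D" "y \<in> J"
    then obtain a d where *: "y = a \<oplus> d \<otimes> x" "a \<in> q" "d \<in> D"
      unfolding J_def by blast
    hence "c \<otimes> y = c \<otimes> a \<oplus> (c \<otimes> d) \<otimes> x" using qc dc x \<open>c \<in> D\<close> by (simp, algebra)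
    thus "c \<otimes> y \<in> J" unfolding J_def using * ideal_inD(4)[OF q] Dc(6) \<open>c \<in> D\<close> by blast
  qed
qed

text \<open>Zorn's lemma, for an arbitrary set \<open>T\<close>. A multiplicative \<open>T\<close>
  yields prime ideals in \<open>ex_prime_avoiding\<close>, and \<open>T = {\<one>}\<close> yields
  maximal ideals in \<open>nonunit_in_maximalideal\<close>.\<close>

lemma (in cring) ex_maximal_ideal_avoiding:
  assumes "ideal_in I D" "I \<inter> T = {}"
  shows "\<exists>q. ideal_in q D \<and> I \<subseteq> q \<and> q \<inter> T = {} \<and>
    (\<forall>J. ideal_in J D \<longrightarrow> q \<subseteq> J \<longrightarrow> J \<inter> T = {} \<longrightarrow> J = q)"
proof -
  define FF where "FF = {q. ideal_in q D \<and> I \<subseteq> q \<and> q \<inter> T = {}}"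
  have "\<exists>M\<in>FF. \<forall>Z\<in>FF. M \<subseteq> Z \<longrightarrow> Z = M"
  proof (rule subset_Zorn_nonempty)
    show "FF \<noteq> {}" using assms by (auto simp: FF_def)
  next
    fix KK assume KK: "KK \<noteq> {}" "subset.chain FF KK"
    have mem: "Z \<in> FF" if "Z \<in> KK" for Z using KK(2) that by (auto simp: subset.chain_def)
    have cmp: "Z \<subseteq> Y \<or> Y \<subseteq> Z" if "Z \<in> KK" "Y \<in> KK" for Z Y
      using KK(2) that by (auto simp: subset_chain_def)
    have idl: "ideal_in Z D" if "Z \<in> KK" for Z using mem[OF that] by (simp add: FF_def)
    have "ideal_in (\<Union>KK) D"
      unfolding ideal_in_def
    proof (intro conjI ballI)
      fix x y assume "x \<in> \<Union>KK" "y \<in> \<Union>KK"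
      then obtain Z Y where "Z \<in> KK" "Y \<in> KK" "x \<in> Z" "y \<in> Y" by blast
      thus "x \<oplus> y \<in> \<Union>KK" using cmp[of Z Y] ideal_inD(3)[OF idl] by blast
    next
      show "\<Union>KK \<subseteq> D" using ideal_inD(1)[OF idl] by blast
      show "\<zero> \<in> \<Union>KK" using ideal_inD(2)[OF idl] KK(1) by blast
    next
      fix d x assume "d \<in> D" "x \<in> \<Union>KK"
      thus "d \<otimes> x \<in> \<Union>KK" using ideal_inD(4)[OF idl] by blast
    qed
    thus "\<Union>KK \<in> FF" using mem KK(1) by (auto simp: FF_def)
  qed
  then obtain q where q: "q \<in> FF" "\<And>J. J \<in> FF \<Longrightarrow> q \<subseteq> J \<Longrightarrow> J = q" by blast
  have "J = q" if "ideal_in J D" "q \<subseteq> J" "J \<inter> T = {}" for J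
    using q(2)[of J] q(1) that by (auto simp: FF_def)
  thus ?thesis using q(1) by (auto simp: FF_def)
qed

text \<open>An ideal \<open>q\<close> maximal among those that miss \<open>T\<close> is prime:
  adjoining \<open>x\<close> or \<open>y\<close> outside \<open>q\<close> reaches elements
  \<open>s\<close> and \<open>t\<close> of \<open>T\<close>, and \<open>s \<otimes> t\<close> lies
  in \<open>q\<close> as soon as \<open>x \<otimes> y\<close> does.\<close>

lemma (in cring) ex_prime_avoiding:
  assumes D: "subcring D R" and I: "ideal_in I D" "I \<inter> T = {}"
    and T: "T \<subseteq> D" "\<one> \<in> T" "\<And>s t. \<lbrakk>s \<in> T; t \<in> T\<rbrakk> \<Longrightarrow> s \<otimes> t \<in> T"
  shows "\<exists>q. prime_in q D \<and> I \<subseteq> q \<and> q \<inter> T = {}"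
proof -
  obtain q where q: "ideal_in q D" "I \<subseteq> q" "q \<inter> T = {}"
    and max: "\<And>J. \<lbrakk>ideal_in J D; q \<subseteq> J; J \<inter> T = {}\<rbrakk> \<Longrightarrow> J = q"
    using ex_maximal_ideal_avoiding[OF I] by blast
  note Dc = subcringE[OF D]
  have meets: "\<exists>t\<in>T. \<exists>a\<in>q. \<exists>d\<in>D. t = a \<oplus> d \<otimes> x" if x: "x \<in> D" "x \<notin> q" for x
    using max[OF ideal_in_adjoin(1,2)[OF D q(1) x(1)]] ideal_in_adjoin(3)[OF D q(1) x(1)] x(2) by blast
  have "x \<in> q \<or> y \<in> q" if xy: "x \<in> D" "y \<in> D" "x \<otimes> y \<in> q" for x y
  proof (rule ccontr)
    assume "\<not> (x \<in> q \<or> y \<in> q)"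
    then obtain s a d t b e where st: "s \<in> T" "a \<in> q" "d \<in> D" "s = a \<oplus> d \<otimes> x"
      "t \<in> T" "b \<in> q" "e \<in> D" "t = b \<oplus> e \<otimes> y" using meets xy(1,2) by metis
    have c: "a \<in> carrier R" "b \<in> carrier R" "d \<in> carrier R" "e \<in> carrier R" "x \<in> carrier R"
      "y \<in> carrier R" "t \<in> carrier R"
      using st xy Dc(1) ideal_inD(1)[OF q(1)] T(1) by blast+
    have "s \<otimes> t = t \<otimes> a \<oplus> ((d \<otimes> x) \<otimes> b \<oplus> (d \<otimes> e) \<otimes> (x \<otimes> y))"
      unfolding st(4,8) using c by algebra
    moreover have "t \<otimes> a \<in> q" "(d \<otimes> x) \<otimes> b \<in> q" "(d \<otimes> e) \<otimes> (x \<otimes> y) \<in> q"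
      using st xy T(1) Dc(6) ideal_inD(4)[OF q(1)] by (meson subsetD)+
    ultimately have "s \<otimes> t \<in> q" using ideal_inD(3)[OF q(1)] by simp
    thus False using T(3) st q(3) by blast
  qed
  thus ?thesis using q T(2) unfolding prime_in_def by blast
qed

section \<open>Coefficients and evaluation of Laurent polynomials\<close>

lemma laurent_coeff_closed: "f \<in> carrier (laurent R) \<Longrightarrow> f n \<in> carrier R"
  by (auto simp: laurent_def)

lemma laurent_finite_support: "f \<in> carrier (laurent R) \<Longrightarrow> finite {n. f n \<noteq> \<zero>\<^bsub>R\<^esub>}"
  by (auto simp: laurent_def)

lemma laurent_add_coeff: "(f \<oplus>\<^bsub>laurent R\<^esub> g) n = f n \<oplus>\<^bsub>R\<^esub> g n"
  by (simp add: laurent_def)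

lemma laurent_zero_coeff: "\<zero>\<^bsub>laurent R\<^esub> n = \<zero>\<^bsub>R\<^esub>"
  by (simp add: laurent_def)

lemma laurent_one_coeff: "\<one>\<^bsub>laurent R\<^esub> n = (if n = 0 then \<one>\<^bsub>R\<^esub> else \<zero>\<^bsub>R\<^esub>)"
  by (simp add: laurent_def)

lemma laurent_sub_iff:
  "A \<subseteq> carrier R \<Longrightarrow> f \<in> laurent_sub A R \<longleftrightarrow> f \<in> carrier (laurent R) \<and> (\<forall>n. f n \<in> A)"
  by (auto simp: laurent_def)

text \<open>Every other term of the convolution has a factor in \<open>q\<close>, so one term
  survives modulo \<open>q\<close>. This is used for highest and lowest coefficients modulo a prime,
  and for multiplication by an element that is a monomial modulo \<open>q\<close>.\<close>

lemma (in cring) laurent_mult_mod: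
  assumes D: "subcring D R" and q: "ideal_in q D"
    and f: "f \<in> laurent_sub D R" and g: "g \<in> laurent_sub D R"
    and z: "\<And>i. i \<noteq> a \<Longrightarrow> f i \<in> q \<or> g (n - i) \<in> q"
  shows "(f \<otimes>\<^bsub>laurent R\<^esub> g) n \<ominus> f a \<otimes> g (n - a) \<in> q"
proof -
  note Dc = subcringE[OF D]
  have fg: "f \<in> carrier (laurent R)" "g \<in> carrier (laurent R)" and c: "f i \<in> D" "g i \<in> D" for i
    using f g Dc(1) by (auto simp: laurent_sub_iff)
  have c': "f i \<in> carrier R" "g i \<in> carrier R" for i using c Dc(1) by auto
  define S where "S = {i. f i \<noteq> \<zero>} - {a}"
  have S: "finite S" "a \<notin> S" using laurent_finite_support[OF fg(1)] by (auto simp: S_def)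
  have s: "(\<Oplus>i\<in>S. f i \<otimes> g (n - i)) \<in> q"
  proof (rule finsum_in_set[OF S(1)])
    fix i assume "i \<in> S"
    hence "f i \<in> q \<or> g (n - i) \<in> q" using z by (auto simp: S_def)
    thus "f i \<otimes> g (n - i) \<in> q" using ideal_inD(4)[OF q] ideal_in_multr[OF D q] c by blast
  qed (use ideal_inD[OF q] Dc(1) in auto)
  have sc: "(\<Oplus>i\<in>S. f i \<otimes> g (n - i)) \<in> carrier R" using s ideal_inD(1)[OF q] Dc(1) by blast
  have "(f \<otimes>\<^bsub>laurent R\<^esub> g) n = (\<Oplus>i\<in>insert a S. f i \<otimes> g (n - i))"
    by (rule laurent_mult_window[OF fg]) (use S in \<open>auto simp: S_def\<close>)
  also have "\<dots> = f a \<otimes> g (n - a) \<oplus> (\<Oplus>i\<in>S. f i \<otimes> g (n - i))"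
    by (rule finsum_insert[OF S]) (use c' in auto)
  finally have "(f \<otimes>\<^bsub>laurent R\<^esub> g) n \<ominus> f a \<otimes> g (n - a) = (\<Oplus>i\<in>S. f i \<otimes> g (n - i))"
    using sc c' by (simp add: add_minus_cancel_left)
  thus ?thesis using s by simp
qed

section \<open>Monomials and evaluation at X = 1\<close>

definition laurent_monom :: "('a, 'm) ring_scheme \<Rightarrow> 'a \<Rightarrow> int \<Rightarrow> int \<Rightarrow> 'a"
  where "laurent_monom R c k = (\<lambda>n. if n = k then c else \<zero>\<^bsub>R\<^esub>)"

lemma (in cring) laurent_monom_closed:
  "subcring A R \<Longrightarrow> c \<in> A \<Longrightarrow> laurent_monom R c k \<in> laurent_sub A R"
  using subcringE(1,2) by (fastforce simp: laurent_monom_def laurent_sub_iff laurent_def)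

lemma (in cring) laurent_monom_carrier:
  "c \<in> carrier R \<Longrightarrow> laurent_monom R c k \<in> carrier (laurent R)"
  by (auto simp: laurent_monom_def laurent_def)

lemma (in cring) laurent_monom_mult:
  assumes "c \<in> carrier R" "g \<in> carrier (laurent R)"
  shows "laurent_monom R c k \<otimes>\<^bsub>laurent R\<^esub> g = (\<lambda>n. c \<otimes> g (n - k))"
proof
  fix n
  have "(laurent_monom R c k \<otimes>\<^bsub>laurent R\<^esub> g) n = (\<Oplus>i\<in>{k}. laurent_monom R c k i \<otimes> g (n - i))"
    by (rule laurent_mult_window) (use assms laurent_monom_carrier in \<open>auto simp: laurent_monom_def split: if_splits\<close>)
  also have "\<dots> = c \<otimes> g (n - k)"
    using assms laurent_coeff_closed[OF assms(2)] by (simp add: laurent_monom_def finsum_insert)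
  finally show "(laurent_monom R c k \<otimes>\<^bsub>laurent R\<^esub> g) n = c \<otimes> g (n - k)" .
qed

text \<open>Evaluation at \<open>X = 1\<close>, a ring homomorphism back to \<open>R\<close> that
  splits \<open>laurent_const\<close>. It fixes the scalars when modules are normalised.\<close>

definition laurent_eval :: "('a, 'm) ring_scheme \<Rightarrow> (int \<Rightarrow> 'a) \<Rightarrow> 'a"
  where "laurent_eval R f = (\<Oplus>\<^bsub>R\<^esub>n\<in>{n. f n \<noteq> \<zero>\<^bsub>R\<^esub>}. f n)"

lemma (in cring) laurent_eval_window:
  assumes "f \<in> carrier (laurent R)" "finite S" "{n. f n \<noteq> \<zero>} \<subseteq> S"
  shows "laurent_eval R f = (\<Oplus>n\<in>S. f n)"
  unfolding laurent_eval_def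
  by (rule add.finprod_mono_neutral_cong_left) (use assms laurent_coeff_closed in auto)

lemma (in cring) laurent_eval_in:
  assumes "subcring A R" "f \<in> laurent_sub A R"
  shows "laurent_eval R f \<in> A"
proof -
  note E = subcringE[OF assms(1)]
  have f: "f \<in> carrier (laurent R)" "\<And>n. f n \<in> A" using assms(2) E(1) by (auto simp: laurent_sub_iff)
  show ?thesis unfolding laurent_eval_def
    by (rule finsum_in_set) (use f laurent_finite_support[OF f(1)] E in auto)
qed

lemma (in cring) laurent_eval_monom: "c \<in> carrier R \<Longrightarrow> laurent_eval R (laurent_monom R c k) = c"
  using laurent_eval_window[OF laurent_monom_carrier, of c "{k}" k]
  by (simp add: laurent_monom_def finsum_insert Collect_conv_if)

lemma (in cring) laurent_eval_hom: "laurent_eval R \<in> ring_hom (laurent R) R"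
proof (rule ring_hom_memI)
  interpret L: cring "laurent R" by (rule laurent_cring)
  fix f assume f: "f \<in> carrier (laurent R)"
  note fc = laurent_coeff_closed[OF f] and ff = laurent_finite_support[OF f]
  show "laurent_eval R f \<in> carrier R" unfolding laurent_eval_def using fc by (intro finsum_closed) auto
  fix g assume g: "g \<in> carrier (laurent R)"
  note gc = laurent_coeff_closed[OF g] and gf = laurent_finite_support[OF g]
  have fg: "f \<otimes>\<^bsub>laurent R\<^esub> g \<in> carrier (laurent R)" "f \<oplus>\<^bsub>laurent R\<^esub> g \<in> carrier (laurent R)" using f g by auto
  define F where "F = {n. f n \<noteq> \<zero>}"
  define G where "G = {n. g n \<noteq> \<zero>}"
  have fin: "finite F" "finite G" using ff gf by (auto simp: F_def G_def)
  have "laurent_eval R (f \<oplus>\<^bsub>laurent R\<^esub> g) = (\<Oplus>n\<in>F \<union> G. f n \<oplus> g n)"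
  proof -
    have "{n. (f \<oplus>\<^bsub>laurent R\<^esub> g) n \<noteq> \<zero>} \<subseteq> F \<union> G" by (auto simp: laurent_add_coeff F_def G_def)
    thus ?thesis using laurent_eval_window[OF fg(2), of "F \<union> G"] fin by (simp add: laurent_add_coeff)
  qed
  also have "\<dots> = (\<Oplus>n\<in>F \<union> G. f n) \<oplus> (\<Oplus>n\<in>F \<union> G. g n)"
    using fc gc by (intro finsum_addf) auto
  finally show "laurent_eval R (f \<oplus>\<^bsub>laurent R\<^esub> g) = laurent_eval R f \<oplus> laurent_eval R g"
    using laurent_eval_window[OF f, of "F \<union> G"] laurent_eval_window[OF g, of "F \<union> G"] fin
    by (simp add: F_def G_def)
  \<comment> \<open>One finite window for both summations: it contains the support of the product
    and, for each \<open>i\<close> in \<open>F\<close>, the support of \<open>g\<close> shifted by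
    \<open>i\<close>.\<close>
  define T where "T = (\<lambda>(i, j). i + j) ` (F \<times> G)"
  have T: "finite T" using fin by (simp add: T_def)
  have "laurent_eval R (f \<otimes>\<^bsub>laurent R\<^esub> g) = (\<Oplus>n\<in>T. (f \<otimes>\<^bsub>laurent R\<^esub> g) n)"
    using laurent_eval_window[OF fg(1) T] laurent_mult_support[OF f g] by (simp add: F_def G_def T_def)
  also have "\<dots> = (\<Oplus>n\<in>T. \<Oplus>i\<in>F. f i \<otimes> g (n - i))"
    by (rule finsum_cong') (use laurent_mult_window[OF f g fin(1)] fc gc in \<open>auto simp: F_def intro!: finsum_closed\<close>)
  also have "\<dots> = (\<Oplus>i\<in>F. \<Oplus>n\<in>T. f i \<otimes> g (n - i))"
    by (rule finsum_finsum_swap) (use fin T fc gc in auto)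
  also have "\<dots> = (\<Oplus>i\<in>F. f i \<otimes> laurent_eval R g)"
  proof (rule finsum_cong')
    fix i assume i: "i \<in> F"
    have "(\<Oplus>n\<in>T. f i \<otimes> g (n - i)) = f i \<otimes> (\<Oplus>n\<in>T. g (n - i))"
      by (rule finsum_rdistr[symmetric]) (use T fc gc in auto)
    also have "(\<Oplus>n\<in>T. g (n - i)) = (\<Oplus>n\<in>(\<lambda>k. i + k) ` G. g (n - i))"
    proof (rule add.finprod_mono_neutral_cong_right)
      fix n assume "n \<in> T - (\<lambda>k. i + k) ` G"
      hence "n - i \<notin> G" by (metis DiffD2 add_diff_cancel_left' diff_add_cancel image_eqI add.commute)
      thus "g (n - i) = \<zero>\<^bsub>R\<^esub>" by (simp add: G_def)
    next
      show "finite T" "(\<lambda>k. i + k) ` G \<subseteq> T" using T i by (auto simp: T_def)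
    qed (use gc in auto)
    also have "\<dots> = (\<Oplus>k\<in>G. g (i + k - i))"
      by (rule finsum_reindex) (use gc in \<open>auto intro: inj_onI\<close>)
    also have "\<dots> = laurent_eval R g" unfolding laurent_eval_def G_def by simp
    finally show "(\<Oplus>n\<in>T. f i \<otimes> g (n - i)) = f i \<otimes> laurent_eval R g" .
  qed (use fc gc in \<open>auto simp: laurent_eval_def intro!: finsum_closed\<close>)
  also have "\<dots> = laurent_eval R f \<otimes> laurent_eval R g"
    unfolding laurent_eval_def F_def
    by (rule finsum_ldistr[symmetric]) (use ff fc gc in \<open>auto intro!: finsum_closed\<close>)
  finally show "laurent_eval R (f \<otimes>\<^bsub>laurent R\<^esub> g) = laurent_eval R f \<otimes> laurent_eval R g" .
next
  have "\<one>\<^bsub>laurent R\<^esub> = laurent_monom R \<one> 0" by (auto simp: laurent_def laurent_monom_def)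
  thus "laurent_eval R \<one>\<^bsub>laurent R\<^esub> = \<one>" using laurent_eval_monom by simp
qed

section \<open>The ring generated by the coefficients of a Laurent polynomial\<close>

lemma (in cring) submoduleD:
  assumes "subcring A R" "subalgebra A I R"
  shows "I \<subseteq> carrier R" "\<zero> \<in> I" "\<And>x y. \<lbrakk>x \<in> I; y \<in> I\<rbrakk> \<Longrightarrow> x \<oplus> y \<in> I" "\<And>a x. \<lbrakk>a \<in> A; x \<in> I\<rbrakk> \<Longrightarrow> a \<otimes> x \<in> I"
    "\<And>x y. \<lbrakk>x \<in> I; y \<in> I\<rbrakk> \<Longrightarrow> x \<ominus> y \<in> I"
proof -
  show I: "I \<subseteq> carrier R" "\<zero> \<in> I" "\<And>x y. \<lbrakk>x \<in> I; y \<in> I\<rbrakk> \<Longrightarrow> x \<oplus> y \<in> I" "\<And>a x. \<lbrakk>a \<in> A; x \<in> I\<rbrakk> \<Longrightarrow> a \<otimes> x \<in> I"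
    using submodule_iff[OF assms(1), of I] assms(2) by simp_all
  fix x y assume xy: "x \<in> I" "y \<in> I"
  have "\<ominus> \<one> \<otimes> y = \<ominus> y" using I(1) xy(2) l_minus[of \<one> y] by auto
  hence "\<ominus> y \<in> I" using I(4)[OF subcring_uminus_one[OF assms(1)] xy(2)] by simp
  thus "x \<ominus> y \<in> I" using I(3)[OF xy(1)] by (simp add: a_minus_def)
qed

lemma (in cring) submoduleI:
  assumes "subcring A R" "I \<subseteq> carrier R" "\<zero> \<in> I" "\<And>x y. \<lbrakk>x \<in> I; y \<in> I\<rbrakk> \<Longrightarrow> x \<oplus> y \<in> I"
    "\<And>a x. \<lbrakk>a \<in> A; x \<in> I\<rbrakk> \<Longrightarrow> a \<otimes> x \<in> I"
  shows "subalgebra A I R"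
  using submodule_iff[OF assms(1), of I] assms(2-5) by simp

lemma ideal_prod_subset:
  assumes "\<And>i j. \<lbrakk>i \<in> I; j \<in> J\<rbrakk> \<Longrightarrow> i \<otimes>\<^bsub>R\<^esub> j \<in> T" "\<And>x y. \<lbrakk>x \<in> T; y \<in> T\<rbrakk> \<Longrightarrow> x \<oplus>\<^bsub>R\<^esub> y \<in> T"
  shows "ideal_prod R I J \<subseteq> T"
proof
  fix x assume "x \<in> ideal_prod R I J"
  thus "x \<in> T" by (induction rule: ideal_prod.induct) (use assms in auto)
qed

text \<open>With \<open>A\<close> as first factor, \<open>ideal_prod\<close> is the
  \<open>A\<close>-span of \<open>X1\<close>. The set is assumed non-empty because
  \<open>ideal_prod\<close> consists of sums of at least one product, so that the span of the empty
  set would be empty and not zero.\<close>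

lemma (in cring) span_submodule:
  assumes "subcring A R" "X1 \<subseteq> carrier R" "X1 \<noteq> {}"
  shows "subalgebra A (ideal_prod R A X1) R" "X1 \<subseteq> ideal_prod R A X1"
proof -
  have A: "A \<subseteq> carrier R" using subcringE(1)[OF assms(1)] .
  have "ideal_prod R A X1 = ideal_prod R X1 A" by (rule ideal_prod_commute_sets[OF A assms(2)])
  thus "subalgebra A (ideal_prod R A X1) R"
    using ideal_prod_submodule[OF A assms(2,3) subcring_is_submodule[OF assms(1)]] by simp
  show "X1 \<subseteq> ideal_prod R A X1"
  proof
    fix x assume "x \<in> X1"
    hence "\<one> \<otimes> x \<in> ideal_prod R A X1" using subcringE(3)[OF assms(1)] by (auto intro: ideal_prod.prod)
    thus "x \<in> ideal_prod R A X1" using assms(2) \<open>x \<in> X1\<close> by auto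
  qed
qed

text \<open>The colon module \<open>W : c(f)\<close>, where \<open>c(f)\<close> is generated by the
  coefficients of \<open>f\<close>; its \<open>k\<close>-th iterate is \<open>W : c(f)^k\<close>.
  Inclusions between products of content modules thereby become statements about single
  elements.\<close>

definition (in cring) coeff_colon :: "(int \<Rightarrow> 'a) \<Rightarrow> 'a set \<Rightarrow> 'a set"
  where "coeff_colon f W = {y \<in> carrier R. \<forall>i. f i \<otimes> y \<in> W}"

lemma (in cring) coeff_colon_submodule:
  assumes A: "subcring A R" and f: "\<And>i. f i \<in> carrier R" and W: "subalgebra A W R"
  shows "subalgebra A (coeff_colon f W) R"
proof (rule submoduleI[OF A])
  note WD = submoduleD[OF A W]
  show "coeff_colon f W \<subseteq> carrier R" "\<zero> \<in> coeff_colon f W"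
    using WD(2) f by (auto simp: coeff_colon_def)
  show "x \<oplus> y \<in> coeff_colon f W" if "x \<in> coeff_colon f W" "y \<in> coeff_colon f W" for x y
    using that WD(3) f by (simp add: coeff_colon_def r_distr)
  fix a x assume ax: "a \<in> A" "x \<in> coeff_colon f W"
  hence c: "a \<in> carrier R" "x \<in> carrier R" using subcringE(1)[OF A] by (auto simp: coeff_colon_def)
  have "f i \<otimes> (a \<otimes> x) = a \<otimes> (f i \<otimes> x)" for i using c f by (simp add: m_lcomm)
  thus "a \<otimes> x \<in> coeff_colon f W" using ax WD(4) c by (simp add: coeff_colon_def)
qed

lemma (in cring) coeff_colon_pow_submodule:
  assumes "subcring A R" "\<And>i. f i \<in> carrier R" "subalgebra A W R"
  shows "subalgebra A ((coeff_colon f ^^ k) W) R"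
  using assms by (induction k) (auto intro: coeff_colon_submodule)

lemma (in cring) coeff_colon_pow_Suc:
  "(y \<in> (coeff_colon f ^^ Suc k) W) \<longleftrightarrow> y \<in> carrier R \<and> (\<forall>i. f i \<otimes> y \<in> (coeff_colon f ^^ k) W)"
  by (simp add: coeff_colon_def)

text \<open>Multiplication by \<open>s\<close> commutes with multiplication by the coefficients of
  \<open>f\<close>, so the colon by \<open>s\<close> can be pulled out of the iterated colon by
  \<open>c(f)\<close>. This is what allows the induction for Dedekind and Mertens to change
  \<open>W\<close>.\<close>

lemma (in cring) coeff_colon_pow_smult:
  assumes "\<And>i. f i \<in> carrier R" "s \<in> carrier R" "y \<in> carrier R"
  shows "y \<in> (coeff_colon f ^^ k) {y \<in> carrier R. s \<otimes> y \<in> W} \<longleftrightarrow> s \<otimes> y \<in> (coeff_colon f ^^ k) W"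
  using assms(3)
proof (induction k arbitrary: y)
  case (Suc k)
  have "f i \<otimes> (s \<otimes> y) = s \<otimes> (f i \<otimes> y)" for i using Suc(2) assms(1,2) by (simp add: m_lcomm)
  thus ?case unfolding coeff_colon_pow_Suc using Suc assms by simp
qed simp

lemma (in cring) coeff_colon_pow_mono:
  assumes A: "subcring A R" and f: "\<And>i. f i \<in> carrier R" and W: "subalgebra A W R"
    and f': "\<And>i. f' i = f i \<or> f' i = \<zero>"
  shows "y \<in> (coeff_colon f ^^ k) W \<Longrightarrow> y \<in> (coeff_colon f' ^^ k) W"
proof (induction k arbitrary: y)
  case (Suc k)
  have f'c: "f' i \<in> carrier R" for i using f' f by (metis zero_closed)
  have y: "y \<in> carrier R" "\<And>i. f i \<otimes> y \<in> (coeff_colon f ^^ k) W"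
    using Suc(2) unfolding coeff_colon_pow_Suc by blast+
  have "f' i \<otimes> y \<in> (coeff_colon f' ^^ k) W" for i
    using f'[of i] Suc(1)[OF y(2)[of i]] submoduleD(2)[OF A coeff_colon_pow_submodule[of A f' W, OF A f'c W]] y(1)
    by auto
  thus ?case unfolding coeff_colon_pow_Suc using y(1) by blast
qed simp

text \<open>A product of \<open>k + 1\<close> coefficients of \<open>f\<close> either avoids the
  coefficient at \<open>a\<close>, and then consists of coefficients of \<open>f'\<close>, or has
  the factor \<open>f a\<close> next to \<open>k\<close> further coefficients of \<open>f\<close>.
  The two premises treat the two cases.\<close>

lemma (in cring) coeff_colon_pow_split:
  assumes f: "\<And>i. f i \<in> carrier R" and f': "\<And>i. i \<noteq> a \<Longrightarrow> f' i = f i"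
  shows "\<lbrakk>y \<in> (coeff_colon f' ^^ Suc k) W; f a \<otimes> y \<in> (coeff_colon f ^^ k) W\<rbrakk>
    \<Longrightarrow> y \<in> (coeff_colon f ^^ Suc k) W"
proof (induction k arbitrary: y)
  case 0
  thus ?case using f' by (auto simp: coeff_colon_def) metis
next
  case (Suc k)
  have y: "y \<in> carrier R" "\<And>i. f' i \<otimes> y \<in> (coeff_colon f' ^^ Suc k) W"
    using Suc(2) unfolding coeff_colon_pow_Suc[where f = f' and k = "Suc k"] by blast+
  have "f i \<otimes> y \<in> (coeff_colon f ^^ Suc k) W" for i
  proof (cases "i = a")
    case False
    have "f i \<otimes> (f a \<otimes> y) \<in> (coeff_colon f ^^ k) W"
      using Suc(3) unfolding coeff_colon_pow_Suc by blast
    moreover have "f i \<otimes> (f a \<otimes> y) = f a \<otimes> (f i \<otimes> y)" using f y(1) by (simp add: m_lcomm)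
    ultimately show ?thesis using Suc(1)[of "f i \<otimes> y"] y(2)[of i] f'[OF False] by simp
  qed (use Suc(3) in simp)
  thus ?case unfolding coeff_colon_pow_Suc[where k = "Suc k"] using y(1) by blast
qed

section \<open>Leading terms and the inclusion of Dedekind and Mertens\<close>

lemma (in cring) laurent_delete:
  assumes f: "f \<in> carrier (laurent R)" and g: "g \<in> carrier (laurent R)"
  shows "f(a := \<zero>) \<in> carrier (laurent R)"
    "(f(a := \<zero>) \<otimes>\<^bsub>laurent R\<^esub> g) k = (f \<otimes>\<^bsub>laurent R\<^esub> g) k \<ominus> f a \<otimes> g (k - a)"
proof -
  interpret L: cring "laurent R" by (rule laurent_cring)
  note fc = laurent_coeff_closed[OF f]
  have "{n. (f(a := \<zero>)) n \<noteq> \<zero>} \<subseteq> {n. f n \<noteq> \<zero>}" by auto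
  hence "finite {n. (f(a := \<zero>)) n \<noteq> \<zero>}" using laurent_finite_support[OF f] finite_subset by blast
  moreover have "range (f(a := \<zero>)) \<subseteq> carrier R" using fc by (auto simp: fun_upd_def)
  ultimately show f': "f(a := \<zero>) \<in> carrier (laurent R)" by (simp add: laurent_def)
  let ?m = "laurent_monom R (f a) a"
  have m: "?m \<in> carrier (laurent R)" using laurent_monom_carrier[OF fc] .
  have "f = ?m \<oplus>\<^bsub>laurent R\<^esub> f(a := \<zero>)"
    using fc by (auto simp: laurent_add_coeff laurent_monom_def)
  hence "f \<otimes>\<^bsub>laurent R\<^esub> g = ?m \<otimes>\<^bsub>laurent R\<^esub> g \<oplus>\<^bsub>laurent R\<^esub> f(a := \<zero>) \<otimes>\<^bsub>laurent R\<^esub> g"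
    using L.l_distr[OF m f' g] by metis
  hence "(f \<otimes>\<^bsub>laurent R\<^esub> g) k = f a \<otimes> g (k - a) \<oplus> (f(a := \<zero>) \<otimes>\<^bsub>laurent R\<^esub> g) k"
    using laurent_monom_mult[OF fc g] by (simp add: laurent_add_coeff)
  moreover have "(f(a := \<zero>) \<otimes>\<^bsub>laurent R\<^esub> g) k \<in> carrier R" "f a \<otimes> g (k - a) \<in> carrier R"
    using laurent_coeff_closed[OF L.m_closed[OF f' g]] fc laurent_coeff_closed[OF g] by auto
  ultimately show "(f(a := \<zero>) \<otimes>\<^bsub>laurent R\<^esub> g) k = (f \<otimes>\<^bsub>laurent R\<^esub> g) k \<ominus> f a \<otimes> g (k - a)"
    by (simp add: add_minus_cancel_left)
qed

lemma (in cring) laurent_mult_top: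
  assumes f: "f \<in> carrier (laurent R)" and g: "g \<in> carrier (laurent R)"
    and z: "\<And>i. i \<noteq> a \<Longrightarrow> f i = \<zero> \<or> g (n - i) = \<zero>"
  shows "(f \<otimes>\<^bsub>laurent R\<^esub> g) n = f a \<otimes> g (n - a)"
proof -
  interpret L: cring "laurent R" by (rule laurent_cring)
  have "(f \<otimes>\<^bsub>laurent R\<^esub> g) n \<ominus> f a \<otimes> g (n - a) \<in> {\<zero>}"
    by (rule laurent_mult_mod[OF carrier_is_subcring])
       (use f g z in \<open>auto simp: ideal_in_def laurent_sub_iff laurent_coeff_closed\<close>)
  thus ?thesis
    using laurent_coeff_closed[OF L.m_closed[OF f g]] laurent_coeff_closed[OF f] laurent_coeff_closed[OF g]
    by (simp add: r_right_minus_eq)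
qed

text \<open>
  The inclusion \<open>c(f)\<^sup>n\<^sup>+\<^sup>1 c(g) \<subseteq> c(f)\<^sup>n c(f g)\<close> of Dedekind and Mertens, for \<open>g\<close> with at most \<open>n + 1\<close>
  terms. Stating it with colon modules reduces the induction to splitting off the leading
  terms \<open>s\<close> of \<open>f\<close> and \<open>t\<close> of \<open>g\<close>, whose product is a coefficient of \<open>f g\<close>.
\<close>

lemma (in cring) dedekind_mertens:
  assumes A: "subcring A R"
  shows "\<lbrakk>subalgebra A W R; f \<in> carrier (laurent R); g \<in> carrier (laurent R);
    {i. f i \<noteq> \<zero>} \<subseteq> {a..<a + int m}; {i. g i \<noteq> \<zero>} \<subseteq> {b..b + int n};
    \<And>k. (f \<otimes>\<^bsub>laurent R\<^esub> g) k \<in> (coeff_colon f ^^ n) W\<rbrakk> \<Longrightarrow> g j \<in> (coeff_colon f ^^ Suc n) W"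
proof (induction n arbitrary: f g W m j rule: less_induct)
  case (less n f g W m j)
  interpret L: cring "laurent R" by (rule laurent_cring)
  note W = less.prems(1) and g = less.prems(3) and gs = less.prems(5)
  note gc = laurent_coeff_closed[OF g]
  \<comment> \<open>The outer induction is on the width \<open>n\<close> of \<open>g\<close>, for
    all \<open>W\<close> and \<open>f\<close> at once; the inner one, started here, removes terms of
    \<open>f\<close> while \<open>g\<close>, \<open>n\<close> and \<open>W\<close> stay
    fixed.\<close>
  from less.prems(2,4,6) show ?case
  proof (induction m arbitrary: f j)
    case (0 f j)
    have f0: "f i = \<zero>" for i using 0(2) by auto
    have sub: "subalgebra A ((coeff_colon f ^^ n) W) R"
      by (rule coeff_colon_pow_submodule[OF A _ W]) (simp add: f0)
    show ?case unfolding coeff_colon_pow_Suc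
      using submoduleD(2)[OF A sub] gc f0 by simp
  next
    case (Suc m f j)
    note f = Suc.prems(1) and fs = Suc.prems(2) and fg = Suc.prems(3)
    have fc: "f i \<in> carrier R" for i using laurent_coeff_closed[OF f] .
    define s t where "s = f (a + int m)" and "t = g (b + int n)"
    have st: "s \<in> carrier R" "t \<in> carrier R" using fc gc by (auto simp: s_def t_def)
    define f' where "f' = f(a + int m := \<zero>)"
    have f': "f' \<in> carrier (laurent R)" "\<And>k. (f' \<otimes>\<^bsub>laurent R\<^esub> g) k = (f \<otimes>\<^bsub>laurent R\<^esub> g) k \<ominus> s \<otimes> g (k - (a + int m))"
      using laurent_delete[OF f g] by (simp_all add: f'_def s_def)
    note sub = coeff_colon_pow_submodule[where f = f, OF A fc W]
    have "(f \<otimes>\<^bsub>laurent R\<^esub> g) (a + int m + (b + int n)) = f (a + int m) \<otimes> g (a + int m + (b + int n) - (a + int m))"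
    proof (rule laurent_mult_top[OF f g])
      fix i assume i: "i \<noteq> a + int m"
      show "f i = \<zero> \<or> g (a + int m + (b + int n) - i) = \<zero>"
      proof (rule ccontr)
        assume "\<not> ?thesis"
        hence "i \<in> {a..<a + int (Suc m)}" "a + int m + (b + int n) - i \<in> {b..b + int n}"
          using fs gs by auto
        thus False using i by auto
      qed
    qed
    hence top: "s \<otimes> t \<in> (coeff_colon f ^^ n) W" using fg[of "a + int m + (b + int n)"] by (simp add: s_def t_def)
    \<comment> \<open>It suffices that the leading term \<open>s\<close> multiplies every
      coefficient of \<open>g\<close> into \<open>W : c(f)^n\<close>. Deleting that term from
      \<open>f\<close> then changes the coefficients of \<open>f g\<close> only within this module,
      and \<open>coeff_colon_pow_split\<close> puts the term back.\<close>
    have sg: "s \<otimes> g j \<in> (coeff_colon f ^^ n) W" for j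
    proof (cases "j = b + int n")
      case True thus ?thesis using top t_def by simp
    next
      case j: False
      show ?thesis
      proof (cases n)
        case 0
        hence "g j = \<zero>" using gs j by auto
        thus ?thesis using submoduleD(2)[OF A sub] st by simp
      next
        case (Suc n')
        define g' where "g' = g(b + int n := \<zero>)"
        have g': "g' \<in> carrier (laurent R)" using laurent_delete(1)[OF g g] by (simp add: g'_def)
        have fg': "(f \<otimes>\<^bsub>laurent R\<^esub> g') k = (f \<otimes>\<^bsub>laurent R\<^esub> g) k \<ominus> t \<otimes> f (k - (b + int n))" for k
          using laurent_delete(2)[OF g f, of "b + int n" k] L.m_comm[OF f g] L.m_comm[OF f g']
          by (simp add: g'_def t_def)
        \<comment> \<open>The outer induction hypothesis is applied to \<open>g\<close> without its
          leading term and to the colon module \<open>W : s\<close>. Deleting that term changes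
          \<open>f g\<close> by \<open>t f\<close>, and \<open>s\<close> times a coefficient of
          \<open>t f\<close> stays in the module because \<open>s \<otimes> t\<close> is itself a
          coefficient of \<open>f g\<close>.\<close>
        define W' where "W' = {y \<in> carrier R. s \<otimes> y \<in> W}"
        have W': "subalgebra A W' R"
          using coeff_colon_submodule[OF A _ W, of "\<lambda>i. s"] st by (simp add: coeff_colon_def W'_def)
        note subn = coeff_colon_pow_submodule[where f = f, OF A fc W, of n']
        have down: "x \<in> (coeff_colon f ^^ n) W \<Longrightarrow> f i \<otimes> x \<in> (coeff_colon f ^^ n') W" for x i
          unfolding Suc coeff_colon_pow_Suc by blast
        have "g' j \<in> (coeff_colon f ^^ Suc n') W'"
        proof (rule less.IH[of n' W' f g' "Suc m"])
          show "n' < n" using Suc by simp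
          show "{i. g' i \<noteq> \<zero>} \<subseteq> {b..b + int n'}"
          proof
            fix i assume "i \<in> {i. g' i \<noteq> \<zero>}"
            hence "i \<in> {b..b + int n}" "i \<noteq> b + int n" using gs by (auto simp: g'_def split: if_splits)
            thus "i \<in> {b..b + int n'}" using Suc by auto
          qed
          fix k
          let ?h = "(f \<otimes>\<^bsub>laurent R\<^esub> g) k" and ?x = "f (k - (b + int n))"
          have hc: "?h \<in> carrier R" using laurent_coeff_closed[OF L.m_closed[OF f g]] .
          have "s \<otimes> (?h \<ominus> t \<otimes> ?x) = s \<otimes> ?h \<ominus> ?x \<otimes> (s \<otimes> t)"
          proof -
            have "s \<otimes> (h \<ominus> t \<otimes> x) = s \<otimes> h \<ominus> x \<otimes> (s \<otimes> t)" if "h \<in> carrier R" "x \<in> carrier R" for h x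
              using that st by algebra
            thus ?thesis using hc fc by blast
          qed
          moreover have "s \<otimes> ?h \<in> (coeff_colon f ^^ n') W" using down[OF fg] by (simp add: s_def)
          moreover have "?x \<otimes> (s \<otimes> t) \<in> (coeff_colon f ^^ n') W" using down[OF top] .
          ultimately have "s \<otimes> (f \<otimes>\<^bsub>laurent R\<^esub> g') k \<in> (coeff_colon f ^^ n') W"
            using submoduleD(5)[OF A subn] fg' by simp
          thus "(f \<otimes>\<^bsub>laurent R\<^esub> g') k \<in> (coeff_colon f ^^ n') W'"
            unfolding W'_def
            using coeff_colon_pow_smult[where f = f, OF fc st(1) laurent_coeff_closed[OF L.m_closed[OF f g']]] by blast
        qed (use W' f g' fs in auto)
        moreover have "g' j = g j" using j by (simp add: g'_def)
        ultimately show ?thesis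
          unfolding W'_def Suc[symmetric]
          using coeff_colon_pow_smult[where f = f, OF fc st(1) gc] by simp
      qed
    qed
    have "g j \<in> (coeff_colon f' ^^ Suc n) W" for j
    proof (rule Suc.IH[OF f'(1)])
      show "{i. f' i \<noteq> \<zero>} \<subseteq> {a..<a + int m}"
      proof
        fix i assume "i \<in> {i. f' i \<noteq> \<zero>}"
        hence "i \<in> {a..<a + int (Suc m)}" "i \<noteq> a + int m" using fs by (auto simp: f'_def split: if_splits)
        thus "i \<in> {a..<a + int m}" by auto
      qed
      fix k
      have "(f' \<otimes>\<^bsub>laurent R\<^esub> g) k \<in> (coeff_colon f ^^ n) W"
        unfolding f'(2) by (rule submoduleD(5)[OF A sub fg sg])
      thus "(f' \<otimes>\<^bsub>laurent R\<^esub> g) k \<in> (coeff_colon f' ^^ n) W"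
        by (rule coeff_colon_pow_mono[where f = f and f' = f', OF A fc W, rotated]) (simp add: f'_def)
    qed
    thus ?case
      using coeff_colon_pow_split[where f = f and f' = f' and a = "a + int m", OF fc] sg
      by (simp add: f'_def s_def)
  qed
qed

section \<open>Powers of the content module and the ring in which they become stationary\<close>

primrec content_pow :: "('a, 'm) ring_scheme \<Rightarrow> 'a set \<Rightarrow> (int \<Rightarrow> 'a) \<Rightarrow> nat \<Rightarrow> 'a set"
  where "content_pow R A f 0 = A"
  | "content_pow R A f (Suc k) = ideal_prod R (range f) (content_pow R A f k)"

lemma (in cring) content_pow_submodule:
  assumes "subcring A R" "\<And>i. f i \<in> carrier R"
  shows "subalgebra A (content_pow R A f k) R"
proof (induction k)
  case (Suc k)
  thus ?case
    using ideal_prod_submodule[OF subcringE(1)[OF assms(1)] _ _ Suc, of "range f"] assms(2) by auto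
qed (simp add: subcring_is_submodule[OF assms(1)])

text \<open>With \<open>content_pow_coeff_colon\<close> this translates between the two
  descriptions: \<open>A\<close> lies in \<open>W : c(f)^k\<close> exactly if
  \<open>A c(f)^k\<close> lies in \<open>W\<close>. The induction moves the innermost colon onto
  \<open>W\<close>, since \<open>content_pow\<close> multiplies from the outside.\<close>

lemma (in cring) content_pow_subset:
  assumes A: "subcring A R" and f: "\<And>i. f i \<in> carrier R" and W: "subalgebra A W R"
  shows "A \<subseteq> (coeff_colon f ^^ k) W \<Longrightarrow> content_pow R A f k \<subseteq> W"
  using W
proof (induction k arbitrary: W)
  case (Suc k)
  have "content_pow R A f k \<subseteq> coeff_colon f W"
    by (rule Suc(1)) (use Suc(2) coeff_colon_submodule[OF A f Suc(3)] in \<open>simp_all add: funpow_swap1\<close>)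
  thus ?case
    unfolding content_pow.simps
    by (intro ideal_prod_subset) (use submoduleD(3)[OF A Suc(3)] in \<open>auto simp: coeff_colon_def\<close>)
qed simp

lemma (in cring) content_pow_coeff_colon:
  assumes A: "subcring A R" and f: "\<And>i. f i \<in> carrier R" and a: "a \<in> A"
  shows "a \<in> (coeff_colon f ^^ k) (content_pow R A f k)"
proof (induction k)
  case (Suc k)
  have *: "content_pow R A f k \<subseteq> coeff_colon f (content_pow R A f (Suc k))"
    using submoduleD(1)[OF A content_pow_submodule[where f = f, OF A f]]
    by (auto simp: coeff_colon_def intro: ideal_prod.prod)
  have "V \<subseteq> W \<Longrightarrow> (coeff_colon f ^^ k) V \<subseteq> (coeff_colon f ^^ k) W" for V W
    by (induction k) (auto simp: coeff_colon_def)
  thus ?case using Suc *  by (simp add: funpow_swap1) blast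
qed (use a in simp)

text \<open>Once a content power is known to be a ring containing \<open>A\<close> and the
  coefficients, this makes it the smallest such ring.\<close>

lemma (in cring) subcring_contains_content_pow:
  assumes "subcring D R" "A \<subseteq> D" "range f \<subseteq> D"
  shows "content_pow R A f k \<subseteq> D"
proof (induction k)
  case (Suc k)
  thus ?case unfolding content_pow.simps
    by (intro ideal_prod_subset) (use assms(3) subcringE(6,7)[OF assms(1)] in blast)+
qed (use assms(2) in simp)

lemma (in cring) content_pow_mult:
  assumes A: "subcring A R" and f: "\<And>i. f i \<in> carrier R"
    and y: "y \<in> content_pow R A f k"
  shows "x \<in> content_pow R A f l \<Longrightarrow> x \<otimes> y \<in> content_pow R A f (l + k)"
proof (induction l arbitrary: x)
  case 0
  thus ?case using submoduleD(4)[OF A content_pow_submodule[where f = f, OF A f] _ y] by simp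
next
  case (Suc l)
  note c = submoduleD(1)[OF A content_pow_submodule[where f = f, OF A f]]
  from Suc(2) show ?case unfolding content_pow.simps
  proof (induction rule: ideal_prod.induct)
    case (prod i j)
    have "i \<otimes> j \<otimes> y = i \<otimes> (j \<otimes> y)" using prod f y c by (intro m_assoc) auto
    thus ?case using prod Suc(1)[OF prod(2)] by (simp add: ideal_prod.prod)
  next
    case (sum s t)
    have "s \<in> carrier R" "t \<in> carrier R" "y \<in> carrier R"
      using sum(1,2) c[of "Suc l"] y c[of k] by auto
    thus ?case using sum(3,4) by (simp add: l_distr ideal_prod.sum)
  qed
qed

text \<open>If \<open>\<one>\<close> is a combination of the \<open>f i\<close> and every
  \<open>f i \<otimes> y\<close> lies in \<open>W\<close>, then so does
  \<open>y = \<one> \<otimes> y\<close>.\<close>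

lemma (in cring) unit_content_colon:
  assumes A: "subcring A R" and f: "\<And>i. f i \<in> carrier R" and one: "\<one> \<in> ideal_prod R A (range f)"
    and W: "subalgebra A W R"
  shows "(coeff_colon f ^^ k) W \<subseteq> W"
proof -
  have *: "coeff_colon f W \<subseteq> W" if W: "subalgebra A W R" for W
  proof
    fix y assume y: "y \<in> coeff_colon f W"
    hence yc: "y \<in> carrier R" by (simp add: coeff_colon_def)
    have "z \<otimes> y \<in> W" if "z \<in> ideal_prod R A (range f)" for z
      using that
    proof (induction rule: ideal_prod.induct)
      case (prod a b)
      have "b \<otimes> y \<in> W" using prod y by (auto simp: coeff_colon_def)
      moreover have "a \<otimes> b \<otimes> y = a \<otimes> (b \<otimes> y)"
        using prod f yc subcringE(1)[OF A] by (intro m_assoc) auto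
      ultimately show ?case using submoduleD(4)[OF A W prod(1)] by simp
    next
      case (sum s t)
      have "ideal_prod R A (range f) \<subseteq> carrier R"
        by (rule ideal_prod_carrier) (use f subcringE(1)[OF A] in auto)
      hence "(s \<oplus> t) \<otimes> y = s \<otimes> y \<oplus> t \<otimes> y" using sum(1,2) yc by (intro l_distr) auto
      thus ?case using sum(3,4) submoduleD(3)[OF A W] by simp
    qed
    thus "y \<in> W" using one yc by fastforce
  qed
  show ?thesis
  proof (induction k)
    case (Suc k)
    thus ?case using *[OF coeff_colon_pow_submodule[where f = f, OF A f W], of k] by simp
  qed simp
qed

lemma finite_int_bounds:
  assumes "finite (S :: int set)"
  obtains a b where "S \<subseteq> {a..<b}"
proof (cases "S = {}")
  case False
  hence "S \<subseteq> {Min S..<Max S + 1}" using assms by auto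
  thus ?thesis by (rule that)
qed (use that[of 0 0] in simp)

text \<open>Since the coefficients of \<open>f g\<close> are in \<open>A\<close>, Dedekind and
  Mertens give \<open>c(f)^(n+1) c(g) \<subseteq> A c(f)^n\<close>. With \<open>\<one>\<close> in
  \<open>A c(g)\<close> the powers of \<open>c(f)\<close> stop growing at \<open>n\<close>, and with
  \<open>\<one>\<close> in \<open>A c(f)\<close> they form an increasing chain. Hence
  \<open>A c(f)^n\<close> is closed under products, and the same inclusion places the coefficients
  of \<open>g\<close> in it. As a content power it is also a finite module over
  \<open>A\<close>.\<close>

lemma (in cring) content_ring:
  assumes A: "subcring A R" and f: "f \<in> carrier (laurent R)" and g: "g \<in> carrier (laurent R)"
    and fg: "f \<otimes>\<^bsub>laurent R\<^esub> g \<in> laurent_sub A R"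
    and f1: "\<one> \<in> ideal_prod R A (range f)" and g1: "\<one> \<in> ideal_prod R A (range g)"
  obtains n where "subcring (content_pow R A f n) R" "A \<subseteq> content_pow R A f n"
    "range f \<subseteq> content_pow R A f n" "range g \<subseteq> content_pow R A f n"
proof -
  note fc = laurent_coeff_closed[OF f]
  have bnd: "\<exists>a m. {i. h i \<noteq> \<zero>} \<subseteq> {a..<a + int m}" if "h \<in> carrier (laurent R)" for h
  proof -
    have "finite {i. h i \<noteq> \<zero>}" using laurent_finite_support[OF that] .
    then obtain a b where "{i. h i \<noteq> \<zero>} \<subseteq> {a..<b}" using finite_int_bounds by blast
    hence "{i. h i \<noteq> \<zero>} \<subseteq> {a..<a + int (nat (b - a))}" by auto
    thus ?thesis by blast
  qed
  obtain a m where fs: "{i. f i \<noteq> \<zero>} \<subseteq> {a..<a + int m}" using bnd[OF f] by blast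
  obtain b n where "{i. g i \<noteq> \<zero>} \<subseteq> {b..<b + int n}" using bnd[OF g] by blast
  hence gs: "{i. g i \<noteq> \<zero>} \<subseteq> {b..b + int n}" by fastforce
  define P where "P = content_pow R A f"
  have P: "subalgebra A (P k) R" for k unfolding P_def by (rule content_pow_submodule[OF A fc])
  have fgA: "(f \<otimes>\<^bsub>laurent R\<^esub> g) k \<in> A" for k
    using fg laurent_sub_iff[OF subcringE(1)[OF A]] by blast
  have gW: "g j \<in> (coeff_colon f ^^ Suc n) (P n)" for j
    by (rule dedekind_mertens[OF A P f g fs gs])
       (use content_pow_coeff_colon[where f = f, OF A fc fgA] in \<open>simp add: P_def\<close>)
  note sub = coeff_colon_pow_submodule[where f = f, OF A fc P]
  have "ideal_prod R A (range g) \<subseteq> (coeff_colon f ^^ Suc n) (P n)"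
    by (rule ideal_prod_subset) (use gW submoduleD(3,4)[OF A sub[of "Suc n" n]] in blast)+
  hence "\<one> \<in> (coeff_colon f ^^ Suc n) (P n)" using g1 by blast
  hence "a \<otimes> \<one> \<in> (coeff_colon f ^^ Suc n) (P n)" if "a \<in> A" for a
    by (rule submoduleD(4)[OF A sub[of "Suc n" n] that])
  hence "A \<subseteq> (coeff_colon f ^^ Suc n) (P n)"
    using subcringE(1)[OF A] r_one by fastforce
  hence "P (Suc n) \<subseteq> P n" unfolding P_def by (rule content_pow_subset[OF A fc P[unfolded P_def]])
  hence down: "P (n + k) \<subseteq> P n" for k
  proof (induction k)
    case (Suc k)
    have "P (n + Suc k) \<subseteq> ideal_prod R (range f) (P n)"
      using Suc ideal_prod_mono[of "range f" "range f" "P (n + k)" "P n" R] by (simp add: P_def)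
    thus ?case using Suc(2) by (auto simp: P_def)
  qed simp
  have up1: "P k \<subseteq> P (Suc k)" for k
  proof -
    have "P k \<subseteq> (coeff_colon f ^^ 1) (P (Suc k))"
      using submoduleD(1)[OF A P[of k]] by (auto simp: coeff_colon_def P_def intro: ideal_prod.prod)
    thus ?thesis using unit_content_colon[where f = f, OF A fc f1 P, of 1 "Suc k"] by blast
  qed
  have up: "P 0 \<subseteq> P k" for k using up1 by (induction k) auto
  have "f i \<in> P 1" for i
  proof -
    have "f i \<otimes> \<one> \<in> P 1" using subcringE(3)[OF A] by (auto simp: P_def intro: ideal_prod.prod)
    thus ?thesis using fc by simp
  qed
  moreover have "P 1 \<subseteq> P (n + 1)"
    by (induction n) (use up1 in auto)
  ultimately have "range f \<subseteq> P n" using down[of 1] by blast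
  moreover have "range g \<subseteq> P n" using gW unit_content_colon[where f = f, OF A fc f1 P] by blast
  moreover have "A \<subseteq> P n" using up[of n] by (simp add: P_def)
  moreover have "subcring (P n) R"
  proof (rule subcringI'[OF subringI])
    show "\<one> \<in> P n" using \<open>A \<subseteq> P n\<close> subcringE(3)[OF A] by blast
    fix h assume h: "h \<in> P n"
    have "\<zero> \<ominus> h \<in> P n" using submoduleD(2,5)[OF A P] h by blast
    moreover have "h \<in> carrier R" using h submoduleD(1)[OF A P] by blast
    ultimately show "\<ominus> h \<in> P n" by (simp add: a_minus_def)
    fix k assume k: "k \<in> P n"
    show "h \<oplus> k \<in> P n" using submoduleD(3)[OF A P] h k by blast
    show "h \<otimes> k \<in> P n"
      using content_pow_mult[where f = f, OF A fc k[unfolded P_def] h[unfolded P_def]] down[of n]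
      by (auto simp: P_def)
  qed (use submoduleD(1)[OF A P] in auto)
  ultimately show ?thesis using that by (simp add: P_def)
qed

definition (in cring) fin_over :: "'a set \<Rightarrow> 'a set \<Rightarrow> bool"
  where "fin_over A D \<longleftrightarrow> (\<exists>S. finite S \<and> S \<subseteq> carrier R \<and> D = ideal_prod R A S)"

lemma (in cring) ideal_prod_span:
  assumes "A \<subseteq> carrier R" "S \<subseteq> carrier R" "T \<subseteq> carrier R" "subcring A R" "S \<noteq> {}" "T \<noteq> {}"
  shows "ideal_prod R S (ideal_prod R A T) = ideal_prod R A ((\<lambda>(s, t). s \<otimes> t) ` (S \<times> T))" (is "?l = ideal_prod R A ?ST")
proof
  have ST: "?ST \<subseteq> carrier R" "?ST \<noteq> {}" using assms by auto
  note subT = span_submodule[OF assms(4) assms(3,6)]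
  show "?l \<subseteq> ideal_prod R A ?ST"
  proof (rule ideal_prod_subset)
    fix s x assume s: "s \<in> S" and x: "x \<in> ideal_prod R A T"
    from x show "s \<otimes> x \<in> ideal_prod R A ?ST"
    proof (induction rule: ideal_prod.induct)
      case (prod a t)
      have "s \<otimes> (a \<otimes> t) = a \<otimes> (s \<otimes> t)" using prod s assms(1-3) by (intro m_lcomm) auto
      moreover have "s \<otimes> t \<in> ?ST" using s prod by auto
      ultimately show ?case using ideal_prod.prod[OF prod(1)] by metis
    next
      case (sum x y)
      hence "s \<otimes> (x \<oplus> y) = s \<otimes> x \<oplus> s \<otimes> y"
        using s assms(2) submoduleD(1)[OF assms(4) subT(1)] by (intro r_distr) auto
      thus ?case using sum by (simp add: ideal_prod.sum)
    qed
  qed (rule ideal_prod.sum)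
  show "ideal_prod R A ?ST \<subseteq> ?l"
  proof (rule ideal_prod_subset)
    fix a z assume a: "a \<in> A" and "z \<in> ?ST"
    then obtain s t where st: "s \<in> S" "t \<in> T" "z = s \<otimes> t" by auto
    have "a \<otimes> (s \<otimes> t) = s \<otimes> (a \<otimes> t)" using st a assms(1-3) by (intro m_lcomm) auto
    thus "a \<otimes> z \<in> ?l" using st a by (auto intro: ideal_prod.prod)
  qed (rule ideal_prod.sum)
qed

lemma (in cring) fin_over_refl:
  assumes "subcring A R" shows "fin_over A A"
proof -
  have "ideal_prod R A {\<one>} = ideal_prod R {\<one>} A"
    using subcringE(1)[OF assms] by (intro ideal_prod_commute_sets) auto
  also have "\<dots> = A"
  proof
    show "ideal_prod R {\<one>} A \<subseteq> A"
      by (rule ideal_prod_subset) (use subcringE(1,7)[OF assms] in auto)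
    show "A \<subseteq> ideal_prod R {\<one>} A"
      using ideal_prod.prod[of \<one> "{\<one>}" _ A R] subcringE(1)[OF assms] by (metis l_one singletonI subset_iff)
  qed
  finally show ?thesis unfolding fin_over_def by (intro exI[of _ "{\<one>}"]) auto
qed

lemma (in cring) fin_over_content_pow:
  assumes A: "subcring A R" and E: "subcring E R" "fin_over A E" and f: "f \<in> carrier (laurent R)"
  shows "fin_over A (content_pow R E f k)"
proof (induction k)
  case (Suc k)
  then obtain S where S: "finite S" "S \<subseteq> carrier R" "content_pow R E f k = ideal_prod R A S"
    unfolding fin_over_def by blast
  note fc = laurent_coeff_closed[OF f]
  have ne: "S \<noteq> {}"
  proof
    assume "S = {}"
    hence "ideal_prod R A S = {}" by (auto elim: ideal_prod.induct)
    thus False using S(3) submoduleD(2)[OF E(1) content_pow_submodule[where f = f, OF E(1) fc]] by auto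
  qed
  have "range f \<subseteq> insert \<zero> (f ` {i. f i \<noteq> \<zero>})" by auto
  hence "finite (range f)" using laurent_finite_support[OF f] finite_subset by blast
  hence "finite ((\<lambda>(s, t). s \<otimes> t) ` (range f \<times> S))" using S(1) by simp
  moreover have "(\<lambda>(s, t). s \<otimes> t) ` (range f \<times> S) \<subseteq> carrier R" using fc S(2) by auto
  moreover have "content_pow R E f (Suc k) = ideal_prod R A ((\<lambda>(s, t). s \<otimes> t) ` (range f \<times> S))"
    using ideal_prod_span[OF subcringE(1)[OF A] _ S(2) A _ ne, of "range f"] fc S(3) by auto
  ultimately show ?case unfolding fin_over_def by blast
qed (use E in simp)

section \<open>Idempotents of finite algebras over a Hensel local ring\<close>

lemma (in cring) ideal_in_carrier_imp_ideal:
  assumes "ideal_in I (carrier R)" shows "ideal I R"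
proof (rule idealI)
  note I = ideal_inD[OF assms]
  show "ring R" by (rule ring_axioms)
  show "subgroup I (add_monoid R)"
  proof (rule add.subgroupI)
    show "\<ominus> x \<in> I" if "x \<in> I" for x using ideal_in_minus(1)[OF carrier_is_subcring assms that] .
  qed (use I(1,2,3) in auto)
  fix a x assume ax: "a \<in> I" "x \<in> carrier R"
  show "x \<otimes> a \<in> I" using I(4) ax by blast
  thus "a \<otimes> x \<in> I" using ax I(1) by (metis m_comm subsetD)
qed

lemma (in cring) nonunit_in_maximalideal:
  assumes x: "x \<in> carrier R" "x \<notin> Units R"
  shows "\<exists>M. maximalideal M R \<and> x \<in> M"
proof -
  have z: "ideal_in {\<zero>} (carrier R)" by (auto simp: ideal_in_def)
  define J where "J = {a \<oplus> d \<otimes> x |a d. a \<in> {\<zero>} \<and> d \<in> carrier R}"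
  note J = ideal_in_adjoin[OF carrier_is_subcring z x(1), folded J_def]
  have "J \<inter> {\<one>} = {}"
  proof (rule ccontr)
    assume "J \<inter> {\<one>} \<noteq> {}"
    hence "\<one> \<in> J" by blast
    then obtain d where d: "d \<in> carrier R" "\<one> = \<zero> \<oplus> d \<otimes> x" by (auto simp: J_def)
    hence "d \<otimes> x = \<one>" "x \<otimes> d = \<one>" using x m_comm by auto
    hence "x \<in> Units R" using x d(1) unfolding Units_def by blast
    thus False using x(2) by simp
  qed
  then obtain M where M: "ideal_in M (carrier R)" "J \<subseteq> M" "M \<inter> {\<one>} = {}"
    and max: "\<And>K. \<lbrakk>ideal_in K (carrier R); M \<subseteq> K; K \<inter> {\<one>} = {}\<rbrakk> \<Longrightarrow> K = M"
    using ex_maximal_ideal_avoiding[OF J(1)] by blast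
  have "maximalideal M R"
  proof (rule maximalidealI)
    show "ideal M R" by (rule ideal_in_carrier_imp_ideal[OF M(1)])
    show "carrier R \<noteq> M" using M(3) by auto
    fix K assume K: "ideal K R" "M \<subseteq> K" "K \<subseteq> carrier R"
    have "ideal_in K (carrier R)"
      using K(3) ideal.I_l_closed[OF K(1)] additive_subgroup.a_closed[OF ideal.axioms(1)[OF K(1)]]
        additive_subgroup.zero_closed[OF ideal.axioms(1)[OF K(1)]]
      by (auto simp: ideal_in_def)
    thus "K = M \<or> K = carrier R"
      using max[OF _ K(2)] ideal.one_imp_carrier[OF K(1)] by blast
  qed
  thus ?thesis using J(3) M(2) by blast
qed

text \<open>Two non-units lie in maximal ideals, which coincide, and then so does their sum. This is
  the form in which locality is used later.\<close>

lemma local_ring_add_Units: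
  assumes "local_ring S" "a \<in> carrier S" "b \<in> carrier S" "a \<oplus>\<^bsub>S\<^esub> b \<in> Units S"
  shows "a \<in> Units S \<or> b \<in> Units S"
proof (rule ccontr)
  interpret S: cring S using assms(1) by (simp add: local_ring_def)
  assume "\<not> ?thesis"
  then obtain M N where MN: "maximalideal M S" "a \<in> M" "maximalideal N S" "b \<in> N"
    using S.nonunit_in_maximalideal assms(2,3) by metis
  hence "N = M" using assms(1) by (auto simp: local_ring_def)
  interpret M: maximalideal M S by fact
  have "a \<oplus>\<^bsub>S\<^esub> b \<in> M" using MN \<open>N = M\<close> by auto
  moreover obtain c where "c \<in> carrier S" "c \<otimes>\<^bsub>S\<^esub> (a \<oplus>\<^bsub>S\<^esub> b) = \<one>\<^bsub>S\<^esub>"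
    using assms(4) by (auto simp: Units_def)
  ultimately have "\<one>\<^bsub>S\<^esub> \<in> M" using M.I_l_closed by metis
  thus False using M.one_imp_carrier M.I_notcarr by simp
qed

lemma local_ring_one_not_zero: "local_ring S \<Longrightarrow> \<one>\<^bsub>S\<^esub> \<noteq> \<zero>\<^bsub>S\<^esub>"
proof
  assume S: "local_ring S" "\<one>\<^bsub>S\<^esub> = \<zero>\<^bsub>S\<^esub>"
  interpret S: cring S using S(1) by (simp add: local_ring_def)
  obtain M where "maximalideal M S" using S(1) by (auto simp: local_ring_def)
  then interpret M: maximalideal M S .
  have "\<one>\<^bsub>S\<^esub> \<in> M" using S(2) M.zero_closed by simp
  thus False using M.one_imp_carrier M.I_notcarr by simp
qed

lemma RDirProd_list_ops_nth:
  assumes "x \<in> carrier (RDirProd_list Rs)" "y \<in> carrier (RDirProd_list Rs)" "i < length Rs"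
  shows "(x \<otimes>\<^bsub>RDirProd_list Rs\<^esub> y) ! i = x ! i \<otimes>\<^bsub>Rs ! i\<^esub> y ! i"
    and "(x \<oplus>\<^bsub>RDirProd_list Rs\<^esub> y) ! i = x ! i \<oplus>\<^bsub>Rs ! i\<^esub> y ! i"
    and "\<one>\<^bsub>RDirProd_list Rs\<^esub> ! i = \<one>\<^bsub>Rs ! i\<^esub>"
  using assms
proof (induction Rs arbitrary: x y i)
  case (Cons R Rs)
  let ?h = "\<lambda>(a, as). a # as"
  note hom = RDirProd_list_hom1[of R Rs]
  {
    case 1
    then obtain a as b bs where ab: "x = a # as" "y = b # bs" "a \<in> carrier R" "b \<in> carrier R"
      "as \<in> carrier (RDirProd_list Rs)" "bs \<in> carrier (RDirProd_list Rs)"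
      by (auto simp: RDirProd_list_carrier)
    have "x \<otimes>\<^bsub>RDirProd_list (R # Rs)\<^esub> y = ?h ((a, as) \<otimes>\<^bsub>RDirProd R (RDirProd_list Rs)\<^esub> (b, bs))"
      using ring_hom_mult[OF hom, of "(a, as)" "(b, bs)"] ab by (simp add: RDirProd_carrier)
    also have "\<dots> = (a \<otimes>\<^bsub>R\<^esub> b) # (as \<otimes>\<^bsub>RDirProd_list Rs\<^esub> bs)"
      by (simp add: RDirProd_def DirProd_def monoid.defs)
    finally show ?case using 1 Cons.IH(1)[OF ab(5,6)] by (cases i) (simp_all add: ab)
  next
    case 2
    then obtain a as b bs where ab: "x = a # as" "y = b # bs" "a \<in> carrier R" "b \<in> carrier R"
      "as \<in> carrier (RDirProd_list Rs)" "bs \<in> carrier (RDirProd_list Rs)"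
      by (auto simp: RDirProd_list_carrier)
    have "x \<oplus>\<^bsub>RDirProd_list (R # Rs)\<^esub> y = ?h ((a, as) \<oplus>\<^bsub>RDirProd R (RDirProd_list Rs)\<^esub> (b, bs))"
      using ring_hom_add[OF hom, of "(a, as)" "(b, bs)"] ab by (simp add: RDirProd_carrier)
    also have "\<dots> = (a \<oplus>\<^bsub>R\<^esub> b) # (as \<oplus>\<^bsub>RDirProd_list Rs\<^esub> bs)"
      by (simp add: RDirProd_def DirProd_def monoid.defs)
    finally show ?case using 2 Cons.IH(2)[OF ab(5,6)] by (cases i) (simp_all add: ab)
  next
    case 3
    then obtain a as where "as \<in> carrier (RDirProd_list Rs)" by (auto simp: RDirProd_list_carrier)
    thus ?case using 3 Cons.IH(3)[of as as] by (cases i) (simp_all add: RDirProd_list_one)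
  }
qed simp_all

text \<open>The image of \<open>x\<close> is a unit of the factor ring \<open>D e\<close>, whose
  identity is \<open>e\<close>. The condition mentions elements of \<open>D\<close> only, so the
  factor itself never has to be formed.\<close>

definition (in cring) unit_at :: "'a set \<Rightarrow> 'a \<Rightarrow> 'a \<Rightarrow> bool"
  where "unit_at D e x \<longleftrightarrow> (\<exists>y\<in>D. x \<otimes> y \<otimes> e = e)"

text \<open>A decomposition of \<open>D\<close> into local rings \<open>D e_i\<close>, written
  inside \<open>R\<close>: a complete orthogonal system of nonzero idempotents, with locality of
  each factor expressed by the behaviour of units under addition. The case \<open>n = 0\<close>
  belongs to the zero ring.\<close>

definition (in cring) local_idempotents :: "nat \<Rightarrow> (nat \<Rightarrow> 'a) \<Rightarrow> 'a set \<Rightarrow> bool"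
  where "local_idempotents n e D \<longleftrightarrow> (\<forall>i<n. e i \<in> D \<and> e i \<noteq> \<zero> \<and> e i \<otimes> e i = e i) \<and>
    (\<forall>i<n. \<forall>j<n. i \<noteq> j \<longrightarrow> e i \<otimes> e j = \<zero>) \<and> (\<Oplus>i\<in>{..<n}. e i) = \<one> \<and>
    (\<forall>i<n. \<forall>x\<in>D. \<forall>y\<in>D. unit_at D (e i) (x \<oplus> y) \<longrightarrow> unit_at D (e i) x \<or> unit_at D (e i) y)"

text \<open>The idempotents are the preimages of the unit vectors. Components determine an element
  and may be prescribed at will, so every condition can be checked in the factors, where
  \<open>unit_at\<close> becomes membership in \<open>Units\<close>.\<close>

lemma (in cring) ex_local_idempotents_product:
  assumes loc: "\<And>S. S \<in> set Rs \<Longrightarrow> local_ring S" and iso: "R \<simeq> RDirProd_list Rs"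
  shows "\<exists>n e. local_idempotents n e (carrier R)"
proof -
  let ?Q = "RDirProd_list Rs"
  define n where "n = length Rs"
  obtain h where h: "h \<in> ring_iso R ?Q" using iso by (auto simp: is_ring_iso_def)
  note hE = ring_iso_memE[OF h]
  define p where "p i x = h x ! i" for i x
  have loci: "local_ring (Rs ! i)" if "i < n" for i using loc that n_def by simp
  have cr: "cring (Rs ! i)" if "i < n" for i using loci[OF that] by (simp add: local_ring_def)
  have pc: "p i x \<in> carrier (Rs ! i)" if "i < n" "x \<in> carrier R" for i x
    using RDirProd_list_carrier_mem(2)[OF hE(1)] that by (simp add: p_def n_def)
  have pm: "p i (x \<otimes> y) = p i x \<otimes>\<^bsub>Rs ! i\<^esub> p i y" and pa: "p i (x \<oplus> y) = p i x \<oplus>\<^bsub>Rs ! i\<^esub> p i y"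
    and p1: "p i \<one> = \<one>\<^bsub>Rs ! i\<^esub>"
    if "i < n" "x \<in> carrier R" "y \<in> carrier R" for i x y
    using that RDirProd_list_ops_nth[of "h x" Rs "h y" i] hE(1-4) by (simp_all add: p_def n_def)
  have inj: "x = y" if "x \<in> carrier R" "y \<in> carrier R" "\<And>i. i < n \<Longrightarrow> p i x = p i y" for x y
  proof -
    have "h x = h y"
      using that RDirProd_list_carrier_mem(1)[OF hE(1)]
      by (intro nth_equalityI) (auto simp: p_def n_def)
    thus ?thesis using hE(5) that(1,2) by (auto simp: bij_betw_def inj_on_def)
  qed
  have surj: "\<exists>x\<in>carrier R. \<forall>i<n. p i x = c i" if "\<And>i. i < n \<Longrightarrow> c i \<in> carrier (Rs ! i)" for c
  proof -
    have "map c [0..<n] \<in> carrier ?Q" by (rule RDirProd_list_carrier_memI) (use that n_def in auto)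
    hence "map c [0..<n] \<in> h ` carrier R" using hE(5) by (simp add: bij_betw_def)
    then obtain x where "x \<in> carrier R" "h x = map c [0..<n]" by (metis imageE)
    thus ?thesis by (intro bexI[of _ x]) (auto simp: p_def)
  qed
  have p0: "p i \<zero> = \<zero>\<^bsub>Rs ! i\<^esub>" if "i < n" for i
  proof -
    interpret S: cring "Rs ! i" using cr[OF that] .
    have "p i \<zero> \<oplus>\<^bsub>Rs ! i\<^esub> p i \<zero> = p i \<zero>" using pa[OF that, of \<zero> \<zero>] by simp
    thus ?thesis using pc[OF that] S.add.l_cancel_one' by (metis zero_closed)
  qed
  have "\<exists>x\<in>carrier R. \<forall>j<n. p j x = (if j = i then \<one>\<^bsub>Rs ! j\<^esub> else \<zero>\<^bsub>Rs ! j\<^esub>)" for i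
  proof (rule surj)
    fix j assume "j < n"
    then interpret S: cring "Rs ! j" using cr by simp
    show "(if j = i then \<one>\<^bsub>Rs ! j\<^esub> else \<zero>\<^bsub>Rs ! j\<^esub>) \<in> carrier (Rs ! j)"
      using S.one_closed S.zero_closed by (cases "j = i") simp_all
  qed
  then obtain e where e: "\<And>i. e i \<in> carrier R"
    "\<And>i j. j < n \<Longrightarrow> p j (e i) = (if j = i then \<one>\<^bsub>Rs ! j\<^esub> else \<zero>\<^bsub>Rs ! j\<^esub>)" by metis
  have prod: "p j (x \<otimes> e i) = (if j = i then p j x else \<zero>\<^bsub>Rs ! j\<^esub>)" if "j < n" "x \<in> carrier R" for i j x
  proof -
    interpret S: cring "Rs ! j" using cr[OF that(1)] .
    show ?thesis using pm[OF that e(1), of i] e(2)[OF that(1), of i] S.r_one[OF pc[OF that]] S.r_null[OF pc[OF that]]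
      by (cases "j = i") simp_all
  qed
  have psum: "(\<Oplus>i\<in>{..<m}. e i) \<in> carrier R \<and>
      (\<forall>j<n. p j (\<Oplus>i\<in>{..<m}. e i) = (if j < m then \<one>\<^bsub>Rs ! j\<^esub> else \<zero>\<^bsub>Rs ! j\<^esub>))" for m
  proof (induction m)
    case (Suc m)
    have "(\<Oplus>i\<in>{..<Suc m}. e i) = e m \<oplus> (\<Oplus>i\<in>{..<m}. e i)"
      unfolding lessThan_Suc using e(1) by (intro finsum_insert) auto
    moreover have "p j (e m \<oplus> (\<Oplus>i\<in>{..<m}. e i)) = (if j < Suc m then \<one>\<^bsub>Rs ! j\<^esub> else \<zero>\<^bsub>Rs ! j\<^esub>)" if "j < n" for j
    proof -
      interpret S: cring "Rs ! j" using cr[OF that] .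
      show ?thesis using pa[OF that e(1)] Suc e(2)[OF that, of m] that by simp
    qed
    ultimately show ?case using Suc e(1) by simp
  qed (use p0 in simp)
  have ua: "unit_at (carrier R) (e i) x \<longleftrightarrow> p i x \<in> Units (Rs ! i)" if i: "i < n" and x: "x \<in> carrier R" for i x
  proof
    interpret S: cring "Rs ! i" using cr[OF i] .
    assume "unit_at (carrier R) (e i) x"
    then obtain y where y: "y \<in> carrier R" "x \<otimes> y \<otimes> e i = e i" unfolding unit_at_def by blast
    have "p i (x \<otimes> y \<otimes> e i) = p i x \<otimes>\<^bsub>Rs ! i\<^esub> p i y" using prod[OF i, of "x \<otimes> y" i] pm[OF i x y(1)] x y(1) by simp
    hence "p i x \<otimes>\<^bsub>Rs ! i\<^esub> p i y = \<one>\<^bsub>Rs ! i\<^esub>" using y(2) e(2)[OF i, of i] by simp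
    moreover from this have "p i y \<otimes>\<^bsub>Rs ! i\<^esub> p i x = \<one>\<^bsub>Rs ! i\<^esub>"
      using S.m_comm[OF pc[OF i x] pc[OF i y(1)]] by simp
    ultimately show "p i x \<in> Units (Rs ! i)" using pc[OF i x] pc[OF i y(1)] unfolding Units_def by blast
  next
    interpret S: cring "Rs ! i" using cr[OF i] .
    assume "p i x \<in> Units (Rs ! i)"
    then obtain c where c: "c \<in> carrier (Rs ! i)" "p i x \<otimes>\<^bsub>Rs ! i\<^esub> c = \<one>\<^bsub>Rs ! i\<^esub>" unfolding Units_def by blast
    have "\<exists>y\<in>carrier R. \<forall>j<n. p j y = (if j = i then c else \<zero>\<^bsub>Rs ! j\<^esub>)"
    proof (rule surj)
      fix j assume "j < n"
      then interpret S': cring "Rs ! j" using cr by simp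
      show "(if j = i then c else \<zero>\<^bsub>Rs ! j\<^esub>) \<in> carrier (Rs ! j)" using c by simp
    qed
    then obtain y where y: "y \<in> carrier R" "p i y = c" using i by auto
    have "p j (x \<otimes> y \<otimes> e i) = p j (e i)" if "j < n" for j
      using prod[OF that, of "x \<otimes> y" i] pm[OF that x y(1)] x y c e(2)[OF that, of i] by auto
    hence "x \<otimes> y \<otimes> e i = e i" using x y(1) e(1) by (intro inj) auto
    thus "unit_at (carrier R) (e i) x" unfolding unit_at_def using y(1) by blast
  qed
  have "local_idempotents n e (carrier R)"
    unfolding local_idempotents_def
  proof (intro conjI allI impI ballI)
    fix i assume i: "i < n"
    show "e i \<in> carrier R" by (rule e(1))
    show "e i \<noteq> \<zero>" using local_ring_one_not_zero[OF loci[OF i]] e(2)[OF i, of i] p0[OF i] by auto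
    show "e i \<otimes> e i = e i" by (rule inj) (use e prod in auto)
    show "e i \<otimes> e j = \<zero>" if "j < n" "i \<noteq> j" for j by (rule inj) (use e prod p0 that in auto)
    fix x y assume xy: "x \<in> carrier R" "y \<in> carrier R" "unit_at (carrier R) (e i) (x \<oplus> y)"
    thus "unit_at (carrier R) (e i) x \<or> unit_at (carrier R) (e i) y"
      using local_ring_add_Units[OF loci[OF i] pc[OF i] pc[OF i]] ua[OF i] pa[OF i] by simp
  next
    show "(\<Oplus>i\<in>{..<n}. e i) = \<one>" using psum[of n] p1 by (intro inj) auto
  qed
  thus ?thesis by blast
qed

section \<open>Passing between a ring and the rings on its subrings\<close>

lemma (in cring) finsum_carrier_update:
  assumes "subcring D R" "finite S" "\<And>i. i \<in> S \<Longrightarrow> h i \<in> D"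
  shows "finsum (R\<lparr>carrier := D\<rparr>) h S = finsum R h S"
  using assms(2,3)
proof (induction S)
  case empty
  interpret D: cring "R\<lparr>carrier := D\<rparr>"
    using assms(1) subcring_iff subcringE(1) by blast
  show ?case using D.finsum_empty by simp
next
  case (insert x S)
  interpret D: cring "R\<lparr>carrier := D\<rparr>"
    using assms(1) subcring_iff subcringE(1) by blast
  have "h x \<in> carrier R" "h \<in> S \<rightarrow> carrier R" using insert subcringE(1)[OF assms(1)] by auto
  moreover have "finsum (R\<lparr>carrier := D\<rparr>) h (insert x S) = h x \<oplus> finsum (R\<lparr>carrier := D\<rparr>) h S"
    using insert by (subst D.finsum_insert) auto
  ultimately show ?case using insert by simp
qed

lemma ideal_prod_carrier_update: "ideal_prod (R\<lparr>carrier := D\<rparr>) I J = ideal_prod R I J"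
proof
  show "ideal_prod (R\<lparr>carrier := D\<rparr>) I J \<subseteq> ideal_prod R I J"
    by (rule ideal_prod_subset) (auto intro: ideal_prod.intros)
  have "x \<in> ideal_prod (R\<lparr>carrier := D\<rparr>) I J" if "x \<in> ideal_prod R I J" for x
    using that
  proof (induction rule: ideal_prod.induct)
    case (prod i j) thus ?case using ideal_prod.prod[of i I j J "R\<lparr>carrier := D\<rparr>"] by simp
  next
    case (sum s t) thus ?case using ideal_prod.sum[of s "R\<lparr>carrier := D\<rparr>" I J t] by simp
  qed
  thus "ideal_prod R I J \<subseteq> ideal_prod (R\<lparr>carrier := D\<rparr>) I J" by blast
qed

lemma (in cring) span_eq_finsum:
  assumes A: "subcring A R" and S: "finite S" "S \<subseteq> carrier R" and x: "x \<in> ideal_prod R A S"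
  shows "\<exists>f\<in>S \<rightarrow> A. x = (\<Oplus>s\<in>S. f s \<otimes> s)"
  using x
proof (induction rule: ideal_prod.induct)
  case (prod a s)
  have a: "a \<in> carrier R" "s \<in> carrier R" using prod S subcringE(1)[OF A] by auto
  have "(\<Oplus>t\<in>S. (if t = s then a else \<zero>) \<otimes> t) = (\<Oplus>t\<in>{s}. (if t = s then a else \<zero>) \<otimes> t)"
    by (rule add.finprod_mono_neutral_cong_right) (use S prod a in auto)
  also have "\<dots> = a \<otimes> s" using a by (simp add: finsum_insert)
  finally show ?case
    by (intro bexI[of _ "\<lambda>t. if t = s then a else \<zero>"]) (use prod subcringE(2)[OF A] in auto)
next
  case (sum y z)
  then obtain f g where fg: "f \<in> S \<rightarrow> A" "g \<in> S \<rightarrow> A" "y = (\<Oplus>s\<in>S. f s \<otimes> s)" "z = (\<Oplus>s\<in>S. g s \<otimes> s)"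
    by blast
  have c: "f s \<in> carrier R" "g s \<in> carrier R" "s \<in> carrier R" if "s \<in> S" for s
    using fg(1,2) that subcringE(1)[OF A] S(2) by auto
  have "(\<Oplus>s\<in>S. (f s \<oplus> g s) \<otimes> s) = (\<Oplus>s\<in>S. f s \<otimes> s \<oplus> g s \<otimes> s)"
    by (rule finsum_cong') (use c in \<open>auto simp: l_distr\<close>)
  also have "\<dots> = y \<oplus> z" unfolding fg(3,4) by (rule finsum_addf) (use c in auto)
  finally show ?case
    by (intro bexI[of _ "\<lambda>s. f s \<oplus> g s"]) (use fg(1,2) subcringE(7)[OF A] in auto)
qed

text \<open>The inclusion makes \<open>D\<close> a finite algebra over \<open>A\<close>, to which
  the Hensel property applies; the idempotents found in the ring on \<open>D\<close> are then read
  in \<open>R\<close>.\<close>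

lemma (in cring) ex_local_idempotents:
  assumes A: "subcring A R" and hensel: "hensel_local_ring (R\<lparr>carrier := A\<rparr>)"
    and D: "subcring D R" "A \<subseteq> D" "fin_over A D"
  shows "\<exists>n e. local_idempotents n e D"
proof -
  let ?RA = "R\<lparr>carrier := A\<rparr>" and ?RD = "R\<lparr>carrier := D\<rparr>"
  interpret RD: cring ?RD using D(1) subcring_iff subcringE(1) by blast
  obtain S where S: "finite S" "S \<subseteq> carrier R" "D = ideal_prod R A S"
    using D(3) unfolding fin_over_def by blast
  have "\<one> \<otimes> s \<in> ideal_prod R A S" if "s \<in> S" for s
    using that subcringE(3)[OF A] by (intro ideal_prod.prod)
  hence SD: "S \<subseteq> D" using S(2,3) by fastforce
  have AD: "subcring A ?RD" using subcring_carrier_update_iff[OF D(1,2)] A by simp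
  have "finite_algebra ?RA ?RD id"
    unfolding finite_algebra_def
  proof (intro conjI exI[of _ S] ballI)
    show "cring ?RD" by (rule RD.is_cring)
    show "id \<in> ring_hom ?RA ?RD" using D(2) by (intro ring_hom_memI) auto
    show "S \<subseteq> carrier ?RD" using SD by simp
    fix c assume "c \<in> carrier ?RD"
    hence "c \<in> ideal_prod ?RD A S" using S(3) by (simp add: ideal_prod_carrier_update)
    thus "\<exists>f\<in>S \<rightarrow> carrier ?RA. c = (\<Oplus>\<^bsub>?RD\<^esub>s\<in>S. id (f s) \<otimes>\<^bsub>?RD\<^esub> s)"
      using RD.span_eq_finsum[OF AD S(1)] SD by simp
  qed (use S in simp)
  moreover have "cring ?RA" using A subcring_iff subcringE(1) by blast
  ultimately obtain Rs :: "'a list ring list" where "\<forall>S\<in>set Rs. local_ring S" "?RD \<simeq> RDirProd_list Rs"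
    using hensel_local_ring_algebra[OF _ hensel, of ?RD id] by blast
  then obtain n e where ne: "RD.local_idempotents n e D"
    using RD.ex_local_idempotents_product[of Rs] by auto
  have ua: "RD.unit_at D = unit_at D"
    by (intro ext) (simp add: RD.unit_at_def unit_at_def)
  have "finsum ?RD e {..<n} = finsum R e {..<n}"
    by (rule finsum_carrier_update[OF D(1)]) (use ne in \<open>auto simp: RD.local_idempotents_def\<close>)
  hence "local_idempotents n e D"
    using ne unfolding RD.local_idempotents_def local_idempotents_def ua by simp
  thus ?thesis by blast
qed

section \<open>Invertible modules modulo a prime ideal\<close>

definition (in cring) cong_mod :: "'a set \<Rightarrow> 'a \<Rightarrow> 'a \<Rightarrow> bool"
  where "cong_mod q x y \<longleftrightarrow> x \<ominus> y \<in> q"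

context cring
begin

context
  fixes D q assumes D: "subcring D R" and q: "ideal_in q D"
begin

lemma cong_mod_carrier: "x \<in> D \<Longrightarrow> x \<in> carrier R"
  using subcringE(1)[OF D] by blast

lemma cong_mod_refl: "x \<in> D \<Longrightarrow> cong_mod q x x"
  using cong_mod_carrier[of x] ideal_inD(2)[OF q] by (simp add: cong_mod_def a_minus_def r_neg)

lemma cong_mod_sym: "\<lbrakk>x \<in> D; y \<in> D; cong_mod q x y\<rbrakk> \<Longrightarrow> cong_mod q y x"
proof -
  assume a: "x \<in> D" "y \<in> D" "cong_mod q x y"
  have "y \<ominus> x = \<ominus> (x \<ominus> y)" if "x \<in> carrier R" "y \<in> carrier R" using that by algebra
  thus ?thesis using a cong_mod_carrier ideal_in_minus(1)[OF D q] by (simp add: cong_mod_def)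
qed

lemma cong_mod_trans: "\<lbrakk>x \<in> D; y \<in> D; z \<in> D; cong_mod q x y; cong_mod q y z\<rbrakk> \<Longrightarrow> cong_mod q x z"
proof -
  assume a: "x \<in> D" "y \<in> D" "z \<in> D" "cong_mod q x y" "cong_mod q y z"
  have "x \<ominus> z = (x \<ominus> y) \<oplus> (y \<ominus> z)" if "x \<in> carrier R" "y \<in> carrier R" "z \<in> carrier R" using that by algebra
  thus ?thesis using a cong_mod_carrier ideal_inD(3)[OF q] by (simp add: cong_mod_def)
qed

lemma cong_mod_add: "\<lbrakk>x \<in> D; y \<in> D; x' \<in> D; y' \<in> D; cong_mod q x y; cong_mod q x' y'\<rbrakk> \<Longrightarrow> cong_mod q (x \<oplus> x') (y \<oplus> y')"
proof -
  assume a: "x \<in> D" "y \<in> D" "x' \<in> D" "y' \<in> D" "cong_mod q x y" "cong_mod q x' y'"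
  have "(x \<oplus> x') \<ominus> (y \<oplus> y') = (x \<ominus> y) \<oplus> (x' \<ominus> y')"
    if "x \<in> carrier R" "y \<in> carrier R" "x' \<in> carrier R" "y' \<in> carrier R" using that by algebra
  thus ?thesis using a cong_mod_carrier ideal_inD(3)[OF q] by (simp add: cong_mod_def)
qed

lemma cong_mod_mult: "\<lbrakk>x \<in> D; y \<in> D; x' \<in> D; y' \<in> D; cong_mod q x y; cong_mod q x' y'\<rbrakk> \<Longrightarrow> cong_mod q (x \<otimes> x') (y \<otimes> y')"
proof -
  assume a: "x \<in> D" "y \<in> D" "x' \<in> D" "y' \<in> D" "cong_mod q x y" "cong_mod q x' y'"
  have e: "(x \<otimes> x') \<ominus> (y \<otimes> y') = x' \<otimes> (x \<ominus> y) \<oplus> y \<otimes> (x' \<ominus> y')"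
    if "x \<in> carrier R" "y \<in> carrier R" "x' \<in> carrier R" "y' \<in> carrier R" using that by algebra
  have "x' \<otimes> (x \<ominus> y) \<in> q" "y \<otimes> (x' \<ominus> y') \<in> q" using a ideal_inD(4)[OF q] by (simp_all add: cong_mod_def)
  thus ?thesis using e a cong_mod_carrier ideal_inD(3)[OF q] by (simp add: cong_mod_def)
qed

lemma cong_mod_mem: "\<lbrakk>x \<in> D; y \<in> D; cong_mod q x y\<rbrakk> \<Longrightarrow> x \<in> q \<longleftrightarrow> y \<in> q"
proof -
  assume a: "x \<in> D" "y \<in> D" "cong_mod q x y"
  have 1: "x = (x \<ominus> y) \<oplus> y" and 2: "y = x \<ominus> (x \<ominus> y)"
    if "x \<in> carrier R" "y \<in> carrier R" using that by algebra+
  show ?thesis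
    using 1 2 a cong_mod_carrier ideal_inD(3)[OF q] ideal_in_minus(2)[OF D q]
    unfolding cong_mod_def by metis
qed

lemma laurent_ideal_in: "cring.ideal_in (laurent R) {f \<in> laurent_sub D R. \<forall>n. f n \<in> q} (laurent_sub D R)"
proof -
  interpret L: cring "laurent R" by (rule laurent_cring)
  note DL = laurent_sub_subcring[OF D]
  note Dc = subcringE(1)[OF D]
  show ?thesis
    unfolding L.ideal_in_def
  proof (intro conjI ballI)
    show "\<zero>\<^bsub>laurent R\<^esub> \<in> {f \<in> laurent_sub D R. \<forall>n. f n \<in> q}"
      using subcringE(2)[OF DL] ideal_inD(2)[OF q] by (simp add: laurent_zero_coeff)
    fix x y assume x: "x \<in> {f \<in> laurent_sub D R. \<forall>n. f n \<in> q}"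
    show "x \<oplus>\<^bsub>laurent R\<^esub> y \<in> {f \<in> laurent_sub D R. \<forall>n. f n \<in> q}" if y: "y \<in> {f \<in> laurent_sub D R. \<forall>n. f n \<in> q}"
      using subcringE(7)[OF DL, of x y] x y ideal_inD(3)[OF q] by (simp add: laurent_add_coeff)
    show "y \<otimes>\<^bsub>laurent R\<^esub> x \<in> {f \<in> laurent_sub D R. \<forall>n. f n \<in> q}" if y: "y \<in> laurent_sub D R"
    proof -
      have "(y \<otimes>\<^bsub>laurent R\<^esub> x) n \<in> q" for n
      proof -
        have "(y \<otimes>\<^bsub>laurent R\<^esub> x) n \<ominus> y 0 \<otimes> x (n - 0) \<in> q"
          by (rule laurent_mult_mod[OF D q y]) (use x in auto)
        moreover have "y 0 \<otimes> x n \<in> q"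
          using ideal_inD(4)[OF q] y x by (simp add: laurent_sub_iff[OF Dc])
        moreover have "(y \<otimes>\<^bsub>laurent R\<^esub> x) n \<in> D"
          using subcringE(6)[OF DL y] x by (simp add: laurent_sub_iff[OF Dc])
        ultimately show ?thesis
          using cong_mod_mem[of "(y \<otimes>\<^bsub>laurent R\<^esub> x) n" "y 0 \<otimes> x n"] ideal_inD(1)[OF q]
          by (auto simp: cong_mod_def)
      qed
      thus ?thesis using subcringE(6)[OF DL y] x by simp
    qed
  qed auto
qed

lemma laurent_eval_mod:
  assumes "f \<in> laurent_sub D R" "\<And>i. i \<noteq> a \<Longrightarrow> f i \<in> q"
  shows "cong_mod q (laurent_eval R f) (f a)"
proof -
  note Dc = subcringE(1)[OF D]
  have f: "f \<in> carrier (laurent R)" "\<And>i. f i \<in> D" using assms(1) laurent_sub_iff[OF Dc] by auto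
  define S where "S = {i. f i \<noteq> \<zero>} - {a}"
  have S: "finite S" "a \<notin> S" using laurent_finite_support[OF f(1)] by (auto simp: S_def)
  have s: "(\<Oplus>i\<in>S. f i) \<in> q"
    by (rule finsum_in_set[OF S(1)]) (use ideal_inD[OF q] Dc assms(2) S_def in auto)
  have "laurent_eval R f = (\<Oplus>i\<in>insert a S. f i)"
    by (rule laurent_eval_window[OF f(1)]) (use S in \<open>auto simp: S_def\<close>)
  also have "\<dots> = f a \<oplus> (\<Oplus>i\<in>S. f i)"
    by (rule finsum_insert[OF S]) (use f Dc in auto)
  finally have "laurent_eval R f = f a \<oplus> (\<Oplus>i\<in>S. f i)" .
  moreover have "f a \<in> carrier R" "(\<Oplus>i\<in>S. f i) \<in> carrier R"
    using s ideal_inD(1)[OF q] Dc f(2)[of a] by blast+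
  ultimately show ?thesis using s by (simp add: cong_mod_def add_minus_cancel_left)
qed

end

text \<open>Over the domain \<open>D/q\<close> the highest coefficients of \<open>f\<close> and
  \<open>w\<close> multiply to a nonzero coefficient of \<open>f w\<close>, and so do the lowest
  ones. As \<open>f w\<close> is a nonzero constant there, both sums of degrees vanish, so highest
  and lowest degrees agree.\<close>

lemma monomial_mod_prime:
  assumes D: "subcring D R" and q: "prime_in q D"
    and f: "f \<in> laurent_sub D R" and w: "w \<in> laurent_sub D R"
    and fw: "(f \<otimes>\<^bsub>laurent R\<^esub> w) 0 \<notin> q" "\<And>k. k \<noteq> 0 \<Longrightarrow> (f \<otimes>\<^bsub>laurent R\<^esub> w) k \<in> q"
  shows "\<exists>a. f a \<notin> q \<and> w (- a) \<notin> q \<and> (\<forall>i. i \<noteq> a \<longrightarrow> f i \<in> q) \<and> (\<forall>i. i \<noteq> - a \<longrightarrow> w i \<in> q)"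
proof -
  note Dc = subcringE(1)[OF D] and qi = prime_inD(1)[OF q]
  have c: "f i \<in> D" "w i \<in> D" "f \<in> carrier (laurent R)" "w \<in> carrier (laurent R)" for i
    using f w laurent_sub_iff[OF Dc] by auto
  have fwD: "(f \<otimes>\<^bsub>laurent R\<^esub> w) n \<in> D" for n
    using subcringE(6)[OF laurent_sub_subcring[OF D] f w] laurent_sub_iff[OF Dc] by blast
  have cg: "f a \<otimes> w b \<in> q \<longleftrightarrow> (f \<otimes>\<^bsub>laurent R\<^esub> w) (a + b) \<in> q"
    if "\<And>i. i \<noteq> a \<Longrightarrow> f i \<in> q \<or> w (a + b - i) \<in> q" for a b
  proof -
    have "cong_mod q ((f \<otimes>\<^bsub>laurent R\<^esub> w) (a + b)) (f a \<otimes> w (a + b - a))"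
      unfolding cong_mod_def by (rule laurent_mult_mod[OF D qi f w that])
    thus ?thesis using cong_mod_mem[OF D qi fwD subcringE(6)[OF D c(1,2)], of "a + b" a b] by simp
  qed
  define F where "F = {i. f i \<notin> q}"
  define W where "W = {i. w i \<notin> q}"
  have "F \<subseteq> {i. f i \<noteq> \<zero>}" "W \<subseteq> {i. w i \<noteq> \<zero>}" using ideal_inD(2)[OF qi] by (auto simp: F_def W_def)
  hence fin: "finite F" "finite W"
    using laurent_finite_support c finite_subset by blast+
  have ne: "F \<noteq> {}" "W \<noteq> {}"
  proof -
    show "F \<noteq> {}"
    proof
      assume "F = {}"
      hence "f i \<in> q" for i by (auto simp: F_def)
      thus False using cg[of 0 0] fw(1) ideal_in_multr[OF D qi c(2)] by auto
    qed
    show "W \<noteq> {}"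
    proof
      assume "W = {}"
      hence "w i \<in> q" for i by (auto simp: W_def)
      thus False using cg[of 0 0] fw(1) ideal_inD(4)[OF qi c(1)] by auto
    qed
  qed
  have "Max F + Max W = 0"
  proof -
    have "f i \<in> q \<or> w (Max F + Max W - i) \<in> q" if "i \<noteq> Max F" for i
    proof (rule ccontr)
      assume "\<not> ?thesis"
      hence "i \<in> F" "Max F + Max W - i \<in> W" by (auto simp: F_def W_def)
      hence "i \<le> Max F" "Max F + Max W - i \<le> Max W" using fin Max_ge by blast+
      thus False using that by simp
    qed
    moreover have "f (Max F) \<notin> q" "w (Max W) \<notin> q" using Max_in fin ne by (auto simp: F_def W_def)
    hence "f (Max F) \<otimes> w (Max W) \<notin> q" using prime_inD(3)[OF q c(1,2)] by blast
    ultimately have "(f \<otimes>\<^bsub>laurent R\<^esub> w) (Max F + Max W) \<notin> q" using cg by blast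
    thus ?thesis using fw(2) by blast
  qed
  moreover have "Min F + Min W = 0"
  proof -
    have "f i \<in> q \<or> w (Min F + Min W - i) \<in> q" if "i \<noteq> Min F" for i
    proof (rule ccontr)
      assume "\<not> ?thesis"
      hence "i \<in> F" "Min F + Min W - i \<in> W" by (auto simp: F_def W_def)
      hence "Min F \<le> i" "Min W \<le> Min F + Min W - i" using fin Min_le by blast+
      thus False using that by simp
    qed
    moreover have "f (Min F) \<notin> q" "w (Min W) \<notin> q" using Min_in fin ne by (auto simp: F_def W_def)
    hence "f (Min F) \<otimes> w (Min W) \<notin> q" using prime_inD(3)[OF q c(1,2)] by blast
    ultimately have "(f \<otimes>\<^bsub>laurent R\<^esub> w) (Min F + Min W) \<notin> q" using cg by blast
    thus ?thesis using fw(2) by blast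
  qed
  moreover have "Min F \<le> Max F" "Min W \<le> Max W" using fin ne Max_ge Min_in by blast+
  ultimately have eq: "Min F = Max F" "Min W = - Max F" "Max W = - Max F" by linarith+
  have "i \<in> F \<Longrightarrow> i = Max F" "i \<in> W \<Longrightarrow> i = - Max F" for i
    using eq Max_ge[OF fin(1), of i] Min_le[OF fin(1), of i] Max_ge[OF fin(2), of i] Min_le[OF fin(2), of i]
    by linarith+
  moreover have "Max F \<in> F" by (rule Max_in[OF fin(1) ne(1)])
  moreover have "- Max F \<in> W" unfolding eq(3)[symmetric] by (rule Max_in[OF fin(2) ne(2)])
  ultimately have "f i \<notin> q \<longleftrightarrow> i = Max F" "w i \<notin> q \<longleftrightarrow> i = - Max F" for i
    unfolding F_def W_def by blast+
  thus ?thesis by blast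
qed

section \<open>Identities for division with remainder, to be used in \<open>R\<close> and in
  \<open>laurent R\<close>\<close>

lemma minus_add_cancel_right: "\<lbrakk>u \<in> carrier R; v \<in> carrier R\<rbrakk> \<Longrightarrow> (u \<ominus> v) \<oplus> v = u"
  by algebra

lemma division_step_identity:
  "\<lbrakk>T \<in> carrier R; c \<in> carrier R; g \<in> carrier R; h0 \<in> carrier R; h \<in> carrier R; f \<in> carrier R\<rbrakk> \<Longrightarrow>
    T \<otimes> (c \<otimes> g) \<ominus> (T \<otimes> h0 \<oplus> h) \<otimes> f = T \<otimes> (c \<otimes> g \<ominus> h0 \<otimes> f) \<ominus> h \<otimes> f"
  by algebra

text \<open>This cross-multiplies congruences of \<open>c2\<close> with \<open>x \<otimes> z\<close>
  and of \<open>c1\<close> with \<open>y \<otimes> z\<close>: if both differences on the left lie in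
  a prime that does not contain \<open>z\<close>, then the prime contains
  \<open>c1 \<otimes> x \<ominus> c2 \<otimes> y\<close>.\<close>

lemma leading_coeff_identity:
  "\<lbrakk>c1 \<in> carrier R; c2 \<in> carrier R; x \<in> carrier R; y \<in> carrier R; z \<in> carrier R\<rbrakk> \<Longrightarrow>
    (c2 \<otimes> c1 \<ominus> c2 \<otimes> (y \<otimes> z)) \<ominus> (c1 \<otimes> c2 \<ominus> c1 \<otimes> (x \<otimes> z)) = (c1 \<otimes> x \<ominus> c2 \<otimes> y) \<otimes> z"
  by algebra

lemma minus_mult_identity1:
  "\<lbrakk>x \<in> carrier R; t \<in> carrier R; g \<in> carrier R; h \<in> carrier R; f \<in> carrier R\<rbrakk> \<Longrightarrow>
    x \<otimes> (t \<otimes> g \<ominus> h \<otimes> f) = t \<otimes> (x \<otimes> g) \<ominus> (x \<otimes> h) \<otimes> f"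
  by algebra

lemma minus_mult_identity2:
  "\<lbrakk>x \<in> carrier R; t \<in> carrier R; g \<in> carrier R; h \<in> carrier R; f \<in> carrier R\<rbrakk> \<Longrightarrow>
    x \<otimes> (t \<otimes> g \<ominus> h \<otimes> f) = t \<otimes> (g \<otimes> x) \<ominus> f \<otimes> (h \<otimes> x)"
  by algebra

lemma minus_add_identity:
  "\<lbrakk>s \<in> carrier R; t \<in> carrier R; y \<in> carrier R; z \<in> carrier R; v \<in> carrier R; w \<in> carrier R; f \<in> carrier R\<rbrakk> \<Longrightarrow>
    t \<otimes> (s \<otimes> y \<ominus> f \<otimes> v) \<oplus> s \<otimes> (t \<otimes> z \<ominus> f \<otimes> w) = (s \<otimes> t) \<otimes> (y \<oplus> z) \<ominus> f \<otimes> (t \<otimes> v \<oplus> s \<otimes> w)"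
  by algebra

text \<open>
  Over the fraction field \<open>K\<close> of \<open>A\<close> modulo \<open>q\<close>, an element of \<open>J\<close> of least width generates \<open>J\<close>
  by division with remainder (the quotients of leading coefficients lie in \<open>K\<close> because \<open>J J'\<close> is
  \<open>A[X, X\<^sup>-\<^sup>1]\<close>), hence is a monomial, and evaluation at \<open>X = 1\<close> puts its coefficient into \<open>K\<close>.
\<close>

lemma ex_const_mod_prime:
  assumes A: "subcring A R" and D: "subcring D R" "A \<subseteq> D" and q: "prime_in q D"
    and J: "subalgebra (laurent_sub A R) J (laurent R)" "J \<subseteq> laurent_sub D R"
    and J': "subalgebra (laurent_sub A R) J' (laurent R)" "J' \<subseteq> laurent_sub D R"
    and JJ': "ideal_prod (laurent R) J J' = laurent_sub A R"
    and x1: "x1 \<in> J" "laurent_eval R x1 = \<one>"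
  shows "\<exists>w\<in>J. \<exists>\<tau>\<in>A. \<tau> \<notin> q \<and> cong_mod q (w 0) \<tau> \<and> (\<forall>i. i \<noteq> 0 \<longrightarrow> w i \<in> q)"
proof -
  interpret L: cring "laurent R" by (rule laurent_cring)
  let ?L = "laurent R" and ?AL = "laurent_sub A R" and ?DL = "laurent_sub D R"
  define Q where "Q = {f \<in> ?DL. \<forall>n. f n \<in> q}"
  note Dc = subcringE(1)[OF D(1)] and Ac = subcringE(1)[OF A] and qi = prime_inD(1)[OF q]
  note AL = laurent_sub_subcring[OF A] and DL = laurent_sub_subcring[OF D(1)]
  have Q: "L.ideal_in Q ?DL" unfolding Q_def by (rule laurent_ideal_in[OF D(1) qi])
  note JD = L.submoduleD[OF AL J(1)] and J'D = L.submoduleD[OF AL J'(1)]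
  have AD: "?AL \<subseteq> ?DL" using D(2) laurent_sub_iff[OF Ac] laurent_sub_iff[OF Dc] by blast
  have cD: "f n \<in> D" if "f \<in> ?DL" for f n using that laurent_sub_iff[OF Dc] by blast
  have cA: "f n \<in> A" if "f \<in> ?AL" for f n using that laurent_sub_iff[OF Ac] by blast
  have DLc: "f \<in> carrier ?L" if "f \<in> ?DL" for f using that subcringE(1)[OF DL] by blast
  have Qi: "f \<in> Q \<longleftrightarrow> (\<forall>n. f n \<in> q)" if "f \<in> ?DL" for f using that by (simp add: Q_def)
  have prodA: "f \<otimes>\<^bsub>?L\<^esub> j \<in> ?AL" if "f \<in> J" "j \<in> J'" for f j
    using ideal_prod.prod[OF that, of ?L] JJ' by simp
  have one: "\<one>\<^bsub>?L\<^esub> \<notin> Q" using prime_inD(2)[OF q] by (auto simp: Q_def laurent_one_coeff intro: exI[of _ 0])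
  have nz: "\<exists>f\<in>J. \<exists>j\<in>J'. f \<notin> Q \<and> j \<notin> Q"
  proof (rule ccontr)
    assume *: "\<not> ?thesis"
    have "ideal_prod ?L J J' \<subseteq> Q"
    proof (rule ideal_prod_subset)
      fix f j assume fj: "f \<in> J" "j \<in> J'"
      hence "f \<in> Q \<or> j \<in> Q" using * by blast
      thus "f \<otimes>\<^bsub>?L\<^esub> j \<in> Q"
        using L.ideal_inD(4)[OF Q, of f j] L.ideal_in_multr[OF DL Q, of j f] fj J(2) J'(2) by blast
    qed (rule L.ideal_inD(3)[OF Q])
    thus False using one subcringE(3)[OF AL] JJ' by blast
  qed
  obtain j where j: "j \<in> J'" "j \<notin> Q" using nz by blast
  \<comment> \<open>The element \<open>j\<close> serves for measuring. Its degree modulo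
    \<open>q\<close> is \<open>b\<close>, and multiplying an element of \<open>J\<close> by
    \<open>j\<close> gives coefficients in \<open>A\<close>, the top one being congruent to the
    leading coefficient of that element times \<open>j b\<close>.\<close>
  define b where "b = Max {i. j i \<notin> q}"
  have "{i. j i \<notin> q} \<subseteq> {i. j i \<noteq> \<zero>}" using ideal_inD(2)[OF qi] by auto
  hence "finite {i. j i \<notin> q}" "{i. j i \<notin> q} \<noteq> {}"
    using laurent_finite_support[OF DLc] j J'(2) Qi finite_subset by blast+
  hence b: "j b \<notin> q" "\<And>i. i > b \<Longrightarrow> j i \<in> q"
    unfolding b_def using Max_in[of "{i. j i \<notin> q}"] Max_ge[of "{i. j i \<notin> q}"] by (blast, fastforce)
  \<comment> \<open>Modulo \<open>q\<close> the support lies between \<open>0\<close> and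
    \<open>m - 1\<close>, so \<open>m\<close> bounds the width. Powers of \<open>X\<close> are units
    over \<open>A\<close>, so elements of \<open>J\<close> may be shifted into this
    position.\<close>
  define bdd where "bdd m g \<longleftrightarrow> (\<forall>i. i < 0 \<or> i \<ge> int m \<longrightarrow> g i \<in> q)" for m and g :: "int \<Rightarrow> 'a"
  define Xp where "Xp k = laurent_monom R \<one> k" for k
  have XA: "Xp k \<in> ?AL" for k unfolding Xp_def by (rule laurent_monom_closed[OF A subcringE(3)[OF A]])
  have Xm: "(Xp k \<otimes>\<^bsub>?L\<^esub> g) n = g (n - k)" if "g \<in> carrier ?L" for k g n
    using laurent_monom_mult[OF one_closed that] laurent_coeff_closed[OF that] by (simp add: Xp_def)
  have XX: "Xp k \<otimes>\<^bsub>?L\<^esub> (Xp (- k) \<otimes>\<^bsub>?L\<^esub> g) = g" if "g \<in> carrier ?L" for k g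
  proof
    fix n
    have "Xp (- k) \<otimes>\<^bsub>?L\<^esub> g \<in> carrier ?L" using that XA subcringE(1)[OF AL] by auto
    thus "(Xp k \<otimes>\<^bsub>?L\<^esub> (Xp (- k) \<otimes>\<^bsub>?L\<^esub> g)) n = g n" using Xm that by simp
  qed
  have shift: "\<exists>k m. bdd m (Xp k \<otimes>\<^bsub>?L\<^esub> g)" if g: "g \<in> ?DL" for g
  proof -
    obtain a c where ac: "{i. g i \<noteq> \<zero>} \<subseteq> {a..<c}"
      using finite_int_bounds laurent_finite_support[OF DLc[OF g]] by blast
    have "g (i - (- a)) \<in> q" if "i < 0 \<or> i \<ge> int (nat (c - a))" for i
    proof (rule ccontr)
      assume "g (i - (- a)) \<notin> q"
      hence "g (i + a) \<noteq> \<zero>" using ideal_inD(2)[OF qi] by auto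
      hence "i + a \<in> {a..<c}" using ac by blast
      thus False using that by auto
    qed
    hence "bdd (nat (c - a)) (Xp (- a) \<otimes>\<^bsub>?L\<^esub> g)"
      using Xm[OF DLc[OF g]] by (simp add: bdd_def)
    thus ?thesis by blast
  qed
  have XJ: "Xp k \<otimes>\<^bsub>?L\<^esub> g \<in> J" if "g \<in> J" for k g using JD(4)[OF XA that] .
  define P where "P m \<longleftrightarrow> (\<exists>f\<in>J. f \<notin> Q \<and> bdd m f)" for m
  have "\<exists>m. P m"
  proof -
    obtain f where f: "f \<in> J" "f \<notin> Q" using nz by blast
    obtain k m where km: "bdd m (Xp k \<otimes>\<^bsub>?L\<^esub> f)" using shift f(1) J(2) by blast
    obtain i where i: "f i \<notin> q" using f Qi J(2) by blast
    have "(Xp k \<otimes>\<^bsub>?L\<^esub> f) (i + k) \<notin> q" using Xm[OF DLc] f(1) J(2) i by auto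
    hence "Xp k \<otimes>\<^bsub>?L\<^esub> f \<notin> Q" by (auto simp: Q_def)
    thus ?thesis using km XJ[OF f(1)] by (auto simp: P_def)
  qed
  define n where "n = (LEAST m. P m)"
  have n: "P n" "\<And>m. m < n \<Longrightarrow> \<not> P m" unfolding n_def using \<open>\<exists>m. P m\<close> LeastI_ex not_less_Least by blast+
  obtain f where f: "f \<in> J" "f \<notin> Q" "bdd n f" using n(1) by (auto simp: P_def)
  have fD: "f \<in> ?DL" using f(1) J(2) by blast
  have n0: "n > 0"
  proof (rule ccontr)
    assume "\<not> n > 0"
    hence "f i \<in> q" for i using f(3) by (auto simp: bdd_def)
    thus False using f(2) Qi[OF fD] by blast
  qed
  have fn: "f (int n - 1) \<notin> q"
  proof
    assume "f (int n - 1) \<in> q"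
    have "f i \<in> q" if "i < 0 \<or> i \<ge> int (n - 1)" for i
      using f(3) that \<open>f (int n - 1) \<in> q\<close> n0 by (cases "i = int n - 1") (auto simp: bdd_def)
    hence "P (n - 1)" using f by (auto simp: P_def bdd_def)
    thus False using n(2)[of "n - 1"] n0 by simp
  qed
  have lead: "(g \<otimes>\<^bsub>?L\<^esub> j) (int m - 1 + b) \<in> A \<and> cong_mod q ((g \<otimes>\<^bsub>?L\<^esub> j) (int m - 1 + b)) (g (int m - 1) \<otimes> j b)"
    if g: "g \<in> J" "bdd m g" for g m
  proof
    show "(g \<otimes>\<^bsub>?L\<^esub> j) (int m - 1 + b) \<in> A" by (rule cA[OF prodA[OF g(1) j(1)]])
    have "cong_mod q ((g \<otimes>\<^bsub>?L\<^esub> j) (int m - 1 + b)) (g (int m - 1) \<otimes> j (int m - 1 + b - (int m - 1)))"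
      unfolding cong_mod_def
    proof (rule laurent_mult_mod[OF D(1) qi])
      fix i assume "i \<noteq> int m - 1"
      hence "i \<ge> int m \<or> int m - 1 + b - i > b" by auto
      thus "g i \<in> q \<or> j (int m - 1 + b - i) \<in> q" using g(2) b(2) by (auto simp: bdd_def)
    qed (use g j J(2) J'(2) in auto)
    thus "cong_mod q ((g \<otimes>\<^bsub>?L\<^esub> j) (int m - 1 + b)) (g (int m - 1) \<otimes> j b)" by simp
  qed
  define c1 where "c1 = (f \<otimes>\<^bsub>?L\<^esub> j) (int n - 1 + b)"
  have jD: "j i \<in> D" for i using cD j(1) J'(2) by blast
  have c1: "c1 \<in> A" "c1 \<notin> q" "cong_mod q c1 (f (int n - 1) \<otimes> j b)"
  proof -
    show *: "c1 \<in> A" "cong_mod q c1 (f (int n - 1) \<otimes> j b)" using lead[OF f(1,3)] by (simp_all add: c1_def)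
    have "f (int n - 1) \<otimes> j b \<notin> q" using prime_inD(3)[OF q cD[OF fD] jD] fn b(1) by blast
    thus "c1 \<notin> q" using cong_mod_mem[OF D(1) qi _ _ *(2)] *(1) D(2) subcringE(6)[OF D(1) cD[OF fD] jD] by blast
  qed
  define Cc where "Cc a = laurent_monom R a 0" for a
  have CA: "Cc a \<in> ?AL" if "a \<in> A" for a unfolding Cc_def by (rule laurent_monom_closed[OF A that])
  have Cm: "(Cc a \<otimes>\<^bsub>?L\<^esub> g) i = a \<otimes> g i" if "a \<in> A" "g \<in> carrier ?L" for a g i
    using laurent_monom_mult[OF _ that(2), of a 0] that(1) Ac by (auto simp: Cc_def)
  have CC: "Cc a \<otimes>\<^bsub>?L\<^esub> Cc a' = Cc (a \<otimes> a')" if "a \<in> A" "a' \<in> A" for a a'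
  proof
    fix i
    have "Cc a' \<in> carrier ?L" using CA[OF that(2)] AD DLc by blast
    moreover have "a \<in> carrier R" using that Ac by blast
    ultimately show "(Cc a \<otimes>\<^bsub>?L\<^esub> Cc a') i = Cc (a \<otimes> a') i"
      using Cm[OF that(1)] by (simp add: Cc_def laurent_monom_def)
  qed
  \<comment> \<open>Modulo \<open>q\<close>, \<open>g\<close> is a multiple of \<open>f\<close> over
    the field of fractions of \<open>A\<close> modulo \<open>q\<close>; the denominator
    \<open>t\<close> has been cleared.\<close>
  define red where "red g \<longleftrightarrow> (\<exists>t\<in>A - q. \<exists>h\<in>?AL. Cc t \<otimes>\<^bsub>?L\<^esub> g \<ominus>\<^bsub>?L\<^esub> h \<otimes>\<^bsub>?L\<^esub> f \<in> Q)" for g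
  have ALc: "h \<in> carrier ?L" if "h \<in> ?AL" for h using that AD DLc by blast
  have Jc: "h \<in> carrier ?L" if "h \<in> J" for h using that JD(1) by blast
  have J'c: "h \<in> carrier ?L" if "h \<in> J'" for h using that J'D(1) by blast
  have Amult: "s \<otimes> t \<in> A - q" if "s \<in> A - q" "t \<in> A - q" for s t
    using that prime_inD(3)[OF q, of s t] D(2) subcringE(6)[OF A] by blast
  have red_bdd: "red g" if "g \<in> J" "bdd m g" for g m
    using that
  proof (induction m arbitrary: g)
    case less: 0
    hence "g i \<in> q" for i by (auto simp: bdd_def)
    hence "g \<in> Q" using Qi less(1) J(2) by blast
    moreover have "Cc \<one> \<otimes>\<^bsub>?L\<^esub> g \<ominus>\<^bsub>?L\<^esub> \<zero>\<^bsub>?L\<^esub> \<otimes>\<^bsub>?L\<^esub> f = g"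
    proof -
      have "Cc \<one> = \<one>\<^bsub>?L\<^esub>" by (auto simp: Cc_def laurent_monom_def laurent_one_coeff)
      thus ?thesis using Jc less(1) f(1) by (simp add: L.minus_eq)
    qed
    ultimately show ?case unfolding red_def using subcringE(3)[OF A] prime_inD(2)[OF q] subcringE(2)[OF AL]
      by (intro bexI[of _ \<one>] bexI[of _ "\<zero>\<^bsub>?L\<^esub>"]) auto
  next
    case (Suc m g)
    have gD: "g \<in> ?DL" using Suc.prems(1) J(2) by blast
    show ?case
    proof (cases "Suc m < n")
      case True
      \<comment> \<open>Anything narrower than the minimal width \<open>n\<close> vanishes modulo
        \<open>q\<close>, so the bound can simply be lowered to \<open>m\<close>.\<close>
      hence "g \<in> Q" using n(2)[of "Suc m"] Suc.prems by (auto simp: P_def)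
      hence "bdd m g" by (auto simp: bdd_def Q_def)
      thus ?thesis using Suc by blast
    next
      case False
      define c2 where "c2 = (g \<otimes>\<^bsub>?L\<^esub> j) (int (Suc m) - 1 + b)"
      have c2: "c2 \<in> A" "cong_mod q c2 (g (int m) \<otimes> j b)" using lead[OF Suc.prems] by (simp_all add: c2_def)
      define k where "k = int (Suc m) - int n"
      define h0 where "h0 = Cc c2 \<otimes>\<^bsub>?L\<^esub> Xp k"
      have h0: "h0 \<in> ?AL" unfolding h0_def using subcringE(6)[OF AL CA[OF c2(1)] XA] .
      \<comment> \<open>Modulo \<open>q\<close> the leading coefficients of \<open>g\<close> and
        \<open>f\<close> have the ratio of \<open>c2\<close> to \<open>c1\<close>, because
        \<open>c1\<close> and \<open>c2\<close> carry the same factor \<open>j b\<close>. So this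
        combination, with \<open>f\<close> shifted by \<open>k\<close>, loses its top term.\<close>
      define g' where "g' = Cc c1 \<otimes>\<^bsub>?L\<^esub> g \<ominus>\<^bsub>?L\<^esub> h0 \<otimes>\<^bsub>?L\<^esub> f"
      have g'J: "g' \<in> J" unfolding g'_def
        by (rule JD(5)[OF JD(4)[OF CA[OF c1(1)] Suc.prems(1)] JD(4)[OF h0 f(1)]])
      have c: "c1 \<in> D" "c2 \<in> D" "g i \<in> D" "f i \<in> D" for i using c1(1) c2(1) D(2) cD[OF gD] cD[OF fD] by auto
      have h0f: "(h0 \<otimes>\<^bsub>?L\<^esub> f) i = c2 \<otimes> f (i - k)" for i
        using Cm[OF c2(1), of "Xp k \<otimes>\<^bsub>?L\<^esub> f"] Xm[OF Jc[OF f(1)]] L.m_assoc[OF ALc[OF CA[OF c2(1)]] ALc[OF XA] Jc[OF f(1)]]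
          Jc[OF XJ[OF f(1)]] by (simp add: h0_def)
      have sum: "Cc c1 \<otimes>\<^bsub>?L\<^esub> g = g' \<oplus>\<^bsub>?L\<^esub> h0 \<otimes>\<^bsub>?L\<^esub> f"
        unfolding g'_def
        by (rule L.minus_add_cancel_right[symmetric]) (use JD(4)[OF CA[OF c1(1)] Suc.prems(1)] JD(4)[OF h0 f(1)] Jc in blast)+
      have g'i: "g' i = c1 \<otimes> g i \<ominus> c2 \<otimes> f (i - k)" for i
      proof -
        have "c1 \<otimes> g i = g' i \<oplus> c2 \<otimes> f (i - k)"
          using fun_cong[OF sum, of i] Cm[OF c1(1) Jc[OF Suc.prems(1)]] h0f by (simp add: laurent_add_coeff)
        moreover have "u = u \<oplus> v \<ominus> v" if "u \<in> carrier R" "v \<in> carrier R" for u v using that by algebra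
        moreover have "g' i \<in> carrier R" "c2 \<otimes> f (i - k) \<in> carrier R"
          using laurent_coeff_closed[OF Jc[OF g'J]] c(2) c(4)[of "i - k"] Dc by auto
        ultimately show ?thesis by metis
      qed
      have kk: "k \<ge> 0" using False by (simp add: k_def)
      have "bdd m g'"
        unfolding bdd_def
      proof (intro allI impI)
        fix i assume i: "i < 0 \<or> int m \<le> i"
        show "g' i \<in> q"
        proof (cases "i = int m")
          case False
          hence "g i \<in> q" "f (i - k) \<in> q"
            using i Suc.prems(2) f(3) kk by (auto simp: bdd_def k_def)
          hence "c1 \<otimes> g i \<in> q" "c2 \<otimes> f (i - k) \<in> q" using ideal_inD(4)[OF qi] c(1,2) by blast+
          thus ?thesis unfolding g'i using ideal_in_minus(2)[OF D(1) qi] by blast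
        next
          case True
          have ik: "i - k = int n - 1" using True by (simp add: k_def)
          have "cong_mod q (c1 \<otimes> c2) (c1 \<otimes> (g i \<otimes> j b))" "cong_mod q (c2 \<otimes> c1) (c2 \<otimes> (f (i - k) \<otimes> j b))"
            using c2(2) c1(3) c jD True ik subcringE(6)[OF D(1)] cong_mod_refl[OF D(1) qi]
            by (auto intro!: cong_mod_mult[OF D(1) qi])
          hence "c1 \<otimes> c2 \<ominus> c1 \<otimes> (g i \<otimes> j b) \<in> q" "c2 \<otimes> c1 \<ominus> c2 \<otimes> (f (i - k) \<otimes> j b) \<in> q"
            by (simp_all add: cong_mod_def)
          hence "(c2 \<otimes> c1 \<ominus> c2 \<otimes> (f (i - k) \<otimes> j b)) \<ominus> (c1 \<otimes> c2 \<ominus> c1 \<otimes> (g i \<otimes> j b)) \<in> q"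
            by (rule ideal_in_minus(2)[OF D(1) qi])
          moreover have "c1 \<in> carrier R" "c2 \<in> carrier R" "g i \<in> carrier R" "f (i - k) \<in> carrier R" "j b \<in> carrier R"
            using c jD Dc by blast+
          ultimately have "g' i \<otimes> j b \<in> q" unfolding g'i by (simp add: leading_coeff_identity)
          moreover have "g' i \<in> D" using cD g'J J(2) by blast
          ultimately show ?thesis using prime_inD(3)[OF q _ jD] b(1) by blast
        qed
      qed
      then obtain t h where th: "t \<in> A - q" "h \<in> ?AL" "Cc t \<otimes>\<^bsub>?L\<^esub> g' \<ominus>\<^bsub>?L\<^esub> h \<otimes>\<^bsub>?L\<^esub> f \<in> Q"
        using Suc.IH[OF g'J] unfolding red_def by blast
      have ct: "t \<otimes> c1 \<in> A - q" by (rule Amult) (use th(1) c1 in auto)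
      have hh: "Cc t \<otimes>\<^bsub>?L\<^esub> h0 \<oplus>\<^bsub>?L\<^esub> h \<in> ?AL"
        using subcringE(6,7)[OF AL] CA th h0 by simp
      have "Cc (t \<otimes> c1) \<otimes>\<^bsub>?L\<^esub> g \<ominus>\<^bsub>?L\<^esub> (Cc t \<otimes>\<^bsub>?L\<^esub> h0 \<oplus>\<^bsub>?L\<^esub> h) \<otimes>\<^bsub>?L\<^esub> f = Cc t \<otimes>\<^bsub>?L\<^esub> g' \<ominus>\<^bsub>?L\<^esub> h \<otimes>\<^bsub>?L\<^esub> f"
      proof -
        have cc: "Cc t \<in> carrier ?L" "Cc c1 \<in> carrier ?L" "g \<in> carrier ?L" "h0 \<in> carrier ?L" "h \<in> carrier ?L" "f \<in> carrier ?L"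
          using ALc CA th c1 h0 Jc Suc.prems(1) f(1) by auto
        have "Cc (t \<otimes> c1) \<otimes>\<^bsub>?L\<^esub> g = Cc t \<otimes>\<^bsub>?L\<^esub> (Cc c1 \<otimes>\<^bsub>?L\<^esub> g)"
          using CC[of t c1, symmetric] th(1) c1(1) L.m_assoc[OF cc(1-3)] by simp
        thus ?thesis using L.division_step_identity[OF cc] by (simp add: g'_def)
      qed
      hence "Cc (t \<otimes> c1) \<otimes>\<^bsub>?L\<^esub> g \<ominus>\<^bsub>?L\<^esub> (Cc t \<otimes>\<^bsub>?L\<^esub> h0 \<oplus>\<^bsub>?L\<^esub> h) \<otimes>\<^bsub>?L\<^esub> f \<in> Q" using th(3) by simp
      thus ?thesis unfolding red_def using ct hh by blast
    qed
  qed
  have QD: "x \<in> Q \<Longrightarrow> d \<in> ?DL \<Longrightarrow> d \<otimes>\<^bsub>?L\<^esub> x \<in> Q" for x d using L.ideal_inD(4)[OF Q] by blast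
  have red_all: "red g" if g: "g \<in> J" for g
  proof -
    obtain k m where "bdd m (Xp k \<otimes>\<^bsub>?L\<^esub> g)" using shift g J(2) by blast
    then obtain t h where th: "t \<in> A - q" "h \<in> ?AL" "Cc t \<otimes>\<^bsub>?L\<^esub> (Xp k \<otimes>\<^bsub>?L\<^esub> g) \<ominus>\<^bsub>?L\<^esub> h \<otimes>\<^bsub>?L\<^esub> f \<in> Q"
      using red_bdd[OF XJ[OF g]] unfolding red_def by blast
    have "Xp (- k) \<otimes>\<^bsub>?L\<^esub> (Cc t \<otimes>\<^bsub>?L\<^esub> (Xp k \<otimes>\<^bsub>?L\<^esub> g) \<ominus>\<^bsub>?L\<^esub> h \<otimes>\<^bsub>?L\<^esub> f) \<in> Q"
      by (rule QD[OF th(3)]) (use XA AD in blast)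
    moreover have "Xp (- k) \<otimes>\<^bsub>?L\<^esub> (Cc t \<otimes>\<^bsub>?L\<^esub> (Xp k \<otimes>\<^bsub>?L\<^esub> g) \<ominus>\<^bsub>?L\<^esub> h \<otimes>\<^bsub>?L\<^esub> f) =
        Cc t \<otimes>\<^bsub>?L\<^esub> (Xp (- k) \<otimes>\<^bsub>?L\<^esub> (Xp k \<otimes>\<^bsub>?L\<^esub> g)) \<ominus>\<^bsub>?L\<^esub> (Xp (- k) \<otimes>\<^bsub>?L\<^esub> h) \<otimes>\<^bsub>?L\<^esub> f"
      by (rule L.minus_mult_identity1) (use ALc XA CA th Jc XJ g f(1) in auto)
    moreover have "Xp (- k) \<otimes>\<^bsub>?L\<^esub> (Xp k \<otimes>\<^bsub>?L\<^esub> g) = g" using XX[OF Jc[OF g], of "- k"] by simp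
    ultimately have "Cc t \<otimes>\<^bsub>?L\<^esub> g \<ominus>\<^bsub>?L\<^esub> (Xp (- k) \<otimes>\<^bsub>?L\<^esub> h) \<otimes>\<^bsub>?L\<^esub> f \<in> Q" by simp
    thus ?thesis unfolding red_def using th(1) subcringE(6)[OF AL XA th(2)] by blast
  qed
  \<comment> \<open>As \<open>J\<close> consists of multiples of \<open>f\<close> up to
    denominators, each element of \<open>J J'\<close> is \<open>f\<close> times an element of
    \<open>J'\<close>, again up to denominators and modulo \<open>q\<close>. Taken at
    \<open>\<one>\<close>, this makes \<open>f\<close> invertible over the fraction field and hence
    a monomial modulo \<open>q\<close>.\<close>
  have prod: "\<exists>t\<in>A - q. \<exists>w\<in>J'. Cc t \<otimes>\<^bsub>?L\<^esub> z \<ominus>\<^bsub>?L\<^esub> f \<otimes>\<^bsub>?L\<^esub> w \<in> Q" if "z \<in> ideal_prod ?L J J'" for z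
    using that
  proof (induction rule: ideal_prod.induct)
    case (prod g y)
    obtain t h where th: "t \<in> A - q" "h \<in> ?AL" "Cc t \<otimes>\<^bsub>?L\<^esub> g \<ominus>\<^bsub>?L\<^esub> h \<otimes>\<^bsub>?L\<^esub> f \<in> Q"
      using red_all[OF prod(1)] unfolding red_def by blast
    have "y \<otimes>\<^bsub>?L\<^esub> (Cc t \<otimes>\<^bsub>?L\<^esub> g \<ominus>\<^bsub>?L\<^esub> h \<otimes>\<^bsub>?L\<^esub> f) \<in> Q"
      by (rule QD[OF th(3)]) (use prod J'(2) in blast)
    moreover have "y \<otimes>\<^bsub>?L\<^esub> (Cc t \<otimes>\<^bsub>?L\<^esub> g \<ominus>\<^bsub>?L\<^esub> h \<otimes>\<^bsub>?L\<^esub> f) = Cc t \<otimes>\<^bsub>?L\<^esub> (g \<otimes>\<^bsub>?L\<^esub> y) \<ominus>\<^bsub>?L\<^esub> f \<otimes>\<^bsub>?L\<^esub> (h \<otimes>\<^bsub>?L\<^esub> y)"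
      by (rule L.minus_mult_identity2) (use ALc CA th Jc J'c prod f(1) in auto)
    ultimately show ?case using th(1) J'D(4)[OF th(2) prod(2)] by (metis (no_types, lifting))
  next
    case (sum y z)
    then obtain s t v w where st: "s \<in> A - q" "t \<in> A - q" "v \<in> J'" "w \<in> J'"
      "Cc s \<otimes>\<^bsub>?L\<^esub> y \<ominus>\<^bsub>?L\<^esub> f \<otimes>\<^bsub>?L\<^esub> v \<in> Q" "Cc t \<otimes>\<^bsub>?L\<^esub> z \<ominus>\<^bsub>?L\<^esub> f \<otimes>\<^bsub>?L\<^esub> w \<in> Q" by blast
    have stA: "s \<in> A" "t \<in> A" using st by auto
    have yz: "y \<in> carrier ?L" "z \<in> carrier ?L" using sum(1,2) JJ' ALc by blast+
    have "Cc t \<otimes>\<^bsub>?L\<^esub> (Cc s \<otimes>\<^bsub>?L\<^esub> y \<ominus>\<^bsub>?L\<^esub> f \<otimes>\<^bsub>?L\<^esub> v) \<oplus>\<^bsub>?L\<^esub> Cc s \<otimes>\<^bsub>?L\<^esub> (Cc t \<otimes>\<^bsub>?L\<^esub> z \<ominus>\<^bsub>?L\<^esub> f \<otimes>\<^bsub>?L\<^esub> w) \<in> Q"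
      by (intro L.ideal_inD(3)[OF Q] QD st(5,6)) (use CA stA AD in auto)
    moreover have "Cc t \<otimes>\<^bsub>?L\<^esub> (Cc s \<otimes>\<^bsub>?L\<^esub> y \<ominus>\<^bsub>?L\<^esub> f \<otimes>\<^bsub>?L\<^esub> v) \<oplus>\<^bsub>?L\<^esub> Cc s \<otimes>\<^bsub>?L\<^esub> (Cc t \<otimes>\<^bsub>?L\<^esub> z \<ominus>\<^bsub>?L\<^esub> f \<otimes>\<^bsub>?L\<^esub> w) =
        (Cc s \<otimes>\<^bsub>?L\<^esub> Cc t) \<otimes>\<^bsub>?L\<^esub> (y \<oplus>\<^bsub>?L\<^esub> z) \<ominus>\<^bsub>?L\<^esub> f \<otimes>\<^bsub>?L\<^esub> (Cc t \<otimes>\<^bsub>?L\<^esub> v \<oplus>\<^bsub>?L\<^esub> Cc s \<otimes>\<^bsub>?L\<^esub> w)"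
      by (rule L.minus_add_identity) (use ALc CA stA J'c st yz Jc f(1) in auto)
    ultimately have "Cc (s \<otimes> t) \<otimes>\<^bsub>?L\<^esub> (y \<oplus>\<^bsub>?L\<^esub> z) \<ominus>\<^bsub>?L\<^esub> f \<otimes>\<^bsub>?L\<^esub> (Cc t \<otimes>\<^bsub>?L\<^esub> v \<oplus>\<^bsub>?L\<^esub> Cc s \<otimes>\<^bsub>?L\<^esub> w) \<in> Q"
      using CC[OF stA] by simp
    moreover have "Cc t \<otimes>\<^bsub>?L\<^esub> v \<oplus>\<^bsub>?L\<^esub> Cc s \<otimes>\<^bsub>?L\<^esub> w \<in> J'"
      using J'D(3)[OF J'D(4)[OF CA[OF stA(2)] st(3)] J'D(4)[OF CA[OF stA(1)] st(4)]] .
    ultimately show ?case using Amult[OF st(1,2)] by blast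
  qed
  have coeff_cong: "cong_mod q (x i) (y i)" if "x \<in> ?DL" "y \<in> ?DL" "x \<ominus>\<^bsub>?L\<^esub> y \<in> Q" for x y i
  proof -
    have "x i = (x \<ominus>\<^bsub>?L\<^esub> y) i \<oplus> y i"
      using L.minus_add_cancel_right[OF DLc[OF that(1)] DLc[OF that(2)]] laurent_add_coeff by metis
    moreover have "(x \<ominus>\<^bsub>?L\<^esub> y) i \<in> q" using that(3) by (simp add: Q_def)
    moreover have "u \<oplus> v \<ominus> v = u" if "u \<in> carrier R" "v \<in> carrier R" for u v using that by algebra
    moreover have "(x \<ominus>\<^bsub>?L\<^esub> y) i \<in> carrier R" "y i \<in> carrier R"
      using calculation(2) ideal_inD(1)[OF qi] Dc cD[OF that(2)] by blast+
    ultimately show ?thesis by (simp add: cong_mod_def)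
  qed
  obtain t w where tw: "t \<in> A - q" "w \<in> J'" "Cc t \<otimes>\<^bsub>?L\<^esub> \<one>\<^bsub>?L\<^esub> \<ominus>\<^bsub>?L\<^esub> f \<otimes>\<^bsub>?L\<^esub> w \<in> Q"
    using prod[of "\<one>\<^bsub>?L\<^esub>"] subcringE(3)[OF AL] JJ' by auto
  have tD: "Cc t \<in> ?DL" using CA tw(1) AD by blast
  have wD: "w \<in> ?DL" using tw(2) J'(2) by blast
  have fwD: "f \<otimes>\<^bsub>?L\<^esub> w \<in> ?DL" using subcringE(6)[OF DL fD wD] .
  have cg: "(f \<otimes>\<^bsub>?L\<^esub> w) i \<in> q \<longleftrightarrow> Cc t i \<in> q" for i
    using cong_mod_mem[OF D(1) qi cD[OF tD] cD[OF fwD] coeff_cong[OF tD fwD]] tw(3) DLc[OF tD] by simp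
  have "\<exists>a. f a \<notin> q \<and> w (- a) \<notin> q \<and> (\<forall>i. i \<noteq> a \<longrightarrow> f i \<in> q) \<and> (\<forall>i. i \<noteq> - a \<longrightarrow> w i \<in> q)"
    by (rule monomial_mod_prime[OF D(1) q fD wD])
       (use cg tw(1) ideal_inD(2)[OF qi] in \<open>auto simp: Cc_def laurent_monom_def\<close>)
  then obtain a where a: "f a \<notin> q" "\<And>i. i \<noteq> a \<Longrightarrow> f i \<in> q" by blast
  obtain \<tau> h where th: "\<tau> \<in> A - q" "h \<in> ?AL" "Cc \<tau> \<otimes>\<^bsub>?L\<^esub> x1 \<ominus>\<^bsub>?L\<^esub> h \<otimes>\<^bsub>?L\<^esub> f \<in> Q"
    using red_all[OF x1(1)] unfolding red_def by blast
  define e where "e = laurent_eval R h"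
  have e: "e \<in> A" unfolding e_def by (rule laurent_eval_in[OF A th(2)])
  \<comment> \<open>Evaluating the congruence of \<open>\<tau> x1\<close> with \<open>h f\<close> at
    \<open>X = 1\<close> shows that \<open>\<tau>\<close> is congruent to
    \<open>e \<otimes> f a\<close>. Shifting \<open>f\<close> to degree \<open>0\<close> and
    multiplying by \<open>e\<close> therefore gives the constant \<open>\<tau>\<close>.\<close>
  define v where "v = Cc e \<otimes>\<^bsub>?L\<^esub> (Xp (- a) \<otimes>\<^bsub>?L\<^esub> f)"
  have vJ: "v \<in> J" unfolding v_def using JD(4)[OF CA[OF e] XJ[OF f(1)]] .
  have vi: "v i = e \<otimes> f (i + a)" for i
    unfolding v_def using Cm[OF e Jc[OF XJ[OF f(1)]]] Xm[OF Jc[OF f(1)]] by simp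
  have eD: "e \<in> D" using e D(2) by blast
  have x1D: "Cc \<tau> \<otimes>\<^bsub>?L\<^esub> x1 \<in> ?DL" and hfD: "h \<otimes>\<^bsub>?L\<^esub> f \<in> ?DL"
    using subcringE(6)[OF DL] CA th x1(1) J(2) AD fD by blast+
  have ev: "cong_mod q (laurent_eval R x) (laurent_eval R y)" if xy: "x \<in> ?DL" "y \<in> ?DL" "x \<ominus>\<^bsub>?L\<^esub> y \<in> Q" for x y
  proof -
    have m: "x \<ominus>\<^bsub>?L\<^esub> y \<in> ?DL" using xy(3) by (simp add: Q_def)
    have "cong_mod q (laurent_eval R (x \<ominus>\<^bsub>?L\<^esub> y)) ((x \<ominus>\<^bsub>?L\<^esub> y) 0)"
      by (rule laurent_eval_mod[OF D(1) qi m]) (use xy(3) Q_def in auto)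
    hence mq: "laurent_eval R (x \<ominus>\<^bsub>?L\<^esub> y) \<in> q"
      using cong_mod_mem[OF D(1) qi laurent_eval_in[OF D(1) m] cD[OF m]] xy(3) by (simp add: Q_def)
    have "laurent_eval R x = laurent_eval R (x \<ominus>\<^bsub>?L\<^esub> y) \<oplus> laurent_eval R y"
      using ring_hom_add[OF laurent_eval_hom DLc[OF m] DLc[OF xy(2)]]
        L.minus_add_cancel_right[OF DLc[OF xy(1)] DLc[OF xy(2)]] by simp
    moreover have "u \<oplus> v \<ominus> v = u" if "u \<in> carrier R" "v \<in> carrier R" for u v using that by algebra
    moreover have "laurent_eval R (x \<ominus>\<^bsub>?L\<^esub> y) \<in> carrier R" "laurent_eval R y \<in> carrier R"
      using laurent_eval_in[OF D(1) m] laurent_eval_in[OF D(1) xy(2)] Dc by auto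
    ultimately show ?thesis using mq by (simp add: cong_mod_def)
  qed
  have \<tau>: "\<tau> \<in> D" "\<tau> \<in> carrier R" using th(1) D(2) Dc by auto
  have "laurent_eval R (Cc \<tau> \<otimes>\<^bsub>?L\<^esub> x1) = \<tau>"
    using ring_hom_mult[OF laurent_eval_hom ALc[OF CA] Jc[OF x1(1)], of \<tau>] x1(2) th(1) \<tau>
      laurent_eval_monom[of \<tau> 0] by (simp add: Cc_def)
  moreover have "laurent_eval R (h \<otimes>\<^bsub>?L\<^esub> f) = e \<otimes> laurent_eval R f"
    using ring_hom_mult[OF laurent_eval_hom ALc[OF th(2)] Jc[OF f(1)]] by (simp add: e_def)
  ultimately have 1: "cong_mod q \<tau> (e \<otimes> laurent_eval R f)" using ev[OF x1D hfD th(3)] by simp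
  have fe: "laurent_eval R f \<in> D" by (rule laurent_eval_in[OF D(1) fD])
  have "cong_mod q (e \<otimes> laurent_eval R f) (e \<otimes> f a)"
    by (rule cong_mod_mult[OF D(1) qi eD eD fe cD[OF fD] cong_mod_refl[OF D(1) qi eD] laurent_eval_mod[OF D(1) qi fD a(2)]])
  hence "cong_mod q \<tau> (v 0)"
    using cong_mod_trans[OF D(1) qi \<tau>(1) _ _ 1] subcringE(6)[OF D(1) eD] fe cD[OF fD] by (simp add: vi)
  hence "cong_mod q (v 0) \<tau>" using cong_mod_sym[OF D(1) qi \<tau>(1)] cD vJ J(2) by blast
  moreover have "v i \<in> q" if "i \<noteq> 0" for i
    unfolding vi using ideal_inD(4)[OF qi eD a(2)[of "i + a"]] that by simp
  ultimately show ?thesis using vJ th(1) by blast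
qed

text \<open>The coefficients of \<open>f w\<close> are in \<open>A\<close>, so its congruence with
  the constant \<open>s \<otimes> \<tau>\<close> depends only on the contraction of the prime to
  \<open>A\<close> and carries over to \<open>q'\<close>. There \<open>w\<close> is therefore a
  monomial too, and its value at \<open>X = 1\<close>, which also lies in \<open>A\<close>,
  identifies the coefficient. The exponent \<open>\<delta>\<close> is left open at this
  point.\<close>

lemma const_mod_other_prime:
  assumes A: "subcring A R" and D: "subcring D R" "A \<subseteq> D"
    and q: "prime_in q D" and q': "prime_in q' D" "q' \<inter> A = q \<inter> A"
    and f: "f \<in> laurent_sub D R" "s \<in> A" "s \<notin> q" "cong_mod q (f 0) s" "\<And>i. i \<noteq> 0 \<Longrightarrow> f i \<in> q"
    and w: "w \<in> laurent_sub D R" "\<tau> \<in> A" "\<tau> \<notin> q" "cong_mod q (w 0) \<tau>" "\<And>i. i \<noteq> 0 \<Longrightarrow> w i \<in> q"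
    and fw: "f \<otimes>\<^bsub>laurent R\<^esub> w \<in> laurent_sub A R" and ev: "laurent_eval R w \<in> A"
  shows "\<exists>\<delta>. cong_mod q' (w \<delta>) \<tau> \<and> (\<forall>i. i \<noteq> \<delta> \<longrightarrow> w i \<in> q')"
proof -
  note Dc = subcringE(1)[OF D(1)] and Ac = subcringE(1)[OF A] and qi = prime_inD(1)[OF q] and qi' = prime_inD(1)[OF q'(1)]
  have c: "f i \<in> D" "w i \<in> D" for i using f(1) w(1) laurent_sub_iff[OF Dc] by auto
  have fwA: "(f \<otimes>\<^bsub>laurent R\<^esub> w) i \<in> A" for i using fw laurent_sub_iff[OF Ac] by blast
  have st: "s \<in> D" "\<tau> \<in> D" "s \<otimes> \<tau> \<in> A" using f(2) w(2) D(2) subcringE(6)[OF A] by auto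
  have fwk: "cong_mod q ((f \<otimes>\<^bsub>laurent R\<^esub> w) k) (f 0 \<otimes> w k)" for k
    using laurent_mult_mod[OF D(1) qi f(1) w(1), of 0 k] f(5) by (simp add: cong_mod_def)
  have Aq: "cong_mod q x y \<Longrightarrow> x \<in> A \<Longrightarrow> y \<in> A \<Longrightarrow> cong_mod q' x y" for x y
  proof -
    assume a: "cong_mod q x y" "x \<in> A" "y \<in> A"
    have "x \<ominus> y \<in> A" using submoduleD(5)[OF A subcring_is_submodule[OF A] a(2,3)] .
    thus ?thesis using a(1) q'(2) by (auto simp: cong_mod_def)
  qed
  have "cong_mod q (f 0 \<otimes> w 0) (s \<otimes> \<tau>)" by (rule cong_mod_mult[OF D(1) qi c(1) st(1) c(2) st(2) f(4) w(4)])
  hence "cong_mod q ((f \<otimes>\<^bsub>laurent R\<^esub> w) 0) (s \<otimes> \<tau>)"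
    using cong_mod_trans[OF D(1) qi _ _ _ fwk[of 0]] fwA D(2) subcringE(6)[OF D(1)] c st by blast
  hence 1: "cong_mod q' ((f \<otimes>\<^bsub>laurent R\<^esub> w) 0) (s \<otimes> \<tau>)" using Aq fwA st(3) by blast
  have "s \<otimes> \<tau> \<notin> q" using prime_inD(3)[OF q st(1,2)] f(3) w(3) by blast
  hence "s \<otimes> \<tau> \<notin> q'" using st(3) q'(2) by blast
  hence 2: "(f \<otimes>\<^bsub>laurent R\<^esub> w) 0 \<notin> q'" using cong_mod_mem[OF D(1) qi' _ _ 1] fwA st(3) D(2) by blast
  have 3: "(f \<otimes>\<^bsub>laurent R\<^esub> w) k \<in> q'" if "k \<noteq> 0" for k
  proof -
    have "f 0 \<otimes> w k \<in> q" using ideal_inD(4)[OF qi c(1) w(5)[OF that]] .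
    hence "(f \<otimes>\<^bsub>laurent R\<^esub> w) k \<in> q"
      using cong_mod_mem[OF D(1) qi _ _ fwk[of k]] fwA D(2) subcringE(6)[OF D(1) c] by blast
    thus ?thesis using fwA q'(2) by blast
  qed
  obtain a where a: "\<And>i. i \<noteq> - a \<Longrightarrow> w i \<in> q'" using monomial_mod_prime[OF D(1) q'(1) f(1) w(1) 2 3] by blast
  have evD: "laurent_eval R w \<in> D" using ev D(2) by blast
  have "cong_mod q (laurent_eval R w) \<tau>"
    by (rule cong_mod_trans[OF D(1) qi evD c(2) st(2) laurent_eval_mod[OF D(1) qi w(1,5)] w(4)])
  hence 4: "cong_mod q' (laurent_eval R w) \<tau>" using Aq ev w(2) by blast
  have 5: "cong_mod q' (laurent_eval R w) (w (- a))" by (rule laurent_eval_mod[OF D(1) qi' w(1) a])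
  have "cong_mod q' (w (- a)) \<tau>"
    by (rule cong_mod_trans[OF D(1) qi' c(2) evD st(2) cong_mod_sym[OF D(1) qi' evD c(2) 5] 4])
  thus ?thesis using a by blast
qed

text \<open>Modulo \<open>q\<close> multiplication by \<open>w\<close> only scales by
  \<open>\<tau>\<close> and shifts by \<open>\<delta>\<close>. This is used when \<open>g w\<close>
  has coefficients in the base ring, so that \<open>g\<close> is expressed by base elements up to
  the factor \<open>\<tau>\<close>.\<close>

lemma coeff_mult_monomial_mod:
  assumes D: "subcring D R" and q: "ideal_in q D"
    and g: "g \<in> laurent_sub D R" and w: "w \<in> laurent_sub D R" "\<tau> \<in> D"
      "cong_mod q (w \<delta>) \<tau>" "\<And>i. i \<noteq> \<delta> \<Longrightarrow> w i \<in> q"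
  shows "cong_mod q (\<tau> \<otimes> g (s - \<delta>)) ((g \<otimes>\<^bsub>laurent R\<^esub> w) s)"
proof -
  note Dc = subcringE(1)[OF D]
  have c: "g i \<in> D" "w i \<in> D" "(g \<otimes>\<^bsub>laurent R\<^esub> w) i \<in> D" for i
    using g w(1) subcringE(6)[OF laurent_sub_subcring[OF D] g w(1)] laurent_sub_iff[OF Dc] by auto
  have "(g \<otimes>\<^bsub>laurent R\<^esub> w) s \<ominus> g (s - \<delta>) \<otimes> w (s - (s - \<delta>)) \<in> q"
    by (rule laurent_mult_mod[OF D q g w(1)]) (use w(4) in auto)
  hence 1: "cong_mod q ((g \<otimes>\<^bsub>laurent R\<^esub> w) s) (g (s - \<delta>) \<otimes> w \<delta>)" by (simp add: cong_mod_def)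
  have "cong_mod q (g (s - \<delta>) \<otimes> w \<delta>) (g (s - \<delta>) \<otimes> \<tau>)"
    by (rule cong_mod_mult[OF D q c(1) c(1) c(2) w(2) cong_mod_refl[OF D q c(1)] w(3)])
  hence "cong_mod q ((g \<otimes>\<^bsub>laurent R\<^esub> w) s) (g (s - \<delta>) \<otimes> \<tau>)"
    using cong_mod_trans[OF D q c(3) _ _ 1] subcringE(6)[OF D c(1)] c(2) w(2) by blast
  moreover have "g (s - \<delta>) \<otimes> \<tau> = \<tau> \<otimes> g (s - \<delta>)" using c(1) w(2) Dc by (metis m_comm subsetD)
  ultimately show ?thesis
    using cong_mod_sym[OF D q c(3)] subcringE(6)[OF D w(2) c(1)] by simp
qed

section \<open>Descent to the subintegral closure\<close>

lemma subcring_pow: "\<lbrakk>subcring E R; x \<in> E\<rbrakk> \<Longrightarrow> x [^] (k::nat) \<in> E"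
proof (induction k)
  case (Suc k)
  thus ?case using subcringE(6)[OF Suc(2) Suc(1)[OF Suc(2,3)] Suc(3)] by simp
qed (use subcringE(3) in auto)

text \<open>The exponent is rounded up to an even one and halved; with \<open>m = k div 2\<close>
  the new exponent \<open>Suc m\<close> is large enough and, for positive \<open>k\<close>, smaller
  than \<open>Suc k\<close>.\<close>

lemma radical_pow:
  assumes E: "subcring E R" and I: "ideal_in I E" and rad: "\<And>x. \<lbrakk>x \<in> E; x \<otimes> x \<in> I\<rbrakk> \<Longrightarrow> x \<in> I"
  shows "\<lbrakk>x \<in> E; x [^] (Suc k) \<in> I\<rbrakk> \<Longrightarrow> x \<in> I"
proof (induction k arbitrary: x rule: less_induct)
  case (less k x)
  have xc: "x \<in> carrier R" using less.prems(1) subcringE(1)[OF E] by blast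
  show ?case
  proof (cases k)
    case 0 thus ?thesis using less.prems xc by simp
  next
    case (Suc k')
    define m where "m = k div 2"
    have m: "m < k" using Suc by (simp add: m_def)
    have le: "Suc k \<le> 2 * Suc m" unfolding m_def by presburger
    have pE: "x [^] j \<in> E" for j :: nat by (rule subcring_pow[OF E less.prems(1)])
    have "x [^] (2 * Suc m - Suc k) \<otimes> x [^] Suc k \<in> I" by (rule ideal_inD(4)[OF I pE less.prems(2)])
    moreover have "x [^] (2 * Suc m - Suc k) \<otimes> x [^] Suc k = x [^] (2 * Suc m)"
      using nat_pow_mult[OF xc, of "2 * Suc m - Suc k" "Suc k"] le by simp
    moreover have "x [^] (2 * Suc m) = x [^] Suc m \<otimes> x [^] Suc m"
      using nat_pow_mult[OF xc, of "Suc m" "Suc m"] by (simp add: mult_2)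
    ultimately have "x [^] Suc m \<in> I" using rad[OF pE, of "Suc m"] by simp
    thus ?thesis using less.IH[OF m less.prems(1)] by simp
  qed
qed

text \<open>
  The conductor of \<open>C\<close> in \<open>E\<close> is a radical ideal of \<open>E\<close> because \<open>C\<close> is closed under extracting
  common square and cube roots. The set \<open>S\<close> is the complement of a minimal prime of \<open>C\<close> over the
  conductor, and \<open>N\<close> is the contraction to \<open>E\<close> of the localised conductor.
\<close>

lemma ex_localised_conductor:
  assumes C: "subcring C R" and E: "subcring E R" "C \<subseteq> E"
    and closed: "\<And>b. \<lbrakk>b \<in> E; b \<otimes> b \<in> C; b \<otimes> b \<otimes> b \<in> C\<rbrakk> \<Longrightarrow> b \<in> C"
    and ne: "\<not> E \<subseteq> C"
  obtains S N where "S \<subseteq> C" "\<one> \<in> S" "\<And>s t. \<lbrakk>s \<in> S; t \<in> S\<rbrakk> \<Longrightarrow> s \<otimes> t \<in> S"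
    "ideal_in N E" "N \<inter> S = {}" "\<And>x. \<lbrakk>x \<in> C; x \<notin> S\<rbrakk> \<Longrightarrow> x \<in> N"
    "\<And>x. \<lbrakk>x \<in> E; x \<otimes> x \<in> N\<rbrakk> \<Longrightarrow> x \<in> N" "\<And>s x. \<lbrakk>s \<in> S; x \<in> E; s \<otimes> x \<in> N\<rbrakk> \<Longrightarrow> x \<in> N"
    "\<And>x. x \<in> N \<Longrightarrow> \<exists>s\<in>S. s \<otimes> x \<in> C" "\<And>x. \<lbrakk>x \<in> E; \<forall>y\<in>E. x \<otimes> y \<in> C\<rbrakk> \<Longrightarrow> x \<in> N"
proof -
  note Ec = subcringE[OF E(1)] and Cc = subcringE[OF C]
  have car: "x \<in> carrier R" if "x \<in> E" for x using that Ec(1) by blast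
  define c where "c = {x \<in> E. \<forall>y\<in>E. x \<otimes> y \<in> C}"
  have cC: "x \<in> C" if "x \<in> c" for x using that Ec(3) car[of x] by (force simp: c_def)
  have c: "ideal_in c E"
    unfolding ideal_in_def
  proof (intro conjI ballI)
    show "c \<subseteq> E" by (auto simp: c_def)
    show "\<zero> \<in> c" using Ec(2) Cc(2) car by (auto simp: c_def)
  next
    fix x y assume "x \<in> c" "y \<in> c"
    thus "x \<oplus> y \<in> c" using Ec(7) Cc(7) car by (auto simp: c_def l_distr)
  next
    fix d x assume dx: "d \<in> E" "x \<in> c"
    have "d \<otimes> x \<otimes> y = x \<otimes> (d \<otimes> y)" if "y \<in> E" for y
      using car[OF dx(1)] car[OF that] car[of x] dx(2) by (simp add: c_def m_ac)
    thus "d \<otimes> x \<in> c" using dx Ec(6) by (auto simp: c_def)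
  qed
  \<comment> \<open>For \<open>y\<close> in \<open>E\<close> both the square and the cube of
    \<open>x \<otimes> y\<close> contain the factor \<open>x \<otimes> x\<close> from the conductor,
    so they lie in \<open>C\<close> and \<open>closed\<close> applies.\<close>
  have crad: "x \<in> c" if x: "x \<in> E" "x \<otimes> x \<in> c" for x
  proof -
    have "x \<otimes> y \<in> C" if y: "y \<in> E" for y
    proof (rule closed)
      have "x \<otimes> y \<otimes> (x \<otimes> y) = x \<otimes> x \<otimes> (y \<otimes> y)" "x \<otimes> y \<otimes> (x \<otimes> y) \<otimes> (x \<otimes> y) = x \<otimes> x \<otimes> (x \<otimes> (y \<otimes> y \<otimes> y))"
        using car[OF x(1)] car[OF y] by algebra+
      moreover have "x \<otimes> x \<otimes> z \<in> C" if "z \<in> E" for z using x(2) that by (simp add: c_def)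
      ultimately show "x \<otimes> y \<otimes> (x \<otimes> y) \<in> C" "x \<otimes> y \<otimes> (x \<otimes> y) \<otimes> (x \<otimes> y) \<in> C"
        using Ec(6) x(1) y by simp_all
    qed (use Ec(6) x(1) y in simp)
    thus ?thesis using x(1) by (simp add: c_def)
  qed
  have one: "\<one> \<notin> c" using ne car by (auto simp: c_def)
  \<comment> \<open>Multiplicative subsets of \<open>C\<close> that miss the conductor; a maximal
    such set corresponds to a minimal prime.\<close>
  define FF where "FF = {S. S \<subseteq> C \<and> \<one> \<in> S \<and> (\<forall>s\<in>S. \<forall>t\<in>S. s \<otimes> t \<in> S) \<and> S \<inter> c = {}}"
  have "\<exists>M\<in>FF. \<forall>Z\<in>FF. M \<subseteq> Z \<longrightarrow> Z = M"
  proof (rule subset_Zorn_nonempty)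
    have "{\<one>} \<in> FF" using one Cc(3) by (auto simp: FF_def)
    thus "FF \<noteq> {}" by blast
  next
    fix KK assume KK: "KK \<noteq> {}" "subset.chain FF KK"
    have mem: "Z \<in> FF" if "Z \<in> KK" for Z using KK(2) that by (auto simp: subset.chain_def)
    have cmp: "Z \<subseteq> Y \<or> Y \<subseteq> Z" if "Z \<in> KK" "Y \<in> KK" for Z Y
      using KK(2) that by (auto simp: subset_chain_def)
    have "s \<otimes> t \<in> \<Union>KK" if st: "s \<in> \<Union>KK" "t \<in> \<Union>KK" for s t
    proof -
      obtain Z Y where ZY: "Z \<in> KK" "Y \<in> KK" "s \<in> Z" "t \<in> Y" using st by blast
      define W where "W = (if Z \<subseteq> Y then Y else Z)"
      have W: "W \<in> KK" "s \<in> W" "t \<in> W" using ZY cmp[OF ZY(1,2)] by (auto simp: W_def)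
      hence "s \<otimes> t \<in> W" using mem[OF W(1)] by (auto simp: FF_def)
      thus ?thesis using W(1) by blast
    qed
    moreover have "Z \<subseteq> C" "Z \<inter> c = {}" if "Z \<in> KK" for Z using mem[OF that] by (auto simp: FF_def)
    hence "\<Union>KK \<subseteq> C" "\<Union>KK \<inter> c = {}" by blast+
    moreover have "\<one> \<in> \<Union>KK" using mem KK(1) by (auto simp: FF_def)
    ultimately show "\<Union>KK \<in> FF" by (auto simp: FF_def)
  qed
  then obtain S where SF: "S \<in> FF" and max: "\<And>Z. \<lbrakk>Z \<in> FF; S \<subseteq> Z\<rbrakk> \<Longrightarrow> Z = S" by blast
  have S: "S \<subseteq> C" "\<one> \<in> S" "\<And>s t. \<lbrakk>s \<in> S; t \<in> S\<rbrakk> \<Longrightarrow> s \<otimes> t \<in> S" "S \<inter> c = {}"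
    using SF by (auto simp: FF_def)
  have SE: "s \<in> E" "s \<in> carrier R" if "s \<in> S" for s using that S(1) E(2) car by blast+
  have Spow: "s [^] (k::nat) \<in> S" if "s \<in> S" for s k
    using that S(2,3) by (induction k) auto
  define N where "N = {x \<in> E. \<exists>s\<in>S. s \<otimes> x \<in> c}"
  have sat: "x \<in> N" if sx: "s \<in> S" "x \<in> E" "s \<otimes> x \<in> N" for s x
  proof -
    obtain t where t: "t \<in> S" "t \<otimes> (s \<otimes> x) \<in> c" using sx(3) by (auto simp: N_def)
    hence "(t \<otimes> s) \<otimes> x \<in> c" using SE sx(1) car[OF sx(2)] by (simp add: m_assoc)
    thus ?thesis using S(3)[OF t(1) sx(1)] sx(2) by (auto simp: N_def)
  qed
  have cN: "x \<in> N" if "x \<in> c" for x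
    using that S(2) car[of x] c ideal_inD(1)[OF c] by (auto simp: N_def intro!: bexI[of _ \<one>])
  show ?thesis
  proof (rule that[of S N])
    show "ideal_in N E"
      unfolding ideal_in_def
    proof (intro conjI ballI)
      show "N \<subseteq> E" by (auto simp: N_def)
      show "\<zero> \<in> N" using cN ideal_inD(2)[OF c] by blast
    next
      fix x y assume xy: "x \<in> N" "y \<in> N"
      then obtain s t where st: "s \<in> S" "t \<in> S" "s \<otimes> x \<in> c" "t \<otimes> y \<in> c" by (auto simp: N_def)
      have xyE: "x \<in> E" "y \<in> E" using xy by (auto simp: N_def)
      have cc: "s \<in> carrier R" "t \<in> carrier R" "x \<in> carrier R" "y \<in> carrier R" using SE st xyE car by auto
      have "(s \<otimes> t) \<otimes> (x \<oplus> y) = t \<otimes> (s \<otimes> x) \<oplus> s \<otimes> (t \<otimes> y)" using cc by algebra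
      moreover have "t \<otimes> (s \<otimes> x) \<oplus> s \<otimes> (t \<otimes> y) \<in> c"
        using ideal_inD(3,4)[OF c] SE(1)[OF st(1)] SE(1)[OF st(2)] st(3,4) by blast
      ultimately have "(s \<otimes> t) \<otimes> (x \<oplus> y) \<in> c" by simp
      thus "x \<oplus> y \<in> N" using S(3)[OF st(1,2)] Ec(7)[OF xyE] unfolding N_def by blast
    next
      fix d x assume dx: "d \<in> E" "x \<in> N"
      then obtain s where s: "s \<in> S" "s \<otimes> x \<in> c" "x \<in> E" by (auto simp: N_def)
      have "s \<otimes> (d \<otimes> x) = d \<otimes> (s \<otimes> x)" using SE s car dx by (intro m_lcomm) auto
      hence "s \<otimes> (d \<otimes> x) \<in> c" using ideal_inD(4)[OF c dx(1) s(2)] by simp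
      thus "d \<otimes> x \<in> N" using s Ec(6)[OF dx(1) s(3)] unfolding N_def by blast
    qed
    show "N \<inter> S = {}" using S(3,4) by (fastforce simp: N_def)
    show "x \<in> N" if x: "x \<in> C" "x \<notin> S" for x
    proof -
      have xE: "x \<in> E" "x \<in> carrier R" using x E(2) car by auto
      \<comment> \<open>The multiplicative set generated by \<open>S\<close> and \<open>x\<close>
        properly contains \<open>S\<close>, so by maximality it meets the conductor.\<close>
      define Z where "Z = {s \<otimes> x [^] (k::nat) |s k. s \<in> S}"
      have "S \<subseteq> Z"
      proof
        fix s assume "s \<in> S"
        hence "s = s \<otimes> x [^] (0::nat)" using SE by simp
        thus "s \<in> Z" using \<open>s \<in> S\<close> unfolding Z_def by blast
      qed
      have "\<one> \<otimes> x [^] (1::nat) \<in> Z" using S(2) unfolding Z_def by blast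
      hence "x \<in> Z" using xE by simp
      hence "Z \<notin> FF" using max[OF _ \<open>S \<subseteq> Z\<close>] x(2) by blast
      moreover have "Z \<subseteq> C" using S(1) subcring_pow[OF C x(1)] Cc(6) by (auto simp: Z_def)
      moreover have "\<one> \<in> Z" using \<open>S \<subseteq> Z\<close> S(2) by blast
      moreover have "\<forall>a\<in>Z. \<forall>b\<in>Z. a \<otimes> b \<in> Z"
      proof (intro ballI)
        fix a b assume "a \<in> Z" "b \<in> Z"
        then obtain s t k l where "a = s \<otimes> x [^] (k::nat)" "b = t \<otimes> x [^] (l::nat)" "s \<in> S" "t \<in> S"
          unfolding Z_def by blast
        moreover have "s \<otimes> p \<otimes> (t \<otimes> r) = s \<otimes> t \<otimes> (p \<otimes> r)"
          if "s \<in> carrier R" "t \<in> carrier R" "p \<in> carrier R" "r \<in> carrier R" for s t p r using that by algebra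
        ultimately have "a \<otimes> b = (s \<otimes> t) \<otimes> x [^] (k + l)" using SE xE nat_pow_mult[of x k l] by simp
        thus "a \<otimes> b \<in> Z" using S(3)[OF \<open>s \<in> S\<close> \<open>t \<in> S\<close>] unfolding Z_def by blast
      qed
      ultimately have "Z \<inter> c \<noteq> {}" by (auto simp: FF_def)
      then obtain s and k :: nat where sk: "s \<in> S" "s \<otimes> x [^] k \<in> c" unfolding Z_def by blast
      have "k \<noteq> 0" using sk S(4) SE by (cases k) auto
      then obtain k' where k': "k = Suc k'" by (cases k) auto
      \<comment> \<open>Extra factors \<open>s\<close> turn the element found into a full power of
        \<open>s \<otimes> x\<close>, to which radicality of the conductor applies.\<close>
      have "s [^] k' \<otimes> (s \<otimes> x [^] k) \<in> c" by (rule ideal_inD(4)[OF c _ sk(2)]) (use Spow SE sk in blast)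
      moreover have "s [^] k' \<otimes> (s \<otimes> x [^] k) = (s \<otimes> x) [^] Suc k'"
        unfolding k' using SE[OF sk(1)] xE nat_pow_distrib[of s x "Suc k'"] by (simp add: m_assoc)
      ultimately have "s \<otimes> x \<in> c"
        using radical_pow[OF E(1) c crad Ec(6)[OF SE(1)[OF sk(1)] xE(1)], of k'] by simp
      thus "x \<in> N" using sk(1) xE by (auto simp: N_def)
    qed
    show "x \<in> N" if x: "x \<in> E" "x \<otimes> x \<in> N" for x
    proof -
      obtain s where s: "s \<in> S" "s \<otimes> (x \<otimes> x) \<in> c" using x(2) by (auto simp: N_def)
      have "s \<otimes> (s \<otimes> (x \<otimes> x)) \<in> c" using ideal_inD(4)[OF c SE(1)[OF s(1)] s(2)] .
      moreover have "s \<otimes> (s \<otimes> (x \<otimes> x)) = (s \<otimes> x) \<otimes> (s \<otimes> x)" using SE[OF s(1)] car[OF x(1)] by algebra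
      ultimately have "s \<otimes> x \<in> c" using crad Ec(6)[OF SE(1)[OF s(1)] x(1)] by simp
      thus ?thesis using s(1) x(1) by (auto simp: N_def)
    qed
    show "\<exists>s\<in>S. s \<otimes> x \<in> C" if "x \<in> N" for x using that cC by (auto simp: N_def)
    show "x \<in> N" if "x \<in> E" "\<forall>y\<in>E. x \<otimes> y \<in> C" for x using cN that by (auto simp: c_def)
  qed (use S sat in auto)
qed

text \<open>By \<open>dec\<close> each factor \<open>D e_i\<close> is the image of \<open>E\<close>.
  The set \<open>I\<close> is the extension of \<open>N\<close> to \<open>D\<close>, and it
  contracts to \<open>N\<close>: if \<open>y e_i = b_i e_i\<close> with \<open>b_i\<close> in
  \<open>N\<close> for all \<open>i\<close>, then the product of the \<open>y - b_i\<close> is zero,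
  so a power of \<open>y\<close> lies in the radical ideal \<open>N\<close>. Hence \<open>I\<close>
  misses the multiplicative set generated by \<open>S\<close> and \<open>z\<close>, and a prime over
  it can be chosen to miss that set too. Letting \<open>z\<close> vary, these primes cut out
  \<open>N\<close> in \<open>E\<close>.\<close>

lemma ex_prime_over_localised_conductor:
  assumes D: "subcring D R" and E: "subcring E R" "E \<subseteq> D"
    and e: "\<And>i. i < n \<Longrightarrow> e i \<in> D" "(\<Oplus>i\<in>{..<(n::nat)}. e i) = \<one>"
    and dec: "\<And>x i. \<lbrakk>x \<in> D; i < n\<rbrakk> \<Longrightarrow> \<exists>d\<in>E. x \<otimes> e i = d \<otimes> e i"
    and S: "S \<subseteq> E" "\<one> \<in> S" "\<And>s t. \<lbrakk>s \<in> S; t \<in> S\<rbrakk> \<Longrightarrow> s \<otimes> t \<in> S"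
    and N: "ideal_in N E" "N \<inter> S = {}" "\<And>x. \<lbrakk>x \<in> E; x \<otimes> x \<in> N\<rbrakk> \<Longrightarrow> x \<in> N"
      "\<And>s x. \<lbrakk>s \<in> S; x \<in> E; s \<otimes> x \<in> N\<rbrakk> \<Longrightarrow> x \<in> N"
    and z: "z \<in> E" "z \<notin> N"
  shows "\<exists>q. prime_in q D \<and> N \<subseteq> q \<and> q \<inter> S = {} \<and> z \<notin> q"
proof -
  note Ec = subcringE[OF E(1)] and Dc = subcringE[OF D]
  have Ecar: "x \<in> carrier R" if "x \<in> E" for x using that Ec(1) by blast
  have ecar: "e i \<in> carrier R" if "i < n" for i using e(1)[OF that] Dc(1) by blast
  have NE: "x \<in> E" if "x \<in> N" for x using that ideal_inD(1)[OF N(1)] by blast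
  define I where "I = {x \<in> D. \<forall>i<n. \<exists>d\<in>N. x \<otimes> e i = d \<otimes> e i}"
  have NI: "N \<subseteq> I" using NE E(2) by (auto simp: I_def)
  have I: "ideal_in I D"
    unfolding ideal_in_def
  proof (intro conjI ballI)
    show "I \<subseteq> D" by (auto simp: I_def)
    show "\<zero> \<in> I" using NI ideal_inD(2)[OF N(1)] by blast
  next
    fix x y assume xy: "x \<in> I" "y \<in> I"
    have "\<exists>d\<in>N. (x \<oplus> y) \<otimes> e i = d \<otimes> e i" if i: "i < n" for i
    proof -
      obtain a b where ab: "a \<in> N" "b \<in> N" "x \<otimes> e i = a \<otimes> e i" "y \<otimes> e i = b \<otimes> e i"
        using xy i unfolding I_def by blast
      have "x \<in> carrier R" "y \<in> carrier R" using xy Dc(1) by (auto simp: I_def)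
      hence "(x \<oplus> y) \<otimes> e i = (a \<oplus> b) \<otimes> e i"
        using ab ecar[OF i] Ecar[OF NE[OF ab(1)]] Ecar[OF NE[OF ab(2)]] by (simp add: l_distr)
      thus ?thesis using ideal_inD(3)[OF N(1) ab(1,2)] by blast
    qed
    thus "x \<oplus> y \<in> I" using xy Dc(7) by (auto simp: I_def)
  next
    fix d x assume dx: "d \<in> D" "x \<in> I"
    have "\<exists>b\<in>N. (d \<otimes> x) \<otimes> e i = b \<otimes> e i" if i: "i < n" for i
    proof -
      obtain a where a: "a \<in> N" "x \<otimes> e i = a \<otimes> e i" using dx(2) i unfolding I_def by blast
      obtain b where b: "b \<in> E" "d \<otimes> e i = b \<otimes> e i" using dec[OF dx(1) i] by blast
      have cc: "d \<in> carrier R" "x \<in> carrier R" "a \<in> carrier R" "b \<in> carrier R" "e i \<in> carrier R"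
        using dx Dc(1) a b Ecar NE ecar[OF i] by (auto simp: I_def)
      have "(d \<otimes> x) \<otimes> e i = d \<otimes> (x \<otimes> e i)" using cc by (simp add: m_assoc)
      also have "\<dots> = a \<otimes> (d \<otimes> e i)" unfolding a(2) using cc by (simp add: m_lcomm)
      also have "\<dots> = (b \<otimes> a) \<otimes> e i" unfolding b(2) using cc by (simp add: m_ac)
      finally show ?thesis using ideal_inD(4)[OF N(1) b(1) a(1)] by blast
    qed
    thus "d \<otimes> x \<in> I" using dx Dc(6) by (auto simp: I_def)
  qed
  have IE: "y \<in> N" if y: "y \<in> E" "y \<in> I" for y
  proof -
    have yc: "y \<in> carrier R" using Ecar y(1) .
    have "k \<le> n \<Longrightarrow> \<exists>m. \<exists>d\<in>N. y [^] (m::nat) \<otimes> (\<Oplus>i\<in>{..<k}. e i) = d \<otimes> (\<Oplus>i\<in>{..<k}. e i)" for k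
    proof (induction k)
      case 0
      thus ?case using ideal_inD(2)[OF N(1)] yc by (intro exI[of _ 0] bexI[of _ \<zero>]) auto
    next
      case (Suc k)
      then obtain m d where md: "d \<in> N" "y [^] (m::nat) \<otimes> (\<Oplus>i\<in>{..<k}. e i) = d \<otimes> (\<Oplus>i\<in>{..<k}. e i)" by auto
      have "\<forall>i<n. \<exists>d\<in>N. y \<otimes> e i = d \<otimes> e i" using y(2) unfolding I_def by blast
      then obtain b where b: "b \<in> N" "y \<otimes> e k = b \<otimes> e k" using Suc.prems by (meson Suc_le_lessD)
      let ?s = "\<Oplus>i\<in>{..<k}. e i"
      have ec: "e \<in> {..<k} \<rightarrow> carrier R" using ecar Suc.prems by auto
      have s: "?s \<in> carrier R" using ec by (rule finsum_closed)
      have ek: "e k \<in> carrier R" using ecar Suc.prems by simp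
      have sum: "(\<Oplus>i\<in>{..<Suc k}. e i) = e k \<oplus> ?s"
        unfolding lessThan_Suc by (rule finsum_insert) (use ec ek in auto)
      define p where "p = y [^] m"
      have cc: "p \<in> carrier R" "d \<in> carrier R" "b \<in> carrier R"
        using yc Ecar[OF NE[OF md(1)]] Ecar[OF NE[OF b(1)]] by (auto simp: p_def)
      \<comment> \<open>This choice makes \<open>p y - r\<close> equal to
        \<open>(p - d) (y - b)\<close>: the first factor kills the sum of the earlier idempotents,
        the second kills \<open>e k\<close>.\<close>
      define r where "r = y \<otimes> d \<oplus> (p \<otimes> b \<ominus> d \<otimes> b)"
      have pE: "p \<in> E" unfolding p_def by (rule subcring_pow[OF E(1) y(1)])
      have rN: "r \<in> N" unfolding r_def
        by (intro ideal_inD(3)[OF N(1)] ideal_in_minus(2)[OF E(1) N(1)] ideal_inD(4)[OF N(1)])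
          (use y(1) md(1) b(1) pE NE in auto)
      have 1: "p \<otimes> y \<otimes> u = r \<otimes> u" if "u \<in> carrier R" "p \<otimes> u = d \<otimes> u" for u
      proof -
        have "r \<otimes> u = y \<otimes> (d \<otimes> u) \<oplus> b \<otimes> (p \<otimes> u) \<ominus> b \<otimes> (d \<otimes> u)"
          unfolding r_def using cc yc that(1) by algebra
        also have "\<dots> = y \<otimes> (p \<otimes> u)" unfolding that(2) using cc yc that(1) by algebra
        finally show ?thesis using cc yc that(1) by (simp add: m_ac)
      qed
      have 2: "p \<otimes> y \<otimes> u = r \<otimes> u" if "u \<in> carrier R" "y \<otimes> u = b \<otimes> u" for u
      proof -
        have "r \<otimes> u = d \<otimes> (y \<otimes> u) \<oplus> p \<otimes> (b \<otimes> u) \<ominus> d \<otimes> (b \<otimes> u)"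
          unfolding r_def using cc yc that(1) by algebra
        also have "\<dots> = p \<otimes> (y \<otimes> u)" unfolding that(2) using cc yc that(1) by algebra
        finally show ?thesis using cc yc that(1) by (simp add: m_ac)
      qed
      have rc: "r \<in> carrier R" using rN NE Ecar by blast
      have "y [^] Suc m \<otimes> (e k \<oplus> ?s) = r \<otimes> (e k \<oplus> ?s)"
        using 1[OF s] 2[OF ek] md(2) b(2) cc yc s ek rc by (simp add: p_def[symmetric] r_distr)
      thus ?case unfolding sum using rN by blast
    qed
    from this[of n] obtain m d where md: "d \<in> N" "y [^] (m::nat) \<otimes> \<one> = d \<otimes> \<one>" using e(2) by auto
    hence pN: "y [^] m \<in> N" using yc Ecar[OF NE[OF md(1)]] by simp
    show "y \<in> N"
    proof (cases m)
      case 0 thus ?thesis using pN N(2) S(2) by auto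
    next
      case (Suc m') thus ?thesis using radical_pow[OF E(1) N(1,3) y(1), of m'] pN by simp
    qed
  qed
  define T where "T = {s \<otimes> z [^] (k::nat) |s k. s \<in> S}"
  have zc: "z \<in> carrier R" using Ecar z(1) .
  have Sc: "s \<in> carrier R" if "s \<in> S" for s using that S(1) Ecar by blast
  have TE: "T \<subseteq> E" using S(1) subcring_pow[OF E(1) z(1)] Ec(6) by (auto simp: T_def)
  have TN: "t \<notin> N" if tT: "t \<in> T" for t
  proof
    assume "t \<in> N"
    obtain s and k :: nat where sk: "s \<in> S" "t = s \<otimes> z [^] k" using tT unfolding T_def by blast
    hence zk: "z [^] k \<in> N" using N(4)[OF sk(1) subcring_pow[OF E(1) z(1)]] \<open>t \<in> N\<close> by simp
    show False
    proof (cases k)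
      case 0 thus ?thesis using zk N(2) S(2) by auto
    next
      case (Suc k') thus ?thesis using radical_pow[OF E(1) N(1,3) z(1), of k'] zk z(2) by simp
    qed
  qed
  have ST: "S \<subseteq> T"
  proof
    fix s assume "s \<in> S"
    hence "s = s \<otimes> z [^] (0::nat)" using Sc by simp
    thus "s \<in> T" using \<open>s \<in> S\<close> unfolding T_def by blast
  qed
  have "\<one> \<otimes> z [^] (1::nat) \<in> T" using S(2) unfolding T_def by blast
  hence zT: "z \<in> T" using zc by simp
  have Tm: "a \<otimes> b \<in> T" if ab: "a \<in> T" "b \<in> T" for a b
  proof -
    obtain s t k l where st: "a = s \<otimes> z [^] (k::nat)" "b = t \<otimes> z [^] (l::nat)" "s \<in> S" "t \<in> S"
      using ab unfolding T_def by blast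
    have "s \<otimes> p \<otimes> (t \<otimes> r) = s \<otimes> t \<otimes> (p \<otimes> r)"
      if "s \<in> carrier R" "t \<in> carrier R" "p \<in> carrier R" "r \<in> carrier R" for s t p r using that by algebra
    hence "a \<otimes> b = (s \<otimes> t) \<otimes> z [^] (k + l)" unfolding st using st(3,4) Sc zc nat_pow_mult[of z k l] by simp
    thus "a \<otimes> b \<in> T" using S(3)[OF st(3,4)] unfolding T_def by blast
  qed
  have "I \<inter> T = {}" using IE TN TE by blast
  moreover have "T \<subseteq> D" "\<one> \<in> T" using TE E(2) ST S(2) by auto
  ultimately obtain q where "prime_in q D" "I \<subseteq> q" "q \<inter> T = {}"
    using ex_prime_avoiding[OF D I _ _ _ Tm] by blast
  thus ?thesis using NI ST zT by blast
qed

text \<open>As \<open>e i\<close> is an idempotent outside \<open>q\<close>, the residue ring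
  \<open>D/q\<close> is a quotient of the local ring \<open>D e_i\<close>, and units lift along
  quotients of local rings: \<open>x y\<close> and \<open>1 - x y\<close> add up to
  \<open>1\<close>, and the second one, lying in \<open>q\<close>, cannot be a unit at
  \<open>e i\<close>.\<close>

lemma unit_at_iff_unit_mod:
  assumes D: "subcring D R" and loc: "local_idempotents n e D" and i: "i < n"
    and q: "prime_in q D" "e i \<notin> q" and x: "x \<in> D"
  shows "unit_at D (e i) x \<longleftrightarrow> (\<exists>y\<in>D. cong_mod q (x \<otimes> y) \<one>)"
proof
  note Dc = subcringE[OF D] and qi = prime_inD(1)[OF q(1)]
  have car: "y \<in> carrier R" if "y \<in> D" for y using that Dc(1) by blast
  have e: "e i \<in> D" using loc i by (auto simp: local_idempotents_def)
  {
    assume "unit_at D (e i) x"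
    then obtain y where y: "y \<in> D" "x \<otimes> y \<otimes> e i = e i" by (auto simp: unit_at_def)
    have xy: "x \<otimes> y \<ominus> \<one> \<in> D" using submoduleD(5)[OF D subcring_is_submodule[OF D]] Dc(3,6) x y(1) by blast
    have "(x \<otimes> y \<ominus> \<one>) \<otimes> e i = x \<otimes> y \<otimes> e i \<ominus> e i" using car[OF x] car[OF y(1)] car[OF e] by algebra
    also have "\<dots> = \<zero>" unfolding y(2) using car[OF e] by (simp add: r_neg a_minus_def)
    finally have "x \<otimes> y \<ominus> \<one> \<in> q" using prime_inD(3)[OF q(1) xy e] q(2) ideal_inD(2)[OF qi] by auto
    thus "\<exists>y\<in>D. cong_mod q (x \<otimes> y) \<one>" using y(1) by (auto simp: cong_mod_def)
  }
  assume "\<exists>y\<in>D. cong_mod q (x \<otimes> y) \<one>"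
  then obtain y where y: "y \<in> D" "x \<otimes> y \<ominus> \<one> \<in> q" by (auto simp: cong_mod_def)
  have xyD: "x \<otimes> y \<in> D" using Dc(6)[OF x y(1)] .
  have r: "\<ominus> (x \<otimes> y \<ominus> \<one>) \<in> q" by (rule ideal_in_minus(1)[OF D qi y(2)])
  hence rD: "\<ominus> (x \<otimes> y \<ominus> \<one>) \<in> D" using ideal_inD(1)[OF qi] by blast
  have "x \<otimes> y \<oplus> \<ominus> (x \<otimes> y \<ominus> \<one>) = \<one>" using car[OF x] car[OF y(1)] by algebra
  moreover have "unit_at D (e i) \<one>" using Dc(3) car[OF e] by (auto simp: unit_at_def intro!: bexI[of _ \<one>])
  ultimately have "unit_at D (e i) (x \<otimes> y \<oplus> \<ominus> (x \<otimes> y \<ominus> \<one>))" by simp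
  hence "unit_at D (e i) (x \<otimes> y) \<or> unit_at D (e i) (\<ominus> (x \<otimes> y \<ominus> \<one>))"
    using loc i xyD rD by (auto simp: local_idempotents_def)
  moreover have "\<not> unit_at D (e i) (\<ominus> (x \<otimes> y \<ominus> \<one>))"
  proof
    assume "unit_at D (e i) (\<ominus> (x \<otimes> y \<ominus> \<one>))"
    then obtain z where "z \<in> D" "\<ominus> (x \<otimes> y \<ominus> \<one>) \<otimes> z \<otimes> e i = e i" by (auto simp: unit_at_def)
    thus False using ideal_in_multr[OF D qi e ideal_in_multr[OF D qi _ r]] q(2) by metis
  qed
  ultimately obtain z where z: "z \<in> D" "x \<otimes> y \<otimes> z \<otimes> e i = e i" by (auto simp: unit_at_def)
  hence "x \<otimes> (y \<otimes> z) \<otimes> e i = e i" using car x y(1) by (simp add: m_assoc)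
  thus "unit_at D (e i) x" using Dc(6)[OF y(1) z(1)] by (auto simp: unit_at_def)
qed

lemma ex_idempotent_notin_prime:
  assumes D: "subcring D R" and loc: "local_idempotents n e D" and q: "prime_in q D"
  shows "\<exists>i<n. e i \<notin> q"
proof (rule ccontr)
  note qi = prime_inD(1)[OF q]
  assume "\<not> ?thesis"
  hence "(\<Oplus>i\<in>{..<n}. e i) \<in> q"
    using ideal_inD[OF qi] subcringE(1)[OF D] by (intro finsum_in_set) auto
  thus False using loc prime_inD(2)[OF q] by (simp add: local_idempotents_def)
qed

text \<open>
  The coefficients of \<open>f\<close> modulo \<open>q\<close> are those modulo \<open>q'\<close> shifted by \<open>\<delta>\<close>, so both residue rings
  are the same local ring, and the positions of the unit coefficients are shifted by \<open>\<delta>\<close> as well.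
\<close>

lemma coeff_shift_nonpos:
  assumes D: "subcring D R" and C: "subcring C R" "C \<subseteq> D" and loc: "local_idempotents n e D"
    and gen: "\<And>E x i. \<lbrakk>subcring E R; C \<subseteq> E; range f \<subseteq> E; x \<in> D; i < n\<rbrakk> \<Longrightarrow> \<exists>d\<in>E. x \<otimes> e i = d \<otimes> e i"
    and q: "prime_in q D" and q': "prime_in q' D" "q' \<inter> C = q \<inter> C"
    and f: "range f \<subseteq> D"
    and tr: "\<And>s::int. \<exists>t\<in>C - q. \<exists>r\<in>C. cong_mod q (t \<otimes> f s) r \<and> cong_mod q' (t \<otimes> f (s - \<delta>)) r"
    and norm: "\<And>i. i < n \<Longrightarrow> unit_at D (e i) (f 0)" "\<And>i s. \<lbrakk>i < n; s < 0\<rbrakk> \<Longrightarrow> \<not> unit_at D (e i) (f s)"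
  shows "\<delta> \<le> 0"
proof -
  note Dc = subcringE[OF D] and Cc = subcringE[OF C(1)] and qi = prime_inD(1)[OF q] and qi' = prime_inD(1)[OF q'(1)]
  have car: "y \<in> carrier R" if "y \<in> D" for y using that Dc(1) by blast
  \<comment> \<open>\<open>T\<close> relates residues modulo \<open>q\<close> and modulo
    \<open>q'\<close> that represent the same fraction \<open>r / t\<close> over the common residue
    ring of \<open>C\<close>. It is compatible with sums and products and contains the pairs of
    \<open>f s\<close> and \<open>f (s - \<delta>)\<close>.\<close>
  define T where "T y y' \<longleftrightarrow> y \<in> D \<and> y' \<in> D \<and> (\<exists>t\<in>C - q. \<exists>r\<in>C. cong_mod q (t \<otimes> y) r \<and> cong_mod q' (t \<otimes> y') r)" for y y'
  have Cm: "s \<otimes> t \<in> C - q" if "s \<in> C - q" "t \<in> C - q" for s t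
    using that prime_inD(3)[OF q, of s t] C(2) Cc(6) by blast
  have TC: "T x x" if "x \<in> C" for x
  proof -
    have "x \<in> D" using that C(2) by blast
    thus ?thesis unfolding T_def
      using Cc(3) prime_inD(2)[OF q] that cong_mod_refl[OF D qi] cong_mod_refl[OF D qi'] car
      by (intro conjI bexI[of _ \<one>] bexI[of _ x]) auto
  qed
  have Tadd: "T (x \<oplus> y) (x' \<oplus> y')" and Tmult: "T (x \<otimes> y) (x' \<otimes> y')" if xy: "T x x'" "T y y'" for x y x' y'
  proof -
    obtain s a where sa: "s \<in> C - q" "a \<in> C" "cong_mod q (s \<otimes> x) a" "cong_mod q' (s \<otimes> x') a"
      using xy(1) by (auto simp: T_def)
    obtain t b where tb: "t \<in> C - q" "b \<in> C" "cong_mod q (t \<otimes> y) b" "cong_mod q' (t \<otimes> y') b"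
      using xy(2) by (auto simp: T_def)
    have xyD: "x \<in> D" "x' \<in> D" "y \<in> D" "y' \<in> D" using xy by (auto simp: T_def)
    have stD: "s \<in> D" "t \<in> D" "a \<in> D" "b \<in> D" using sa tb C(2) by auto
    have eq: "s \<otimes> t \<otimes> (u \<oplus> v) = t \<otimes> (s \<otimes> u) \<oplus> s \<otimes> (t \<otimes> v)" "s \<otimes> t \<otimes> (u \<otimes> v) = (s \<otimes> u) \<otimes> (t \<otimes> v)"
      if "u \<in> D" "v \<in> D" for u v
      using car[OF that(1)] car[OF that(2)] car[OF stD(1)] car[OF stD(2)] by algebra+
    have step: "cong_mod p (s \<otimes> t \<otimes> (u \<oplus> v)) (t \<otimes> a \<oplus> s \<otimes> b) \<and> cong_mod p (s \<otimes> t \<otimes> (u \<otimes> v)) (a \<otimes> b)"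
      if p: "ideal_in p D" and uv: "u \<in> D" "v \<in> D" "cong_mod p (s \<otimes> u) a" "cong_mod p (t \<otimes> v) b" for p u v
    proof -
      note cm = cong_mod_mult[OF D p] and ca = cong_mod_add[OF D p] and cr = cong_mod_refl[OF D p]
      have m: "s \<otimes> u \<in> D" "t \<otimes> v \<in> D" using Dc(6) stD uv by auto
      have "cong_mod p (t \<otimes> (s \<otimes> u)) (t \<otimes> a)" "cong_mod p (s \<otimes> (t \<otimes> v)) (s \<otimes> b)"
        using cm[OF stD(2,2) m(1) stD(3) cr[OF stD(2)] uv(3)] cm[OF stD(1,1) m(2) stD(4) cr[OF stD(1)] uv(4)] .
      hence "cong_mod p (t \<otimes> (s \<otimes> u) \<oplus> s \<otimes> (t \<otimes> v)) (t \<otimes> a \<oplus> s \<otimes> b)"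
        by (intro ca) (use Dc(6) stD m in auto)
      moreover have "cong_mod p ((s \<otimes> u) \<otimes> (t \<otimes> v)) (a \<otimes> b)" by (rule cm[OF m(1) stD(3) m(2) stD(4) uv(3,4)])
      ultimately show ?thesis using eq[OF uv(1,2)] by simp
    qed
    note st = Cm[OF sa(1) tb(1)]
    note s1 = step[OF qi xyD(1,3) sa(3) tb(3)] and s2 = step[OF qi' xyD(2,4) sa(4) tb(4)]
    have "t \<otimes> a \<oplus> s \<otimes> b \<in> C" "a \<otimes> b \<in> C" using sa tb Cc(6,7) by auto
    thus "T (x \<oplus> y) (x' \<oplus> y')" "T (x \<otimes> y) (x' \<otimes> y')"
      unfolding T_def using st s1 s2 Dc(6,7) xyD by blast+
  qed
  define Y where "Y = {y \<in> D. \<exists>y'. T y y'}"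
  have Y: "subcring Y R"
  proof (rule subcringI'[OF subringI])
    show "Y \<subseteq> carrier R" using car by (auto simp: Y_def)
    show "\<one> \<in> Y" using TC[OF Cc(3)] Dc(3) by (auto simp: Y_def)
    fix h assume h: "h \<in> Y"
    then obtain h' where "h \<in> D" "T h h'" by (auto simp: Y_def)
    hence "T (\<ominus> \<one> \<otimes> h) (\<ominus> \<one> \<otimes> h')" "\<ominus> \<one> \<otimes> h \<in> D"
      using Tmult[OF TC[OF subcring_uminus_one[OF C(1)]]] Dc(6) subcring_uminus_one[OF D] by blast+
    moreover have "\<ominus> \<one> \<otimes> h = \<ominus> h" using car[OF \<open>h \<in> D\<close>] l_minus[of \<one> h] by simp
    ultimately show "\<ominus> h \<in> Y" by (auto simp: Y_def)
    fix k assume "k \<in> Y"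
    thus "h \<otimes> k \<in> Y" "h \<oplus> k \<in> Y" using h Tadd Tmult Dc(6,7) unfolding Y_def by blast+
  qed
  have CY: "C \<subseteq> Y" using TC C(2) by (auto simp: Y_def)
  have Tf: "T (f s) (f (s - \<delta>))" for s using tr[of s] f by (auto simp: T_def)
  hence fY: "range f \<subseteq> Y" using f by (auto simp: Y_def)
  obtain i where i: "i < n" "e i \<notin> q" using ex_idempotent_notin_prime[OF D loc q] by blast
  obtain i' where i': "i' < n" "e i' \<notin> q'" using ex_idempotent_notin_prime[OF D loc q'(1)] by blast
  have eD: "e i \<in> D" using loc i(1) by (auto simp: local_idempotents_def)
  \<comment> \<open>The domain \<open>Y\<close> of \<open>T\<close> is a subring with
    \<open>C\<close> and the coefficients of \<open>f\<close> in it, so by \<open>gen\<close> it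
    fills the factor of \<open>e i\<close>, and modulo \<open>q\<close> nothing else is
    left.\<close>
  have total: "\<exists>y'. T y y'" if y: "y \<in> D" for y
  proof -
    obtain d where d: "d \<in> Y" "y \<otimes> e i = d \<otimes> e i" using gen[OF Y CY fY y i(1)] by blast
    then obtain d' where d': "T d d'" by (auto simp: Y_def)
    have dD: "d \<in> D" using d(1) by (simp add: Y_def)
    have "(y \<ominus> d) \<otimes> e i = y \<otimes> e i \<ominus> d \<otimes> e i" using car[OF y] car[OF dD] car[OF eD] by algebra
    also have "\<dots> = \<zero>" unfolding d(2) using car[OF dD] car[OF eD] by (simp add: r_neg a_minus_def)
    finally have "y \<ominus> d \<in> q"
      using prime_inD(3)[OF q _ eD, of "y \<ominus> d"] submoduleD(5)[OF D subcring_is_submodule[OF D] y dD] i(2) ideal_inD(2)[OF qi] by auto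
    hence yd: "cong_mod q y d" by (simp add: cong_mod_def)
    obtain t r where tr: "t \<in> C - q" "r \<in> C" "cong_mod q (t \<otimes> d) r" "cong_mod q' (t \<otimes> d') r"
      using d' by (auto simp: T_def)
    have tD: "t \<in> D" "r \<in> D" using tr C(2) by auto
    have "cong_mod q (t \<otimes> y) (t \<otimes> d)" by (rule cong_mod_mult[OF D qi tD(1,1) y dD cong_mod_refl[OF D qi tD(1)] yd])
    hence "cong_mod q (t \<otimes> y) r" using cong_mod_trans[OF D qi _ _ tD(2) _ tr(3)] Dc(6) tD y dD by blast
    thus ?thesis using tr d' y by (auto simp: T_def)
  qed
  \<comment> \<open>The inverse of \<open>f 0\<close> modulo \<open>q\<close> has a partner
    \<open>y'\<close>, which inverts \<open>f (- \<delta>)\<close> modulo \<open>q'\<close>. By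
    \<open>norm\<close> a unit coefficient cannot stand in negative degree.\<close>
  have "\<exists>y\<in>D. cong_mod q (f 0 \<otimes> y) \<one>"
    using unit_at_iff_unit_mod[OF D loc i(1) q i(2)] norm(1)[OF i(1)] f by blast
  then obtain y where y: "y \<in> D" "cong_mod q (f 0 \<otimes> y) \<one>" by blast
  obtain y' where y': "T y y'" using total[OF y(1)] by blast
  have yD': "y' \<in> D" using y' by (simp add: T_def)
  have "T (f 0 \<otimes> y) (f (0 - \<delta>) \<otimes> y')" by (rule Tmult[OF Tf y'])
  then obtain t r where t: "t \<in> C - q" "r \<in> C" "cong_mod q (t \<otimes> (f 0 \<otimes> y)) r" "cong_mod q' (t \<otimes> (f (- \<delta>) \<otimes> y')) r"
    by (auto simp: T_def)
  have tD: "t \<in> D" "r \<in> D" using t C(2) by auto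
  have fD: "f s \<in> D" for s using f by blast
  have fy: "f 0 \<otimes> y \<in> D" "f (- \<delta>) \<otimes> y' \<in> D" using Dc(6) fD y(1) yD' by auto
  have "cong_mod q (t \<otimes> (f 0 \<otimes> y)) (t \<otimes> \<one>)"
    by (rule cong_mod_mult[OF D qi tD(1,1) fy(1) Dc(3) cong_mod_refl[OF D qi tD(1)] y(2)])
  hence "cong_mod q t (t \<otimes> (f 0 \<otimes> y))"
    using cong_mod_sym[OF D qi, of "t \<otimes> (f 0 \<otimes> y)" t] Dc(6) tD fy car[OF tD(1)] by simp
  hence "cong_mod q t r" using cong_mod_trans[OF D qi tD(1) _ tD(2) _ t(3)] Dc(6) tD fy by blast
  moreover have "t \<ominus> r \<in> C" using submoduleD(5)[OF C(1) subcring_is_submodule[OF C(1)]] t by blast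
  ultimately have "t \<ominus> r \<in> q'" using q'(2) by (auto simp: cong_mod_def)
  hence "cong_mod q' t r" by (simp add: cong_mod_def)
  hence "cong_mod q' (t \<otimes> (f (- \<delta>) \<otimes> y')) t"
    using cong_mod_trans[OF D qi' _ tD(2) tD(1) t(4)] cong_mod_sym[OF D qi' tD] Dc(6) tD fy by blast
  hence "t \<otimes> (f (- \<delta>) \<otimes> y') \<ominus> t \<in> q'" by (simp add: cong_mod_def)
  moreover have "t \<otimes> (f (- \<delta>) \<otimes> y') \<ominus> t = t \<otimes> (f (- \<delta>) \<otimes> y' \<ominus> \<one>)"
    using car[OF tD(1)] car[OF fD] car[OF yD'] by algebra
  ultimately have "t \<otimes> (f (- \<delta>) \<otimes> y' \<ominus> \<one>) \<in> q'" by simp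
  moreover have "f (- \<delta>) \<otimes> y' \<ominus> \<one> \<in> D" using submoduleD(5)[OF D subcring_is_submodule[OF D] fy(2) Dc(3)] .
  moreover have "t \<notin> q'" using t(1) q'(2) by blast
  ultimately have "f (- \<delta>) \<otimes> y' \<ominus> \<one> \<in> q'" using prime_inD(3)[OF q'(1) tD(1)] by blast
  hence "unit_at D (e i') (f (- \<delta>))"
    using unit_at_iff_unit_mod[OF D loc i'(1) q'(1) i'(2) fD] yD' by (auto simp: cong_mod_def)
  thus ?thesis using norm(2)[OF i'(1), of "- \<delta>"] by linarith
qed

text \<open>Suppose that the coefficients generate a ring \<open>E\<close> larger than
  \<open>C1\<close>. All primes of \<open>D\<close> that contain \<open>N'\<close> and miss
  \<open>S\<close> have the same contraction to \<open>C1\<close>. An element \<open>w\<close> of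
  \<open>J'\<close> that is the constant \<open>\<tau>\<close> modulo one of them is
  \<open>\<tau>\<close> times a power of \<open>X\<close> modulo any other, and the normalisation of
  \<open>f\<close> makes this power trivial. So \<open>\<tau> \<otimes> f s\<close> agrees with a
  coefficient of \<open>f w\<close> modulo all these primes, hence modulo \<open>N'\<close>, and an
  element of \<open>S\<close> multiplies every \<open>f s\<close> into \<open>C1\<close>. A power of
  it multiplies all of \<open>E\<close> into \<open>C1\<close> and thus lies in the conductor, which
  \<open>S\<close> avoids.\<close>

lemma coeffs_in_closed_subring:
  assumes A: "subcring A R" and C: "subcring C R" "A \<subseteq> C"
    and closed: "\<And>b. \<lbrakk>b \<in> carrier R; b \<otimes> b \<in> C; b \<otimes> b \<otimes> b \<in> C\<rbrakk> \<Longrightarrow> b \<in> C"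
    and D: "subcring D R" "A \<subseteq> D" and loc: "local_idempotents n e D"
    and J: "subalgebra (laurent_sub A R) J (laurent R)" "J \<subseteq> laurent_sub D R"
    and J': "subalgebra (laurent_sub A R) J' (laurent R)" "J' \<subseteq> laurent_sub D R"
    and JJ': "ideal_prod (laurent R) J J' = laurent_sub A R"
    and ev: "laurent_eval R ` J' \<subseteq> A"
    and x1: "x1 \<in> J" "laurent_eval R x1 = \<one>" and y1: "y1 \<in> J'" "laurent_eval R y1 = \<one>"
    and f: "f \<in> J" "\<one> \<in> ideal_prod R A (range f)" and g: "g \<in> J'" "\<one> \<in> ideal_prod R A (range g)"
    and gen: "\<And>E x i. \<lbrakk>subcring E R; A \<subseteq> E; range f \<subseteq> E; x \<in> D; i < n\<rbrakk> \<Longrightarrow> \<exists>d\<in>E. x \<otimes> e i = d \<otimes> e i"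
    and norm: "\<And>i. i < n \<Longrightarrow> unit_at D (e i) (f 0)" "\<And>i s. \<lbrakk>i < n; s < 0\<rbrakk> \<Longrightarrow> \<not> unit_at D (e i) (f s)"
  shows "range f \<subseteq> C" "range g \<subseteq> C"
proof -
  interpret L: cring "laurent R" by (rule laurent_cring)
  let ?L = "laurent R"
  note Dc = subcringE[OF D(1)] and Ac = subcringE[OF A]
  \<comment> \<open>\<open>C\<close> need not lie in \<open>D\<close>, where the idempotents and the
    primes live. Closedness under common square and cube roots survives for elements of
    \<open>D\<close>.\<close>
  define C1 where "C1 = C \<inter> D"
  have C1: "subcring C1 R"
  proof (rule subcringI'[OF subringI])
    show "C1 \<subseteq> carrier R" "\<one> \<in> C1" using Dc(1,3) subcringE(3)[OF C(1)] by (auto simp: C1_def)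
    show "\<ominus> h \<in> C1" if "h \<in> C1" for h using that subcringE(5)[OF C(1)] Dc(5) by (simp add: C1_def)
    fix h k assume "h \<in> C1" "k \<in> C1"
    thus "h \<otimes> k \<in> C1" "h \<oplus> k \<in> C1" using subcringE(6,7)[OF C(1)] Dc(6,7) by (auto simp: C1_def)
  qed
  have AC1: "A \<subseteq> C1" "C1 \<subseteq> D" using C(2) D(2) by (auto simp: C1_def)
  have fD: "f \<in> laurent_sub D R" and gD: "g \<in> laurent_sub D R" using f(1) g(1) J(2) J'(2) by auto
  have fc: "f \<in> carrier ?L" "\<And>s. f s \<in> D" and gc: "g \<in> carrier ?L" "\<And>s. g s \<in> D"
    using fD gD laurent_sub_iff[OF Dc(1)] by auto
  have fg: "f \<otimes>\<^bsub>?L\<^esub> g \<in> laurent_sub A R" using JJ' ideal_prod.prod[OF f(1) g(1), of ?L] by simp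
  have "laurent_sub A R \<subseteq> laurent_sub C1 R"
    using AC1(1) laurent_sub_iff[OF Ac(1)] laurent_sub_iff[OF subcringE(1)[OF C1]] by blast
  hence fg1: "f \<otimes>\<^bsub>?L\<^esub> g \<in> laurent_sub C1 R" using fg by blast
  have f1: "\<one> \<in> ideal_prod R C1 (range f)" and g1: "\<one> \<in> ideal_prod R C1 (range g)"
    using ideal_prod_mono[OF AC1(1) order_refl] f(2) g(2) by blast+
  obtain N where N: "subcring (content_pow R C1 f N) R" "C1 \<subseteq> content_pow R C1 f N"
    "range f \<subseteq> content_pow R C1 f N" "range g \<subseteq> content_pow R C1 f N"
    using content_ring[OF C1 fc(1) gc(1) fg1 f1 g1] by blast
  define E where "E = content_pow R C1 f N"
  have E: "subcring E R" "C1 \<subseteq> E" "range f \<subseteq> E" "range g \<subseteq> E" using N by (simp_all add: E_def)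
  have ED: "E \<subseteq> D" unfolding E_def by (rule subcring_contains_content_pow[OF D(1) AC1(2)]) (use fc in auto)
  have "E \<subseteq> C1"
  proof (rule ccontr)
    assume ne: "\<not> E \<subseteq> C1"
    have cl: "b \<in> C1" if "b \<in> E" "b \<otimes> b \<in> C1" "b \<otimes> b \<otimes> b \<in> C1" for b
      using closed[of b] that ED Dc(1) by (auto simp: C1_def)
    obtain S N' where S: "S \<subseteq> C1" "\<one> \<in> S" "\<And>s t. \<lbrakk>s \<in> S; t \<in> S\<rbrakk> \<Longrightarrow> s \<otimes> t \<in> S"
      and N': "ideal_in N' E" "N' \<inter> S = {}" and NC: "\<And>x. \<lbrakk>x \<in> C1; x \<notin> S\<rbrakk> \<Longrightarrow> x \<in> N'"
      and Nr: "\<And>x. \<lbrakk>x \<in> E; x \<otimes> x \<in> N'\<rbrakk> \<Longrightarrow> x \<in> N'" "\<And>s x. \<lbrakk>s \<in> S; x \<in> E; s \<otimes> x \<in> N'\<rbrakk> \<Longrightarrow> x \<in> N'"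
      and Ns: "\<And>x. x \<in> N' \<Longrightarrow> \<exists>s\<in>S. s \<otimes> x \<in> C1"
      and Nc: "\<And>x. \<lbrakk>x \<in> E; \<forall>y\<in>E. x \<otimes> y \<in> C1\<rbrakk> \<Longrightarrow> x \<in> N'"
      by (rule ex_localised_conductor[OF C1 E(1,2) cl ne]; (assumption | rule that))
    have SE: "S \<subseteq> E" using S(1) E(2) by blast
    have genE: "\<exists>d\<in>E'. x \<otimes> e i = d \<otimes> e i" if "subcring E' R" "C1 \<subseteq> E'" "range f \<subseteq> E'" "x \<in> D" "i < n" for E' x i
      using gen[OF that(1) _ that(3-5)] that(2) AC1(1) by blast
    have eD: "\<And>i. i < n \<Longrightarrow> e i \<in> D" "(\<Oplus>i\<in>{..<n}. e i) = \<one>"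
      using loc by (auto simp: local_idempotents_def)
    have primes: "\<exists>q. prime_in q D \<and> N' \<subseteq> q \<and> q \<inter> S = {} \<and> z \<notin> q" if "z \<in> E" "z \<notin> N'" for z
      by (rule ex_prime_over_localised_conductor[OF D(1) E(1) ED eD genE[OF E(1-3)] SE S(2,3) N' Nr that])
    have qC: "q \<inter> C1 = C1 - S" if "N' \<subseteq> q" "q \<inter> S = {}" for q using that NC S(1) by blast
    have "\<one> \<in> E" "\<one> \<notin> N'" using S(2) SE N'(2) by auto
    then obtain q where q: "prime_in q D" "N' \<subseteq> q" "q \<inter> S = {}" using primes by blast
    have J'J: "ideal_prod ?L J' J = laurent_sub A R"
      using JJ' L.ideal_prod_commute_sets[OF L.submoduleD(1)[OF laurent_sub_subcring[OF A] J(1)]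
        L.submoduleD(1)[OF laurent_sub_subcring[OF A] J'(1)]] by simp
    obtain w \<tau> where w: "w \<in> J'" "\<tau> \<in> A" "\<tau> \<notin> q" "cong_mod q (w 0) \<tau>" "\<And>i. i \<noteq> 0 \<Longrightarrow> w i \<in> q"
      using ex_const_mod_prime[OF A D q(1) J' J J'J y1] by blast
    obtain v \<rho> where v: "v \<in> J" "\<rho> \<in> A" "\<rho> \<notin> q" "cong_mod q (v 0) \<rho>" "\<And>i. i \<noteq> 0 \<Longrightarrow> v i \<in> q"
      using ex_const_mod_prime[OF A D q(1) J J' JJ' x1] by blast
    have wD: "w \<in> laurent_sub D R" and vD: "v \<in> laurent_sub D R" using w(1) v(1) J(2) J'(2) by auto
    have vw: "v \<otimes>\<^bsub>?L\<^esub> w \<in> laurent_sub A R" using JJ' ideal_prod.prod[OF v(1) w(1), of ?L] by simp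
    have "f \<otimes>\<^bsub>?L\<^esub> w \<in> laurent_sub A R" using JJ' ideal_prod.prod[OF f(1) w(1), of ?L] by simp
    hence fwA: "(f \<otimes>\<^bsub>?L\<^esub> w) s \<in> A" for s using laurent_sub_iff[OF Ac(1)] by blast
    have \<tau>: "\<tau> \<in> D" "\<tau> \<in> S" "\<tau> \<in> C1" using w(2,3) D(2) AC1(1) qC[OF q(2,3)] by blast+
    have key: "cong_mod q' (\<tau> \<otimes> f s) ((f \<otimes>\<^bsub>?L\<^esub> w) s)" if q': "prime_in q' D" "N' \<subseteq> q'" "q' \<inter> S = {}" for q' s
    proof -
      have qq: "q' \<inter> C1 = q \<inter> C1" using qC q q' by simp
      hence qA: "q' \<inter> A = q \<inter> A" using AC1(1) by blast
      have "laurent_eval R w \<in> A" using ev w(1) by blast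
      then obtain \<delta> where d: "cong_mod q' (w \<delta>) \<tau>" "\<And>i. i \<noteq> \<delta> \<Longrightarrow> w i \<in> q'"
        using const_mod_other_prime[OF A D q(1) q'(1) qA vD v(2-5) wD w(2-5) vw] by blast
      note m' = coeff_mult_monomial_mod[OF D(1) prime_inD(1)[OF q'(1)] fD wD \<tau>(1) d]
      note m = coeff_mult_monomial_mod[OF D(1) prime_inD(1)[OF q(1)] fD wD \<tau>(1) w(4,5), simplified]
      have \<tau>q': "\<tau> \<notin> q'" using \<tau>(2) q'(3) by blast
      have fwC: "(f \<otimes>\<^bsub>?L\<^esub> w) s \<in> C1" for s using fwA AC1(1) by blast
      \<comment> \<open>The comparison is made in both directions: from \<open>q\<close> to
        \<open>q'\<close> with shift \<open>\<delta>\<close>, and back with the opposite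
        shift.\<close>
      have "\<delta> \<le> 0"
      proof (rule coeff_shift_nonpos[where f = f and \<delta> = \<delta>, OF D(1) C1 AC1(2) loc genE q(1) q'(1) qq])
        show "range f \<subseteq> D" using fc(2) by blast
        show "\<exists>t\<in>C1 - q. \<exists>r\<in>C1. cong_mod q (t \<otimes> f s) r \<and> cong_mod q' (t \<otimes> f (s - \<delta>)) r" for s
          using m[of s] m'[of s] \<tau>(3) w(3) fwC by blast
      qed (use norm in auto)
      moreover have "- \<delta> \<le> 0"
      proof (rule coeff_shift_nonpos[where f = f and \<delta> = "- \<delta>", OF D(1) C1 AC1(2) loc genE q'(1) q(1) qq[symmetric]])
        show "range f \<subseteq> D" using fc(2) by blast
      next
        fix s
        have "cong_mod q' (\<tau> \<otimes> f s) ((f \<otimes>\<^bsub>?L\<^esub> w) (s + \<delta>))" using m'[of "s + \<delta>"] by simp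
        moreover have "cong_mod q (\<tau> \<otimes> f (s - - \<delta>)) ((f \<otimes>\<^bsub>?L\<^esub> w) (s + \<delta>))" using m[of "s + \<delta>"] by simp
        ultimately show "\<exists>t\<in>C1 - q'. \<exists>r\<in>C1. cong_mod q' (t \<otimes> f s) r \<and> cong_mod q (t \<otimes> f (s - - \<delta>)) r"
          using \<tau>(3) \<tau>q' fwC by blast
      qed (use norm in auto)
      ultimately have "\<delta> = 0" by simp
      thus ?thesis using m'[of s] by simp
    qed
    have ex: "\<exists>t\<in>S. t \<otimes> f s \<in> C1" for s
    proof -
      define z where "z = \<tau> \<otimes> f s \<ominus> (f \<otimes>\<^bsub>?L\<^esub> w) s"
      have fE: "f s \<in> E" "\<tau> \<in> E" "(f \<otimes>\<^bsub>?L\<^esub> w) s \<in> E" using E \<tau>(3) fwA AC1(1) by blast+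
      have zE: "z \<in> E" unfolding z_def
        using submoduleD(5)[OF E(1) subcring_is_submodule[OF E(1)] subcringE(6)[OF E(1) fE(2,1)] fE(3)] .
      have "z \<in> N'" using primes[OF zE] key unfolding z_def cong_mod_def by blast
      then obtain s1 where s1: "s1 \<in> S" "s1 \<otimes> z \<in> C1" using Ns by blast
      have cc: "s1 \<in> carrier R" "\<tau> \<in> carrier R" "f s \<in> carrier R" "(f \<otimes>\<^bsub>?L\<^esub> w) s \<in> carrier R"
        using s1(1) SE fE subcringE(1)[OF E(1)] by blast+
      have eq: "a \<otimes> b \<otimes> c = a \<otimes> (b \<otimes> c \<ominus> d) \<oplus> a \<otimes> d"
        if "a \<in> carrier R" "b \<in> carrier R" "c \<in> carrier R" "d \<in> carrier R" for a b c d using that by algebra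
      have "s1 \<otimes> \<tau> \<otimes> f s = s1 \<otimes> z \<oplus> s1 \<otimes> (f \<otimes>\<^bsub>?L\<^esub> w) s" unfolding z_def by (rule eq[OF cc])
      moreover have "s1 \<otimes> (f \<otimes>\<^bsub>?L\<^esub> w) s \<in> C1" using subcringE(6)[OF C1] s1(1) S(1) fwA AC1(1) by blast
      ultimately have "s1 \<otimes> \<tau> \<otimes> f s \<in> C1" using subcringE(7)[OF C1 s1(2)] by simp
      thus ?thesis using S(3)[OF s1(1) \<tau>(2)] by blast
    qed
    have Scar: "s \<in> carrier R" if "s \<in> S" for s using that SE subcringE(1)[OF E(1)] by blast
    have fcar: "f s \<in> carrier R" for s using fc(2) Dc(1) by blast
    have "finite F \<Longrightarrow> \<exists>t\<in>S. \<forall>s\<in>F. t \<otimes> f s \<in> C1" for F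
    proof (induction F rule: finite_induct)
      case (insert s F)
      obtain t where t: "t \<in> S" "\<forall>s\<in>F. t \<otimes> f s \<in> C1" using insert by blast
      obtain u where u: "u \<in> S" "u \<otimes> f s \<in> C1" using ex by blast
      have "t \<otimes> u \<otimes> f s = t \<otimes> (u \<otimes> f s)" "t \<otimes> u \<otimes> f k = u \<otimes> (t \<otimes> f k)" for k
        using Scar t(1) u(1) fcar by (simp_all add: m_ac)
      hence "\<forall>k\<in>insert s F. t \<otimes> u \<otimes> f k \<in> C1" using t u S(1) subcringE(6)[OF C1] by auto
      thus ?case using S(3)[OF t(1) u(1)] by blast
    qed (use S(2) in auto)
    from this[OF laurent_finite_support[OF fc(1)]] obtain t where
      t: "t \<in> S" "\<And>s. f s \<noteq> \<zero> \<Longrightarrow> t \<otimes> f s \<in> C1" by blast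
    have tf: "t \<otimes> f s \<in> C1" for s
      using t(2)[of s] Scar[OF t(1)] subcringE(2)[OF C1] by (cases "f s = \<zero>") auto
    \<comment> \<open>\<open>E\<close> is generated as a module over \<open>C1\<close> by products
      of \<open>N\<close> coefficients, so \<open>t [^] N\<close> clears all its denominators at
      once.\<close>
    have tpow: "x \<in> content_pow R C1 f k \<Longrightarrow> t [^] k \<otimes> x \<in> C1" for x k
    proof (induction k arbitrary: x)
      case 0 thus ?case using subcringE(1)[OF C1] by auto
    next
      case (Suc k)
      note sub = submoduleD(1)[OF C1 content_pow_submodule[where f = f, OF C1 fcar]]
      from Suc(2) show ?case unfolding content_pow.simps
      proof (induction rule: ideal_prod.induct)
        case (prod y x)
        then obtain s where "y = f s" by blast
        have eq: "a \<otimes> b \<otimes> (c \<otimes> d) = (b \<otimes> c) \<otimes> (a \<otimes> d)"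
          if "a \<in> carrier R" "b \<in> carrier R" "c \<in> carrier R" "d \<in> carrier R" for a b c d using that by algebra
        have "t [^] Suc k \<otimes> (y \<otimes> x) = (t \<otimes> f s) \<otimes> (t [^] k \<otimes> x)"
          unfolding nat_pow_Suc \<open>y = f s\<close> by (rule eq) (use Scar[OF t(1)] fcar sub prod(2) in auto)
        thus ?case using subcringE(6)[OF C1 tf Suc(1)[OF prod(2)]] by simp
      next
        case (sum x y)
        have "x \<in> carrier R" "y \<in> carrier R" using sum(1,2) sub[of "Suc k"] by auto
        hence "t [^] Suc k \<otimes> (x \<oplus> y) = t [^] Suc k \<otimes> x \<oplus> t [^] Suc k \<otimes> y"
          using Scar[OF t(1)] by (intro r_distr) auto
        thus ?case using subcringE(7)[OF C1 sum(3,4)] by simp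
      qed
    qed
    have tS: "t [^] k \<in> S" for k :: nat using t(1) S(2,3) by (induction k) auto
    have "t [^] N \<in> N'" using Nc[of "t [^] N"] tpow tS SE by (auto simp: E_def)
    thus False using tS N'(2) by blast
  qed
  thus "range f \<subseteq> C" "range g \<subseteq> C" using E(3,4) by (auto simp: C1_def)
qed

section \<open>Multiples of modules, twists by idempotents, and elements with enough
  coefficients\<close>

lemma unit_mult_submodule:
  assumes A: "subcring A R" and I: "subalgebra A I R" and v: "v \<in> carrier R"
  shows "subalgebra A ((\<otimes>) v ` I) R"
proof (rule submoduleI[OF A])
  note ID = submoduleD[OF A I]
  show "(\<otimes>) v ` I \<subseteq> carrier R" using v ID(1) by auto
  have "v \<otimes> \<zero> \<in> (\<otimes>) v ` I" using ID(2) by blast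
  thus "\<zero> \<in> (\<otimes>) v ` I" using v by simp
  fix x y assume "x \<in> (\<otimes>) v ` I" "y \<in> (\<otimes>) v ` I"
  then obtain a b where ab: "a \<in> I" "b \<in> I" "x = v \<otimes> a" "y = v \<otimes> b" by blast
  hence "x \<oplus> y = v \<otimes> (a \<oplus> b)" using v ID(1) by (simp add: r_distr subset_iff)
  thus "x \<oplus> y \<in> (\<otimes>) v ` I" using ID(3)[OF ab(1,2)] by blast
next
  note ID = submoduleD[OF A I]
  fix c x assume c: "c \<in> A" and "x \<in> (\<otimes>) v ` I"
  then obtain a where a: "a \<in> I" "x = v \<otimes> a" by blast
  hence "c \<otimes> x = v \<otimes> (c \<otimes> a)" using v ID(1) c subcringE(1)[OF A] by (simp add: m_lcomm subset_iff)
  thus "c \<otimes> x \<in> (\<otimes>) v ` I" using ID(4)[OF c a(1)] by blast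
qed

lemma ideal_prod_image_mult:
  assumes I: "I \<subseteq> carrier R" and J: "J \<subseteq> carrier R" and uv: "u \<in> carrier R" "v \<in> carrier R"
  shows "ideal_prod R ((\<otimes>) u ` I) ((\<otimes>) v ` J) = (\<otimes>) (u \<otimes> v) ` ideal_prod R I J"
proof
  have IJ: "ideal_prod R I J \<subseteq> carrier R" by (rule ideal_prod_carrier[OF I J])
  have eq: "u \<otimes> i \<otimes> (v \<otimes> j) = u \<otimes> v \<otimes> (i \<otimes> j)" if "i \<in> I" "j \<in> J" for i j
    using that I J uv by (simp add: m_ac subset_iff)
  show "ideal_prod R ((\<otimes>) u ` I) ((\<otimes>) v ` J) \<subseteq> (\<otimes>) (u \<otimes> v) ` ideal_prod R I J"
  proof (rule ideal_prod_subset)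
    fix i j assume "i \<in> (\<otimes>) u ` I" "j \<in> (\<otimes>) v ` J"
    thus "i \<otimes> j \<in> (\<otimes>) (u \<otimes> v) ` ideal_prod R I J" using eq by (auto intro!: imageI ideal_prod.prod)
  next
    fix x y assume "x \<in> (\<otimes>) (u \<otimes> v) ` ideal_prod R I J" "y \<in> (\<otimes>) (u \<otimes> v) ` ideal_prod R I J"
    then obtain a b where ab: "a \<in> ideal_prod R I J" "b \<in> ideal_prod R I J" "x = u \<otimes> v \<otimes> a" "y = u \<otimes> v \<otimes> b" by blast
    hence "x \<oplus> y = u \<otimes> v \<otimes> (a \<oplus> b)" using uv IJ by (simp add: r_distr subset_iff)
    thus "x \<oplus> y \<in> (\<otimes>) (u \<otimes> v) ` ideal_prod R I J" using ideal_prod.sum[OF ab(1,2)] by blast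
  qed
  have "u \<otimes> v \<otimes> x \<in> ideal_prod R ((\<otimes>) u ` I) ((\<otimes>) v ` J)" if "x \<in> ideal_prod R I J" for x
    using that
  proof (induction rule: ideal_prod.induct)
    case (prod i j)
    thus ?case using eq[OF prod] by (metis ideal_prod.prod imageI)
  next
    case (sum s t)
    hence "u \<otimes> v \<otimes> (s \<oplus> t) = u \<otimes> v \<otimes> s \<oplus> u \<otimes> v \<otimes> t" using uv IJ by (simp add: r_distr subset_iff)
    thus ?case using sum by (simp add: ideal_prod.sum)
  qed
  thus "(\<otimes>) (u \<otimes> v) ` ideal_prod R I J \<subseteq> ideal_prod R ((\<otimes>) u ` I) ((\<otimes>) v ` J)" by blast
qed

lemma eq_by_idempotents:
  assumes e: "\<And>i. i < (n::nat) \<Longrightarrow> e i \<in> carrier R" "(\<Oplus>i\<in>{..<n}. e i) = \<one>"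
    and xy: "x \<in> carrier R" "y \<in> carrier R" "\<And>i. i < n \<Longrightarrow> x \<otimes> e i = y \<otimes> e i"
  shows "x = y"
proof -
  have *: "z = (\<Oplus>i\<in>{..<n}. z \<otimes> e i)" if "z \<in> carrier R" for z
  proof -
    have "z = z \<otimes> (\<Oplus>i\<in>{..<n}. e i)" using e(2) that by simp
    also have "\<dots> = (\<Oplus>i\<in>{..<n}. z \<otimes> e i)" by (rule finsum_rdistr) (use e(1) that in auto)
    finally show ?thesis .
  qed
  have "(\<Oplus>i\<in>{..<n}. x \<otimes> e i) = (\<Oplus>i\<in>{..<n}. y \<otimes> e i)"
    by (rule finsum_cong') (use xy e(1) in auto)
  thus ?thesis using *[OF xy(1)] *[OF xy(2)] by simp
qed

text \<open>The element is the sum of the monomials \<open>e i X^(k i)\<close>. It acts on the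
  factor of \<open>e i\<close> as the shift by \<open>k i\<close>, so degrees can be changed in each
  factor independently, and its value at \<open>X = 1\<close> is the sum of the idempotents.\<close>

lemma ex_twist:
  assumes D: "subcring D R"
    and e: "\<And>i. i < (n::nat) \<Longrightarrow> e i \<in> D" "\<And>i. i < n \<Longrightarrow> e i \<otimes> e i = e i"
      "\<And>i j. \<lbrakk>i < n; j < n; i \<noteq> j\<rbrakk> \<Longrightarrow> e i \<otimes> e j = \<zero>" "(\<Oplus>i\<in>{..<n}. e i) = \<one>"
  shows "\<exists>u\<in>laurent_sub D R. laurent_eval R u = \<one> \<and>
    (\<forall>x\<in>carrier (laurent R). \<forall>s. \<forall>i<n. (u \<otimes>\<^bsub>laurent R\<^esub> x) s \<otimes> e i = x (s - k i) \<otimes> e i)"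
proof -
  interpret L: cring "laurent R" by (rule laurent_cring)
  let ?L = "laurent R"
  note Dc = subcringE[OF D]
  note DL = laurent_sub_subcring[OF D]
  have ec: "e i \<in> carrier R" if "i < n" for i using e(1)[OF that] Dc(1) by blast
  define mo where "mo i = laurent_monom R (e i) (k i)" for i
  have mo: "mo i \<in> laurent_sub D R" "mo i \<in> carrier ?L" if "i < n" for i
    unfolding mo_def using laurent_monom_closed[OF D e(1)[OF that]] laurent_monom_carrier[OF ec[OF that]] by auto
  define U where "U m = finsum ?L mo {..<m}" for m
  have U: "U m \<in> laurent_sub D R \<and> laurent_eval R (U m) = (\<Oplus>i\<in>{..<m}. e i) \<and>
    (\<forall>x\<in>carrier ?L. \<forall>s. \<forall>i<n. (U m \<otimes>\<^bsub>?L\<^esub> x) s \<otimes> e i = (if i < m then x (s - k i) \<otimes> e i else \<zero>))"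
    if "m \<le> n" for m
    using that
  proof (induction m)
    case 0
    have "U 0 = \<zero>\<^bsub>?L\<^esub>" by (simp add: U_def)
    moreover have "laurent_eval R \<zero>\<^bsub>?L\<^esub> = \<zero>"
      by (simp add: laurent_eval_def laurent_zero_coeff)
    moreover have "(\<zero>\<^bsub>?L\<^esub> \<otimes>\<^bsub>?L\<^esub> x) s \<otimes> e i = \<zero>" if "x \<in> carrier ?L" "i < n" for x s i
      using L.l_null[OF that(1)] ec[OF that(2)] fun_cong[of _ _ s] laurent_zero_coeff[of R s] by simp
    ultimately show ?case using subcringE(2)[OF DL] by simp
  next
    case (Suc m)
    hence m: "m < n" and IH: "U m \<in> laurent_sub D R" "laurent_eval R (U m) = (\<Oplus>i\<in>{..<m}. e i)"
      "\<And>x s i. \<lbrakk>x \<in> carrier ?L; i < n\<rbrakk> \<Longrightarrow> (U m \<otimes>\<^bsub>?L\<^esub> x) s \<otimes> e i = (if i < m then x (s - k i) \<otimes> e i else \<zero>)"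
      by auto
    have UL: "U m \<in> carrier ?L" using IH(1) subcringE(1)[OF DL] by blast
    have US: "U (Suc m) = mo m \<oplus>\<^bsub>?L\<^esub> U m"
      unfolding U_def lessThan_Suc by (rule L.finsum_insert) (use mo m in auto)
    have 1: "U (Suc m) \<in> laurent_sub D R" unfolding US using subcringE(7)[OF DL mo(1)[OF m] IH(1)] .
    have "laurent_eval R (U (Suc m)) = e m \<oplus> (\<Oplus>i\<in>{..<m}. e i)"
      unfolding US using ring_hom_add[OF laurent_eval_hom mo(2)[OF m] UL] IH(2) laurent_eval_monom[OF ec[OF m]]
      by (simp add: mo_def)
    also have "\<dots> = (\<Oplus>i\<in>{..<Suc m}. e i)"
      unfolding lessThan_Suc by (rule finsum_insert[symmetric]) (use ec m in auto)
    finally have 2: "laurent_eval R (U (Suc m)) = (\<Oplus>i\<in>{..<Suc m}. e i)" .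
    have 3: "(U (Suc m) \<otimes>\<^bsub>?L\<^esub> x) s \<otimes> e i = (if i < Suc m then x (s - k i) \<otimes> e i else \<zero>)"
      if x: "x \<in> carrier ?L" and i: "i < n" for x s i
    proof -
      note xc = laurent_coeff_closed[OF x]
      have uc: "(U m \<otimes>\<^bsub>?L\<^esub> x) s \<in> carrier R" using laurent_coeff_closed[OF L.m_closed[OF UL x]] .
      have "(U (Suc m) \<otimes>\<^bsub>?L\<^esub> x) s = e m \<otimes> x (s - k m) \<oplus> (U m \<otimes>\<^bsub>?L\<^esub> x) s"
        unfolding US L.l_distr[OF mo(2)[OF m] UL x]
        using laurent_monom_mult[OF ec[OF m] x] by (simp add: laurent_add_coeff mo_def)
      hence *: "(U (Suc m) \<otimes>\<^bsub>?L\<^esub> x) s \<otimes> e i = e m \<otimes> x (s - k m) \<otimes> e i \<oplus> (if i < m then x (s - k i) \<otimes> e i else \<zero>)"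
        using IH(3)[OF x i] ec[OF m] ec[OF i] xc uc by (simp add: l_distr)
      have **: "e m \<otimes> x (s - k m) \<otimes> e i = x (s - k m) \<otimes> (e m \<otimes> e i)"
        using ec[OF m] ec[OF i] xc by (simp add: m_ac)
      show ?thesis
      proof (cases "i = m")
        case True
        thus ?thesis using * ** e(2)[OF m] xc ec[OF m] by simp
      next
        case False
        thus ?thesis using * ** e(3)[OF m i] xc ec[OF i] by auto
      qed
    qed
    show ?case using 1 2 3 by blast
  qed
  have u: "U n \<in> laurent_sub D R" "laurent_eval R (U n) = \<one>" using U[of n] e(4) by simp_all
  moreover have "\<forall>x\<in>carrier ?L. \<forall>s. \<forall>i<n. (U n \<otimes>\<^bsub>?L\<^esub> x) s \<otimes> e i = x (s - k i) \<otimes> e i"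
    using U[of n] by auto
  ultimately show ?thesis by blast
qed

text \<open>Before adding, \<open>g\<close> is moved beyond the support of \<open>f\<close> by a
  power of \<open>X\<close>, so that no two coefficients interfere. The last clause records that
  \<open>h\<close> begins with \<open>f\<close>, which preserves statements about the lowest unit
  coefficient.\<close>

lemma ex_combined_element:
  assumes A: "subcring A R" and J: "subalgebra (laurent_sub A R) J (laurent R)" and fg: "f \<in> J" "g \<in> J"
  shows "\<exists>h\<in>J. range f \<union> range g \<subseteq> range h \<and> (\<exists>b. (\<forall>s<b. h s = f s) \<and> (\<forall>s\<ge>b. f s = \<zero>))"
proof -
  interpret L: cring "laurent R" by (rule laurent_cring)
  note AL = laurent_sub_subcring[OF A]
  note JD = L.submoduleD[OF AL J]
  have c: "f \<in> carrier (laurent R)" "g \<in> carrier (laurent R)" using fg JD(1) by auto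
  note fc = laurent_coeff_closed[OF c(1)] and gc = laurent_coeff_closed[OF c(2)]
  obtain a b where ab: "{i. f i \<noteq> \<zero>} \<subseteq> {a..<b}" using finite_int_bounds[OF laurent_finite_support[OF c(1)]] .
  obtain l m where lm: "{i. g i \<noteq> \<zero>} \<subseteq> {l..<m}" using finite_int_bounds[OF laurent_finite_support[OF c(2)]] .
  have f0: "f s = \<zero>" if "s \<ge> b" for s using ab that by force
  have g0: "g s = \<zero>" if "s < l" for s using lm that by force
  define h where "h = f \<oplus>\<^bsub>laurent R\<^esub> laurent_monom R \<one> (b - l) \<otimes>\<^bsub>laurent R\<^esub> g"
  have hJ: "h \<in> J" unfolding h_def
    using JD(3)[OF fg(1) JD(4)[OF laurent_monom_closed[OF A subcringE(3)[OF A]] fg(2)]] .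
  have hs: "h s = f s \<oplus> g (s - (b - l))" for s
    unfolding h_def laurent_add_coeff using laurent_monom_mult[OF one_closed c(2)] gc by simp
  have hf: "h s = f s" if "s < b" for s using hs[of s] g0[of "s - (b - l)"] fc that by simp
  have hg: "h (s + (b - l)) = g s" if "s \<ge> l" for s using hs[of "s + (b - l)"] f0[of "s + (b - l)"] gc that by simp
  \<comment> \<open>Outside their supports \<open>f\<close> and \<open>g\<close> take the value
    \<open>\<zero>\<close>, which therefore has to occur in \<open>h\<close> as well.\<close>
  have hz: "\<exists>s. h s = \<zero>"
  proof -
    have "finite {s. h s \<noteq> \<zero>}" using laurent_finite_support hJ JD(1) by blast
    hence "{s. h s \<noteq> \<zero>} \<noteq> UNIV" by (metis infinite_UNIV_int)
    thus ?thesis by blast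
  qed
  have hz: "\<zero> \<in> range h" using hz by (metis rangeI)
  have "f s \<in> range h" for s
    using hf[of s] f0[of s] hz rangeI[of h s] by (cases "s < b") simp_all
  moreover have "g s \<in> range h" for s
    using hg[of s] g0[of s] hz rangeI[of h "s + (b - l)"] by (cases "s < l") simp_all
  ultimately show ?thesis using hJ hf f0 by blast
qed

text \<open>Writing \<open>\<one>\<close> as a sum of products \<open>i j\<close> turns each
  \<open>x\<close> of \<open>J\<close> into the sum of the \<open>(x j) i\<close>, where
  \<open>x j\<close> has coefficients in \<open>A\<close>. So the coefficients of \<open>x\<close>
  are combinations of those of finitely many \<open>i\<close>, which
  \<open>ex_combined_element\<close> merges. The induction treats all \<open>z\<close> of
  \<open>J J'\<close> in place of \<open>\<one>\<close>.\<close>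

lemma ex_coeff_generator:
  assumes A: "subcring A R" and J: "subalgebra (laurent_sub A R) J (laurent R)"
    and J': "subalgebra (laurent_sub A R) J' (laurent R)"
    and JJ': "ideal_prod (laurent R) J J' = laurent_sub A R"
  shows "\<exists>f\<in>J. \<forall>x\<in>J. \<forall>s. x s \<in> ideal_prod R A (range f)"
proof -
  interpret L: cring "laurent R" by (rule laurent_cring)
  let ?L = "laurent R"
  note AL = laurent_sub_subcring[OF A]
  note JD = L.submoduleD[OF AL J] and J'D = L.submoduleD[OF AL J']
  have span: "subalgebra A (ideal_prod R A (range f)) R" if "f \<in> J" for f
  proof -
    have "f s \<in> carrier R" for s using laurent_coeff_closed JD(1) that by blast
    thus ?thesis using span_submodule(1)[OF A, of "range f"] by auto
  qed
  have "\<exists>f\<in>J. \<forall>x\<in>J. \<forall>s. (x \<otimes>\<^bsub>?L\<^esub> z) s \<in> ideal_prod R A (range f)" if "z \<in> ideal_prod ?L J J'" for z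
    using that
  proof (induction rule: ideal_prod.induct)
    case (prod i j)
    have "(x \<otimes>\<^bsub>?L\<^esub> (i \<otimes>\<^bsub>?L\<^esub> j)) s \<in> ideal_prod R A (range i)" if x: "x \<in> J" for x s
    proof -
      have c: "x \<in> carrier ?L" "i \<in> carrier ?L" "j \<in> carrier ?L" using x prod JD(1) J'D(1) by auto
      define y where "y = x \<otimes>\<^bsub>?L\<^esub> j"
      have y: "y \<in> laurent_sub A R" unfolding y_def using JJ' ideal_prod.prod[OF x prod(2), of ?L] by simp
      hence yc: "y \<in> carrier ?L" "\<And>n. y n \<in> A" using laurent_sub_iff[OF subcringE(1)[OF A]] by auto
      have "x \<otimes>\<^bsub>?L\<^esub> (i \<otimes>\<^bsub>?L\<^esub> j) = y \<otimes>\<^bsub>?L\<^esub> i" unfolding y_def using c by (simp add: L.m_ac)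
      moreover have "(y \<otimes>\<^bsub>?L\<^esub> i) s = (\<Oplus>m\<in>{m. y m \<noteq> \<zero>}. y m \<otimes> i (s - m))"
        by (rule laurent_mult_window[OF yc(1) c(2) laurent_finite_support[OF yc(1)]]) simp
      moreover have "\<dots> \<in> ideal_prod R A (range i)"
        by (rule finsum_in_set[OF laurent_finite_support[OF yc(1)]])
          (use yc submoduleD[OF A span[OF prod(1)]] in \<open>auto intro: ideal_prod.prod\<close>)
      ultimately show ?thesis by simp
    qed
    thus ?case using prod(1) by blast
  next
    case (sum z w)
    then obtain f g where fg: "f \<in> J" "g \<in> J" "\<And>x s. x \<in> J \<Longrightarrow> (x \<otimes>\<^bsub>?L\<^esub> z) s \<in> ideal_prod R A (range f)"
      "\<And>x s. x \<in> J \<Longrightarrow> (x \<otimes>\<^bsub>?L\<^esub> w) s \<in> ideal_prod R A (range g)" by blast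
    obtain h where h: "h \<in> J" "range f \<union> range g \<subseteq> range h" using ex_combined_element[OF A J fg(1,2)] by blast
    have sub: "ideal_prod R A (range f) \<subseteq> ideal_prod R A (range h)" "ideal_prod R A (range g) \<subseteq> ideal_prod R A (range h)"
      by (rule ideal_prod_mono; use h(2) in blast)+
    have zw: "z \<in> carrier ?L" "w \<in> carrier ?L" using sum(1,2) JJ' subcringE(1)[OF AL] by blast+
    have "(x \<otimes>\<^bsub>?L\<^esub> (z \<oplus>\<^bsub>?L\<^esub> w)) s \<in> ideal_prod R A (range h)" if x: "x \<in> J" for x s
    proof -
      have "x \<in> carrier ?L" using x JD(1) by blast
      hence "(x \<otimes>\<^bsub>?L\<^esub> (z \<oplus>\<^bsub>?L\<^esub> w)) s = (x \<otimes>\<^bsub>?L\<^esub> z) s \<oplus> (x \<otimes>\<^bsub>?L\<^esub> w) s"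
        using zw by (simp add: L.r_distr laurent_add_coeff)
      moreover have "(x \<otimes>\<^bsub>?L\<^esub> z) s \<in> ideal_prod R A (range h)" "(x \<otimes>\<^bsub>?L\<^esub> w) s \<in> ideal_prod R A (range h)"
        using fg(3,4)[OF x] sub by blast+
      ultimately show ?thesis by (simp add: ideal_prod.sum)
    qed
    thus ?case using h(1) by blast
  qed
  then obtain f where "f \<in> J" "\<And>x s. x \<in> J \<Longrightarrow> (x \<otimes>\<^bsub>?L\<^esub> \<one>\<^bsub>?L\<^esub>) s \<in> ideal_prod R A (range f)"
    using subcringE(3)[OF AL] JJ' by blast
  thus ?thesis using JD(1) by (metis L.r_one subsetD)
qed

text \<open>In \<one> = \<Sum> i j each \<open>j\<close> may be replaced by its value at
  \<open>X = 1\<close>, a scalar from \<open>A\<close>. The sum then lies in \<open>J\<close> and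
  still has value \<open>\<one>\<close> at \<open>X = 1\<close>.\<close>

lemma ex_eval_one:
  assumes A: "subcring A R" and J: "subalgebra (laurent_sub A R) J (laurent R)"
    and J': "subalgebra (laurent_sub A R) J' (laurent R)"
    and JJ': "ideal_prod (laurent R) J J' = laurent_sub A R" and ev: "laurent_eval R ` J' \<subseteq> A"
  shows "\<exists>x\<in>J. laurent_eval R x = \<one>"
proof -
  interpret L: cring "laurent R" by (rule laurent_cring)
  let ?L = "laurent R"
  note AL = laurent_sub_subcring[OF A]
  note JD = L.submoduleD[OF AL J] and J'D = L.submoduleD[OF AL J']
  have "\<exists>x\<in>J. laurent_eval R x = laurent_eval R z" if "z \<in> ideal_prod ?L J J'" for z
    using that
  proof (induction rule: ideal_prod.induct)
    case (prod i j)
    have c: "i \<in> carrier ?L" "j \<in> carrier ?L" using prod JD(1) J'D(1) by auto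
    have a: "laurent_eval R j \<in> A" using ev prod(2) by blast
    hence ac: "laurent_eval R j \<in> carrier R" using subcringE(1)[OF A] by blast
    have "laurent_eval R (laurent_monom R (laurent_eval R j) 0 \<otimes>\<^bsub>?L\<^esub> i) = laurent_eval R j \<otimes> laurent_eval R i"
      using ring_hom_mult[OF laurent_eval_hom laurent_monom_carrier[OF ac] c(1)] laurent_eval_monom[OF ac] by simp
    also have "\<dots> = laurent_eval R (i \<otimes>\<^bsub>?L\<^esub> j)"
      using ring_hom_mult[OF laurent_eval_hom c] ring_hom_closed[OF laurent_eval_hom] c m_comm by simp
    finally show ?case using JD(4)[OF laurent_monom_closed[OF A a] prod(1)] by blast
  next
    case (sum z w)
    then obtain x y where xy: "x \<in> J" "y \<in> J" "laurent_eval R x = laurent_eval R z" "laurent_eval R y = laurent_eval R w"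
      by blast
    have c: "x \<in> carrier ?L" "y \<in> carrier ?L" "z \<in> carrier ?L" "w \<in> carrier ?L"
      using xy sum(1,2) JD(1) JJ' subcringE(1)[OF AL] by blast+
    have "laurent_eval R (x \<oplus>\<^bsub>?L\<^esub> y) = laurent_eval R (z \<oplus>\<^bsub>?L\<^esub> w)"
      using ring_hom_add[OF laurent_eval_hom c(1,2)] ring_hom_add[OF laurent_eval_hom c(3,4)] xy by simp
    thus ?case using JD(3)[OF xy(1,2)] by blast
  qed
  thus ?thesis using subcringE(3)[OF AL] JJ' ring_hom_one[OF laurent_eval_hom] by metis
qed

lemma one_in_content:
  assumes A: "subcring A R" and f: "f \<in> carrier (laurent R)"
    and x: "x \<in> carrier (laurent R)" "\<And>s. x s \<in> ideal_prod R A (range f)" "laurent_eval R x = \<one>"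
  shows "\<one> \<in> ideal_prod R A (range f)"
proof -
  have "subalgebra A (ideal_prod R A (range f)) R"
    using span_submodule(1)[OF A, of "range f"] laurent_coeff_closed[OF f] by auto
  note D = submoduleD[OF A this]
  show ?thesis
    unfolding x(3)[symmetric] laurent_eval_def
    by (rule finsum_in_set[OF laurent_finite_support[OF x(1)] _ D(1-3)]) (use x(2) in auto)
qed

text \<open>The splitting of finite algebras is the premise \<open>fin\<close> instead of a Hensel
  condition on \<open>A\<close>, because the statement is applied over a finite extension of the
  Hensel ring, whose finite algebras are finite over the Hensel ring itself. In each local factor of
  \<open>D\<close> the unit \<open>u\<close> shifts the lowest unit coefficient of \<open>f0\<close>
  to degree \<open>0\<close>, and \<open>v\<close> shifts back.\<close>

lemma ex_twist_into_closed_subring: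
  assumes A: "subcring A R" and C: "subcring C R" "A \<subseteq> C"
    and closed: "\<And>b. \<lbrakk>b \<in> carrier R; b \<otimes> b \<in> C; b \<otimes> b \<otimes> b \<in> C\<rbrakk> \<Longrightarrow> b \<in> C"
    and fin: "\<And>D. \<lbrakk>subcring D R; A \<subseteq> D; fin_over A D\<rbrakk> \<Longrightarrow> \<exists>n e. local_idempotents n e D"
    and J: "subalgebra (laurent_sub A R) J (laurent R)" and J': "subalgebra (laurent_sub A R) J' (laurent R)"
    and JJ': "ideal_prod (laurent R) J J' = laurent_sub A R"
    and ev: "laurent_eval R ` J \<subseteq> A" "laurent_eval R ` J' \<subseteq> A"
  shows "\<exists>u\<in>carrier (laurent R). \<exists>v\<in>carrier (laurent R). u \<otimes>\<^bsub>laurent R\<^esub> v = \<one>\<^bsub>laurent R\<^esub> \<and>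
    (\<forall>x\<in>J. u \<otimes>\<^bsub>laurent R\<^esub> x \<in> laurent_sub C R) \<and> (\<forall>x\<in>J'. v \<otimes>\<^bsub>laurent R\<^esub> x \<in> laurent_sub C R)"
proof -
  interpret L: cring "laurent R" by (rule laurent_cring)
  let ?L = "laurent R" and ?AL = "laurent_sub A R"
  note AL = laurent_sub_subcring[OF A]
  note JD = L.submoduleD[OF AL J] and J'D = L.submoduleD[OF AL J']
  have J'J: "ideal_prod ?L J' J = ?AL" using JJ' L.ideal_prod_commute_sets[OF JD(1) J'D(1)] by simp
  obtain f0 where f0: "f0 \<in> J" "\<And>x s. x \<in> J \<Longrightarrow> x s \<in> ideal_prod R A (range f0)"
    using ex_coeff_generator[OF A J J' JJ'] by blast
  obtain g0 where g0: "g0 \<in> J'" "\<And>x s. x \<in> J' \<Longrightarrow> x s \<in> ideal_prod R A (range g0)"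
    using ex_coeff_generator[OF A J' J J'J] by blast
  obtain x0 where x0: "x0 \<in> J" "laurent_eval R x0 = \<one>" using ex_eval_one[OF A J J' JJ' ev(2)] by blast
  obtain y0 where y0: "y0 \<in> J'" "laurent_eval R y0 = \<one>" using ex_eval_one[OF A J' J J'J ev(1)] by blast
  have c0: "f0 \<in> carrier ?L" "g0 \<in> carrier ?L" "x0 \<in> carrier ?L" "y0 \<in> carrier ?L"
    using f0 g0 x0 y0 JD(1) J'D(1) by auto
  have f01: "\<one> \<in> ideal_prod R A (range f0)" by (rule one_in_content[OF A c0(1,3) f0(2)[OF x0(1)] x0(2)])
  have g01: "\<one> \<in> ideal_prod R A (range g0)" by (rule one_in_content[OF A c0(2,4) g0(2)[OF y0(1)] y0(2)])
  have fg0: "f0 \<otimes>\<^bsub>?L\<^esub> g0 \<in> ?AL" using JJ' ideal_prod.prod[OF f0(1) g0(1), of ?L] by simp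
  obtain N where N: "subcring (content_pow R A f0 N) R" "A \<subseteq> content_pow R A f0 N"
    "range f0 \<subseteq> content_pow R A f0 N" "range g0 \<subseteq> content_pow R A f0 N"
    using content_ring[OF A c0(1,2) fg0 f01 g01] by blast
  define D where "D = content_pow R A f0 N"
  have D: "subcring D R" "A \<subseteq> D" "range f0 \<subseteq> D" "range g0 \<subseteq> D" using N by (simp_all add: D_def)
  note Dc = subcringE[OF D(1)] and DL = laurent_sub_subcring[OF D(1)]
  have "fin_over A D" unfolding D_def by (rule fin_over_content_pow[OF A A fin_over_refl[OF A] c0(1)])
  then obtain n e where loc: "local_idempotents n e D" using fin[OF D(1,2)] by blast
  have e: "\<And>i. i < n \<Longrightarrow> e i \<in> D" "\<And>i. i < n \<Longrightarrow> e i \<noteq> \<zero>" "\<And>i. i < n \<Longrightarrow> e i \<otimes> e i = e i"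
    "\<And>i j. \<lbrakk>i < n; j < n; i \<noteq> j\<rbrakk> \<Longrightarrow> e i \<otimes> e j = \<zero>" "(\<Oplus>i\<in>{..<n}. e i) = \<one>"
    and eloc: "\<And>i x y. \<lbrakk>i < n; x \<in> D; y \<in> D; unit_at D (e i) (x \<oplus> y)\<rbrakk> \<Longrightarrow> unit_at D (e i) x \<or> unit_at D (e i) y"
    using loc by (auto simp: local_idempotents_def)
  have car: "x \<in> carrier R" if "x \<in> D" for x using that Dc(1) by blast
  have spanD: "ideal_prod R A (range h) \<subseteq> D" if "range h \<subseteq> D" for h :: "int \<Rightarrow> 'a"
    by (rule ideal_prod_subset) (use that D(2) Dc(6,7) in blast)+
  have JDs: "J \<subseteq> laurent_sub D R" "J' \<subseteq> laurent_sub D R"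
    using f0(2) g0(2) spanD[OF D(3)] spanD[OF D(4)] JD(1) J'D(1) laurent_sub_iff[OF Dc(1)] by blast+
  have f0D: "f0 s \<in> D" for s using D(3) by blast
  have uz: "\<not> unit_at D (e i) \<zero>" if "i < n" for i
    using e(1,2)[OF that] car by (auto simp: unit_at_def)
  have ucong: "unit_at D (e i) x \<longleftrightarrow> unit_at D (e i) y" if "i < n" "x \<in> carrier R" "y \<in> carrier R" "x \<otimes> e i = y \<otimes> e i" for i x y
  proof -
    have "x \<otimes> z \<otimes> e i = y \<otimes> z \<otimes> e i" if "z \<in> D" for z
    proof -
      have "a \<otimes> z \<otimes> e i = z \<otimes> (a \<otimes> e i)" if "a \<in> carrier R" for a
        using that car[OF \<open>z \<in> D\<close>] car[OF e(1)[OF \<open>i < n\<close>]] by (simp add: m_ac)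
      thus ?thesis using \<open>x \<in> carrier R\<close> \<open>y \<in> carrier R\<close> \<open>x \<otimes> e i = y \<otimes> e i\<close> by simp
    qed
    thus ?thesis by (auto simp: unit_at_def)
  qed
  define K where "K i = {s. unit_at D (e i) (f0 s)}" for i
  have Kfin: "finite (K i)" if "i < n" for i
  proof (rule finite_subset[OF _ laurent_finite_support[OF c0(1)]])
    show "K i \<subseteq> {s. f0 s \<noteq> \<zero>}" using uz[OF that] by (auto simp: K_def)
  qed
  \<comment> \<open>\<open>\<one>\<close> is a combination of the coefficients of \<open>f0\<close>,
    and in a local factor a sum that is a unit has a summand that is a unit.\<close>
  have Kne: "K i \<noteq> {}" if i: "i < n" for i
  proof -
    have "z \<in> ideal_prod R A (range f0) \<Longrightarrow> unit_at D (e i) z \<Longrightarrow> K i \<noteq> {}" for z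
    proof (induction rule: ideal_prod.induct)
      case (prod a b)
      then obtain s y where s: "b = f0 s" "y \<in> D" "a \<otimes> f0 s \<otimes> y \<otimes> e i = e i" by (auto simp: unit_at_def)
      have aD: "a \<in> D" using prod(1) D(2) by blast
      have "f0 s \<otimes> (a \<otimes> y) \<otimes> e i = a \<otimes> f0 s \<otimes> y \<otimes> e i"
        using car[OF f0D] car[OF aD] car[OF s(2)] car[OF e(1)[OF i]] by (simp add: m_ac)
      hence "unit_at D (e i) (f0 s)" using s(3) Dc(6)[OF aD s(2)] by (auto simp: unit_at_def)
      thus ?case by (auto simp: K_def)
    next
      case (sum x y)
      thus ?case using eloc[OF i, of x y] spanD[OF D(3)] by blast
    qed
    moreover have "unit_at D (e i) \<one>"
      using Dc(3) car[OF e(1)[OF i]] by (auto simp: unit_at_def intro!: bexI[of _ \<one>])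
    ultimately show ?thesis using f01 by blast
  qed
  define k where "k i = Min (K i)" for i
  have k: "unit_at D (e i) (f0 (k i))" "\<And>s. unit_at D (e i) (f0 s) \<Longrightarrow> k i \<le> s" if "i < n" for i
    using Min_in[OF Kfin[OF that] Kne[OF that]] Min_le[OF Kfin[OF that]] by (auto simp: k_def K_def)
  obtain u where u: "u \<in> laurent_sub D R" "laurent_eval R u = \<one>"
    "\<And>x s i. \<lbrakk>x \<in> carrier ?L; i < n\<rbrakk> \<Longrightarrow> (u \<otimes>\<^bsub>?L\<^esub> x) s \<otimes> e i = x (s + k i) \<otimes> e i"
    using ex_twist[OF D(1) e(1,3,4,5), where k = "\<lambda>i. - k i"] by auto
  obtain v where v: "v \<in> laurent_sub D R" "laurent_eval R v = \<one>"
    "\<And>x s i. \<lbrakk>x \<in> carrier ?L; i < n\<rbrakk> \<Longrightarrow> (v \<otimes>\<^bsub>?L\<^esub> x) s \<otimes> e i = x (s - k i) \<otimes> e i"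
    using ex_twist[OF D(1) e(1,3,4,5), where k = k] by auto
  have uvc: "u \<in> carrier ?L" "v \<in> carrier ?L" using u(1) v(1) subcringE(1)[OF DL] by auto
  have uv: "u \<otimes>\<^bsub>?L\<^esub> v = \<one>\<^bsub>?L\<^esub>"
  proof
    fix s
    show "(u \<otimes>\<^bsub>?L\<^esub> v) s = \<one>\<^bsub>?L\<^esub> s"
    proof (rule eq_by_idempotents[where e = e and n = n, OF _ e(5)])
      show "e i \<in> carrier R" if "i < n" for i using car[OF e(1)[OF that]] .
      show "(u \<otimes>\<^bsub>?L\<^esub> v) s \<in> carrier R" "\<one>\<^bsub>?L\<^esub> s \<in> carrier R"
        using laurent_coeff_closed[OF L.m_closed[OF uvc]] laurent_coeff_closed[OF L.one_closed] by auto
      show "(u \<otimes>\<^bsub>?L\<^esub> v) s \<otimes> e i = \<one>\<^bsub>?L\<^esub> s \<otimes> e i" if "i < n" for i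
        using u(3)[OF uvc(2) that, of s] v(3)[OF L.one_closed that, of "s + k i"] uvc(2) by simp
    qed
  qed
  define J1 where "J1 = (\<otimes>\<^bsub>?L\<^esub>) u ` J"
  define J1' where "J1' = (\<otimes>\<^bsub>?L\<^esub>) v ` J'"
  have J1: "subalgebra ?AL J1 ?L" "J1 \<subseteq> laurent_sub D R" and J1': "subalgebra ?AL J1' ?L" "J1' \<subseteq> laurent_sub D R"
    unfolding J1_def J1'_def
    using L.unit_mult_submodule[OF AL J uvc(1)] L.unit_mult_submodule[OF AL J' uvc(2)] subcringE(6)[OF DL] u(1) v(1) JDs by auto
  have "ideal_prod ?L J1 J1' = (\<otimes>\<^bsub>?L\<^esub>) \<one>\<^bsub>?L\<^esub> ` ?AL"
    unfolding J1_def J1'_def L.ideal_prod_image_mult[OF JD(1) J'D(1) uvc] uv JJ' ..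
  also have "\<dots> = ?AL" using subcringE(1)[OF AL] L.l_one by (force simp: subset_iff)
  finally have JJ1: "ideal_prod ?L J1 J1' = ?AL" .
  have JJ1': "ideal_prod ?L J1' J1 = ?AL"
    using JJ1 L.ideal_prod_commute_sets[OF L.submoduleD(1)[OF AL J1(1)] L.submoduleD(1)[OF AL J1'(1)]] by simp
  have evu: "laurent_eval R (u \<otimes>\<^bsub>?L\<^esub> x) = laurent_eval R x" "laurent_eval R (v \<otimes>\<^bsub>?L\<^esub> x) = laurent_eval R x"
    if "x \<in> carrier ?L" for x
    using ring_hom_mult[OF laurent_eval_hom uvc(1) that] ring_hom_mult[OF laurent_eval_hom uvc(2) that] u(2) v(2)
      ring_hom_closed[OF laurent_eval_hom that] by simp_all
  have ev1: "laurent_eval R ` J1' \<subseteq> A" "laurent_eval R ` J1 \<subseteq> A"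
    using ev evu JD(1) J'D(1) unfolding J1_def J1'_def by (auto simp: image_subset_iff subset_iff)
  obtain f1 where f1: "f1 \<in> J1" "\<And>x s. x \<in> J1 \<Longrightarrow> x s \<in> ideal_prod R A (range f1)"
    using ex_coeff_generator[OF A J1(1) J1'(1) JJ1] by blast
  obtain g where g: "g \<in> J1'" "\<And>x s. x \<in> J1' \<Longrightarrow> x s \<in> ideal_prod R A (range g)"
    using ex_coeff_generator[OF A J1'(1) J1(1) JJ1'] by blast
  obtain x1 where x1: "x1 \<in> J1" "laurent_eval R x1 = \<one>" using ex_eval_one[OF A J1(1) J1'(1) JJ1 ev1(1)] by blast
  obtain y1 where y1: "y1 \<in> J1'" "laurent_eval R y1 = \<one>" using ex_eval_one[OF A J1'(1) J1(1) JJ1' ev1(2)] by blast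
  have J1c: "x \<in> carrier ?L" if "x \<in> J1 \<or> x \<in> J1'" for x
    using that J1(2) J1'(2) subcringE(1)[OF DL] by blast
  define f2 where "f2 = u \<otimes>\<^bsub>?L\<^esub> f0"
  have f2: "f2 \<in> J1" using f0(1) by (simp add: f2_def J1_def)
  have f2c: "f2 s \<in> carrier R" for s using laurent_coeff_closed J1c f2 by blast
  have f2e: "f2 s \<otimes> e i = f0 (s + k i) \<otimes> e i" if "i < n" for s i
    unfolding f2_def by (rule u(3)[OF c0(1) that])
  have f2u: "unit_at D (e i) (f2 s) \<longleftrightarrow> unit_at D (e i) (f0 (s + k i))" if "i < n" for s i
    by (rule ucong[OF that f2c car[OF f0D] f2e[OF that]])
  \<comment> \<open>Two demands meet here: the coefficients of \<open>f2\<close> generate each local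
    factor of \<open>D\<close> over \<open>A\<close>, and those of \<open>f1\<close> span the
    coefficients of all of \<open>J1\<close>. With \<open>f1\<close> placed above \<open>f2\<close>
    the lowest unit coefficients stay in degree \<open>0\<close>.\<close>
  obtain f b where f: "f \<in> J1" "range f2 \<union> range f1 \<subseteq> range f"
    and b: "\<And>s. s < b \<Longrightarrow> f s = f2 s" "\<And>s. s \<ge> b \<Longrightarrow> f2 s = \<zero>"
    using ex_combined_element[OF A J1(1) f2 f1(1)] by blast
  have ff1: "ideal_prod R A (range f1) \<subseteq> ideal_prod R A (range f)" using f(2) by (intro ideal_prod_mono) auto
  have f1one: "\<one> \<in> ideal_prod R A (range f)"
    by (rule one_in_content[OF A _ _ _ x1(2)]) (use J1c f(1) x1(1) f1(2)[OF x1(1)] ff1 in auto)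
  have g1one: "\<one> \<in> ideal_prod R A (range g)"
    by (rule one_in_content[OF A _ _ _ y1(2)]) (use J1c g(1) y1(1) g(2)[OF y1(1)] in auto)
  have norm1: "unit_at D (e i) (f 0)" if i: "i < n" for i
  proof -
    have *: "unit_at D (e i) (f2 0)" using f2u[OF i, of 0] k(1)[OF i] by simp
    hence "f2 0 \<noteq> \<zero>" using uz[OF i] by metis
    hence "0 < b" using b(2)[of 0] by linarith
    thus ?thesis using b(1)[of 0] * by simp
  qed
  have norm2: "\<not> unit_at D (e i) (f s)" if i: "i < n" and s: "s < 0" for i s
  proof -
    have "\<not> unit_at D (e i) (f2 s)" using f2u[OF i, of s] k(2)[OF i, of "s + k i"] s by auto
    moreover have "f2 0 \<noteq> \<zero>" using f2u[OF i, of 0] k(1)[OF i] uz[OF i] by auto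
    hence "0 < b" using b(2)[of 0] by linarith
    ultimately show ?thesis using b(1)[of s] s by simp
  qed
  \<comment> \<open>On the factor of \<open>e i\<close> the coefficients of \<open>f0\<close> and of
    \<open>f2\<close> agree up to a shift of the index. So the elements that become equal to
    elements of \<open>E\<close> on this factor form a ring containing \<open>A\<close> and the
    generators of \<open>D\<close>.\<close>
  have gen: "\<exists>d\<in>E. x \<otimes> e i = d \<otimes> e i" if E: "subcring E R" "A \<subseteq> E" "range f \<subseteq> E" and x: "x \<in> D" "i < n" for E x i
  proof -
    note Ec = subcringE[OF E(1)]
    have Ecar: "x \<in> carrier R" if "x \<in> E" for x using that Ec(1) by blast
    define Y where "Y = {x \<in> carrier R. \<exists>d\<in>E. x \<otimes> e i = d \<otimes> e i}"
    have ei: "e i \<in> carrier R" using car e(1) x(2) by blast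
    have EY: "E \<subseteq> Y" using Ecar by (auto simp: Y_def)
    have "subcring Y R"
    proof (rule subcringI'[OF subringI])
      show "Y \<subseteq> carrier R" "\<one> \<in> Y" using EY Ec(3) by (auto simp: Y_def)
      fix h assume "h \<in> Y"
      then obtain a where a: "a \<in> E" "h \<in> carrier R" "h \<otimes> e i = a \<otimes> e i" by (auto simp: Y_def)
      have "\<ominus> h \<otimes> e i = \<ominus> a \<otimes> e i" using a ei Ecar by (simp add: l_minus)
      thus "\<ominus> h \<in> Y" using a Ec(5) by (auto simp: Y_def)
      fix l assume "l \<in> Y"
      then obtain c where c: "c \<in> E" "l \<in> carrier R" "l \<otimes> e i = c \<otimes> e i" by (auto simp: Y_def)
      have "(h \<oplus> l) \<otimes> e i = (a \<oplus> c) \<otimes> e i" using a c ei Ecar by (simp add: l_distr)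
      thus "h \<oplus> l \<in> Y" using a c Ec(7) unfolding Y_def by blast
      have "h \<otimes> l \<otimes> e i = h \<otimes> (l \<otimes> e i)" using a c ei by (simp add: m_assoc)
      also have "\<dots> = c \<otimes> (h \<otimes> e i)" unfolding c(3) using a c ei Ecar by (simp add: m_lcomm)
      also have "\<dots> = (a \<otimes> c) \<otimes> e i" unfolding a(3) using a c ei Ecar by (simp add: m_ac)
      finally show "h \<otimes> l \<in> Y" using a c Ec(6) unfolding Y_def by blast
    qed
    moreover have "A \<subseteq> Y" using EY E(2) by blast
    moreover have "range f0 \<subseteq> Y"
    proof
      fix y assume "y \<in> range f0"
      then obtain s where s: "y = f0 s" by blast
      have "f0 s \<otimes> e i = f2 (s - k i) \<otimes> e i" using f2e[OF x(2), of "s - k i"] by simp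
      moreover have "f2 (s - k i) \<in> E" using f(2) E(3) by blast
      ultimately show "y \<in> Y" using s car[OF f0D] by (auto simp: Y_def)
    qed
    ultimately have "D \<subseteq> Y" unfolding D_def by (rule subcring_contains_content_pow)
    thus ?thesis using x(1) by (auto simp: Y_def)
  qed
  have fgC: "range f \<subseteq> C" "range g \<subseteq> C"
    using coeffs_in_closed_subring[OF A C closed D(1,2) loc J1 J1' JJ1 ev1(1) x1 y1 f(1) f1one g(1) g1one gen norm1 norm2]
    by blast+
  have spanC: "ideal_prod R A (range h) \<subseteq> C" if "range h \<subseteq> C" for h :: "int \<Rightarrow> 'a"
    by (rule ideal_prod_subset) (use that C(2) subcringE(6,7)[OF C(1)] in blast)+
  have "x \<in> laurent_sub C R" if "x \<in> J1 \<or> x \<in> J1'" for x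
    using that f1(2) g(2) ff1 spanC[OF fgC(1)] spanC[OF fgC(2)] J1c[OF that] laurent_sub_iff[OF subcringE(1)[OF C(1)]]
    by blast
  thus ?thesis using uvc uv by (intro bexI[of _ u] bexI[of _ v]) (auto simp: J1_def J1'_def)
qed

section \<open>Subintegral extensions\<close>

text \<open>As \<open>b \<otimes> b\<close> lies in \<open>E\<close>, the module
  \<open>E + E b\<close> is already a ring and hence all of \<open>E[b]\<close>.\<close>

lemma el_step_elements:
  assumes "el_step E F"
  obtains b where "b \<in> F" "b \<otimes> b \<in> E" "b \<otimes> b \<otimes> b \<in> E" "F = {r \<oplus> s \<otimes> b |r s. r \<in> E \<and> s \<in> E}"
proof -
  have E: "subcring E R" and F: "subcring F R" "E \<subseteq> F" using assms by (auto simp: el_step_def)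
  have Fr: "subring F R" using F(1) subcring.axioms(1) by blast
  obtain b where b: "b \<in> F" "F = generate_ring R (insert b E)" "b [^] (2::nat) \<in> E" "b [^] (3::nat) \<in> E"
    using assms elementary_subintegral_carrier_update[OF Fr F(2)] unfolding el_step_def by blast
  note Ec = subcringE[OF E] and Fc = subcringE[OF F(1)]
  have bc: "b \<in> carrier R" using b(1) Fc(1) by blast
  have b2: "b \<otimes> b \<in> E" using b(3) bc by (simp add: numeral_2_eq_2)
  have b3: "b \<otimes> b \<otimes> b \<in> E" using b(4) bc by (simp add: numeral_3_eq_3)
  have car: "x \<in> carrier R" if "x \<in> E" for x using that Ec(1) by blast
  define G where "G = {r \<oplus> s \<otimes> b |r s. r \<in> E \<and> s \<in> E}"
  have "subring G R"
  proof (rule subringI)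
    show "G \<subseteq> carrier R" using car bc by (auto simp: G_def)
    have "\<one> = \<one> \<oplus> \<zero> \<otimes> b" using bc by simp
    thus "\<one> \<in> G" using Ec(2,3) unfolding G_def by blast
    fix h assume "h \<in> G"
    then obtain r s where h: "h = r \<oplus> s \<otimes> b" "r \<in> E" "s \<in> E" unfolding G_def by blast
    have "\<ominus> h = \<ominus> r \<oplus> \<ominus> s \<otimes> b" unfolding h(1) using car[OF h(2)] car[OF h(3)] bc by algebra
    thus "\<ominus> h \<in> G" using Ec(5) h unfolding G_def by blast
    fix k assume "k \<in> G"
    then obtain r' s' where k: "k = r' \<oplus> s' \<otimes> b" "r' \<in> E" "s' \<in> E" unfolding G_def by blast
    note cc = car[OF h(2)] car[OF h(3)] car[OF k(2)] car[OF k(3)] bc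
    have "h \<oplus> k = (r \<oplus> r') \<oplus> (s \<oplus> s') \<otimes> b" unfolding h(1) k(1) using cc by algebra
    thus "h \<oplus> k \<in> G" using Ec(7) h k unfolding G_def by blast
    have "h \<otimes> k = (r \<otimes> r' \<oplus> s \<otimes> s' \<otimes> (b \<otimes> b)) \<oplus> (r \<otimes> s' \<oplus> s \<otimes> r') \<otimes> b" unfolding h(1) k(1) using cc by algebra
    moreover have "r \<otimes> r' \<oplus> s \<otimes> s' \<otimes> (b \<otimes> b) \<in> E" "r \<otimes> s' \<oplus> s \<otimes> r' \<in> E" using Ec(6,7) h k b2 by auto
    ultimately show "h \<otimes> k \<in> G" unfolding G_def by blast
  qed
  moreover have "insert b E \<subseteq> G"
  proof
    fix x assume "x \<in> insert b E"
    moreover have "b = \<zero> \<oplus> \<one> \<otimes> b" using bc by simp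
    moreover have "x = x \<oplus> \<zero> \<otimes> b" if "x \<in> E" using car[OF that] bc by simp
    ultimately show "x \<in> G" using Ec(2,3) unfolding G_def by blast
  qed
  moreover have "insert b E \<subseteq> carrier R" using bc Ec(1) by blast
  ultimately have "F \<subseteq> G" unfolding b(2) using generate_ring_min_subring1 by blast
  moreover have "G \<subseteq> F"
  proof
    fix x assume "x \<in> G"
    then obtain r s where "x = r \<oplus> s \<otimes> b" "r \<in> F" "s \<in> F" using F(2) unfolding G_def by blast
    thus "x \<in> F" using Fc(6,7) b(1) by blast
  qed
  ultimately have "F = G" by blast
  thus ?thesis using that b(1) b2 b3 by (simp add: G_def)
qed

text \<open>
  The conductor of \<open>E\<close> in \<open>F = E[b]\<close> contains \<open>b\<^sup>2\<close>. Write \<open>x = r + y\<close> with \<open>y\<close> a multiple of \<open>b\<close>. Modulo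
  the conductor \<open>r\<^sup>2\<close> is \<open>x - 2 x y\<close> and \<open>r\<^sup>3\<close> is \<open>x - 3 x y\<close>, and \<open>x\<close> is a combination of the two.
\<close>

lemma el_step_idempotent:
  assumes "el_step E F" "x \<in> F" "x \<otimes> x = x"
  shows "x \<in> E"
proof -
  obtain b where b: "b \<in> F" "b \<otimes> b \<in> E" "b \<otimes> b \<otimes> b \<in> E" "F = {r \<oplus> s \<otimes> b |r s. r \<in> E \<and> s \<in> E}"
    by (rule el_step_elements[OF assms(1)])
  have E: "subcring E R" and F: "subcring F R" "E \<subseteq> F" using assms by (auto simp: el_step_def)
  note Ec = subcringE[OF E] and Fc = subcringE[OF F(1)]
  have car: "y \<in> carrier R" if "y \<in> F" for y using that Fc(1) by blast
  obtain r s where rs: "x = r \<oplus> s \<otimes> b" "r \<in> E" "s \<in> E" using assms(2) b(4) by blast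
  have rsc: "r \<in> carrier R" "s \<in> carrier R" using rs F(2) car by auto
  have xc: "x \<in> carrier R" and bc: "b \<in> carrier R" using car assms(2) b(1) by auto
  have b2F: "b \<otimes> b \<otimes> y \<in> E" if "y \<in> F" for y
  proof -
    obtain u v where uv: "y = u \<oplus> v \<otimes> b" "u \<in> E" "v \<in> E" using \<open>y \<in> F\<close> b(4) by blast
    have "u \<in> carrier R" "v \<in> carrier R" using uv F(2) car by auto
    hence "b \<otimes> b \<otimes> y = u \<otimes> (b \<otimes> b) \<oplus> v \<otimes> (b \<otimes> b \<otimes> b)"
      unfolding uv(1) using bc by algebra
    thus ?thesis using Ec(6,7) uv b by auto
  qed
  define y where "y = s \<otimes> b"
  have yF: "y \<in> F" "y \<in> carrier R" using Fc(6) rs(3) F(2) b(1) car by (auto simp: y_def)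
  have ry: "r = x \<ominus> y" unfolding rs(1) y_def[symmetric] using rsc yF by algebra
  define a where "a = x \<otimes> y"
  define c where "c = a \<otimes> y"
  \<comment> \<open>\<open>t\<close> differs from \<open>r \<otimes> r\<close> by
    \<open>y \<otimes> y\<close>, and \<open>r \<otimes> t\<close> differs from
    \<open>t \<ominus> a\<close> by twice \<open>c\<close>. So \<open>t\<close> and
    \<open>t \<ominus> a\<close> are in \<open>E\<close>, and with them \<open>a\<close> and
    \<open>x\<close>, without any division by 2 or 3.\<close>
  define t where "t = x \<ominus> (a \<oplus> a)"
  have cc: "a \<in> carrier R" "c \<in> carrier R" "t \<in> carrier R"
    using xc yF(2) by (simp_all add: a_def c_def t_def)
  have sub: "u \<ominus> v \<in> E" if "u \<in> E" "v \<in> E" for u v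
    using submoduleD(5)[OF E subcring_is_submodule[OF E]] that .
  have yy: "y \<otimes> y \<otimes> z \<in> E" if "z \<in> F" for z
  proof -
    have "y \<otimes> y \<otimes> z = s \<otimes> s \<otimes> (b \<otimes> b \<otimes> z)" unfolding y_def using rsc bc car[OF that] by (simp add: m_ac)
    thus ?thesis using Ec(6) rs(3) b2F[OF that] by simp
  qed
  have cE: "c \<in> E"
  proof -
    have "c = y \<otimes> y \<otimes> x" unfolding c_def a_def using xc yF(2) by (simp add: m_ac)
    thus ?thesis using yy[OF assms(2)] by simp
  qed
  have xa: "x \<otimes> a = a" unfolding a_def using xc yF(2) assms(3) by (simp add: m_assoc[symmetric])
  have "t = r \<otimes> r \<ominus> y \<otimes> y \<otimes> \<one>"
  proof -
    have "(x \<ominus> y) \<otimes> (x \<ominus> y) \<ominus> y \<otimes> y = x \<otimes> x \<ominus> (x \<otimes> y \<oplus> x \<otimes> y)" using xc yF(2) by algebra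
    thus ?thesis unfolding ry t_def a_def assms(3) using yF(2) by simp
  qed
  hence tE: "t \<in> E" using sub Ec(6) rs(2) yy Fc(3) by simp
  have "r \<otimes> t = (x \<otimes> x \<ominus> (x \<otimes> a \<oplus> x \<otimes> a)) \<ominus> a \<oplus> (c \<oplus> c)"
  proof -
    have "(x \<ominus> y) \<otimes> (x \<ominus> (u \<oplus> u)) = (x \<otimes> x \<ominus> (x \<otimes> u \<oplus> x \<otimes> u)) \<ominus> x \<otimes> y \<oplus> (u \<otimes> y \<oplus> u \<otimes> y)"
      if "u \<in> carrier R" for u using that xc yF(2) by algebra
    from this[OF cc(1)] show ?thesis unfolding ry t_def c_def by (simp add: a_def)
  qed
  hence "r \<otimes> t = t \<ominus> a \<oplus> (c \<oplus> c)" unfolding xa assms(3) t_def[symmetric] .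
  hence "t \<ominus> a = r \<otimes> t \<ominus> (c \<oplus> c)" using cc by algebra
  hence "t \<ominus> a \<in> E" using sub Ec(6)[OF rs(2) tE] Ec(7)[OF cE cE] by simp
  hence "t \<ominus> (t \<ominus> a) \<in> E" by (rule sub[OF tE])
  moreover have "t \<ominus> (t \<ominus> a) = a" using cc by algebra
  ultimately have aE: "a \<in> E" by simp
  have "x = t \<oplus> (a \<oplus> a)" unfolding t_def using xc cc(1) by algebra
  thus ?thesis using Ec(7) tE aE by simp
qed

lemma el_steps_idempotent:
  assumes "el_step\<^sup>*\<^sup>* A D" "x \<in> D" "x \<otimes> x = x"
  shows "x \<in> A"
  using assms(1,2) by (induction rule: rtranclp_induct) (use assms(3) el_step_idempotent in auto)

lemma fin_over_trans:
  assumes A: "subcring A R" and E: "subcring E R" "fin_over A E" and D: "subcring D R" "fin_over E D"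
  shows "fin_over A D"
proof -
  obtain T where T: "finite T" "T \<subseteq> carrier R" "E = ideal_prod R A T" using E(2) by (auto simp: fin_over_def)
  obtain S where S: "finite S" "S \<subseteq> carrier R" "D = ideal_prod R E S" using D(2) by (auto simp: fin_over_def)
  have empty: "ideal_prod R I {} = {}" for I by (auto elim: ideal_prod.induct)
  have ne: "S \<noteq> {}" "T \<noteq> {}" using empty S(3) T(3) subcringE(3)[OF D(1)] subcringE(3)[OF E(1)] by auto
  have "D = ideal_prod R S E" unfolding S(3) by (rule ideal_prod_commute_sets[OF subcringE(1)[OF E(1)] S(2)])
  also have "\<dots> = ideal_prod R A ((\<lambda>(s, t). s \<otimes> t) ` (S \<times> T))"
    unfolding T(3) by (rule ideal_prod_span[OF subcringE(1)[OF A] S(2) T(2) A ne])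
  finally show ?thesis
    unfolding fin_over_def using S(1,2) T(1,2) by (intro exI[of _ "(\<lambda>(s, t). s \<otimes> t) ` (S \<times> T)"]) auto
qed

lemma el_step_fin_over:
  assumes "el_step E F" shows "fin_over E F"
proof -
  obtain b where b: "b \<in> F" "F = {r \<oplus> s \<otimes> b |r s. r \<in> E \<and> s \<in> E}"
    by (rule el_step_elements[OF assms])
  have E: "subcring E R" and F: "subcring F R" "E \<subseteq> F" using assms by (auto simp: el_step_def)
  note Ec = subcringE[OF E] and Fc = subcringE[OF F(1)]
  have "F = ideal_prod R E {\<one>, b}"
  proof
    show "F \<subseteq> ideal_prod R E {\<one>, b}"
    proof
      fix x assume "x \<in> F"
      then obtain r s where rs: "x = r \<oplus> s \<otimes> b" "r \<in> E" "s \<in> E" using b(2) by blast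
      have "r \<otimes> \<one> \<oplus> s \<otimes> b \<in> ideal_prod R E {\<one>, b}" using rs by (intro ideal_prod.intros) auto
      thus "x \<in> ideal_prod R E {\<one>, b}" using rs Ec(1) by auto
    qed
    show "ideal_prod R E {\<one>, b} \<subseteq> F"
      by (rule ideal_prod_subset) (use F(2) b(1) Fc(3,6,7) in auto)
  qed
  thus ?thesis unfolding fin_over_def using b(1) Fc(1) by (intro exI[of _ "{\<one>, b}"]) auto
qed

lemma el_steps_fin_over:
  assumes "el_step\<^sup>*\<^sup>* A D" "subcring A R" shows "fin_over A D"
  using assms(1)
proof (induction rule: rtranclp_induct)
  case (step D D')
  show ?case
    by (rule fin_over_trans[OF assms(2) _ step(3) _ el_step_fin_over[OF step(2)]])
      (use step(2) in \<open>auto simp: el_step_def\<close>)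
qed (rule fin_over_refl[OF assms(2)])

text \<open>The closure is defined as a greatest set; this describes it from below as the union of
  the finite chains of elementary steps, which is the form used afterwards.\<close>

lemma subintegral_closure_iff:
  assumes A: "subcring A R"
  shows "x \<in> subintegral_closure A R \<longleftrightarrow> (\<exists>D. el_step\<^sup>*\<^sup>* A D \<and> x \<in> D)"
proof
  note C = subintegral_closure_greatest[OF A]
  show "x \<in> subintegral_closure A R \<Longrightarrow> \<exists>D. el_step\<^sup>*\<^sup>* A D \<and> x \<in> D"
    using C(3) subintegral_carrier_update[OF A C(1)] by blast
  assume "\<exists>D. el_step\<^sup>*\<^sup>* A D \<and> x \<in> D"
  then obtain D where D: "el_step\<^sup>*\<^sup>* A D" "x \<in> D" by blast
  note AD = el_steps_subcring[OF D(1) A]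
  have "subintegral A (R\<lparr>carrier := D\<rparr>)" using subintegral_carrier_update[OF A] AD D(1) by blast
  thus "x \<in> subintegral_closure A R" using C(4) AD D(2) by blast
qed

text \<open>Chains of elementary steps are directed. With \<open>el_steps_fin_over\<close> this
  places finitely many elements of the closure in one ring that is finite over
  \<open>A\<close>.\<close>

lemma subintegral_closure_finite_subset:
  assumes A: "subcring A R" and "finite S" "S \<subseteq> subintegral_closure A R"
  shows "\<exists>D. el_step\<^sup>*\<^sup>* A D \<and> S \<subseteq> D"
  using assms(2,3)
proof (induction S rule: finite_induct)
  case (insert x S)
  then obtain D where D: "el_step\<^sup>*\<^sup>* A D" "S \<subseteq> D" by blast
  obtain E where E: "el_step\<^sup>*\<^sup>* A E" "x \<in> E" using insert(4) subintegral_closure_iff[OF A] by blast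
  show ?case using el_steps_directed[OF D(1) E(1) A] D(2) E(2) by blast
qed auto

text \<open>The square and the cube of \<open>b\<close> lie at the end of one common chain, which is
  prolonged by the elementary step that adjoins \<open>b\<close>.\<close>

lemma subintegral_closure_closed:
  assumes A: "subcring A R" and b: "b \<in> carrier R" "b \<otimes> b \<in> subintegral_closure A R" "b \<otimes> b \<otimes> b \<in> subintegral_closure A R"
  shows "b \<in> subintegral_closure A R"
proof -
  obtain D where D: "el_step\<^sup>*\<^sup>* A D" "{b \<otimes> b, b \<otimes> b \<otimes> b} \<subseteq> D"
    using subintegral_closure_finite_subset[OF A, of "{b \<otimes> b, b \<otimes> b \<otimes> b}"] b(2,3) by blast
  have DR: "subcring D R" using el_steps_subcring[OF D(1) A] by blast
  define F where "F = generate_ring R (insert b D)"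
  have F: "subring F R" "b \<in> F" "D \<subseteq> F"
    using generate_ring_is_subring[of "insert b D"] b(1) subcringE(1)[OF DR] generate_ring.incl[of _ "insert b D" R]
    unfolding F_def by auto
  have "b [^] (2::nat) \<in> D" "b [^] (3::nat) \<in> D" using D(2) b(1) by (simp_all add: numeral_2_eq_2 numeral_3_eq_3)
  hence "elementary_subintegral D (R\<lparr>carrier := F\<rparr>)"
    using elementary_subintegral_carrier_update[OF F(1,3)] F(2) unfolding F_def by blast
  hence "el_step D F" using DR subcringI'[OF F(1)] F(3) by (simp add: el_step_def)
  hence "el_step\<^sup>*\<^sup>* A F" using D(1) by (rule rtranclp.rtrancl_into_rtrancl[rotated])
  thus ?thesis using F(2) subintegral_closure_iff[OF A] by blast
qed

text \<open>\<open>x\<close> and \<open>\<one> \<ominus> x\<close> add up to \<open>\<one>\<close>,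
  so one of them is a unit, and an idempotent that is a unit equals \<open>\<one>\<close>.\<close>

lemma local_subring_idempotent:
  assumes A: "subcring A R" "local_ring (R\<lparr>carrier := A\<rparr>)" and x: "x \<in> A" "x \<otimes> x = x"
  shows "x = \<zero> \<or> x = \<one>"
proof -
  note Ac = subcringE[OF A(1)]
  have c: "x \<in> carrier R" using x(1) Ac(1) by blast
  have m: "\<one> \<ominus> x \<in> A" using submoduleD(5)[OF A(1) subcring_is_submodule[OF A(1)] Ac(3) x(1)] .
  interpret RA: cring "R\<lparr>carrier := A\<rparr>" using A(2) by (simp add: local_ring_def)
  have "x \<oplus> (\<one> \<ominus> x) = \<one>" using c by algebra
  hence "x \<in> Units (R\<lparr>carrier := A\<rparr>) \<or> \<one> \<ominus> x \<in> Units (R\<lparr>carrier := A\<rparr>)"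
    using local_ring_add_Units[OF A(2), of x "\<one> \<ominus> x"] x(1) m RA.Units_one_closed by simp
  thus ?thesis
  proof
    assume "x \<in> Units (R\<lparr>carrier := A\<rparr>)"
    then obtain y where y: "y \<in> A" "y \<otimes> x = \<one>" by (auto simp: Units_def)
    have yc: "y \<in> carrier R" using y(1) Ac(1) by blast
    have "x = y \<otimes> x \<otimes> x" using y(2) c by simp
    also have "\<dots> = y \<otimes> x" using yc c x(2) by (simp add: m_assoc)
    finally show ?thesis using y(2) by simp
  next
    assume "\<one> \<ominus> x \<in> Units (R\<lparr>carrier := A\<rparr>)"
    then obtain y where y: "y \<in> A" "y \<otimes> (\<one> \<ominus> x) = \<one>" by (auto simp: Units_def)
    have yc: "y \<in> carrier R" using y(1) Ac(1) by blast
    have "x = y \<otimes> (\<one> \<ominus> x) \<otimes> x" using y(2) c by simp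
    also have "\<dots> = y \<otimes> (x \<ominus> x \<otimes> x)" using yc c by algebra
    also have "\<dots> = \<zero>" using yc c x(2) by (simp add: r_neg a_minus_def)
    finally show ?thesis by simp
  qed
qed

lemma subintegral_closure_idempotent:
  assumes A: "subcring A R" "local_ring (R\<lparr>carrier := A\<rparr>)"
    and x: "x \<in> subintegral_closure A R" "x \<otimes> x = x"
  shows "x = \<zero> \<or> x = \<one>"
  using x(1) subintegral_closure_iff[OF A(1)] el_steps_idempotent[OF _ _ x(2)] local_subring_idempotent[OF A _ x(2)] by blast

section \<open>Units of Laurent polynomial rings\<close>

text \<open>The choice \<open>b = c = x\<close> satisfies the premise of seminormality, since both
  powers vanish, and yields \<open>x = a^2 = a^3\<close>. Then \<open>x = x a = x a a = x x\<close>,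
  which is zero.\<close>

lemma seminormal_reduced:
  assumes "seminormal_ring R" "x \<in> carrier R" "x \<otimes> x = \<zero>"
  shows "x = \<zero>"
proof -
  have "x [^] (3::nat) = x [^] (2::nat)" using assms(2,3) by (simp add: numeral_2_eq_2 numeral_3_eq_3)
  then obtain a where a: "a \<in> carrier R" "x = a [^] (2::nat)" "x = a [^] (3::nat)"
    using assms(1,2) unfolding seminormal_ring_def by blast
  have x2: "x = a \<otimes> a" and x3: "x = a \<otimes> a \<otimes> a" using a by (simp_all add: numeral_2_eq_2 numeral_3_eq_3)
  have "x = x \<otimes> a" using x2 x3 by simp
  also have "\<dots> = x \<otimes> a \<otimes> a" using \<open>x = x \<otimes> a\<close> by simp
  also have "\<dots> = x \<otimes> x" unfolding x2 using a(1) by (simp add: m_assoc)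
  finally show ?thesis using assms(3) by simp
qed

text \<open>A nonzero \<open>f i \<otimes> g j\<close> is not nilpotent, so some prime avoids its
  powers; modulo this prime \<open>f\<close> and \<open>g\<close> are monomials of opposite degrees,
  whence \<open>i + j = 0\<close>. The products of opposite coefficients are then orthogonal
  idempotents with sum \<open>\<one>\<close>, and one of them has to be
  \<open>\<one>\<close>.\<close>

lemma laurent_unit_monomial:
  assumes C: "subcring C R" and red: "\<And>x. \<lbrakk>x \<in> C; x \<otimes> x = \<zero>\<rbrakk> \<Longrightarrow> x = \<zero>"
    and idem: "\<And>x. \<lbrakk>x \<in> C; x \<otimes> x = x\<rbrakk> \<Longrightarrow> x = \<zero> \<or> x = \<one>"
    and f: "f \<in> laurent_sub C R" and g: "g \<in> laurent_sub C R" and fg: "f \<otimes>\<^bsub>laurent R\<^esub> g = \<one>\<^bsub>laurent R\<^esub>"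
  shows "\<exists>k. f k \<otimes> g (- k) = \<one> \<and> (\<forall>i. i \<noteq> k \<longrightarrow> f i = \<zero>)"
proof -
  note Cc = subcringE[OF C]
  have c: "f i \<in> C" "g i \<in> C" and fc: "f \<in> carrier (laurent R)" "g \<in> carrier (laurent R)" for i
    using f g laurent_sub_iff[OF Cc(1)] by auto
  have car: "f i \<in> carrier R" "g i \<in> carrier R" for i using c Cc(1) by auto
  have zI: "ideal_in {\<zero>} C" using Cc(1,2) by (auto simp: ideal_in_def)
  have zero: "f i \<otimes> g j = \<zero>" if ij: "i + j \<noteq> 0" for i j
  proof (rule ccontr)
    define z where "z = f i \<otimes> g j"
    assume "f i \<otimes> g j \<noteq> \<zero>"
    hence z0: "z \<noteq> \<zero>" by (simp add: z_def)
    have zC: "z \<in> C" using Cc(6) c by (simp add: z_def)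
    hence zc: "z \<in> carrier R" using Cc(1) by blast
    define T where "T = range (\<lambda>k::nat. z [^] k)"
    have "z [^] k \<noteq> \<zero>" for k :: nat
    proof (cases k)
      case 0
      have "\<one> \<noteq> \<zero>"
      proof
        assume "\<one> = \<zero>"
        hence "z = \<zero> \<otimes> z" using zc by (metis l_one)
        thus False using z0 zc by simp
      qed
      thus ?thesis using 0 by simp
    next
      case (Suc k')
      thus ?thesis using radical_pow[OF C zI, of z k'] red zC z0 by auto
    qed
    hence "{\<zero>} \<inter> T = {}" unfolding T_def by (metis Int_emptyI rangeE singletonD)
    moreover have "T \<subseteq> C" using subcring_pow[OF C zC] by (auto simp: T_def)
    moreover have "\<one> \<in> T" unfolding T_def by (rule range_eqI[of _ _ 0]) simp
    moreover have "s \<otimes> t \<in> T" if "s \<in> T" "t \<in> T" for s t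
      using that nat_pow_mult[OF zc] by (auto simp: T_def)
    ultimately obtain q where q: "prime_in q C" "q \<inter> T = {}" using ex_prime_avoiding[OF C zI] by blast
    have qi: "ideal_in q C" by (rule prime_inD(1)[OF q(1)])
    have "z [^] (1::nat) \<in> T" unfolding T_def by (rule rangeI)
    hence zq: "z \<notin> q" using q(2) zc by auto
    have "(f \<otimes>\<^bsub>laurent R\<^esub> g) 0 \<notin> q" "\<And>k. k \<noteq> 0 \<Longrightarrow> (f \<otimes>\<^bsub>laurent R\<^esub> g) k \<in> q"
      unfolding fg using prime_inD(2)[OF q(1)] ideal_inD(2)[OF qi] by (simp_all add: laurent_one_coeff)
    then obtain a where a: "\<And>i. i \<noteq> a \<Longrightarrow> f i \<in> q" "\<And>i. i \<noteq> - a \<Longrightarrow> g i \<in> q"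
      using monomial_mod_prime[OF C q(1) f g] by blast
    have "f i \<notin> q" "g j \<notin> q"
      using zq ideal_inD(4)[OF qi c(1)] ideal_in_multr[OF C qi c(2)] by (auto simp: z_def)
    hence "i = a" "j = - a" using a by blast+
    thus False using ij by simp
  qed
  define e where "e i = f i \<otimes> g (- i)" for i
  have eC: "e i \<in> C" "e i \<in> carrier R" for i using c car Cc(6) by (auto simp: e_def)
  have ee: "e i \<otimes> e j = \<zero>" if "i \<noteq> j" for i j
  proof -
    have "e i \<otimes> e j = (f i \<otimes> g (- j)) \<otimes> (f j \<otimes> g (- i))" unfolding e_def using car by (simp add: m_ac)
    thus ?thesis using zero[of i "- j"] that car by simp
  qed
  define F where "F = {i. f i \<noteq> \<zero>}"
  have F: "finite F" unfolding F_def by (rule laurent_finite_support[OF fc(1)])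
  have "(f \<otimes>\<^bsub>laurent R\<^esub> g) 0 = (\<Oplus>i\<in>F. f i \<otimes> g (0 - i))"
    by (rule laurent_mult_window[OF fc F]) (simp add: F_def)
  hence sum: "(\<Oplus>i\<in>F. e i) = \<one>" using fg by (simp add: laurent_one_coeff e_def)
  have idem_e: "e i \<otimes> e i = e i" if i: "i \<in> F" for i
  proof -
    have "e i = e i \<otimes> (\<Oplus>j\<in>F. e j)" using sum eC by simp
    also have "\<dots> = (\<Oplus>j\<in>F. e i \<otimes> e j)" by (rule finsum_rdistr[OF F]) (use eC in auto)
    also have "\<dots> = (\<Oplus>j\<in>{i}. e i \<otimes> e j)"
      by (rule add.finprod_mono_neutral_cong_right) (use F i ee eC in auto)
    also have "\<dots> = e i \<otimes> e i" using eC by (simp add: finsum_insert)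
    finally show ?thesis by simp
  qed
  have "\<exists>k. e k = \<one>"
  proof (rule ccontr)
    assume "\<nexists>k. e k = \<one>"
    hence "e i = \<zero>" if "i \<in> F" for i using idem[OF eC(1) idem_e[OF that]] by blast
    hence "(\<Oplus>i\<in>F. e i) = \<zero>" by (simp add: add.finprod_one_eqI)
    hence "\<one> = \<zero>" using sum by simp
    \<comment> \<open>What remains is the zero ring, where \<open>e 0\<close> is
      \<open>\<zero>\<close> and \<open>\<one>\<close> at once, against the assumption.\<close>
    moreover have "e 0 = \<zero>" using \<open>\<one> = \<zero>\<close> eC by (metis l_one l_null)
    ultimately show False using \<open>\<nexists>k. e k = \<one>\<close> by metis
  qed
  then obtain k where k: "f k \<otimes> g (- k) = \<one>" by (auto simp: e_def)
  have "f i = \<zero>" if "i \<noteq> k" for i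
  proof -
    have "f i = f i \<otimes> (f k \<otimes> g (- k))" using k car by simp
    also have "\<dots> = f k \<otimes> (f i \<otimes> g (- k))" using car by (simp add: m_lcomm)
    finally show ?thesis using zero[of i "- k"] that car by simp
  qed
  thus ?thesis using k by blast
qed

section \<open>Invertible modules over a local ring and over its subintegral closure\<close>

text \<open>One of the summands of \<one> = \<Sum> i j is a unit of the local ring \<open>A\<close>,
  with inverse \<open>u\<close>. Its factor \<open>i\<close> generates \<open>I\<close>, since
  \<open>x = i (x j) u\<close> with \<open>x j\<close> in \<open>A\<close> for every
  \<open>x\<close> in \<open>I\<close>.\<close>

lemma invertible_submodule_local:
  assumes A: "subcring A R" "local_ring (R\<lparr>carrier := A\<rparr>)"
    and I: "subalgebra A I R" and J: "subalgebra A J R" and IJ: "ideal_prod R I J = A"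
  shows "\<exists>a\<in>Units R. I = (\<otimes>) a ` A"
proof -
  note Ac = subcringE[OF A(1)] and ID = submoduleD[OF A(1) I] and JD = submoduleD[OF A(1) J]
  let ?RA = "R\<lparr>carrier := A\<rparr>"
  interpret RA: cring ?RA using A(2) by (simp add: local_ring_def)
  have "\<exists>i\<in>I. \<exists>j\<in>J. i \<otimes> j \<in> Units ?RA" if "z \<in> ideal_prod R I J" "z \<in> Units ?RA" for z
    using that
  proof (induction rule: ideal_prod.induct)
    case (sum s t)
    thus ?case using local_ring_add_Units[OF A(2), of s t] IJ by auto
  qed blast
  then obtain i j where ij: "i \<in> I" "j \<in> J" "i \<otimes> j \<in> Units ?RA"
    using Ac(3) IJ RA.Units_one_closed by fastforce
  then obtain u where u: "u \<in> A" "i \<otimes> j \<otimes> u = \<one>" by (auto simp: Units_def)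
  have c: "i \<in> carrier R" "j \<in> carrier R" "u \<in> carrier R" using ij ID(1) JD(1) u Ac(1) by auto
  have iu: "i \<otimes> (j \<otimes> u) = \<one>" using u(2) c by (simp add: m_assoc)
  hence "i \<in> Units R" using c m_comm[of i "j \<otimes> u"] by (auto simp: Units_def intro!: bexI[of _ "j \<otimes> u"])
  moreover have "I = (\<otimes>) i ` A"
  proof
    show "I \<subseteq> (\<otimes>) i ` A"
    proof
      fix x assume x: "x \<in> I"
      have xc: "x \<in> carrier R" using x ID(1) by blast
      have "x = i \<otimes> (j \<otimes> u) \<otimes> x" using iu xc by simp
      also have "\<dots> = i \<otimes> ((x \<otimes> j) \<otimes> u)" using c xc by (simp add: m_ac)
      finally have "x = i \<otimes> ((x \<otimes> j) \<otimes> u)" .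
      moreover have "(x \<otimes> j) \<otimes> u \<in> A" using Ac(6) IJ ideal_prod.prod[OF x ij(2), of R] u(1) by auto
      ultimately show "x \<in> (\<otimes>) i ` A" by blast
    qed
    show "(\<otimes>) i ` A \<subseteq> I"
    proof
      fix x assume "x \<in> (\<otimes>) i ` A"
      then obtain a where "a \<in> A" "x = i \<otimes> a" by blast
      moreover have "a \<otimes> i = i \<otimes> a" using \<open>a \<in> A\<close> Ac(1) c by (intro m_comm) auto
      ultimately show "x \<in> I" using ID(4)[OF _ ij(1)] by metis
    qed
  qed
  ultimately show ?thesis by blast
qed

lemma ideal_prod_finite_subsets:
  "z \<in> ideal_prod S I J \<Longrightarrow> \<exists>I0 J0. finite I0 \<and> finite J0 \<and> I0 \<subseteq> I \<and> J0 \<subseteq> J \<and> z \<in> ideal_prod S I0 J0"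
proof (induction rule: ideal_prod.induct)
  case (prod i j)
  thus ?case by (intro exI[of _ "{i}"] exI[of _ "{j}"]) (auto intro: ideal_prod.prod)
next
  case (sum s t)
  then obtain I1 J1 I2 J2 where *: "finite I1" "finite J1" "I1 \<subseteq> I" "J1 \<subseteq> J" "s \<in> ideal_prod S I1 J1"
    "finite I2" "finite J2" "I2 \<subseteq> I" "J2 \<subseteq> J" "t \<in> ideal_prod S I2 J2" by blast
  have "s \<in> ideal_prod S (I1 \<union> I2) (J1 \<union> J2)" "t \<in> ideal_prod S (I1 \<union> I2) (J1 \<union> J2)"
    using ideal_prod_mono[of I1 "I1 \<union> I2" J1 "J1 \<union> J2" S] ideal_prod_mono[of I2 "I1 \<union> I2" J2 "J1 \<union> J2" S] * by blast+
  thus ?case using * by (intro exI[of _ "I1 \<union> I2"] exI[of _ "J1 \<union> J2"]) (auto intro: ideal_prod.sum)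
qed

lemma laurent_finite_range: "f \<in> carrier (laurent R) \<Longrightarrow> finite (range f)"
proof -
  assume f: "f \<in> carrier (laurent R)"
  have "range f \<subseteq> insert \<zero> (f ` {i. f i \<noteq> \<zero>})" by auto
  thus ?thesis using laurent_finite_support[OF f] finite_subset by blast
qed

text \<open>\<open>C\<close> need not be finite over \<open>A\<close>, so the splitting of algebras
  is used over a ring \<open>E\<close> at the end of a finite chain. Finite sets with
  \<open>\<one>\<close> among the sums of their products generate modules \<open>K'\<close> and
  \<open>M'\<close> over \<open>E[X]\<close> that are inverse to each other. Once a unit
  \<open>u\<close> moves \<open>K'\<close> into \<open>C[X]\<close> and its inverse \<open>v\<close>
  does the same for \<open>M'\<close>, the relation \<open>\<one> \<in> K' M'\<close> extends this
  to \<open>K\<close> and shows that \<open>v\<close> generates \<open>K\<close>.\<close>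

lemma subintegral_closure_module_principal:
  assumes A: "subcring A R" "hensel_local_ring (R\<lparr>carrier := A\<rparr>)"
  defines "C \<equiv> subintegral_closure A R"
  assumes K: "subalgebra (laurent_sub C R) K (laurent R)" and M: "subalgebra (laurent_sub C R) M (laurent R)"
    and KM: "ideal_prod (laurent R) K M = laurent_sub C R"
    and ev: "laurent_eval R ` K \<subseteq> C" "laurent_eval R ` M \<subseteq> C"
  shows "\<exists>u\<in>Units (laurent R). (\<otimes>\<^bsub>laurent R\<^esub>) u ` K = laurent_sub C R"
proof -
  interpret L: cring "laurent R" by (rule laurent_cring)
  let ?L = "laurent R" and ?CL = "laurent_sub C R"
  have C: "subcring C R" "A \<subseteq> C" unfolding C_def using subintegral_closure_greatest[OF A(1)] by auto
  note Cc = subcringE[OF C(1)] and CL = laurent_sub_subcring[OF C(1)]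
  note CLc = subcringE[OF CL]
  note KD = L.submoduleD[OF CL K] and MD = L.submoduleD[OF CL M]
  obtain I J where IJ: "finite I" "finite J" "I \<subseteq> K" "J \<subseteq> M" "\<one>\<^bsub>?L\<^esub> \<in> ideal_prod ?L I J"
    using ideal_prod_finite_subsets[of "\<one>\<^bsub>?L\<^esub>" ?L K M] CLc(3) KM by blast
  have empty: "ideal_prod ?L {} Y = {}" "ideal_prod ?L Y {} = {}" for Y by (auto elim: ideal_prod.induct)
  have ne: "I \<noteq> {}" "J \<noteq> {}" using IJ(5) empty by auto
  have Ic: "I \<subseteq> carrier ?L" and Jc: "J \<subseteq> carrier ?L" using IJ KD(1) MD(1) by auto
  have ijC: "i \<otimes>\<^bsub>?L\<^esub> j \<in> ?CL" if "i \<in> K" "j \<in> M" for i j using KM ideal_prod.prod[OF that, of ?L] by simp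
  \<comment> \<open>The finitely many elements of \<open>C\<close> that have to lie in
    \<open>E\<close>: the coefficients of the products \<open>i j\<close>, so that
    \<open>K' M'\<close> is defined over \<open>E\<close>, and the values of the generators at
    \<open>X = 1\<close>.\<close>
  define S where "S = (\<Union>i\<in>I. \<Union>j\<in>J. range (i \<otimes>\<^bsub>?L\<^esub> j)) \<union> laurent_eval R ` I \<union> laurent_eval R ` J"
  have "finite S"
    unfolding S_def using IJ(1,2) laurent_finite_range[OF L.m_closed] Ic Jc by blast
  moreover have "S \<subseteq> C"
    unfolding S_def using ijC IJ(3,4) ev laurent_sub_iff[OF Cc(1)] by blast
  ultimately obtain E where E: "el_step\<^sup>*\<^sup>* A E" "S \<subseteq> E"
    using subintegral_closure_finite_subset[OF A(1)] unfolding C_def by blast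
  have ER: "subcring E R" "A \<subseteq> E" using el_steps_subcring[OF E(1) A(1)] by auto
  have EC: "E \<subseteq> C" unfolding C_def using subintegral_closure_iff[OF A(1)] E(1) by blast
  let ?EL = "laurent_sub E R"
  note EL = laurent_sub_subcring[OF ER(1)]
  note ELc = subcringE[OF EL]
  have ECL: "?EL \<subseteq> ?CL" using EC laurent_sub_iff[OF Cc(1)] laurent_sub_iff[OF subcringE(1)[OF ER(1)]] by blast
  define K' where "K' = ideal_prod ?L I ?EL"
  define M' where "M' = ideal_prod ?L J ?EL"
  have K': "subalgebra ?EL K' ?L" and M': "subalgebra ?EL M' ?L"
    unfolding K'_def M'_def
    using L.ideal_prod_submodule[OF ELc(1) Ic ne(1) L.subcring_is_submodule[OF EL]]
      L.ideal_prod_submodule[OF ELc(1) Jc ne(2) L.subcring_is_submodule[OF EL]] by blast+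
  have sub: "ideal_prod ?L Y ?EL \<subseteq> P" if "Y \<subseteq> P" "subalgebra ?CL P ?L" for Y P
  proof (rule ideal_prod_subset)
    note PD = L.submoduleD[OF CL that(2)]
    fix y c assume yc: "y \<in> Y" "c \<in> ?EL"
    hence "y \<otimes>\<^bsub>?L\<^esub> c = c \<otimes>\<^bsub>?L\<^esub> y" using that(1) PD(1) ELc(1) by (intro L.m_comm) auto
    thus "y \<otimes>\<^bsub>?L\<^esub> c \<in> P" using PD(4)[of c y] yc ECL that(1) by auto
  qed (use L.submoduleD(3)[OF CL that(2)] in blast)
  have KK: "K' \<subseteq> K" "M' \<subseteq> M" unfolding K'_def M'_def using sub[OF IJ(3) K] sub[OF IJ(4) M] .
  have IJE: "ideal_prod ?L I J \<subseteq> ?EL"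
  proof (rule ideal_prod_subset)
    fix i j assume ij: "i \<in> I" "j \<in> J"
    have "range (i \<otimes>\<^bsub>?L\<^esub> j) \<subseteq> E" using ij E(2) by (auto simp: S_def)
    moreover have "i \<otimes>\<^bsub>?L\<^esub> j \<in> carrier ?L" using ij Ic Jc by auto
    ultimately show "i \<otimes>\<^bsub>?L\<^esub> j \<in> ?EL" using laurent_sub_iff[OF subcringE(1)[OF ER(1)]] by blast
  qed (rule ELc(7))
  have EE: "ideal_prod ?L ?EL ?EL = ?EL" by (rule L.ideal_prod_unit[OF EL L.subcring_is_submodule[OF EL]])
  have KM': "ideal_prod ?L K' M' = ?EL"
  proof -
    note cc = Ic Jc ELc(1)
    have "ideal_prod ?L K' M' = ideal_prod ?L I (ideal_prod ?L (ideal_prod ?L ?EL J) ?EL)"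
      unfolding K'_def M'_def using cc by (simp add: L.ideal_prod_assoc_sets L.ideal_prod_carrier)
    also have "ideal_prod ?L ?EL J = ideal_prod ?L J ?EL" by (rule L.ideal_prod_commute_sets[OF ELc(1) Jc])
    also have "ideal_prod ?L I (ideal_prod ?L (ideal_prod ?L J ?EL) ?EL) = ideal_prod ?L (ideal_prod ?L I J) ?EL"
      using cc EE by (simp add: L.ideal_prod_assoc_sets L.ideal_prod_carrier)
    also have "\<dots> = ?EL"
    proof
      show "ideal_prod ?L (ideal_prod ?L I J) ?EL \<subseteq> ?EL" using ideal_prod_mono[OF IJE order_refl] EE by blast
      show "?EL \<subseteq> ideal_prod ?L (ideal_prod ?L I J) ?EL"
      proof
        fix x assume x: "x \<in> ?EL"
        have "\<one>\<^bsub>?L\<^esub> \<otimes>\<^bsub>?L\<^esub> x \<in> ideal_prod ?L (ideal_prod ?L I J) ?EL" using IJ(5) x by (rule ideal_prod.prod)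
        thus "x \<in> ideal_prod ?L (ideal_prod ?L I J) ?EL" using x ELc(1) by auto
      qed
    qed
    finally show ?thesis .
  qed
  have evE: "laurent_eval R ` ideal_prod ?L Y ?EL \<subseteq> E" if Y: "Y \<subseteq> carrier ?L" "laurent_eval R ` Y \<subseteq> E" for Y
  proof -
    have "ideal_prod ?L Y ?EL \<subseteq> {x \<in> carrier ?L. laurent_eval R x \<in> E}"
    proof (rule ideal_prod_subset)
      fix y c assume yc: "y \<in> Y" "c \<in> ?EL"
      hence c: "y \<in> carrier ?L" "c \<in> carrier ?L" using Y(1) ELc(1) by auto
      have "laurent_eval R (y \<otimes>\<^bsub>?L\<^esub> c) \<in> E"
        unfolding ring_hom_mult[OF laurent_eval_hom c]
        using subcringE(6)[OF ER(1)] Y(2) yc(1) laurent_eval_in[OF ER(1) yc(2)] by blast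
      thus "y \<otimes>\<^bsub>?L\<^esub> c \<in> {x \<in> carrier ?L. laurent_eval R x \<in> E}" using c by simp
    next
      fix x y assume "x \<in> {x \<in> carrier ?L. laurent_eval R x \<in> E}" "y \<in> {x \<in> carrier ?L. laurent_eval R x \<in> E}"
      thus "x \<oplus>\<^bsub>?L\<^esub> y \<in> {x \<in> carrier ?L. laurent_eval R x \<in> E}"
        using ring_hom_add[OF laurent_eval_hom, of x y] subcringE(7)[OF ER(1)] by simp
    qed
    thus ?thesis by blast
  qed
  have ev': "laurent_eval R ` K' \<subseteq> E" "laurent_eval R ` M' \<subseteq> E"
    unfolding K'_def M'_def using evE[OF Ic] evE[OF Jc] E(2) by (auto simp: S_def)
  have fin: "\<exists>n e. local_idempotents n e D" if D: "subcring D R" "E \<subseteq> D" "fin_over E D" for D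
    using ex_local_idempotents[OF A D(1)] ER(2) D(2)
      fin_over_trans[OF A(1) ER(1) el_steps_fin_over[OF E(1) A(1)] D(1,3)] by blast
  have cl: "b \<in> C" if "b \<in> carrier R" "b \<otimes> b \<in> C" "b \<otimes> b \<otimes> b \<in> C" for b
    using subintegral_closure_closed[OF A(1)] that unfolding C_def by blast
  obtain u v where uv: "u \<in> carrier ?L" "v \<in> carrier ?L" "u \<otimes>\<^bsub>?L\<^esub> v = \<one>\<^bsub>?L\<^esub>"
    "\<And>x. x \<in> K' \<Longrightarrow> u \<otimes>\<^bsub>?L\<^esub> x \<in> ?CL" "\<And>x. x \<in> M' \<Longrightarrow> v \<otimes>\<^bsub>?L\<^esub> x \<in> ?CL"
    using ex_twist_into_closed_subring[OF ER(1) C(1) EC cl fin K' M' KM' ev'] by blast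
  have K'M'1: "\<one>\<^bsub>?L\<^esub> \<in> ideal_prod ?L K' M'" using KM' ELc(3) by simp
  \<comment> \<open>With \<one> = \<Sum> k m, where \<open>k\<close> is in \<open>K'\<close> and
    \<open>m\<close> in \<open>M'\<close>, the element \<open>u x\<close> is the sum of the
    \<open>(u k) (x m)\<close>, and both factors have coefficients in \<open>C\<close>.\<close>
  have uK: "u \<otimes>\<^bsub>?L\<^esub> x \<in> ?CL" if x: "x \<in> K" for x
  proof -
    have xc: "x \<in> carrier ?L" using x KD(1) by blast
    have "ideal_prod ?L K' M' \<subseteq> {z \<in> carrier ?L. u \<otimes>\<^bsub>?L\<^esub> (x \<otimes>\<^bsub>?L\<^esub> z) \<in> ?CL}"
    proof (rule ideal_prod_subset)
      fix k m assume km: "k \<in> K'" "m \<in> M'"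
      have c: "k \<in> carrier ?L" "m \<in> carrier ?L" using km KK KD(1) MD(1) by blast+
      have "u \<otimes>\<^bsub>?L\<^esub> (x \<otimes>\<^bsub>?L\<^esub> (k \<otimes>\<^bsub>?L\<^esub> m)) = (u \<otimes>\<^bsub>?L\<^esub> k) \<otimes>\<^bsub>?L\<^esub> (x \<otimes>\<^bsub>?L\<^esub> m)"
        using c uv xc by (simp add: L.m_ac)
      moreover have "\<dots> \<in> ?CL" using CLc(6)[OF uv(4)[OF km(1)] ijC[OF x]] km(2) KK by blast
      ultimately show "k \<otimes>\<^bsub>?L\<^esub> m \<in> {z \<in> carrier ?L. u \<otimes>\<^bsub>?L\<^esub> (x \<otimes>\<^bsub>?L\<^esub> z) \<in> ?CL}" using c by simp
    next
      fix y z assume "y \<in> {z \<in> carrier ?L. u \<otimes>\<^bsub>?L\<^esub> (x \<otimes>\<^bsub>?L\<^esub> z) \<in> ?CL}" "z \<in> {z \<in> carrier ?L. u \<otimes>\<^bsub>?L\<^esub> (x \<otimes>\<^bsub>?L\<^esub> z) \<in> ?CL}"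
      thus "y \<oplus>\<^bsub>?L\<^esub> z \<in> {z \<in> carrier ?L. u \<otimes>\<^bsub>?L\<^esub> (x \<otimes>\<^bsub>?L\<^esub> z) \<in> ?CL}"
        using uv xc CLc(7) by (simp add: L.r_distr)
    qed
    thus ?thesis using K'M'1 xc by auto
  qed
  \<comment> \<open>With the same sum, \<open>v\<close> is the sum of the \<open>(v m) k\<close>,
    where \<open>v m\<close> has coefficients in \<open>C\<close> and \<open>k\<close> is in
    \<open>K\<close>.\<close>
  have vK: "v \<in> K"
  proof -
    have M'K': "\<one>\<^bsub>?L\<^esub> \<in> ideal_prod ?L K' M'" by (rule K'M'1)
    have "ideal_prod ?L K' M' \<subseteq> {z \<in> carrier ?L. v \<otimes>\<^bsub>?L\<^esub> z \<in> K}"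
    proof (rule ideal_prod_subset)
      fix k m assume km: "k \<in> K'" "m \<in> M'"
      have c: "k \<in> carrier ?L" "m \<in> carrier ?L" using km KK KD(1) MD(1) by blast+
      have "v \<otimes>\<^bsub>?L\<^esub> (k \<otimes>\<^bsub>?L\<^esub> m) = (v \<otimes>\<^bsub>?L\<^esub> m) \<otimes>\<^bsub>?L\<^esub> k" using c uv by (simp add: L.m_ac)
      moreover have "\<dots> \<in> K" using KD(4)[OF uv(5)[OF km(2)]] km(1) KK by blast
      ultimately show "k \<otimes>\<^bsub>?L\<^esub> m \<in> {z \<in> carrier ?L. v \<otimes>\<^bsub>?L\<^esub> z \<in> K}" using c by simp
    next
      fix y z assume "y \<in> {z \<in> carrier ?L. v \<otimes>\<^bsub>?L\<^esub> z \<in> K}" "z \<in> {z \<in> carrier ?L. v \<otimes>\<^bsub>?L\<^esub> z \<in> K}"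
      thus "y \<oplus>\<^bsub>?L\<^esub> z \<in> {z \<in> carrier ?L. v \<otimes>\<^bsub>?L\<^esub> z \<in> K}" using uv KD(3) by (simp add: L.r_distr)
    qed
    thus ?thesis using M'K' uv(2) by auto
  qed
  have "(\<otimes>\<^bsub>?L\<^esub>) u ` K = ?CL"
  proof
    show "(\<otimes>\<^bsub>?L\<^esub>) u ` K \<subseteq> ?CL" using uK by blast
    show "?CL \<subseteq> (\<otimes>\<^bsub>?L\<^esub>) u ` K"
    proof
      fix c assume c: "c \<in> ?CL"
      have cc: "c \<in> carrier ?L" using c CLc(1) by blast
      have "u \<otimes>\<^bsub>?L\<^esub> (c \<otimes>\<^bsub>?L\<^esub> v) = c \<otimes>\<^bsub>?L\<^esub> (u \<otimes>\<^bsub>?L\<^esub> v)" using cc uv by (simp add: L.m_lcomm)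
      hence "c = u \<otimes>\<^bsub>?L\<^esub> (c \<otimes>\<^bsub>?L\<^esub> v)" using uv(3) cc by simp
      thus "c \<in> (\<otimes>\<^bsub>?L\<^esub>) u ` K" using KD(4)[OF c vK] by blast
    qed
  qed
  moreover have "u \<in> Units ?L" using uv L.m_comm[OF uv(1,2)] by (auto simp: Units_def)
  ultimately show ?thesis by blast
qed

end

section \<open>Comparison of the groups\<close>

lemma ring_hom_image_ideal_prod:
  assumes h: "h \<in> ring_hom S T" and S: "cring S" and IJ: "I \<subseteq> carrier S" "J \<subseteq> carrier S"
  shows "h ` ideal_prod S I J = ideal_prod T (h ` I) (h ` J)"
proof
  interpret S: cring S by fact
  have c: "ideal_prod S I J \<subseteq> carrier S" by (rule S.ideal_prod_carrier[OF IJ])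
  have "h z \<in> ideal_prod T (h ` I) (h ` J)" if "z \<in> ideal_prod S I J" for z
    using that
  proof (induction rule: ideal_prod.induct)
    case (prod i j)
    have "h (i \<otimes>\<^bsub>S\<^esub> j) = h i \<otimes>\<^bsub>T\<^esub> h j" using ring_hom_mult[OF h] prod IJ by blast
    thus ?case using prod by (auto intro: ideal_prod.prod)
  next
    case (sum x y)
    have "h (x \<oplus>\<^bsub>S\<^esub> y) = h x \<oplus>\<^bsub>T\<^esub> h y" using ring_hom_add[OF h] sum c by blast
    thus ?case using sum by (auto intro: ideal_prod.sum)
  qed
  thus "h ` ideal_prod S I J \<subseteq> ideal_prod T (h ` I) (h ` J)" by blast
  show "ideal_prod T (h ` I) (h ` J) \<subseteq> h ` ideal_prod S I J"
  proof (rule ideal_prod_subset)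
    fix x y assume "x \<in> h ` I" "y \<in> h ` J"
    then obtain i j where ij: "i \<in> I" "j \<in> J" "x = h i" "y = h j" by blast
    have "x \<otimes>\<^bsub>T\<^esub> y = h (i \<otimes>\<^bsub>S\<^esub> j)"
      unfolding ij(3,4) using ring_hom_mult[OF h subsetD[OF IJ(1) ij(1)] subsetD[OF IJ(2) ij(2)]] by (rule sym)
    thus "x \<otimes>\<^bsub>T\<^esub> y \<in> h ` ideal_prod S I J" using ideal_prod.prod[OF ij(1,2)] by blast
  next
    fix x y assume "x \<in> h ` ideal_prod S I J" "y \<in> h ` ideal_prod S I J"
    then obtain i j where ij: "i \<in> ideal_prod S I J" "j \<in> ideal_prod S I J" "x = h i" "y = h j" by blast
    have "x \<oplus>\<^bsub>T\<^esub> y = h (i \<oplus>\<^bsub>S\<^esub> j)"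
      unfolding ij(3,4) using ring_hom_add[OF h subsetD[OF c ij(1)] subsetD[OF c ij(2)]] by (rule sym)
    thus "x \<oplus>\<^bsub>T\<^esub> y \<in> h ` ideal_prod S I J" using ideal_prod.sum[OF ij(1,2)] by blast
  qed
qed

text \<open>The operations of the Laurent ring over \<open>C\<close> agree with those of
  \<open>laurent R\<close> on its carrier but are different functions, since each coefficient of a
  product is a sum formed in the ring on \<open>C\<close>. The locale carries submodules and their
  products across such an inclusion.\<close>

locale cring_inclusion = T: cring T + S: cring S
  for T :: "('a, 'm) ring_scheme" and S :: "('a, 'n) ring_scheme" +
  assumes carrier_le: "carrier T \<subseteq> carrier S"
    and mult_eq: "\<And>x y. \<lbrakk>x \<in> carrier T; y \<in> carrier T\<rbrakk> \<Longrightarrow> x \<otimes>\<^bsub>T\<^esub> y = x \<otimes>\<^bsub>S\<^esub> y"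
    and add_eq: "\<And>x y. \<lbrakk>x \<in> carrier T; y \<in> carrier T\<rbrakk> \<Longrightarrow> x \<oplus>\<^bsub>T\<^esub> y = x \<oplus>\<^bsub>S\<^esub> y"
    and zero_eq: "\<zero>\<^bsub>T\<^esub> = \<zero>\<^bsub>S\<^esub>"
begin

lemma submodule_inclusion_iff:
  assumes "subcring A T" "subcring A S"
  shows "subalgebra A I T \<longleftrightarrow> subalgebra A I S \<and> I \<subseteq> carrier T"
proof (cases "I \<subseteq> carrier T")
  case True
  have "A \<subseteq> carrier T" using subcringE(1)[OF assms(1)] .
  hence "\<forall>x\<in>I. \<forall>y\<in>I. x \<oplus>\<^bsub>T\<^esub> y = x \<oplus>\<^bsub>S\<^esub> y" "\<forall>a\<in>A. \<forall>x\<in>I. a \<otimes>\<^bsub>T\<^esub> x = a \<otimes>\<^bsub>S\<^esub> x"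
    using True mult_eq add_eq by blast+
  thus ?thesis
    using True carrier_le unfolding T.submodule_iff[OF assms(1)] S.submodule_iff[OF assms(2)] zero_eq by auto
qed (use T.submoduleD(1)[OF assms(1)] in blast)

lemma ideal_prod_inclusion:
  assumes "I \<subseteq> carrier T" "J \<subseteq> carrier T"
  shows "ideal_prod T I J = ideal_prod S I J"
proof
  have c: "ideal_prod T I J \<subseteq> carrier T" by (rule T.ideal_prod_carrier[OF assms])
  have "x \<in> ideal_prod S I J" if "x \<in> ideal_prod T I J" for x
    using that
  proof (induction rule: ideal_prod.induct)
    case (prod i j)
    have "i \<otimes>\<^bsub>T\<^esub> j = i \<otimes>\<^bsub>S\<^esub> j" by (rule mult_eq[OF subsetD[OF assms(1) prod(1)] subsetD[OF assms(2) prod(2)]])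
    thus ?case using ideal_prod.prod[OF prod, of S] by argo
  next
    case (sum x y)
    have "x \<oplus>\<^bsub>T\<^esub> y = x \<oplus>\<^bsub>S\<^esub> y" by (rule add_eq[OF subsetD[OF c sum(1)] subsetD[OF c sum(2)]])
    thus ?case using ideal_prod.sum[OF sum(3,4)] by argo
  qed
  thus "ideal_prod T I J \<subseteq> ideal_prod S I J" by blast
  show "ideal_prod S I J \<subseteq> ideal_prod T I J"
  proof (rule ideal_prod_subset)
    show "i \<otimes>\<^bsub>S\<^esub> j \<in> ideal_prod T I J" if "i \<in> I" "j \<in> J" for i j
      using mult_eq[OF subsetD[OF assms(1) that(1)] subsetD[OF assms(2) that(2)]] ideal_prod.prod[OF that, of T] by argo
    show "x \<oplus>\<^bsub>S\<^esub> y \<in> ideal_prod T I J" if "x \<in> ideal_prod T I J" "y \<in> ideal_prod T I J" for x y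
      using add_eq[OF subsetD[OF c that(1)] subsetD[OF c that(2)]] ideal_prod.sum[OF that] by argo
  qed
qed

lemma invertible_inclusion_iff:
  assumes "subcring A T" "subcring A S"
  shows "invertible_submodule A T I \<longleftrightarrow> (\<exists>J. subalgebra A I S \<and> subalgebra A J S \<and>
    I \<subseteq> carrier T \<and> J \<subseteq> carrier T \<and> ideal_prod S I J = A)"
  using ideal_prod_inclusion unfolding invertible_submodule_def submodule_inclusion_iff[OF assms] by auto

end

context cring
begin

lemma cring_inclusion_laurent:
  assumes C: "subcring C R" shows "cring_inclusion (laurent (R\<lparr>carrier := C\<rparr>)) (laurent R)"
proof -
  let ?RC = "R\<lparr>carrier := C\<rparr>"
  interpret C: cring ?RC using C subcring_iff subcringE(1) by blast
  interpret L: cring "laurent R" by (rule laurent_cring)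
  interpret LC: cring "laurent ?RC" by (rule C.laurent_cring)
  show ?thesis
  proof unfold_locales
    show "carrier (laurent ?RC) \<subseteq> carrier (laurent R)" by (rule subcringE(1)[OF laurent_sub_subcring[OF C]])
    fix f g assume f: "f \<in> carrier (laurent ?RC)" and g: "g \<in> carrier (laurent ?RC)"
    show "f \<otimes>\<^bsub>laurent ?RC\<^esub> g = f \<otimes>\<^bsub>laurent R\<^esub> g"
    proof
      fix n
      have c: "f i \<in> C" "g i \<in> C" for i using f g laurent_coeff_closed[of _ ?RC] by auto
      have "(\<Oplus>\<^bsub>?RC\<^esub>i\<in>{i. f i \<noteq> \<zero>}. f i \<otimes> g (n - i)) = (\<Oplus>i\<in>{i. f i \<noteq> \<zero>}. f i \<otimes> g (n - i))"
        using laurent_finite_support[OF f] c subcringE(6)[OF C] by (intro finsum_carrier_update[OF C]) auto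
      thus "(f \<otimes>\<^bsub>laurent ?RC\<^esub> g) n = (f \<otimes>\<^bsub>laurent R\<^esub> g) n" by (simp add: laurent_def)
    qed
  qed (auto simp: laurent_def)
qed

lemma laurent_const_monom: "laurent_const R c = laurent_monom R c 0"
  by (auto simp: laurent_const_def laurent_monom_def)

lemma unit_mult_self:
  assumes A: "subcring A R" and u: "u \<in> A" "v \<in> A" "u \<otimes> v = \<one>"
  shows "(\<otimes>) u ` A = A"
proof
  note Ac = subcringE[OF A]
  show "(\<otimes>) u ` A \<subseteq> A" using Ac(6) u(1) by blast
  show "A \<subseteq> (\<otimes>) u ` A"
  proof
    fix x assume x: "x \<in> A"
    have "u \<otimes> (v \<otimes> x) = u \<otimes> v \<otimes> x" using u x Ac(1) by (intro m_assoc[symmetric]) auto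
    hence "x = u \<otimes> (v \<otimes> x)" using u(3) x Ac(1) by auto
    thus "x \<in> (\<otimes>) u ` A" using Ac(6) u(2) x by blast
  qed
qed

lemma mult_image_image:
  assumes "u \<in> carrier R" "v \<in> carrier R" "I \<subseteq> carrier R"
  shows "(\<otimes>) u ` (\<otimes>) v ` I = (\<otimes>) (u \<otimes> v) ` I"
proof -
  have "u \<otimes> (v \<otimes> x) = u \<otimes> v \<otimes> x" if "x \<in> I" for x using assms that by (intro m_assoc[symmetric]) auto
  thus ?thesis by (force simp: image_image)
qed

lemma one_mult_image: "I \<subseteq> carrier R \<Longrightarrow> (\<otimes>) \<one> ` I = I"
  by (force simp: subset_iff)

lemma unit_mult_invertible:
  assumes A: "subcring A R" and u: "u \<in> Units R" and I: "invertible_submodule A R I"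
  shows "invertible_submodule A R ((\<otimes>) u ` I)"
proof -
  obtain J where J: "subalgebra A I R" "subalgebra A J R" "ideal_prod R I J = A"
    using I by (auto simp: invertible_submodule_def)
  have c: "u \<in> carrier R" "inv u \<in> carrier R" "u \<otimes> inv u = \<one>" using u by auto
  have "ideal_prod R ((\<otimes>) u ` I) ((\<otimes>) (inv u) ` J) = A"
    using ideal_prod_image_mult[OF submoduleD(1)[OF A J(1)] submoduleD(1)[OF A J(2)] c(1,2)]
      c(3) J(3) one_mult_image[OF subcringE(1)[OF A]] by simp
  thus ?thesis unfolding invertible_submodule_def
    using unit_mult_submodule[OF A J(1) c(1)] unit_mult_submodule[OF A J(2) c(2)] by blast
qed

lemma subcring_invertible: "subcring A R \<Longrightarrow> invertible_submodule A R A"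
  using subcring_is_submodule ideal_prod_unit unfolding invertible_submodule_def by blast

lemma laurent_extend_principal:
  assumes A: "subcring A R" and a: "a \<in> carrier R"
  shows "laurent_extend A R ((\<otimes>) a ` A) = (\<otimes>\<^bsub>laurent R\<^esub>) (laurent_const R a) ` laurent_sub A R"
proof
  interpret L: cring "laurent R" by (rule laurent_cring)
  let ?L = "laurent R" and ?c = "laurent_const R"
  note AL = laurent_sub_subcring[OF A] and Ac = subcringE[OF A]
  note ALc = subcringE[OF AL]
  have cc: "?c x \<in> carrier ?L" if "x \<in> carrier R" for x using laurent_const_hom that by (simp add: ring_hom_closed)
  have cA: "?c x \<in> laurent_sub A R" if "x \<in> A" for x
    unfolding laurent_const_monom by (rule laurent_monom_closed[OF A that])
  have "subalgebra (laurent_sub A R) ((\<otimes>\<^bsub>?L\<^esub>) (?c a) ` laurent_sub A R) ?L"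
    by (rule L.unit_mult_submodule[OF AL L.subcring_is_submodule[OF AL] cc[OF a]])
  note sD = L.submoduleD[OF AL this]
  show "laurent_extend A R ((\<otimes>) a ` A) \<subseteq> (\<otimes>\<^bsub>?L\<^esub>) (?c a) ` laurent_sub A R"
    unfolding laurent_extend_def
  proof (rule ideal_prod_subset)
    fix x y assume "x \<in> ?c ` (\<otimes>) a ` A" and y: "y \<in> laurent_sub A R"
    then obtain b where b: "b \<in> A" "x = ?c (a \<otimes> b)" by blast
    have bc: "b \<in> carrier R" using b(1) Ac(1) by blast
    have "x \<otimes>\<^bsub>?L\<^esub> y = ?c a \<otimes>\<^bsub>?L\<^esub> (?c b \<otimes>\<^bsub>?L\<^esub> y)"
      unfolding b(2) ring_hom_mult[OF laurent_const_hom a bc] using cc a bc y ALc(1) by (intro L.m_assoc) auto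
    thus "x \<otimes>\<^bsub>?L\<^esub> y \<in> (\<otimes>\<^bsub>?L\<^esub>) (?c a) ` laurent_sub A R" using ALc(6)[OF cA[OF b(1)] y] by blast
  qed (rule sD(3))
  show "(\<otimes>\<^bsub>?L\<^esub>) (?c a) ` laurent_sub A R \<subseteq> laurent_extend A R ((\<otimes>) a ` A)"
  proof
    fix z assume "z \<in> (\<otimes>\<^bsub>?L\<^esub>) (?c a) ` laurent_sub A R"
    then obtain y where y: "y \<in> laurent_sub A R" "z = ?c a \<otimes>\<^bsub>?L\<^esub> y" by blast
    have "a \<otimes> \<one> \<in> (\<otimes>) a ` A" using Ac(3) by blast
    hence "?c a \<in> ?c ` (\<otimes>) a ` A" using a by auto
    thus "z \<in> laurent_extend A R ((\<otimes>) a ` A)" unfolding y(2) laurent_extend_def using y(1) by (rule ideal_prod.prod)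
  qed
qed

text \<open>Over a local \<open>A\<close> invertible submodules are principal, so the subgroup
  divided out in \<open>MI\<close> consists of the modules generated by constant units.\<close>

lemma laurent_extend_image_local:
  assumes A: "subcring A R" "local_ring (R\<lparr>carrier := A\<rparr>)"
  shows "laurent_extend A R ` carrier (inv_submodules A R) =
    {(\<otimes>\<^bsub>laurent R\<^esub>) (laurent_const R a) ` laurent_sub A R |a. a \<in> Units R}"
proof
  show "laurent_extend A R ` carrier (inv_submodules A R) \<subseteq> {(\<otimes>\<^bsub>laurent R\<^esub>) (laurent_const R a) ` laurent_sub A R |a. a \<in> Units R}"
  proof
    fix x assume "x \<in> laurent_extend A R ` carrier (inv_submodules A R)"
    then obtain I J where IJ: "subalgebra A I R" "subalgebra A J R" "ideal_prod R I J = A" "x = laurent_extend A R I"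
      by (auto simp: inv_submodules_def invertible_submodule_def)
    obtain a where a: "a \<in> Units R" "I = (\<otimes>) a ` A" using invertible_submodule_local[OF A IJ(1-3)] by blast
    thus "x \<in> {(\<otimes>\<^bsub>laurent R\<^esub>) (laurent_const R a) ` laurent_sub A R |a. a \<in> Units R}"
      using laurent_extend_principal[OF A(1), of a] IJ(4) by auto
  qed
  show "{(\<otimes>\<^bsub>laurent R\<^esub>) (laurent_const R a) ` laurent_sub A R |a. a \<in> Units R} \<subseteq> laurent_extend A R ` carrier (inv_submodules A R)"
  proof clarify
    fix a assume a: "a \<in> Units R"
    have "(\<otimes>) a ` A \<in> carrier (inv_submodules A R)"
      using unit_mult_invertible[OF A(1) a subcring_invertible[OF A(1)]] by (simp add: inv_submodules_def)
    thus "(\<otimes>\<^bsub>laurent R\<^esub>) (laurent_const R a) ` laurent_sub A R \<in> laurent_extend A R ` carrier (inv_submodules A R)"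
      using laurent_extend_principal[OF A(1), of a] a by (metis Units_closed image_eqI)
  qed
qed

text \<open>A power of \<open>X\<close> is a unit of the Laurent ring over \<open>A\<close> and is
  absorbed by the module, so the exponent of a generating monomial does not affect its
  class.\<close>

lemma laurent_monom_mult_sub:
  assumes A: "subcring A R" and c: "c \<in> carrier R"
  shows "(\<otimes>\<^bsub>laurent R\<^esub>) (laurent_monom R c k) ` laurent_sub A R =
    (\<otimes>\<^bsub>laurent R\<^esub>) (laurent_const R c) ` laurent_sub A R"
proof -
  interpret L: cring "laurent R" by (rule laurent_cring)
  note AL = laurent_sub_subcring[OF A]
  have m: "laurent_monom R \<one> j \<in> laurent_sub A R" for j by (rule laurent_monom_closed[OF A subcringE(3)[OF A]])
  have mc: "laurent_monom R a j \<in> carrier (laurent R)" if "a \<in> carrier R" for a j by (rule laurent_monom_carrier[OF that])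
  have "laurent_monom R \<one> k \<otimes>\<^bsub>laurent R\<^esub> laurent_monom R \<one> (- k) = \<one>\<^bsub>laurent R\<^esub>"
    unfolding laurent_monom_mult[OF one_closed mc[OF one_closed]] by (auto simp: laurent_monom_def laurent_one_coeff)
  hence 1: "(\<otimes>\<^bsub>laurent R\<^esub>) (laurent_monom R \<one> k) ` laurent_sub A R = laurent_sub A R"
    by (rule L.unit_mult_self[OF AL m m])
  have "laurent_monom R c 0 \<otimes>\<^bsub>laurent R\<^esub> laurent_monom R \<one> k = laurent_monom R c k"
    unfolding laurent_monom_mult[OF c mc[OF one_closed]] using c by (auto simp: laurent_monom_def)
  hence "(\<otimes>\<^bsub>laurent R\<^esub>) (laurent_monom R c k) ` laurent_sub A R =
      (\<otimes>\<^bsub>laurent R\<^esub>) (laurent_monom R c 0) ` (\<otimes>\<^bsub>laurent R\<^esub>) (laurent_monom R \<one> k) ` laurent_sub A R"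
    using L.mult_image_image[OF mc[OF c] mc[OF one_closed] subcringE(1)[OF AL]] by simp
  thus ?thesis unfolding 1 laurent_const_monom .
qed

lemma laurent_eval_sub:
  assumes "subcring A R" shows "laurent_eval R ` laurent_sub A R = A"
proof
  show "laurent_eval R ` laurent_sub A R \<subseteq> A" using laurent_eval_in[OF assms] by blast
  show "A \<subseteq> laurent_eval R ` laurent_sub A R"
  proof
    fix a assume a: "a \<in> A"
    hence "a = laurent_eval R (laurent_monom R a 0)" using laurent_eval_monom subcringE(1)[OF assms] by auto
    thus "a \<in> laurent_eval R ` laurent_sub A R" using laurent_monom_closed[OF assms a] by blast
  qed
qed

lemma laurent_eval_ideal_prod:
  assumes "I \<subseteq> carrier (laurent R)" "J \<subseteq> carrier (laurent R)"
  shows "laurent_eval R ` ideal_prod (laurent R) I J = ideal_prod R (laurent_eval R ` I) (laurent_eval R ` J)"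
  by (rule ring_hom_image_ideal_prod[OF laurent_eval_hom laurent_cring assms])

text \<open>Constants keep their value at \<open>X = 1\<close> and Laurent polynomials over
  \<open>A\<close> have values in \<open>A\<close>, so evaluation undoes extension of scalars. In
  this way \<open>I\<close> is recovered from its extension.\<close>

lemma laurent_eval_extend:
  assumes A: "subcring A R" and I: "subalgebra A I R"
  shows "laurent_eval R ` laurent_extend A R I = I"
proof -
  note ID = submoduleD[OF A I]
  have "laurent_const R ` I \<subseteq> carrier (laurent R)"
    using ring_hom_closed[OF laurent_const_hom] ID(1) by blast
  hence "laurent_eval R ` laurent_extend A R I = ideal_prod R (laurent_eval R ` laurent_const R ` I) (laurent_eval R ` laurent_sub A R)"
    unfolding laurent_extend_def by (rule laurent_eval_ideal_prod[OF _ subcringE(1)[OF laurent_sub_subcring[OF A]]])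
  also have "laurent_eval R ` laurent_const R ` I = I"
    using laurent_eval_monom ID(1) by (force simp: laurent_const_monom image_image subset_iff)
  also have "laurent_eval R ` laurent_sub A R = A" by (rule laurent_eval_sub[OF A])
  also have "ideal_prod R I A = ideal_prod R A I" by (rule ideal_prod_commute_sets[OF ID(1) subcringE(1)[OF A]])
  finally show ?thesis using ideal_prod_unit[OF A I] by simp
qed

lemma laurent_eval_submodule:
  assumes A: "subcring A R" and I: "subalgebra (laurent_sub A R) I (laurent R)"
  shows "subalgebra A (laurent_eval R ` I) R"
proof (rule submoduleI[OF A])
  interpret L: cring "laurent R" by (rule laurent_cring)
  note ID = L.submoduleD[OF laurent_sub_subcring[OF A] I]
  show "laurent_eval R ` I \<subseteq> carrier R" using ring_hom_closed[OF laurent_eval_hom] ID(1) by blast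
  have "laurent_eval R \<zero>\<^bsub>laurent R\<^esub> = \<zero>" by (simp add: laurent_eval_def laurent_zero_coeff)
  thus "\<zero> \<in> laurent_eval R ` I" using ID(2) by (metis imageI)
  show "x \<oplus> y \<in> laurent_eval R ` I" if "x \<in> laurent_eval R ` I" "y \<in> laurent_eval R ` I" for x y
  proof -
    obtain a b where ab: "a \<in> I" "b \<in> I" "x = laurent_eval R a" "y = laurent_eval R b" using \<open>x \<in> _\<close> \<open>y \<in> _\<close> by blast
    have "x \<oplus> y = laurent_eval R (a \<oplus>\<^bsub>laurent R\<^esub> b)"
      unfolding ab(3,4) using ring_hom_add[OF laurent_eval_hom subsetD[OF ID(1) ab(1)] subsetD[OF ID(1) ab(2)]] by (rule sym)
    thus ?thesis using ID(3)[OF ab(1,2)] by blast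
  qed
  show "c \<otimes> x \<in> laurent_eval R ` I" if c: "c \<in> A" and "x \<in> laurent_eval R ` I" for c x
  proof -
    obtain a where a: "a \<in> I" "x = laurent_eval R a" using \<open>x \<in> _\<close> by blast
    have cc: "c \<in> carrier R" using c subcringE(1)[OF A] by blast
    have "c \<otimes> x = laurent_eval R (laurent_monom R c 0 \<otimes>\<^bsub>laurent R\<^esub> a)"
      using ring_hom_mult[OF laurent_eval_hom laurent_monom_carrier[OF cc], of a 0] a ID(1) laurent_eval_monom[OF cc] by auto
    thus ?thesis using ID(4)[OF laurent_monom_closed[OF A c] a(1)] by blast
  qed
qed

end

section \<open>Quotient maps onto the cokernels, and units under evaluation\<close>

lemma iso_of_equal_kernels:
  assumes "group P" "group H" "group K"
    and f: "f \<in> hom P H" "f ` carrier P = carrier H" and g: "g \<in> hom P K" "g ` carrier P = carrier K"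
    and ker: "\<And>p. p \<in> carrier P \<Longrightarrow> f p = \<one>\<^bsub>H\<^esub> \<longleftrightarrow> g p = \<one>\<^bsub>K\<^esub>"
  shows "H \<cong> K"
proof -
  interpret f: group_hom P H f using assms by (simp add: group_hom_def group_hom_axioms_def)
  interpret g: group_hom P K g using assms by (simp add: group_hom_def group_hom_axioms_def)
  have "kernel P H f = kernel P K g" using ker by (auto simp: kernel_def)
  hence "P Mod kernel P H f \<cong> K" using g.FactGroup_iso[OF g(2)] by simp
  moreover have "H \<cong> P Mod kernel P H f"
    using group.iso_sym[OF normal.factorgroup_is_group[OF f.normal_kernel] f.FactGroup_iso[OF f(2)]] .
  ultimately show ?thesis by (rule iso_trans[rotated])
qed

lemma (in comm_group) quotient_map:
  assumes N: "subgroup N G"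
  shows "(\<lambda>x. N #> x) \<in> hom G (G Mod N)" "(\<lambda>x. N #> x) ` carrier G = carrier (G Mod N)"
    "\<And>x. x \<in> carrier G \<Longrightarrow> N #> x = \<one>\<^bsub>G Mod N\<^esub> \<longleftrightarrow> x \<in> N"
proof -
  have nN: "N \<lhd> G" using subgroup_imp_normal[OF N] .
  show "(\<lambda>x. N #> x) \<in> hom G (G Mod N)" by (rule normal.r_coset_hom_Mod[OF nN])
  show "(\<lambda>x. N #> x) ` carrier G = carrier (G Mod N)" by (auto simp: FactGroup_def RCOSETS_def)
  fix x assume x: "x \<in> carrier G"
  show "N #> x = \<one>\<^bsub>G Mod N\<^esub> \<longleftrightarrow> x \<in> N"
    using coset_join1[OF _ x N] coset_join2[OF x N] subgroup.subset[OF N] by (auto simp: FactGroup_def)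
qed

context cring
begin

lemma MI_quotient_map:
  assumes A: "subcring A R"
  defines "G \<equiv> inv_submodules (laurent_sub A R) (laurent R)"
    and "N \<equiv> laurent_extend A R ` carrier (inv_submodules A R)"
  shows "comm_group G" "subgroup N G" "(\<lambda>I. N #>\<^bsub>G\<^esub> I) \<in> hom G (MI A R)" "(\<lambda>I. N #>\<^bsub>G\<^esub> I) ` carrier G = carrier (MI A R)"
    "\<And>I. I \<in> carrier G \<Longrightarrow> N #>\<^bsub>G\<^esub> I = \<one>\<^bsub>MI A R\<^esub> \<longleftrightarrow> I \<in> N"
proof -
  interpret L: cring "laurent R" by (rule laurent_cring)
  show G: "comm_group G" unfolding G_def by (rule L.inv_submodules_comm_group[OF laurent_sub_subcring[OF A]])
  interpret G: comm_group G by fact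
  interpret I: comm_group "inv_submodules A R" by (rule inv_submodules_comm_group[OF A])
  interpret h: group_hom "inv_submodules A R" G "laurent_extend A R"
    using laurent_extend_hom[OF A] by unfold_locales (simp add: G_def)
  show N: "subgroup N G" unfolding N_def by (rule h.img_is_subgroup)
  have M: "MI A R = G Mod N" by (simp add: MI_def G_def N_def)
  show "(\<lambda>I. N #>\<^bsub>G\<^esub> I) \<in> hom G (MI A R)" "(\<lambda>I. N #>\<^bsub>G\<^esub> I) ` carrier G = carrier (MI A R)"
    "\<And>I. I \<in> carrier G \<Longrightarrow> N #>\<^bsub>G\<^esub> I = \<one>\<^bsub>MI A R\<^esub> \<longleftrightarrow> I \<in> N"
    unfolding M by (rule G.quotient_map[OF N])+
qed

lemma unit_of_inverse: "\<lbrakk>u \<in> carrier R; v \<in> carrier R; u \<otimes> v = \<one>\<rbrakk> \<Longrightarrow> u \<in> Units R"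
  using m_comm[of u v] by (auto simp: Units_def)

lemma laurent_eval_units:
  assumes "v \<in> Units (laurent R)" shows "laurent_eval R v \<in> Units R"
proof -
  interpret L: cring "laurent R" by (rule laurent_cring)
  note h = laurent_eval_hom
  have "laurent_eval R v \<otimes> laurent_eval R (inv\<^bsub>laurent R\<^esub> v) = \<one>"
    unfolding ring_hom_mult[OF h L.Units_closed[OF assms] L.Units_inv_closed[OF assms], symmetric]
      L.Units_r_inv[OF assms] by (rule ring_hom_one[OF h])
  thus ?thesis
    using unit_of_inverse ring_hom_closed[OF h L.Units_closed[OF assms]] ring_hom_closed[OF h L.Units_inv_closed[OF assms]] by blast
qed

lemma laurent_const_units:
  assumes a: "a \<in> Units R"
  shows "laurent_const R a \<in> Units (laurent R)" "laurent_const R a \<otimes>\<^bsub>laurent R\<^esub> laurent_const R (inv a) = \<one>\<^bsub>laurent R\<^esub>"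
proof -
  interpret L: cring "laurent R" by (rule laurent_cring)
  note h = laurent_const_hom
  show 1: "laurent_const R a \<otimes>\<^bsub>laurent R\<^esub> laurent_const R (inv a) = \<one>\<^bsub>laurent R\<^esub>"
    unfolding ring_hom_mult[OF h Units_closed[OF a] Units_inv_closed[OF a], symmetric] Units_r_inv[OF a] by (rule ring_hom_one[OF h])
  show "laurent_const R a \<in> Units (laurent R)"
    by (rule L.unit_of_inverse[OF _ _ 1]) (use ring_hom_closed[OF h] a in auto)
qed

lemma laurent_eval_const: "a \<in> carrier R \<Longrightarrow> laurent_eval R (laurent_const R a) = a"
  by (simp add: laurent_const_monom laurent_eval_monom)

lemma laurent_eval_mult_image:
  assumes "v \<in> carrier (laurent R)" "I \<subseteq> carrier (laurent R)"
  shows "laurent_eval R ` (\<otimes>\<^bsub>laurent R\<^esub>) v ` I = (\<otimes>) (laurent_eval R v) ` laurent_eval R ` I"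
proof -
  have "laurent_eval R (v \<otimes>\<^bsub>laurent R\<^esub> x) = laurent_eval R v \<otimes> laurent_eval R x" if "x \<in> I" for x
    using ring_hom_mult[OF laurent_eval_hom] assms that by auto
  thus ?thesis by (force simp: image_image)
qed

text \<open>The value of \<open>J\<close> at \<open>X = 1\<close> is \<open>a A\<close>, because
  \<open>A\<close> is local; multiplying \<open>J\<close> by the inverse of \<open>a\<close> and
  \<open>J'\<close> by \<open>a\<close> makes both values equal to \<open>A\<close>. The extensions
  \<open>K\<close> and \<open>M\<close> to \<open>C[X]\<close> then satisfy the premises of
  \<open>subintegral_closure_module_principal\<close>. A unit \<open>u\<close> with
  \<open>u K = C[X]\<close> moves the first module into \<open>C[X]\<close>, and since its inverse
  lies in \<open>K\<close>, this inverse moves the second one into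
  \<open>K M = C[X]\<close>.\<close>

lemma laurent_invertible_into_closure:
  assumes A: "subcring A R" "hensel_local_ring (R\<lparr>carrier := A\<rparr>)"
  defines "C \<equiv> subintegral_closure A R"
  assumes J: "subalgebra (laurent_sub A R) J (laurent R)" and J': "subalgebra (laurent_sub A R) J' (laurent R)"
    and JJ': "ideal_prod (laurent R) J J' = laurent_sub A R"
  shows "\<exists>v\<in>Units (laurent R). (\<otimes>\<^bsub>laurent R\<^esub>) v ` J \<subseteq> laurent_sub C R \<and>
    (\<otimes>\<^bsub>laurent R\<^esub>) (inv\<^bsub>laurent R\<^esub> v) ` J' \<subseteq> laurent_sub C R"
proof -
  interpret L: cring "laurent R" by (rule laurent_cring)
  let ?L = "laurent R" and ?c = "laurent_const R" and ?ev = "laurent_eval R"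
  let ?AL = "laurent_sub A R" and ?CL = "laurent_sub C R"
  have C: "subcring C R" "A \<subseteq> C" unfolding C_def using subintegral_closure_greatest[OF A(1)] by auto
  have loc: "local_ring (R\<lparr>carrier := A\<rparr>)" using A(2) by (simp add: hensel_local_ring_def)
  note Ac = subcringE[OF A(1)] and Cc = subcringE[OF C(1)]
  note AL = laurent_sub_subcring[OF A(1)] and CL = laurent_sub_subcring[OF C(1)]
  note ALc = subcringE[OF AL] and CLc = subcringE[OF CL]
  have ACL: "?AL \<subseteq> ?CL" using C(2) laurent_sub_iff[OF Ac(1)] laurent_sub_iff[OF Cc(1)] by blast
  have Jc: "J \<subseteq> carrier ?L" "J' \<subseteq> carrier ?L" using L.submoduleD(1)[OF AL] J J' by auto
  have eJ: "ideal_prod R (?ev ` J) (?ev ` J') = A"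
    using laurent_eval_ideal_prod[OF Jc] unfolding JJ' laurent_eval_sub[OF A(1)] by (rule sym)
  obtain a where a: "a \<in> Units R" "?ev ` J = (\<otimes>) a ` A"
    using invertible_submodule_local[OF A(1) loc laurent_eval_submodule[OF A(1) J] laurent_eval_submodule[OF A(1) J'] eJ] by blast
  have ac: "a \<in> carrier R" "inv a \<in> carrier R" "a \<otimes> inv a = \<one>" "inv a \<otimes> a = \<one>" using a(1) by auto
  note cu = laurent_const_units[OF a(1)]
  have cc: "?c a \<in> carrier ?L" "?c (inv a) \<in> carrier ?L" using ring_hom_closed[OF laurent_const_hom] ac by auto
  have cu': "?c (inv a) \<otimes>\<^bsub>?L\<^esub> ?c a = \<one>\<^bsub>?L\<^esub>" using cu(2) L.m_comm[OF cc] by simp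
  define J0 where "J0 = (\<otimes>\<^bsub>?L\<^esub>) (?c (inv a)) ` J"
  define J1 where "J1 = (\<otimes>\<^bsub>?L\<^esub>) (?c a) ` J'"
  have J0: "subalgebra ?AL J0 ?L" and J1: "subalgebra ?AL J1 ?L"
    unfolding J0_def J1_def by (rule L.unit_mult_submodule[OF AL J cc(2)], rule L.unit_mult_submodule[OF AL J' cc(1)])
  have Jc': "J0 \<subseteq> carrier ?L" "J1 \<subseteq> carrier ?L" using L.submoduleD(1)[OF AL] J0 J1 by auto
  have J01: "ideal_prod ?L J0 J1 = ?AL"
    unfolding J0_def J1_def L.ideal_prod_image_mult[OF Jc cc(2,1)] cu' JJ' by (rule L.one_mult_image[OF ALc(1)])
  have e0: "?ev ` J0 = A"
    unfolding J0_def laurent_eval_mult_image[OF cc(2) Jc(1)] a(2) laurent_eval_const[OF ac(2)]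
      mult_image_image[OF ac(2,1) Ac(1)] ac(4) by (rule one_mult_image[OF Ac(1)])
  have "ideal_prod R A (?ev ` J1) = A"
    using laurent_eval_ideal_prod[OF Jc'] unfolding J01 laurent_eval_sub[OF A(1)] e0 by (rule sym)
  hence e1: "?ev ` J1 = A" using ideal_prod_unit[OF A(1) laurent_eval_submodule[OF A(1) J1]] by simp
  define K where "K = ideal_prod ?L J0 ?CL"
  define M where "M = ideal_prod ?L J1 ?CL"
  have ne: "J0 \<noteq> {}" "J1 \<noteq> {}" using L.submoduleD(2)[OF AL J0] L.submoduleD(2)[OF AL J1] by auto
  have K: "subalgebra ?CL K ?L" and M: "subalgebra ?CL M ?L"
    unfolding K_def M_def using L.ideal_prod_submodule[OF CLc(1) _ _ L.subcring_is_submodule[OF CL]] Jc' ne by auto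
  have CC: "ideal_prod ?L ?CL ?CL = ?CL" by (rule L.ideal_prod_unit[OF CL L.subcring_is_submodule[OF CL]])
  have ACc: "ideal_prod ?L ?AL ?CL = ?CL"
  proof
    show "ideal_prod ?L ?AL ?CL \<subseteq> ?CL" using ideal_prod_mono[OF ACL order_refl, of ?L ?CL] unfolding CC .
    show "?CL \<subseteq> ideal_prod ?L ?AL ?CL"
    proof
      fix x assume x: "x \<in> ?CL"
      have "\<one>\<^bsub>?L\<^esub> \<otimes>\<^bsub>?L\<^esub> x \<in> ideal_prod ?L ?AL ?CL" by (rule ideal_prod.prod[OF ALc(3) x])
      thus "x \<in> ideal_prod ?L ?AL ?CL" using x CLc(1) by auto
    qed
  qed
  have KM: "ideal_prod ?L K M = ?CL"
  proof -
    have "ideal_prod ?L K M = ideal_prod ?L J0 (ideal_prod ?L ?CL (ideal_prod ?L J1 ?CL))"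
      unfolding K_def M_def by (rule L.ideal_prod_assoc_sets[OF Jc'(1) CLc(1) L.ideal_prod_carrier[OF Jc'(2) CLc(1)]])
    also have "ideal_prod ?L ?CL (ideal_prod ?L J1 ?CL) = ideal_prod ?L J1 ?CL"
      using L.ideal_prod_unit[OF CL M] by (simp add: M_def)
    also have "ideal_prod ?L J0 (ideal_prod ?L J1 ?CL) = ideal_prod ?L (ideal_prod ?L J0 J1) ?CL"
      by (rule L.ideal_prod_assoc_sets[OF Jc' CLc(1), symmetric])
    finally show ?thesis by (simp add: J01 ACc)
  qed
  have AC: "ideal_prod R A C \<subseteq> C"
    using ideal_prod_mono[OF C(2) order_refl, of R C] ideal_prod_unit[OF C(1) subcring_is_submodule[OF C(1)]] by simp
  have evK: "?ev ` K \<subseteq> C" "?ev ` M \<subseteq> C"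
    unfolding K_def M_def laurent_eval_ideal_prod[OF Jc'(1) CLc(1)] laurent_eval_ideal_prod[OF Jc'(2) CLc(1)]
      e0 e1 laurent_eval_sub[OF C(1)] by (rule AC)+
  obtain u where u: "u \<in> Units ?L" "(\<otimes>\<^bsub>?L\<^esub>) u ` K = ?CL"
    using subintegral_closure_module_principal[OF A K[unfolded C_def] M[unfolded C_def] KM[unfolded C_def] evK[unfolded C_def]]
    unfolding C_def by blast
  have uc: "u \<in> carrier ?L" "inv\<^bsub>?L\<^esub> u \<in> carrier ?L" "u \<otimes>\<^bsub>?L\<^esub> inv\<^bsub>?L\<^esub> u = \<one>\<^bsub>?L\<^esub>" "inv\<^bsub>?L\<^esub> u \<otimes>\<^bsub>?L\<^esub> u = \<one>\<^bsub>?L\<^esub>"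
    using u(1) by auto
  have JK: "J0 \<subseteq> K" "J1 \<subseteq> M"
  proof -
    have "x \<in> ideal_prod ?L I ?CL" if "x \<in> I" "I \<subseteq> carrier ?L" for x I
      using ideal_prod.prod[OF that(1) CLc(3), of ?L] that by auto
    thus "J0 \<subseteq> K" "J1 \<subseteq> M" unfolding K_def M_def using Jc' by blast+
  qed
  have "K = (\<otimes>\<^bsub>?L\<^esub>) (inv\<^bsub>?L\<^esub> u) ` ?CL"
    unfolding u(2)[symmetric] L.mult_image_image[OF uc(2,1) L.submoduleD(1)[OF CL K]] uc(4)
    by (rule L.one_mult_image[OF L.submoduleD(1)[OF CL K], symmetric])
  moreover have "inv\<^bsub>?L\<^esub> u \<otimes>\<^bsub>?L\<^esub> \<one>\<^bsub>?L\<^esub> = inv\<^bsub>?L\<^esub> u" using uc by simp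
  ultimately have uK: "inv\<^bsub>?L\<^esub> u \<in> K" using CLc(3) by (metis imageI)
  have u0: "(\<otimes>\<^bsub>?L\<^esub>) u ` J0 \<subseteq> ?CL" using u(2) JK(1) by blast
  have u1: "(\<otimes>\<^bsub>?L\<^esub>) (inv\<^bsub>?L\<^esub> u) ` J1 \<subseteq> ?CL"
    using ideal_prod.prod[OF uK, of _ M ?L] JK(2) KM by blast
  define v where "v = u \<otimes>\<^bsub>?L\<^esub> ?c (inv a)"
  have vc: "v \<in> carrier ?L" unfolding v_def using uc cc by simp
  have "v \<otimes>\<^bsub>?L\<^esub> (inv\<^bsub>?L\<^esub> u \<otimes>\<^bsub>?L\<^esub> ?c a) = (u \<otimes>\<^bsub>?L\<^esub> inv\<^bsub>?L\<^esub> u) \<otimes>\<^bsub>?L\<^esub> (?c (inv a) \<otimes>\<^bsub>?L\<^esub> ?c a)"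
    unfolding v_def using uc(1,2) cc by (simp add: L.m_ac)
  hence vw: "v \<otimes>\<^bsub>?L\<^esub> (inv\<^bsub>?L\<^esub> u \<otimes>\<^bsub>?L\<^esub> ?c a) = \<one>\<^bsub>?L\<^esub>" unfolding uc(3) cu' by simp
  have vU: "v \<in> Units ?L" by (rule L.unit_of_inverse[OF vc _ vw]) (use uc cc in simp)
  have inv: "inv\<^bsub>?L\<^esub> v = inv\<^bsub>?L\<^esub> u \<otimes>\<^bsub>?L\<^esub> ?c a"
    using L.comm_inv_char[OF vc _ vw] uc cc by simp
  show ?thesis
  proof (intro bexI[OF _ vU] conjI)
    show "(\<otimes>\<^bsub>?L\<^esub>) v ` J \<subseteq> ?CL"
      using u0 unfolding J0_def L.mult_image_image[OF uc(1) cc(2) Jc(1)] v_def .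
    show "(\<otimes>\<^bsub>?L\<^esub>) (inv\<^bsub>?L\<^esub> v) ` J' \<subseteq> ?CL"
      using u1 unfolding J1_def L.mult_image_image[OF uc(2) cc(1) Jc(2)] inv .
  qed
qed

text \<open>Over \<open>C\<close> no generator of the value of \<open>K\<close> at
  \<open>X = 1\<close> is at hand, so the normalisation multiplies \<open>K\<close> by the extension
  of the inverse of that value. The inverse is the value of \<open>K'\<close>, so the product has
  value \<open>C\<close> at \<open>X = 1\<close> and is principal.\<close>

lemma laurent_closure_module_principal_mod_extended:
  assumes A: "subcring A R" "hensel_local_ring (R\<lparr>carrier := A\<rparr>)"
  defines "C \<equiv> subintegral_closure A R"
  assumes K: "subalgebra (laurent_sub C R) K (laurent R)" and K': "subalgebra (laurent_sub C R) K' (laurent R)"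
    and KK': "ideal_prod (laurent R) K K' = laurent_sub C R"
  shows "\<exists>v\<in>Units (laurent R). \<exists>I. invertible_submodule C R I \<and>
    ideal_prod (laurent R) K (laurent_extend C R I) = (\<otimes>\<^bsub>laurent R\<^esub>) v ` laurent_sub C R"
proof -
  interpret L: cring "laurent R" by (rule laurent_cring)
  let ?L = "laurent R" and ?ev = "laurent_eval R" and ?CL = "laurent_sub C R" and ?x = "laurent_extend C R"
  have C: "subcring C R" unfolding C_def using subintegral_closure_greatest[OF A(1)] by auto
  note CL = laurent_sub_subcring[OF C]
  have Kc: "K \<subseteq> carrier ?L" "K' \<subseteq> carrier ?L" using L.submoduleD(1)[OF CL] K K' by auto
  define I where "I = ?ev ` K"
  define I' where "I' = ?ev ` K'"
  have I: "subalgebra C I R" "subalgebra C I' R"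
    unfolding I_def I'_def using laurent_eval_submodule[OF C] K K' by auto
  have Ic: "I \<subseteq> carrier R" "I' \<subseteq> carrier R" using submoduleD(1)[OF C] I by auto
  have II': "ideal_prod R I I' = C" "ideal_prod R I' I = C"
    using laurent_eval_ideal_prod[OF Kc] ideal_prod_commute_sets[OF Ic]
    unfolding KK' laurent_eval_sub[OF C] I_def[symmetric] I'_def[symmetric] by auto
  have inv: "invertible_submodule C R I" "invertible_submodule C R I'"
    using I II' by (auto simp: invertible_submodule_def)
  define G where "G = inv_submodules ?CL ?L"
  interpret G: comm_group G unfolding G_def by (rule L.inv_submodules_comm_group[OF CL])
  interpret h: group_hom "inv_submodules C R" G ?x
    using laurent_extend_hom[OF C] inv_submodules_comm_group[OF C] G.group_axioms
    by (simp add: group_hom_def group_hom_axioms_def comm_group_def G_def)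
  have Iin: "I \<in> carrier (inv_submodules C R)" "I' \<in> carrier (inv_submodules C R)"
    using inv by (auto simp: inv_submodules_def)
  have KG: "K \<in> carrier G" "K' \<in> carrier G"
    using K K' KK' L.ideal_prod_commute_sets[OF Kc] by (auto simp: G_def inv_submodules_def invertible_submodule_def)
  have xG: "?x I \<in> carrier G" "?x I' \<in> carrier G" using Iin by auto
  have sub: "subalgebra ?CL H ?L" if "H \<in> carrier G" for H
    using that by (auto simp: G_def inv_submodules_def invertible_submodule_def)
  have mG: "H \<otimes>\<^bsub>G\<^esub> H' = ideal_prod ?L H H'" for H H' by (simp add: G_def inv_submodules_def)
  have oneG: "\<one>\<^bsub>G\<^esub> = ?CL" by (simp add: G_def inv_submodules_def)
  have "ideal_prod R I I' = \<one>\<^bsub>inv_submodules C R\<^esub>" using II' by (simp add: inv_submodules_def)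
  hence xx: "?x I \<otimes>\<^bsub>G\<^esub> ?x I' = \<one>\<^bsub>G\<^esub>"
    using h.hom_mult[OF Iin] h.hom_one by (simp add: inv_submodules_def)
  have "(K \<otimes>\<^bsub>G\<^esub> ?x I') \<otimes>\<^bsub>G\<^esub> (K' \<otimes>\<^bsub>G\<^esub> ?x I) = (K \<otimes>\<^bsub>G\<^esub> K') \<otimes>\<^bsub>G\<^esub> (?x I \<otimes>\<^bsub>G\<^esub> ?x I')"
    using KG xG by (simp add: G.m_ac)
  hence prod: "ideal_prod ?L (K \<otimes>\<^bsub>G\<^esub> ?x I') (K' \<otimes>\<^bsub>G\<^esub> ?x I) = ?CL"
    unfolding xx unfolding mG KK' oneG using L.ideal_prod_unit[OF CL L.subcring_is_submodule[OF CL]] by simp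
  have xc: "?x I \<subseteq> carrier ?L" "?x I' \<subseteq> carrier ?L" using sub[OF xG(1)] sub[OF xG(2)] L.submoduleD(1)[OF CL] by auto
  have ev: "?ev ` (K \<otimes>\<^bsub>G\<^esub> ?x I') \<subseteq> C" "?ev ` (K' \<otimes>\<^bsub>G\<^esub> ?x I) \<subseteq> C"
    unfolding mG laurent_eval_ideal_prod[OF Kc(1) xc(2)] laurent_eval_ideal_prod[OF Kc(2) xc(1)]
      laurent_eval_extend[OF C I(1)] laurent_eval_extend[OF C I(2)] I_def[symmetric] I'_def[symmetric] II' by auto
  note S = sub[OF G.m_closed[OF KG(1) xG(2)]] sub[OF G.m_closed[OF KG(2) xG(1)]]
  obtain u where u: "u \<in> Units ?L" "(\<otimes>\<^bsub>?L\<^esub>) u ` (K \<otimes>\<^bsub>G\<^esub> ?x I') = ?CL"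
    using subintegral_closure_module_principal[OF A S[unfolded C_def] prod[unfolded C_def] ev[unfolded C_def]]
    unfolding C_def by blast
  have uc: "u \<in> carrier ?L" "inv\<^bsub>?L\<^esub> u \<in> carrier ?L" "inv\<^bsub>?L\<^esub> u \<otimes>\<^bsub>?L\<^esub> u = \<one>\<^bsub>?L\<^esub>"
    using u(1) by auto
  have Sc: "K \<otimes>\<^bsub>G\<^esub> ?x I' \<subseteq> carrier ?L" using L.submoduleD(1)[OF CL S(1)] .
  have "(\<otimes>\<^bsub>?L\<^esub>) (inv\<^bsub>?L\<^esub> u) ` ?CL = K \<otimes>\<^bsub>G\<^esub> ?x I'"
    unfolding u(2)[symmetric] L.mult_image_image[OF uc(2,1) Sc] uc(3) by (rule L.one_mult_image[OF Sc])
  hence "ideal_prod ?L K (?x I') = (\<otimes>\<^bsub>?L\<^esub>) (inv\<^bsub>?L\<^esub> u) ` ?CL" unfolding mG by (rule sym)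
  thus ?thesis using inv(2) L.Units_inv_Units[OF u(1)] by blast
qed

text \<open>Evaluation at \<open>X = 1\<close> gives \<open>I = a C\<close> with \<open>a\<close>
  the value of \<open>v\<close>. Hence \<open>v\<close> and the constant \<open>a\<close> generate
  the same module and differ by a unit of \<open>C[X]\<close>, which is a monomial by
  \<open>laurent_unit_monomial\<close>.\<close>

lemma laurent_extended_principal_monomial:
  assumes C: "subcring C R" and red: "\<And>x. \<lbrakk>x \<in> C; x \<otimes> x = \<zero>\<rbrakk> \<Longrightarrow> x = \<zero>"
    and idem: "\<And>x. \<lbrakk>x \<in> C; x \<otimes> x = x\<rbrakk> \<Longrightarrow> x = \<zero> \<or> x = \<one>"
    and v: "v \<in> Units (laurent R)" and I: "subalgebra C I R"
    and eq: "(\<otimes>\<^bsub>laurent R\<^esub>) v ` laurent_sub C R = laurent_extend C R I"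
  shows "\<exists>k. v = laurent_monom R (laurent_eval R v) k"
proof -
  interpret L: cring "laurent R" by (rule laurent_cring)
  let ?L = "laurent R" and ?ev = "laurent_eval R" and ?c = "laurent_const R" and ?CL = "laurent_sub C R"
  note CL = laurent_sub_subcring[OF C]
  note CLc = subcringE[OF CL]
  define a where "a = ?ev v"
  have a: "a \<in> Units R" "a \<in> carrier R" using laurent_eval_units[OF v] by (auto simp: a_def)
  have vc: "v \<in> carrier ?L" using v by auto
  have ca: "?c a \<in> Units ?L" "?c a \<in> carrier ?L" using laurent_const_units(1)[OF a(1)] by auto
  have "I = (\<otimes>) a ` C"
    using laurent_eval_extend[OF C I] unfolding eq[symmetric] laurent_eval_mult_image[OF vc CLc(1)]
      laurent_eval_sub[OF C] a_def by (rule sym)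
  hence eq2: "(\<otimes>\<^bsub>?L\<^esub>) v ` ?CL = (\<otimes>\<^bsub>?L\<^esub>) (?c a) ` ?CL"
    using eq laurent_extend_principal[OF C a(2)] by simp
  have mem: "x \<in> (\<otimes>\<^bsub>?L\<^esub>) x ` ?CL" if "x \<in> carrier ?L" for x
    using imageI[OF CLc(3), of "(\<otimes>\<^bsub>?L\<^esub>) x"] that by simp
  obtain w where w: "w \<in> ?CL" "v = ?c a \<otimes>\<^bsub>?L\<^esub> w" using mem[OF vc] eq2 by auto
  obtain w' where w': "w' \<in> ?CL" "?c a = v \<otimes>\<^bsub>?L\<^esub> w'" using mem[OF ca(2)] eq2 by auto
  have wc: "w \<in> carrier ?L" "w' \<in> carrier ?L" using w w' CLc(1) by auto
  have "v \<otimes>\<^bsub>?L\<^esub> (w \<otimes>\<^bsub>?L\<^esub> w') = v"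
  proof -
    have "v \<otimes>\<^bsub>?L\<^esub> (w \<otimes>\<^bsub>?L\<^esub> w') = v \<otimes>\<^bsub>?L\<^esub> w' \<otimes>\<^bsub>?L\<^esub> w" using vc wc by (simp add: L.m_ac)
    thus ?thesis unfolding w'(2)[symmetric] w(2)[symmetric] .
  qed
  hence "v \<otimes>\<^bsub>?L\<^esub> (w \<otimes>\<^bsub>?L\<^esub> w') = v \<otimes>\<^bsub>?L\<^esub> \<one>\<^bsub>?L\<^esub>" using vc by simp
  hence "w \<otimes>\<^bsub>?L\<^esub> w' = \<one>\<^bsub>?L\<^esub>" using L.Units_l_cancel[OF v, of "w \<otimes>\<^bsub>?L\<^esub> w'" "\<one>\<^bsub>?L\<^esub>"] wc by simp
  then obtain k where k: "\<forall>i. i \<noteq> k \<longrightarrow> w i = \<zero>"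
    using laurent_unit_monomial[OF C red idem w(1) w'(1)] by blast
  have "v = (\<lambda>n. a \<otimes> w (n - 0))"
    unfolding w(2) laurent_const_monom by (rule laurent_monom_mult[OF a(2) wc(1)])
  hence vm: "v = laurent_monom R (a \<otimes> w k) k" using k a(2) by (auto simp: laurent_monom_def fun_eq_iff)
  have "w k \<in> carrier R" using laurent_coeff_closed[OF wc(1)] by simp
  hence "?ev v = a \<otimes> w k" using a(2) by (subst vm) (simp add: laurent_eval_monom)
  thus ?thesis using vm by metis
qed

lemma MI_direct_product:
  assumes A: "subcring A R" "hensel_local_ring (R\<lparr>carrier := A\<rparr>)" and sn: "seminormal_ring R"
  defines "C \<equiv> subintegral_closure A R"
  shows "MI A R \<cong> MI A (R\<lparr>carrier := C\<rparr>) \<times>\<times> MI C R"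
proof -
  interpret L: cring "laurent R" by (rule laurent_cring)
  let ?L = "laurent R" and ?RC = "R\<lparr>carrier := C\<rparr>"
  let ?AL = "laurent_sub A R" and ?CL = "laurent_sub C R" and ?c = "laurent_const R"
  have C: "subcring C R" "A \<subseteq> C" unfolding C_def using subintegral_closure_greatest[OF A(1)] by auto
  interpret RC: cring ?RC using C subcring_iff subcringE(1) by blast
  interpret LC: cring "laurent ?RC" by (rule RC.laurent_cring)
  interpret incl: cring_inclusion "laurent ?RC" ?L by (rule cring_inclusion_laurent[OF C(1)])
  note Ac = subcringE[OF A(1)] and Cc = subcringE[OF C(1)]
  note AL = laurent_sub_subcring[OF A(1)] and CL = laurent_sub_subcring[OF C(1)]
  note ALc = subcringE[OF AL] and CLc = subcringE[OF CL]
  have ACL: "?AL \<subseteq> ?CL" using C(2) laurent_sub_iff[OF Ac(1)] laurent_sub_iff[OF Cc(1)] by blast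
  have loc: "local_ring (R\<lparr>carrier := A\<rparr>)" using A(2) by (simp add: hensel_local_ring_def)
  have A': "subcring A ?RC" using subcring_carrier_update_iff[OF C] A(1) by simp
  have ALC: "subcring ?AL (laurent ?RC)" using RC.laurent_sub_subcring[OF A'] by simp
  have cc: "?c a \<in> carrier ?L" if "a \<in> carrier R" for a using laurent_const_hom that by (simp add: ring_hom_closed)
  define G1 where "G1 = inv_submodules ?AL (laurent ?RC)"
  define N1 where "N1 = laurent_extend A ?RC ` carrier (inv_submodules A ?RC)"
  define G where "G = inv_submodules ?AL ?L"
  define N where "N = laurent_extend A R ` carrier (inv_submodules A R)"
  define G2 where "G2 = inv_submodules ?CL ?L"
  define N2 where "N2 = laurent_extend C R ` carrier (inv_submodules C R)"
  note q = MI_quotient_map[OF A(1), folded G_def N_def]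
  note q2 = MI_quotient_map[OF C(1), folded G2_def N2_def]
  have "laurent_sub A ?RC = ?AL" by simp
  note q1 = RC.MI_quotient_map[OF A', unfolded this, folded G1_def N1_def]
  interpret G: comm_group G by (rule q(1))
  interpret G1: comm_group G1 by (rule q1(1))
  interpret G2: comm_group G2 by (rule q2(1))
  have G1_iff: "I \<in> carrier G1 \<longleftrightarrow> (\<exists>J. subalgebra ?AL I ?L \<and> subalgebra ?AL J ?L \<and> I \<subseteq> ?CL \<and> J \<subseteq> ?CL \<and> ideal_prod ?L I J = ?AL)" for I
    using incl.invertible_inclusion_iff[OF ALC AL] by (simp add: G1_def inv_submodules_def)
  have G_iff: "I \<in> carrier G \<longleftrightarrow> (\<exists>J. subalgebra ?AL I ?L \<and> subalgebra ?AL J ?L \<and> ideal_prod ?L I J = ?AL)" for I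
    by (auto simp: G_def inv_submodules_def invertible_submodule_def)
  have G2_iff: "I \<in> carrier G2 \<longleftrightarrow> (\<exists>J. subalgebra ?CL I ?L \<and> subalgebra ?CL J ?L \<and> ideal_prod ?L I J = ?CL)" for I
    by (auto simp: G2_def inv_submodules_def invertible_submodule_def)
  have mult: "I \<otimes>\<^bsub>G\<^esub> J = ideal_prod ?L I J" "I \<otimes>\<^bsub>G2\<^esub> J = ideal_prod ?L I J" for I J
    by (simp_all add: G_def G2_def inv_submodules_def)
  have mult1: "I \<otimes>\<^bsub>G1\<^esub> J = ideal_prod ?L I J" if "I \<in> carrier G1" "J \<in> carrier G1" for I J
  proof -
    have "I \<subseteq> ?CL" "J \<subseteq> ?CL" using that G1_iff by blast+
    thus ?thesis unfolding G1_def inv_submodules_def using incl.ideal_prod_inclusion by simp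
  qed
  have N_eq: "N = {(\<otimes>\<^bsub>?L\<^esub>) (?c a) ` ?AL |a. a \<in> Units R}"
    unfolding N_def by (rule laurent_extend_image_local[OF A(1) loc])
  have N1_eq: "N1 = {(\<otimes>\<^bsub>?L\<^esub>) (?c a) ` ?AL |a. a \<in> Units ?RC}"
  proof -
    have "(\<otimes>\<^bsub>laurent ?RC\<^esub>) (laurent_const ?RC a) ` ?AL = (\<otimes>\<^bsub>?L\<^esub>) (?c a) ` ?AL" if "a \<in> Units ?RC" for a
    proof -
      have "a \<in> C" using that by (auto simp: Units_def)
      hence m: "?c a \<in> ?CL" unfolding laurent_const_monom by (rule laurent_monom_closed[OF C(1)])
      have "laurent_const ?RC a = ?c a" by (rule ext) (simp add: laurent_const_def)
      moreover have "?c a \<otimes>\<^bsub>laurent ?RC\<^esub> x = ?c a \<otimes>\<^bsub>?L\<^esub> x" if "x \<in> ?AL" for x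
        using incl.mult_eq[OF m subsetD[OF ACL that]] .
      ultimately show ?thesis by (metis (no_types, lifting) image_cong)
    qed
    hence "{(\<otimes>\<^bsub>laurent ?RC\<^esub>) (laurent_const ?RC a) ` ?AL |a. a \<in> Units ?RC} = {(\<otimes>\<^bsub>?L\<^esub>) (?c a) ` ?AL |a. a \<in> Units ?RC}"
      unfolding setcompr_eq_image Collect_mem_eq by (rule image_cong[OF refl])
    moreover have "N1 = {(\<otimes>\<^bsub>laurent ?RC\<^esub>) (laurent_const ?RC a) ` ?AL |a. a \<in> Units ?RC}"
      using RC.laurent_extend_image_local[OF A'] loc by (simp add: N1_def)
    ultimately show ?thesis by argo
  qed
  define \<Gamma> where "\<Gamma> = units_of ?L"
  interpret \<Gamma>: comm_group \<Gamma> unfolding \<Gamma>_def by (rule L.units_comm_group)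
  have \<Gamma>c: "carrier \<Gamma> = Units ?L" by (simp add: \<Gamma>_def units_of_def)
  have \<Gamma>m: "v \<otimes>\<^bsub>\<Gamma>\<^esub> w = v \<otimes>\<^bsub>?L\<^esub> w" for v w by (simp add: \<Gamma>_def units_of_def)
  define P where "P = G1 \<times>\<times> \<Gamma>"
  have P: "group P" unfolding P_def by (rule DirProd_group) unfold_locales
  define M where "M v I = (\<otimes>\<^bsub>?L\<^esub>) v ` I" for v and I :: "(int \<Rightarrow> 'a) set"
  have Lc: "I \<subseteq> carrier ?L" if "I \<in> carrier G \<or> I \<in> carrier G1 \<or> I \<in> carrier G2" for I
    using that G_iff G1_iff G2_iff L.submoduleD(1)[OF AL] L.submoduleD(1)[OF CL] by blast
  have G1G: "I \<in> carrier G" if "I \<in> carrier G1" for I using that G1_iff G_iff by blast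
  have Mprod: "M (v \<otimes>\<^bsub>?L\<^esub> w) (ideal_prod ?L I J) = ideal_prod ?L (M v I) (M w J)"
    if "v \<in> carrier ?L" "w \<in> carrier ?L" "I \<subseteq> carrier ?L" "J \<subseteq> carrier ?L" for v w I J
    unfolding M_def using L.ideal_prod_image_mult[OF that(3,4,1,2)] by simp
  have MM: "M v (M w I) = M (v \<otimes>\<^bsub>?L\<^esub> w) I" if "v \<in> carrier ?L" "w \<in> carrier ?L" "I \<subseteq> carrier ?L" for v w I
    unfolding M_def by (rule L.mult_image_image[OF that])
  have M1: "M \<one>\<^bsub>?L\<^esub> I = I" if "I \<subseteq> carrier ?L" for I unfolding M_def by (rule L.one_mult_image[OF that])
  have MG: "M v I \<in> carrier G" if "v \<in> Units ?L" "I \<in> carrier G" for v I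
    using L.unit_mult_invertible[OF AL that(1)] that(2) by (simp add: M_def G_def inv_submodules_def)
  have MG2: "M v I \<in> carrier G2" if "v \<in> Units ?L" "I \<in> carrier G2" for v I
    using L.unit_mult_invertible[OF CL that(1)] that(2) by (simp add: M_def G2_def inv_submodules_def)
  have CG2: "?CL \<in> carrier G2" using L.subcring_invertible[OF CL] by (simp add: G2_def inv_submodules_def)
  have CC: "ideal_prod ?L ?CL ?CL = ?CL" by (rule L.ideal_prod_unit[OF CL L.subcring_is_submodule[OF CL]])
  define \<Psi> where "\<Psi> = (\<lambda>(I, v). N #>\<^bsub>G\<^esub> M v I)"
  define \<Theta> where "\<Theta> = (\<lambda>(I, v). (N1 #>\<^bsub>G1\<^esub> I, N2 #>\<^bsub>G2\<^esub> M v ?CL))"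
  have Uc: "v \<in> carrier ?L" if "v \<in> Units ?L" for v using that by blast
  have \<Psi>_hom: "\<Psi> \<in> hom P (MI A R)"
  proof (rule homI)
    fix p assume p: "p \<in> carrier P"
    then obtain I v where Iv: "p = (I, v)" "I \<in> carrier G1" "v \<in> Units ?L" by (auto simp: P_def \<Gamma>c)
    show "\<Psi> p \<in> carrier (MI A R)" using hom_in_carrier[OF q(3) MG[OF Iv(3) G1G[OF Iv(2)]]] by (simp add: \<Psi>_def Iv(1))
    fix r assume "r \<in> carrier P"
    then obtain J w where Jw: "r = (J, w)" "J \<in> carrier G1" "w \<in> Units ?L" by (auto simp: P_def \<Gamma>c)
    have "M (v \<otimes>\<^bsub>?L\<^esub> w) (I \<otimes>\<^bsub>G1\<^esub> J) = M v I \<otimes>\<^bsub>G\<^esub> M w J"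
      unfolding mult mult1[OF Iv(2) Jw(2)] by (rule Mprod) (use Iv Jw Lc Uc in blast)+
    thus "\<Psi> (p \<otimes>\<^bsub>P\<^esub> r) = \<Psi> p \<otimes>\<^bsub>MI A R\<^esub> \<Psi> r"
      using hom_mult[OF q(3) MG[OF Iv(3) G1G[OF Iv(2)]] MG[OF Jw(3) G1G[OF Jw(2)]]]
      by (simp add: \<Psi>_def Iv(1) Jw(1) P_def \<Gamma>m)
  qed
  have \<Theta>_hom: "\<Theta> \<in> hom P (MI A ?RC \<times>\<times> MI C R)"
  proof (rule homI)
    fix p assume p: "p \<in> carrier P"
    then obtain I v where Iv: "p = (I, v)" "I \<in> carrier G1" "v \<in> Units ?L" by (auto simp: P_def \<Gamma>c)
    show "\<Theta> p \<in> carrier (MI A ?RC \<times>\<times> MI C R)"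
      using hom_in_carrier[OF q1(3) Iv(2)] hom_in_carrier[OF q2(3) MG2[OF Iv(3) CG2]] by (simp add: \<Theta>_def Iv(1))
    fix r assume "r \<in> carrier P"
    then obtain J w where Jw: "r = (J, w)" "J \<in> carrier G1" "w \<in> Units ?L" by (auto simp: P_def \<Gamma>c)
    have "M (v \<otimes>\<^bsub>?L\<^esub> w) ?CL = M v ?CL \<otimes>\<^bsub>G2\<^esub> M w ?CL"
      using Mprod[OF Uc[OF Iv(3)] Uc[OF Jw(3)] CLc(1) CLc(1)] CC by (simp add: mult)
    thus "\<Theta> (p \<otimes>\<^bsub>P\<^esub> r) = \<Theta> p \<otimes>\<^bsub>MI A ?RC \<times>\<times> MI C R\<^esub> \<Theta> r"
      using hom_mult[OF q1(3) Iv(2) Jw(2)] hom_mult[OF q2(3) MG2[OF Iv(3) CG2] MG2[OF Jw(3) CG2]]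
      by (simp add: \<Theta>_def Iv(1) Jw(1) P_def \<Gamma>m)
  qed
  have red: "x = \<zero>" if "x \<in> C" "x \<otimes> x = \<zero>" for x
    using seminormal_reduced[OF sn subsetD[OF Cc(1) that(1)] that(2)] .
  have idem: "x = \<zero> \<or> x = \<one>" if "x \<in> C" "x \<otimes> x = x" for x
    using subintegral_closure_idempotent[OF A(1) loc] that by (simp add: C_def)
  have monom: "M (laurent_monom R a k) ?AL = M (?c a) ?AL" if "a \<in> carrier R" for a k
    unfolding M_def by (rule laurent_monom_mult_sub[OF A(1) that])
  have UC: "c \<in> carrier R" "c \<in> Units R" if "c \<in> Units ?RC" for c
    using that Cc(1) by (auto simp: Units_def)
  have N_iff: "I \<in> N \<longleftrightarrow> (\<exists>a\<in>Units R. I = M (?c a) ?AL)" for I by (auto simp: N_eq M_def)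
  have N1_iff: "I \<in> N1 \<longleftrightarrow> (\<exists>a\<in>Units ?RC. I = M (?c a) ?AL)" for I by (auto simp: N1_eq M_def)
  \<comment> \<open>If \<open>v I\<close> is generated by a constant \<open>a\<close>, then
    \<open>I\<close> is generated by an element \<open>x\<close> of \<open>C[X]\<close> with
    \<open>v x = a\<close>. Since the inverse of \<open>I\<close> also lies in \<open>C[X]\<close>,
    \<open>x\<close> is a unit there and so a monomial. Thus \<open>I\<close> has trivial class, and
    \<open>v C[X] = v x C[X] = a C[X]\<close> is extended.\<close>
  have ker1: "I \<in> N1 \<and> M v ?CL \<in> N2" if I: "I \<in> carrier G1" and v: "v \<in> Units ?L" and MN: "M v I \<in> N" for I v
  proof -
    obtain I' where I': "subalgebra ?AL I ?L" "subalgebra ?AL I' ?L" "I \<subseteq> ?CL" "I' \<subseteq> ?CL" "ideal_prod ?L I I' = ?AL"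
      using I G1_iff by blast
    have Ic: "I \<subseteq> carrier ?L" using I'(3) CLc(1) by blast
    obtain a where a: "a \<in> Units R" "M v I = M (?c a) ?AL" using MN N_iff by blast
    have ac: "a \<in> carrier R" using a(1) by auto
    have "?c a \<otimes>\<^bsub>?L\<^esub> \<one>\<^bsub>?L\<^esub> \<in> M (?c a) ?AL" unfolding M_def using ALc(3) by blast
    hence "?c a \<in> M v I" using cc[OF ac] a(2) by simp
    then obtain x where x: "x \<in> I" "?c a = v \<otimes>\<^bsub>?L\<^esub> x" by (auto simp: M_def)
    have xc: "x \<in> carrier ?L" "x \<in> ?CL" using x(1) Ic I'(3) by auto
    have vc: "v \<in> carrier ?L" "inv\<^bsub>?L\<^esub> v \<in> carrier ?L" "inv\<^bsub>?L\<^esub> v \<otimes>\<^bsub>?L\<^esub> v = \<one>\<^bsub>?L\<^esub>" using v by auto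
    have "I = M (inv\<^bsub>?L\<^esub> v) (M v I)" using MM[OF vc(2,1) Ic] M1[OF Ic] vc(3) by simp
    also have "\<dots> = M (inv\<^bsub>?L\<^esub> v) (M v (M x ?AL))" unfolding a(2) x(2) MM[OF vc(1) xc(1) ALc(1)] ..
    also have "\<dots> = M x ?AL"
    proof -
      have "M x ?AL \<subseteq> carrier ?L" unfolding M_def using xc(1) ALc(1) by auto
      thus ?thesis using MM[OF vc(2,1)] M1 vc(3) by simp
    qed
    finally have Ix: "I = M x ?AL" .
    have "ideal_prod ?L I I' = M x I'"
    proof -
      have I'c: "I' \<subseteq> carrier ?L" using I'(4) CLc(1) by blast
      have "M (x \<otimes>\<^bsub>?L\<^esub> \<one>\<^bsub>?L\<^esub>) (ideal_prod ?L ?AL I') = ideal_prod ?L (M x ?AL) (M \<one>\<^bsub>?L\<^esub> I')"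
        by (rule Mprod[OF xc(1) L.one_closed ALc(1) I'c])
      thus ?thesis unfolding Ix M1[OF I'c] using L.ideal_prod_unit[OF AL I'(2)] xc(1) by simp
    qed
    hence "\<one>\<^bsub>?L\<^esub> \<in> M x I'" using I'(5) ALc(3) by simp
    then obtain y where y: "y \<in> I'" "x \<otimes>\<^bsub>?L\<^esub> y = \<one>\<^bsub>?L\<^esub>" by (auto simp: M_def)
    have yC: "y \<in> ?CL" using y(1) I'(4) by blast
    obtain k where k: "x k \<otimes> y (- k) = \<one>" "\<forall>i. i \<noteq> k \<longrightarrow> x i = \<zero>"
      using laurent_unit_monomial[OF C(1) red idem xc(2) yC y(2)] by blast
    have ck: "x k \<in> C" "y (- k) \<in> C" using xc(2) yC laurent_sub_iff[OF Cc(1)] by blast+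
    have xk: "x k \<in> Units ?RC" by (rule RC.unit_of_inverse[of _ "y (- k)"]) (use ck k(1) in auto)
    have xm: "x = laurent_monom R (x k) k" using k(2) by (auto simp: laurent_monom_def fun_eq_iff)
    have "I = M (laurent_monom R (x k) k) ?AL" unfolding Ix using xm by argo
    hence IN: "I = M (?c (x k)) ?AL" unfolding monom[OF UC(1)[OF xk]] .
    have xCL: "M x ?CL = ?CL" unfolding M_def by (rule L.unit_mult_self[OF CL xc(2) yC y(2)])
    have "M v ?CL = M v (M x ?CL)" unfolding xCL ..
    also have "\<dots> = M (?c a) ?CL" unfolding MM[OF vc(1) xc(1) CLc(1)] x(2) ..
    also have "\<dots> = laurent_extend C R ((\<otimes>) a ` C)" unfolding M_def by (rule laurent_extend_principal[OF C(1) ac, symmetric])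
    also have "\<dots> \<in> N2"
      using unit_mult_invertible[OF C(1) a(1) subcring_invertible[OF C(1)]] by (simp add: N2_def inv_submodules_def)
    finally show ?thesis using IN xk N1_iff by blast
  qed
  have ker2: "M v I \<in> N" if I: "I \<in> N1" and v: "v \<in> Units ?L" and vN: "M v ?CL \<in> N2" for I v
  proof -
    obtain c where c: "c \<in> Units ?RC" "I = M (?c c) ?AL" using I N1_iff by blast
    obtain I0 where I0: "subalgebra C I0 R" "M v ?CL = laurent_extend C R I0"
      using vN by (auto simp: N2_def inv_submodules_def invertible_submodule_def)
    obtain k where k: "v = laurent_monom R (laurent_eval R v) k"
      using laurent_extended_principal_monomial[OF C(1) red idem v I0(1) I0(2)[unfolded M_def]] by blast
    define a where "a = laurent_eval R v"
    have a: "a \<in> Units R" "a \<in> carrier R" using laurent_eval_units[OF v] by (auto simp: a_def)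
    note cR = UC[OF c(1)]
    have "v \<otimes>\<^bsub>?L\<^esub> ?c c = laurent_monom R a k \<otimes>\<^bsub>?L\<^esub> ?c c" using k unfolding a_def by argo
    also have "\<dots> = (\<lambda>n. a \<otimes> ?c c (n - k))" by (rule laurent_monom_mult[OF a(2) cc[OF cR(1)]])
    also have "\<dots> = laurent_monom R (a \<otimes> c) k"
      using a(2) by (auto simp: laurent_monom_def laurent_const_def)
    finally have "v \<otimes>\<^bsub>?L\<^esub> ?c c = laurent_monom R (a \<otimes> c) k" .
    moreover have "M v I = M (v \<otimes>\<^bsub>?L\<^esub> ?c c) ?AL" unfolding c(2) by (rule MM[OF Uc[OF v] cc[OF cR(1)] ALc(1)])
    ultimately have "M v I = M (?c (a \<otimes> c)) ?AL" using monom a(2) cR(1) by simp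
    thus ?thesis using N_iff a(1) cR(2) by blast
  qed
  have ker: "\<Psi> p = \<one>\<^bsub>MI A R\<^esub> \<longleftrightarrow> \<Theta> p = \<one>\<^bsub>MI A ?RC \<times>\<times> MI C R\<^esub>" if p: "p \<in> carrier P" for p
  proof -
    obtain I v where Iv: "p = (I, v)" "I \<in> carrier G1" "v \<in> Units ?L" using p by (auto simp: P_def \<Gamma>c)
    have "\<Psi> p = \<one>\<^bsub>MI A R\<^esub> \<longleftrightarrow> M v I \<in> N" using q(5)[OF MG[OF Iv(3) G1G[OF Iv(2)]]] by (simp add: \<Psi>_def Iv(1))
    moreover have "\<Theta> p = \<one>\<^bsub>MI A ?RC \<times>\<times> MI C R\<^esub> \<longleftrightarrow> I \<in> N1 \<and> M v ?CL \<in> N2"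
      using q1(5)[OF Iv(2)] q2(5)[OF MG2[OF Iv(3) CG2]] by (simp add: \<Theta>_def Iv(1))
    ultimately show ?thesis using ker1[OF Iv(2,3)] ker2[OF _ Iv(3)] by blast
  qed
  have inv: "inv\<^bsub>?L\<^esub> v \<in> Units ?L" "M (inv\<^bsub>?L\<^esub> v) (M v I) = I" "M v (M (inv\<^bsub>?L\<^esub> v) I) = I"
    if "v \<in> Units ?L" "I \<subseteq> carrier ?L" for v I
    using that MM[of "inv\<^bsub>?L\<^esub> v" v I] MM[of v "inv\<^bsub>?L\<^esub> v" I] M1 by auto
  have \<Psi>_surj: "\<Psi> ` carrier P = carrier (MI A R)"
  proof
    show "\<Psi> ` carrier P \<subseteq> carrier (MI A R)" using \<Psi>_hom by (auto simp: hom_def)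
    show "carrier (MI A R) \<subseteq> \<Psi> ` carrier P"
    proof
      fix z assume "z \<in> carrier (MI A R)"
      then obtain J where J: "J \<in> carrier G" "z = N #>\<^bsub>G\<^esub> J" unfolding q(4)[symmetric] by blast
      obtain J' where J': "subalgebra ?AL J ?L" "subalgebra ?AL J' ?L" "ideal_prod ?L J J' = ?AL"
        using J(1) G_iff by blast
      have Jc: "J \<subseteq> carrier ?L" "J' \<subseteq> carrier ?L" using J'(1,2) L.submoduleD(1)[OF AL] by auto
      obtain v where v: "v \<in> Units ?L" "M v J \<subseteq> ?CL" "M (inv\<^bsub>?L\<^esub> v) J' \<subseteq> ?CL"
        using laurent_invertible_into_closure[OF A J'] unfolding M_def C_def by blast
      have vc: "v \<in> carrier ?L" "inv\<^bsub>?L\<^esub> v \<in> carrier ?L" "v \<otimes>\<^bsub>?L\<^esub> inv\<^bsub>?L\<^esub> v = \<one>\<^bsub>?L\<^esub>" using v(1) by auto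
      have "ideal_prod ?L (M v J) (M (inv\<^bsub>?L\<^esub> v) J') = ?AL"
        using Mprod[OF vc(1,2) Jc] M1[OF ALc(1)] by (simp add: J'(3) vc(3))
      moreover have "subalgebra ?AL (M v J) ?L" "subalgebra ?AL (M (inv\<^bsub>?L\<^esub> v) J') ?L"
        unfolding M_def by (rule L.unit_mult_submodule[OF AL J'(1) vc(1)], rule L.unit_mult_submodule[OF AL J'(2) vc(2)])
      ultimately have "M v J \<in> carrier G1" using G1_iff v(2,3) by blast
      \<comment> \<open>The unit \<open>v\<close> moves \<open>J\<close> into \<open>C[X]\<close>,
        and the second component of the preimage undoes the move.\<close>
      hence "(M v J, inv\<^bsub>?L\<^esub> v) \<in> carrier P" using inv(1)[OF v(1) Jc(1)] by (simp add: P_def \<Gamma>c)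
      moreover have "\<Psi> (M v J, inv\<^bsub>?L\<^esub> v) = z" using inv(2)[OF v(1) Jc(1)] by (simp add: \<Psi>_def J(2))
      ultimately show "z \<in> \<Psi> ` carrier P" by blast
    qed
  qed
  have \<Theta>_surj: "\<Theta> ` carrier P = carrier (MI A ?RC \<times>\<times> MI C R)"
  proof
    show "\<Theta> ` carrier P \<subseteq> carrier (MI A ?RC \<times>\<times> MI C R)" using \<Theta>_hom unfolding hom_def by blast
    show "carrier (MI A ?RC \<times>\<times> MI C R) \<subseteq> \<Theta> ` carrier P"
    proof
      fix z assume "z \<in> carrier (MI A ?RC \<times>\<times> MI C R)"
      then obtain z1 z2 where z: "z = (z1, z2)" "z1 \<in> carrier (MI A ?RC)" "z2 \<in> carrier (MI C R)" by auto
      obtain I where I: "I \<in> carrier G1" "z1 = N1 #>\<^bsub>G1\<^esub> I" using z(2) unfolding q1(4)[symmetric] by blast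
      obtain K where K: "K \<in> carrier G2" "z2 = N2 #>\<^bsub>G2\<^esub> K" using z(3) unfolding q2(4)[symmetric] by blast
      obtain K' where K': "subalgebra ?CL K ?L" "subalgebra ?CL K' ?L" "ideal_prod ?L K K' = ?CL"
        using K(1) G2_iff by blast
      obtain v I0 where v: "v \<in> Units ?L" "invertible_submodule C R I0"
          "ideal_prod ?L K (laurent_extend C R I0) = M v ?CL"
        using laurent_closure_module_principal_mod_extended[OF A K'[unfolded C_def]] unfolding M_def C_def by blast
      \<comment> \<open>The extended factor has trivial class, so \<open>K\<close> and
        \<open>v C[X]\<close> have the same class. The first component of the preimage stays free
        and is taken from \<open>z1\<close>.\<close>
      have e: "laurent_extend C R I0 \<in> N2" using v(2) by (auto simp: N2_def inv_submodules_def)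
      have eG: "laurent_extend C R I0 \<in> carrier G2" using e subgroup.subset[OF q2(2)] by blast
      interpret MI2: group "MI C R" using MI_comm_group[OF C(1)] by (rule comm_group.axioms)
      have "N2 #>\<^bsub>G2\<^esub> M v ?CL = (N2 #>\<^bsub>G2\<^esub> K) \<otimes>\<^bsub>MI C R\<^esub> (N2 #>\<^bsub>G2\<^esub> laurent_extend C R I0)"
        using hom_mult[OF q2(3) K(1) eG] by (simp add: mult v(3))
      also have "\<dots> = z2" using q2(5)[OF eG] e z(3) by (simp add: K(2))
      finally have "\<Theta> (I, v) = z" by (simp add: \<Theta>_def z(1) I(2))
      moreover have "(I, v) \<in> carrier P" using I(1) v(1) by (simp add: P_def \<Gamma>c)
      ultimately show "z \<in> \<Theta> ` carrier P" by blast
    qed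
  qed
  have "group (MI A R)" "group (MI A ?RC \<times>\<times> MI C R)"
    using MI_comm_group[OF A(1)] MI_comm_group[OF C(1)] RC.MI_comm_group[OF A']
    by (auto intro: DirProd_group comm_group.axioms)
  thus ?thesis by (rule iso_of_equal_kernels[OF P _ _ \<Psi>_hom \<Psi>_surj \<Theta>_hom \<Theta>_surj ker])
qed

end

theorem theorem3p7:
  fixes B :: "('a, 'm) ring_scheme" and A :: "'a set"
  assumes "cring B" and "subcring A B"
    and "hensel_local_ring (B\<lparr>carrier := A\<rparr>)"
    and "seminormal_ring B"
  shows "MI A B \<cong> MI A (B\<lparr>carrier := subintegral_closure A B\<rparr>) \<times>\<times>
                    MI (subintegral_closure A B) B"
proof -
  interpret B: cring B by fact
  show ?thesis by (rule B.MI_direct_product[OF assms(2-4)])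
qed

end
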